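(* Let $X$ be a perfect complex over a commutative noetherian ring $R$. Then $X$ admits a unique decomposition (in the derived category) into perfect complexes $$X\cong\bigoplus_{i\in I}X_i$$ such that the supports of the $X_i$ are pairwise disjoint and indecomposable.
   Context: A perfect complex is a bounded complex of finitely generated projective $R$-modules, viewed as an object of the derived category $D(R)$. $\mathrm{Supp}(X)=\{p\in\mathrm{Spec}(R): X\otimes^L_R K(p)\ne 0\}$, where $K(p)$ is the fraction field of $R/p$. A thick support of $\mathrm{Spec}(R)$ ($R$ noetherian) is a specialisation-closed subset, i.e. a union of Zariski closed subsets. A thick support $S$ is indecomposable if it is nonempty and cannot be written as a union of two disjoint nonempty thick supports. *)

theory Defs
  imports "HOL-Algebra.Ring_Divisibility" "HOL-Algebra.Free_Abelian_Groups" "HOL-Algebra.Generated_Groups"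
begin

section \<open>Modules\<close>

text \<open>
  Modules are \<^const>\<open>module\<close> records over a ring record; the ring multiplication and unit of such
  a record play no role. Every construction inside the derived category takes place in modules
  whose elements have one fixed type \<open>'u\<close>, which acts as a universe.
\<close>

definition module_hom ::
  "('a, 'r) ring_scheme \<Rightarrow> ('a, 'm) module \<Rightarrow> ('a, 'n) module \<Rightarrow> ('m \<Rightarrow> 'n) set" where
  "module_hom R M N =
    {f \<in> carrier M \<rightarrow> carrier N.
      (\<forall>x\<in>carrier M. \<forall>y\<in>carrier M. f (x \<oplus>\<^bsub>M\<^esub> y) = f x \<oplus>\<^bsub>N\<^esub> f y) \<and>
      (\<forall>r\<in>carrier R. \<forall>x\<in>carrier M. f (r \<odot>\<^bsub>M\<^esub> x) = r \<odot>\<^bsub>N\<^esub> f x)}"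

definition fin_gen_module :: "('a, 'r) ring_scheme \<Rightarrow> ('a, 'm) module \<Rightarrow> bool" where
  "fin_gen_module R M \<longleftrightarrow> module R M \<and>
    (\<exists>A. finite A \<and> A \<subseteq> carrier M \<and> (\<forall>H. submodule H R M \<and> A \<subseteq> H \<longrightarrow> H = carrier M))"

text \<open>The lifting property is required against all surjections of modules in the universe of \<open>P\<close>.\<close>

definition projective_module :: "('a, 'r) ring_scheme \<Rightarrow> ('a, 'u) module \<Rightarrow> bool" where
  "projective_module R P \<longleftrightarrow> module R P \<and>
    (\<forall>(M :: ('a, 'u) module) (N :: ('a, 'u) module). \<forall>g f.
      module R M \<and> module R N \<and> g \<in> module_hom R M N \<and> g ` carrier M = carrier N \<and>
      f \<in> module_hom R P N \<longrightarrow>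
      (\<exists>h\<in>module_hom R P M. \<forall>x\<in>carrier P. g (h x) = f x))"

definition dsum_module :: "'i set \<Rightarrow> ('i \<Rightarrow> ('a, 'm) module) \<Rightarrow> ('a, 'i \<Rightarrow> 'm) module" where
  "dsum_module I M =
    \<lparr>carrier = {x \<in> (\<Pi>\<^sub>E i\<in>I. carrier (M i)). finite {i \<in> I. x i \<noteq> \<zero>\<^bsub>M i\<^esub>}},
     monoid.mult = undefined, monoid.one = undefined,
     ring.zero = (\<lambda>i\<in>I. \<zero>\<^bsub>M i\<^esub>),
     ring.add = (\<lambda>x y. \<lambda>i\<in>I. x i \<oplus>\<^bsub>M i\<^esub> y i),
     smult = (\<lambda>r x. \<lambda>i\<in>I. r \<odot>\<^bsub>M i\<^esub> x i)\<rparr>"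

definition zero_module :: "('a, 'm) module" where
  "zero_module =
    \<lparr>carrier = {undefined}, monoid.mult = undefined, monoid.one = undefined,
     ring.zero = undefined, ring.add = (\<lambda>_ _. undefined), smult = (\<lambda>_ _. undefined)\<rparr>"


subsection \<open>Tensor products\<close>

text \<open>
  \<open>M \<otimes>\<^sub>R N\<close> is the free abelian group on \<open>M \<times> N\<close> modulo biadditivity and \<open>R\<close>-balancedness.
  Its elements are cosets; \<open>tensor_map\<close> is the map induced by \<open>f \<otimes> id\<close> on cosets.
\<close>

definition tensor_relations ::
  "('a, 'r) ring_scheme \<Rightarrow> ('a, 'm) module \<Rightarrow> ('a, 'n) module \<Rightarrow> ('m \<times> 'n \<Rightarrow>\<^sub>0 int) set" where
  "tensor_relations R M N =
    {frag_of (x \<oplus>\<^bsub>M\<^esub> x', y) - frag_of (x, y) - frag_of (x', y) | x x' y.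
      x \<in> carrier M \<and> x' \<in> carrier M \<and> y \<in> carrier N} \<union>
    {frag_of (x, y \<oplus>\<^bsub>N\<^esub> y') - frag_of (x, y) - frag_of (x, y') | x y y'.
      x \<in> carrier M \<and> y \<in> carrier N \<and> y' \<in> carrier N} \<union>
    {frag_of (r \<odot>\<^bsub>M\<^esub> x, y) - frag_of (x, r \<odot>\<^bsub>N\<^esub> y) | r x y.
      r \<in> carrier R \<and> x \<in> carrier M \<and> y \<in> carrier N}"

definition tensor_kernel ::
  "('a, 'r) ring_scheme \<Rightarrow> ('a, 'm) module \<Rightarrow> ('a, 'n) module \<Rightarrow> ('m \<times> 'n \<Rightarrow>\<^sub>0 int) set" where
  "tensor_kernel R M N =
    generate (free_Abelian_group (carrier M \<times> carrier N)) (tensor_relations R M N)"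

definition tensor_map ::
  "('a, 'r) ring_scheme \<Rightarrow> ('a, 'm) module \<Rightarrow> ('a, 'n) module \<Rightarrow> ('l \<Rightarrow> 'm) \<Rightarrow>
   ('l \<times> 'n \<Rightarrow>\<^sub>0 int) set \<Rightarrow> ('m \<times> 'n \<Rightarrow>\<^sub>0 int) set" where
  "tensor_map R M N f c =
    tensor_kernel R M N <#>\<^bsub>free_Abelian_group (carrier M \<times> carrier N)\<^esub>
      (frag_extend (\<lambda>(x, y). frag_of (f x, y)) ` c)"

definition tensor_module ::
  "('a, 'r) ring_scheme \<Rightarrow> ('a, 'm) module \<Rightarrow> ('a, 'n) module \<Rightarrow>
   ('a, ('m \<times> 'n \<Rightarrow>\<^sub>0 int) set) module" where
  "tensor_module R M N =
    (let T = free_Abelian_group (carrier M \<times> carrier N) Mod tensor_kernel R M N in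
    \<lparr>carrier = carrier T, monoid.mult = undefined, monoid.one = undefined,
     ring.zero = monoid.one T, ring.add = monoid.mult T,
     smult = (\<lambda>r. tensor_map R M N (\<lambda>x. r \<odot>\<^bsub>M\<^esub> x))\<rparr>)"


section \<open>The prime spectrum\<close>

definition Spec :: "('a, 'r) ring_scheme \<Rightarrow> 'a set set" where
  "Spec R = {p. primeideal p R}"

definition zariski_closed :: "('a, 'r) ring_scheme \<Rightarrow> 'a set set \<Rightarrow> bool" where
  "zariski_closed R Z \<longleftrightarrow> (\<exists>I. ideal I R \<and> Z = {p \<in> Spec R. I \<subseteq> p})"

definition thick_support :: "('a, 'r) ring_scheme \<Rightarrow> 'a set set \<Rightarrow> bool" where
  "thick_support R S \<longleftrightarrow> (\<exists>\<C>. (\<forall>Z\<in>\<C>. zariski_closed R Z) \<and> S = \<Union>\<C>)"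

definition indecomposable_thick_support :: "('a, 'r) ring_scheme \<Rightarrow> 'a set set \<Rightarrow> bool" where
  "indecomposable_thick_support R S \<longleftrightarrow> thick_support R S \<and> S \<noteq> {} \<and>
    \<not> (\<exists>S\<^sub>1 S\<^sub>2. thick_support R S\<^sub>1 \<and> thick_support R S\<^sub>2 \<and> S\<^sub>1 \<noteq> {} \<and> S\<^sub>2 \<noteq> {} \<and>
         S\<^sub>1 \<inter> S\<^sub>2 = {} \<and> S = S\<^sub>1 \<union> S\<^sub>2)"


subsection \<open>Residue fields\<close>

definition fraction_rel :: "('a, 'r) ring_scheme \<Rightarrow> (('a \<times> 'a) \<times> ('a \<times> 'a)) set" where
  "fraction_rel D =
    {((a, b), (c, d)). a \<in> carrier D \<and> c \<in> carrier D \<and>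
      b \<in> carrier D - {\<zero>\<^bsub>D\<^esub>} \<and> d \<in> carrier D - {\<zero>\<^bsub>D\<^esub>} \<and> a \<otimes>\<^bsub>D\<^esub> d = c \<otimes>\<^bsub>D\<^esub> b}"

definition fraction_field :: "('a, 'r) ring_scheme \<Rightarrow> ('a \<times> 'a) set ring" where
  "fraction_field D =
    \<lparr>carrier = (carrier D \<times> (carrier D - {\<zero>\<^bsub>D\<^esub>})) // fraction_rel D,
     monoid.mult = (\<lambda>u v. \<Union>(a, b)\<in>u. \<Union>(c, d)\<in>v.
       fraction_rel D `` {(a \<otimes>\<^bsub>D\<^esub> c, b \<otimes>\<^bsub>D\<^esub> d)}),
     monoid.one = fraction_rel D `` {(\<one>\<^bsub>D\<^esub>, \<one>\<^bsub>D\<^esub>)},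
     ring.zero = fraction_rel D `` {(\<zero>\<^bsub>D\<^esub>, \<one>\<^bsub>D\<^esub>)},
     ring.add = (\<lambda>u v. \<Union>(a, b)\<in>u. \<Union>(c, d)\<in>v.
       fraction_rel D `` {(a \<otimes>\<^bsub>D\<^esub> d \<oplus>\<^bsub>D\<^esub> c \<otimes>\<^bsub>D\<^esub> b, b \<otimes>\<^bsub>D\<^esub> d)})\<rparr>"

text \<open>\<open>K(p)\<close>, with \<open>R\<close> acting through \<open>R \<rightarrow> R/p \<rightarrow> K(p)\<close>.\<close>

definition residue_field ::
  "('a, 'r) ring_scheme \<Rightarrow> 'a set \<Rightarrow> ('a, ('a set \<times> 'a set) set) module" where
  "residue_field R p =
    (let D = R Quot p; K = fraction_field D in
    \<lparr>carrier = carrier K, monoid.mult = monoid.mult K, monoid.one = monoid.one K,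
     ring.zero = ring.zero K, ring.add = ring.add K,
     smult = (\<lambda>r u. monoid.mult K (fraction_rel D `` {(p +>\<^bsub>R\<^esub> r, \<one>\<^bsub>D\<^esub>)}) u)\<rparr>)"


section \<open>Complexes of modules\<close>

record ('a, 'u) cochain_complex =
  obj :: "int \<Rightarrow> ('a, 'u) module"
  diff :: "int \<Rightarrow> 'u \<Rightarrow> 'u"

definition module_complex :: "('a, 'r) ring_scheme \<Rightarrow> ('a, 'u) cochain_complex \<Rightarrow> bool" where
  "module_complex R X \<longleftrightarrow>
    (\<forall>n. module R (obj X n) \<and> diff X n \<in> module_hom R (obj X n) (obj X (n + 1)) \<and>
      (\<forall>x\<in>carrier (obj X n). diff X (n + 1) (diff X n x) = \<zero>\<^bsub>obj X (n + 2)\<^esub>))"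

definition chain_map ::
  "('a, 'r) ring_scheme \<Rightarrow> ('a, 'u) cochain_complex \<Rightarrow> ('a, 'v) cochain_complex \<Rightarrow>
   (int \<Rightarrow> 'u \<Rightarrow> 'v) \<Rightarrow> bool" where
  "chain_map R X Y f \<longleftrightarrow>
    (\<forall>n. f n \<in> module_hom R (obj X n) (obj Y n) \<and>
      (\<forall>x\<in>carrier (obj X n). diff Y n (f n x) = f (n + 1) (diff X n x)))"

definition complex_iso ::
  "('a, 'r) ring_scheme \<Rightarrow> ('a, 'u) cochain_complex \<Rightarrow> ('a, 'v) cochain_complex \<Rightarrow> bool" where
  "complex_iso R X Y \<longleftrightarrow>
    (\<exists>f. chain_map R X Y f \<and> (\<forall>n. bij_betw (f n) (carrier (obj X n)) (carrier (obj Y n))))"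

definition homotopic ::
  "('a, 'r) ring_scheme \<Rightarrow> ('a, 'u) cochain_complex \<Rightarrow> ('a, 'v) cochain_complex \<Rightarrow>
   (int \<Rightarrow> 'u \<Rightarrow> 'v) \<Rightarrow> (int \<Rightarrow> 'u \<Rightarrow> 'v) \<Rightarrow> bool" where
  "homotopic R X Y f g \<longleftrightarrow>
    (\<exists>h. \<forall>n. h n \<in> module_hom R (obj X n) (obj Y (n - 1)) \<and>
      (\<forall>x\<in>carrier (obj X n).
        f n x \<ominus>\<^bsub>obj Y n\<^esub> g n x = diff Y (n - 1) (h n x) \<oplus>\<^bsub>obj Y n\<^esub> h (n + 1) (diff X n x)))"

definition cocycles :: "('a, 'u) cochain_complex \<Rightarrow> int \<Rightarrow> 'u set" where
  "cocycles X n = {x \<in> carrier (obj X n). diff X n x = \<zero>\<^bsub>obj X (n + 1)\<^esub>}"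

definition coboundaries :: "('a, 'u) cochain_complex \<Rightarrow> int \<Rightarrow> 'u set" where
  "coboundaries X n = diff X (n - 1) ` carrier (obj X (n - 1))"

definition cohomology :: "('a, 'u) cochain_complex \<Rightarrow> int \<Rightarrow> 'u set monoid" where
  "cohomology X n = (add_monoid (obj X n))\<lparr>carrier := cocycles X n\<rparr> Mod coboundaries X n"

definition cohomology_map ::
  "('a, 'v) cochain_complex \<Rightarrow> (int \<Rightarrow> 'u \<Rightarrow> 'v) \<Rightarrow> int \<Rightarrow> 'u set \<Rightarrow> 'v set" where
  "cohomology_map Y f n c = coboundaries Y n <+>\<^bsub>obj Y n\<^esub> (f n ` c)"

definition quasi_iso ::
  "('a, 'r) ring_scheme \<Rightarrow> ('a, 'u) cochain_complex \<Rightarrow> ('a, 'v) cochain_complex \<Rightarrow>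
   (int \<Rightarrow> 'u \<Rightarrow> 'v) \<Rightarrow> bool" where
  "quasi_iso R X Y f \<longleftrightarrow> chain_map R X Y f \<and>
    (\<forall>n. cohomology_map Y f n \<in> iso (cohomology X n) (cohomology Y n))"

definition zero_complex :: "('a, 'u) cochain_complex" where
  "zero_complex = \<lparr>obj = (\<lambda>_. zero_module), diff = (\<lambda>_ _. undefined)\<rparr>"

definition dsum_complex ::
  "'i set \<Rightarrow> ('i \<Rightarrow> ('a, 'u) cochain_complex) \<Rightarrow> ('a, 'i \<Rightarrow> 'u) cochain_complex" where
  "dsum_complex I X =
    \<lparr>obj = (\<lambda>n. dsum_module I (\<lambda>i. obj (X i) n)),
     diff = (\<lambda>n x. \<lambda>i\<in>I. diff (X i) n (x i))\<rparr>"

definition tensor_complex ::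
  "('a, 'r) ring_scheme \<Rightarrow> ('a, 'u) cochain_complex \<Rightarrow> ('a, 'n) module \<Rightarrow>
   ('a, ('u \<times> 'n \<Rightarrow>\<^sub>0 int) set) cochain_complex" where
  "tensor_complex R X N =
    \<lparr>obj = (\<lambda>n. tensor_module R (obj X n) N),
     diff = (\<lambda>n. tensor_map R (obj X (n + 1)) N (diff X n))\<rparr>"


section \<open>The derived category\<close>

text \<open>
  A morphism \<open>X \<rightarrow> Y\<close> of \<open>D(R)\<close> is represented by a roof \<open>X \<leftarrow> Z \<rightarrow> Y\<close>, given as \<open>(Z, s, f)\<close> with
  \<open>s\<close> a quasi-isomorphism. Roofs are identified when some third roof dominates both of them in the
  homotopy category. All complexes have elements in the universe \<open>'u\<close>; if \<open>'u\<close> is infinite and at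
  least as large as \<open>R\<close>, this is a full subcategory of the derived category of all \<open>R\<close>-modules, closed
  under countable direct sums and containing a copy of every perfect complex.
\<close>

type_synonym ('a, 'u) roof =
  "('a, 'u) cochain_complex \<times> (int \<Rightarrow> 'u \<Rightarrow> 'u) \<times> (int \<Rightarrow> 'u \<Rightarrow> 'u)"

definition is_roof ::
  "('a, 'r) ring_scheme \<Rightarrow> ('a, 'u) cochain_complex \<Rightarrow> ('a, 'u) cochain_complex \<Rightarrow>
   ('a, 'u) roof \<Rightarrow> bool" where
  "is_roof R X Y = (\<lambda>(Z, s, f). module_complex R Z \<and> quasi_iso R Z X s \<and> chain_map R Z Y f)"

definition roof_equiv ::
  "('a, 'r) ring_scheme \<Rightarrow> ('a, 'u) cochain_complex \<Rightarrow> ('a, 'u) cochain_complex \<Rightarrow>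
   ('a, 'u) roof \<Rightarrow> ('a, 'u) roof \<Rightarrow> bool" where
  "roof_equiv R X Y = (\<lambda>(Z, s, f) (Z', s', f').
    (\<exists>(W :: ('a, 'u) cochain_complex) p p'. module_complex R W \<and> chain_map R W Z p \<and> chain_map R W Z' p' \<and>
      quasi_iso R W X (\<lambda>n. s n \<circ> p n) \<and>
      homotopic R W X (\<lambda>n. s n \<circ> p n) (\<lambda>n. s' n \<circ> p' n) \<and>
      homotopic R W Y (\<lambda>n. f n \<circ> p n) (\<lambda>n. f' n \<circ> p' n)))"

text \<open>\<open>roof_comp R X Y V \<alpha> \<beta> \<gamma>\<close>: the roof \<open>\<gamma>\<close> represents \<open>X \<rightarrow> Y \<rightarrow> V\<close>, first \<open>\<alpha>\<close> and then \<open>\<beta>\<close>.\<close>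

definition roof_comp ::
  "('a, 'r) ring_scheme \<Rightarrow> ('a, 'u) cochain_complex \<Rightarrow> ('a, 'u) cochain_complex \<Rightarrow>
   ('a, 'u) cochain_complex \<Rightarrow> ('a, 'u) roof \<Rightarrow> ('a, 'u) roof \<Rightarrow> ('a, 'u) roof \<Rightarrow> bool" where
  "roof_comp R X Y V = (\<lambda>(Z, s, f) (Z', t, g) \<gamma>.
    (\<exists>(W :: ('a, 'u) cochain_complex) p q. module_complex R W \<and> quasi_iso R W Z p \<and> chain_map R W Z' q \<and>
      homotopic R W Y (\<lambda>n. f n \<circ> p n) (\<lambda>n. t n \<circ> q n) \<and>
      roof_equiv R X V (W, \<lambda>n. s n \<circ> p n, \<lambda>n. g n \<circ> q n) \<gamma>))"

definition id_roof :: "('a, 'u) cochain_complex \<Rightarrow> ('a, 'u) roof" where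
  "id_roof X = (X, \<lambda>_. id, \<lambda>_. id)"

definition derived_iso ::
  "('a, 'r) ring_scheme \<Rightarrow> ('a, 'u) cochain_complex \<Rightarrow> ('a, 'u) cochain_complex \<Rightarrow> bool" where
  "derived_iso R X Y \<longleftrightarrow>
    (\<exists>\<alpha> \<beta>. is_roof R X Y \<alpha> \<and> is_roof R Y X \<beta> \<and>
      roof_comp R X Y X \<alpha> \<beta> (id_roof X) \<and> roof_comp R Y X Y \<beta> \<alpha> (id_roof Y))"


section \<open>Perfect complexes, supports and decompositions\<close>

definition perfect_complex :: "('a, 'r) ring_scheme \<Rightarrow> ('a, 'u) cochain_complex \<Rightarrow> bool" where
  "perfect_complex R X \<longleftrightarrow> module_complex R X \<and>
    (\<forall>n. fin_gen_module R (obj X n) \<and> projective_module R (obj X n)) \<and>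
    (\<exists>a b. \<forall>n. n < a \<or> b < n \<longrightarrow> carrier (obj X n) = {\<zero>\<^bsub>obj X n\<^esub>})"

text \<open>
  Meant for perfect \<open>X\<close> only: these are bounded complexes of projectives, so \<open>X \<otimes>\<^sup>L K(p)\<close> is the
  degreewise tensor product.
\<close>

definition Supp :: "('a, 'r) ring_scheme \<Rightarrow> ('a, 'u) cochain_complex \<Rightarrow> 'a set set" where
  "Supp R X =
    {p \<in> Spec R. \<not> derived_iso R (tensor_complex R X (residue_field R p)) zero_complex}"

text \<open>
  \<open>dsum_complex I Xs\<close> has elements of type \<open>'i \<Rightarrow> 'u\<close>; \<open>S\<close> is an isomorphic copy of it in the
  universe \<open>'u\<close>.
\<close>

definition support_decomposition ::
  "('a, 'r) ring_scheme \<Rightarrow> ('a, 'u) cochain_complex \<Rightarrow> 'i set \<Rightarrow>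
   ('i \<Rightarrow> ('a, 'u) cochain_complex) \<Rightarrow> bool" where
  "support_decomposition R X I Xs \<longleftrightarrow>
    (\<forall>i\<in>I. perfect_complex R (Xs i)) \<and>
    (\<exists>S. module_complex R S \<and> complex_iso R S (dsum_complex I Xs) \<and> derived_iso R X S) \<and>
    (\<forall>i\<in>I. indecomposable_thick_support R (Supp R (Xs i))) \<and>
    (\<forall>i\<in>I. \<forall>j\<in>I. i \<noteq> j \<longrightarrow> Supp R (Xs i) \<inter> Supp R (Xs j) = {})"

end

theory Submission
  imports Defs "HOL-Algebra.Ideal_Product"
begin

text \<open>
  A perfect complex is handled as a bounded complex of modules with finite dual bases. Let \<open>J(X)\<close> be
  the ideal of all \<open>r\<close> whose multiplication on \<open>X\<close> is null-homotopic. By Nakayama's lemma the support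
  of \<open>X\<close> is the closed set \<open>V(J(X))\<close>. If two perfect complexes have disjoint supports, then \<open>r + s = 1\<close>
  with \<open>r \<in> J(X)\<close> and \<open>s \<in> J(Y)\<close>, so every chain map between them is null-homotopic.

  If \<open>V(J(X))\<close> decomposes, then some nontrivial \<open>e\<close> is idempotent modulo \<open>J(X)\<close>, hence up to homotopy
  on \<open>X\<close>. After replacing \<open>e\<close>, the null-homotopy \<open>h\<close> of \<open>e(1 - e)\<close> can be chosen with \<open>h\<^sup>2 = 0\<close>. The
  matrices on \<open>Q = \<Oplus>\<^sub>i X\<^sup>i\<close> with \<open>d + h\<close> off the diagonal and \<open>e\<close>, \<open>1 - e\<close> alternating on it are then
  idempotent up to sign, consecutive ones compose to zero, and truncating the resulting periodic
  complex gives the direct summand of \<open>X\<close> cut out by \<open>e\<close>. Since \<open>J\<close> strictly increases, noetherian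
  induction yields the decomposition.

  For uniqueness, a decomposition is lifted from the derived category to the homotopy category. Each
  component of one decomposition meets exactly one component of the other in its support, and the
  maps between these two through \<open>X\<close> are inverse to each other up to homotopy.
\<close>

section \<open>Modules with dual bases\<close>

text \<open>Projectivity is tested only against modules in the universe \<open>'u\<close>, while the
  tensor products, function modules and sums of the proof live over other types. A dual basis is a
  witness that can be carried across types; \<open>'u\<close> must be infinite and at least as large
  as \<open>R\<close> so that the free module on finitely many generators embeds in it. A homotopy
  idempotent need not be represented by an idempotent chain map, so its image cannot be taken degree
  by degree; on the total module \<open>Q\<close> there are honest idempotents. Left untruncated,
  the complex would be all of \<open>Q\<close> in every low degree; there consecutive differentials
  are complementary idempotents up to sign, so one image replaces the whole tail. \<open>h\<close>
  must square to zero because then d + h squares to e(1 - e), the product of neighbouring diagonal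
  entries. A decomposition that is merely given may have an infinite index set, and its sum is
  isomorphic to \<open>X\<close> only through roofs. Finiteness comes from compactness:
  \<open>X\<close> has finitely many generators in all, and a component that they do not reach would
  be contractible.\<close>

lemma module_homI:
  assumes "\<And>x. x \<in> carrier M \<Longrightarrow> f x \<in> carrier N"
    and "\<And>x y. x \<in> carrier M \<Longrightarrow> y \<in> carrier M \<Longrightarrow> f (x \<oplus>\<^bsub>M\<^esub> y) = f x \<oplus>\<^bsub>N\<^esub> f y"
    and "\<And>r x. r \<in> carrier R \<Longrightarrow> x \<in> carrier M \<Longrightarrow> f (r \<odot>\<^bsub>M\<^esub> x) = r \<odot>\<^bsub>N\<^esub> f x"
  shows "f \<in> module_hom R M N"
  using assms by (auto simp: module_hom_def)

lemma module_hom_closed: "f \<in> module_hom R M N \<Longrightarrow> x \<in> carrier M \<Longrightarrow> f x \<in> carrier N"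
  and module_hom_add: "f \<in> module_hom R M N \<Longrightarrow> x \<in> carrier M \<Longrightarrow> y \<in> carrier M \<Longrightarrow>
    f (x \<oplus>\<^bsub>M\<^esub> y) = f x \<oplus>\<^bsub>N\<^esub> f y"
  and module_hom_smult: "f \<in> module_hom R M N \<Longrightarrow> r \<in> carrier R \<Longrightarrow> x \<in> carrier M \<Longrightarrow>
    f (r \<odot>\<^bsub>M\<^esub> x) = r \<odot>\<^bsub>N\<^esub> f x"
  by (auto simp: module_hom_def)

lemma module_hom_zero:
  assumes "f \<in> module_hom R M N" "abelian_group M" "abelian_group N"
  shows "f \<zero>\<^bsub>M\<^esub> = \<zero>\<^bsub>N\<^esub>"
proof -
  interpret M: abelian_group M by fact
  interpret N: abelian_group N by fact
  have "f \<zero>\<^bsub>M\<^esub> \<oplus>\<^bsub>N\<^esub> f \<zero>\<^bsub>M\<^esub> = f \<zero>\<^bsub>M\<^esub>"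
    using module_hom_add[OF assms(1), of "\<zero>\<^bsub>M\<^esub>" "\<zero>\<^bsub>M\<^esub>"] by simp
  then show ?thesis
    using module_hom_closed[OF assms(1) M.zero_closed] N.add.l_cancel_one by blast
qed

lemma module_hom_minus:
  assumes "f \<in> module_hom R M N" "abelian_group M" "abelian_group N" "x \<in> carrier M"
  shows "f (\<ominus>\<^bsub>M\<^esub> x) = \<ominus>\<^bsub>N\<^esub> f x"
proof -
  interpret M: abelian_group M by fact
  interpret N: abelian_group N by fact
  have "f (\<ominus>\<^bsub>M\<^esub> x) \<oplus>\<^bsub>N\<^esub> f x = \<zero>\<^bsub>N\<^esub>"
    using module_hom_add[OF assms(1), of "\<ominus>\<^bsub>M\<^esub> x" x] module_hom_zero[OF assms(1-3)] assms(4)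
    by (simp add: M.l_neg)
  then show ?thesis
    using module_hom_closed[OF assms(1)] assms(4) by (simp add: N.minus_equality)
qed

lemma module_hom_diff:
  assumes "f \<in> module_hom R M N" "abelian_group M" "abelian_group N" "x \<in> carrier M" "y \<in> carrier M"
  shows "f (x \<ominus>\<^bsub>M\<^esub> y) = f x \<ominus>\<^bsub>N\<^esub> f y"
proof -
  interpret M: abelian_group M by fact
  show ?thesis
    unfolding a_minus_def using assms module_hom_minus[OF assms(1-3,5)] module_hom_add[OF assms(1)]
    by simp
qed

lemma module_abelian_group: "module R M \<Longrightarrow> abelian_group M"
  by (simp add: module_def)

lemma module_hom_cong:
  assumes "f \<in> module_hom R M N" "module R M" "\<And>x. x \<in> carrier M \<Longrightarrow> g x = f x"
  shows "g \<in> module_hom R M N"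
proof -
  interpret M: module R M by fact
  show ?thesis using assms by (auto simp: module_hom_def)
qed

lemma module_hom_id: "(\<lambda>x. x) \<in> module_hom R M M"
  by (simp add: module_hom_def)

lemma module_hom_comp:
  "f \<in> module_hom R M N \<Longrightarrow> g \<in> module_hom R N L \<Longrightarrow> (\<lambda>x. g (f x)) \<in> module_hom R M L"
  by (auto simp: module_hom_def Pi_iff)

lemma module_hom_const_zero: "module R N \<Longrightarrow> (\<lambda>x. \<zero>\<^bsub>N\<^esub>) \<in> module_hom R M N"
proof -
  assume "module R N"
  then interpret N: module R N .
  show ?thesis by (auto simp: module_hom_def)
qed

lemma module_hom_plus:
  assumes "module R N" "f \<in> module_hom R M N" "g \<in> module_hom R M N"
  shows "(\<lambda>x. f x \<oplus>\<^bsub>N\<^esub> g x) \<in> module_hom R M N"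
proof -
  interpret N: module R N by fact
  show ?thesis
  proof (rule module_homI, goal_cases)
    case (1 x)
    then show ?case using assms module_hom_closed by (metis N.add.m_closed)
  next
    case (2 x y)
    then show ?case using assms(2,3)[THEN module_hom_closed] assms(2,3)[THEN module_hom_add]
      by (simp add: N.a_ac)
  next
    case (3 r x)
    then show ?case using assms(2,3)[THEN module_hom_closed] assms(2,3)[THEN module_hom_smult]
      by (simp add: N.smult_r_distr)
  qed
qed

lemma module_hom_times:
  assumes "module R N" "f \<in> module_hom R M N" "r \<in> carrier R"
  shows "(\<lambda>x. r \<odot>\<^bsub>N\<^esub> f x) \<in> module_hom R M N"
proof -
  interpret N: module R N by fact
  show ?thesis
  proof (rule module_homI, goal_cases)
    case (1 x)
    then show ?case using assms module_hom_closed by (metis N.smult_closed)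
  next
    case (2 x y)
    then show ?case using assms(2)[THEN module_hom_closed] assms(2)[THEN module_hom_add] assms(3)
      by (simp add: N.smult_r_distr)
  next
    case (3 s x)
    then show ?case
      using assms(2)[THEN module_hom_closed] assms(2)[THEN module_hom_smult] assms(3)
      by (simp flip: N.smult_assoc1 add: N.m_comm)
  qed
qed

lemma module_hom_neg:
  assumes "module R N" "f \<in> module_hom R M N"
  shows "(\<lambda>x. \<ominus>\<^bsub>N\<^esub> f x) \<in> module_hom R M N"
proof -
  interpret N: module R N by fact
  show ?thesis
  proof (rule module_homI, goal_cases)
    case (1 x)
    then show ?case using assms module_hom_closed by (metis N.add.inv_closed)
  next
    case (2 x y)
    then show ?case using assms(2)[THEN module_hom_closed] assms(2)[THEN module_hom_add]
      by (simp add: N.minus_add)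
  next
    case (3 s x)
    then show ?case
      using assms(2)[THEN module_hom_closed] assms(2)[THEN module_hom_smult]
      by (simp add: N.smult_r_minus)
  qed
qed

lemma module_hom_scalar:
  "module R M \<Longrightarrow> r \<in> carrier R \<Longrightarrow> (\<lambda>x. r \<odot>\<^bsub>M\<^esub> x) \<in> module_hom R M M"
  by (rule module_hom_times[OF _ module_hom_id])


text \<open>A fold over a list instead of \<open>finsum\<close>. Dual bases are lists, possibly with
  repetitions, and the fold depends only on zero and addition, so \<open>obj T n\<close> and the
  total module \<open>Q\<close> below have literally the same sums.\<close>

definition msum :: "('b, 'c) ring_scheme \<Rightarrow> ('l \<Rightarrow> 'b) \<Rightarrow> 'l list \<Rightarrow> 'b" where
  "msum M f L = foldr (\<lambda>l s. f l \<oplus>\<^bsub>M\<^esub> s) L \<zero>\<^bsub>M\<^esub>"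

lemma msum_Nil [simp]: "msum M f [] = \<zero>\<^bsub>M\<^esub>"
  and msum_Cons [simp]: "msum M f (l # L) = f l \<oplus>\<^bsub>M\<^esub> msum M f L"
  by (simp_all add: msum_def)

lemma msum_cong: "(\<And>l. l \<in> set L \<Longrightarrow> f l = g l) \<Longrightarrow> msum M f L = msum M g L"
  by (induction L) auto

lemma msum_map: "msum M f (map g L) = msum M (\<lambda>l. f (g l)) L"
  by (induction L) auto

context abelian_group
begin

lemma msum_closed: "(\<And>l. l \<in> set L \<Longrightarrow> f l \<in> carrier G) \<Longrightarrow> msum G f L \<in> carrier G"
  by (induction L) auto

lemma msum_append:
  "(\<And>l. l \<in> set (L @ L') \<Longrightarrow> f l \<in> carrier G) \<Longrightarrow> msum G f (L @ L') = msum G f L \<oplus> msum G f L'"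
  by (induction L) (auto simp: msum_closed a_assoc)

lemma msum_concat:
  "(\<And>K l. K \<in> set L \<Longrightarrow> l \<in> set K \<Longrightarrow> f l \<in> carrier G) \<Longrightarrow>
    msum G f (concat L) = msum G (\<lambda>K. msum G f K) L"
proof (induction L)
  case (Cons K L)
  have "msum G f (K @ concat L) = msum G f K \<oplus> msum G f (concat L)"
    by (rule msum_append) (use Cons.prems in auto)
  moreover have "msum G f (concat L) = msum G (msum G f) L"
    by (rule Cons.IH) (use Cons.prems in auto)
  ultimately show ?case by simp
qed simp

lemma msum_zero: "(\<And>l. l \<in> set L \<Longrightarrow> f l = \<zero>) \<Longrightarrow> msum G f L = \<zero>"
  by (induction L) auto

lemma msum_add:
  "(\<And>l. l \<in> set L \<Longrightarrow> f l \<in> carrier G) \<Longrightarrow> (\<And>l. l \<in> set L \<Longrightarrow> g l \<in> carrier G) \<Longrightarrow>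
    msum G (\<lambda>l. f l \<oplus> g l) L = msum G f L \<oplus> msum G g L"
proof (induction L)
  case (Cons a L)
  then show ?case by (simp add: msum_closed a_ac)
qed simp

lemma msum_single:
  assumes "distinct L" "k \<in> set L" "\<And>l. l \<in> set L \<Longrightarrow> l \<noteq> k \<Longrightarrow> f l = \<zero>" "f k \<in> carrier G"
  shows "msum G f L = f k"
  using assms
proof (induction L)
  case (Cons a L)
  show ?case
  proof (cases "a = k")
    case True
    then have "msum G f L = \<zero>" using Cons.prems by (intro msum_zero) auto
    then show ?thesis using True Cons.prems by simp
  next
    case False
    then show ?thesis using Cons by (auto simp: msum_closed)
  qed
qed simp

end

lemma module_hom_msum:
  assumes "f \<in> module_hom R M N" "abelian_group M" "abelian_group N"
    and "\<And>l. l \<in> set L \<Longrightarrow> g l \<in> carrier M"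
  shows "f (msum M g L) = msum N (\<lambda>l. f (g l)) L"
  using assms(4)
proof (induction L)
  case Nil
  then show ?case using module_hom_zero[OF assms(1-3)] by simp
next
  case (Cons a L)
  interpret M: abelian_group M by fact
  show ?case using Cons by (simp add: module_hom_add[OF assms(1)] M.msum_closed)
qed

lemma module_hom_msum_maps:
  assumes "module R N" "\<And>l. l \<in> set L \<Longrightarrow> f l \<in> module_hom R M N"
  shows "(\<lambda>x. msum N (\<lambda>l. f l x) L) \<in> module_hom R M N"
  using assms(2)
proof (induction L)
  case Nil
  then show ?case using assms(1) by (simp add: module_hom_const_zero)
next
  case (Cons a L)
  then show ?case by (simp add: module_hom_plus[OF assms(1)])
qed

section \<open>Dual bases of finitely generated projective modules\<close>

definition regular_module :: "('a, 'r) ring_scheme \<Rightarrow> ('a, 'a) module" where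
  "regular_module R = \<lparr>carrier = carrier R, monoid.mult = undefined, monoid.one = undefined,
     ring.zero = \<zero>\<^bsub>R\<^esub>, ring.add = (\<lambda>x y. x \<oplus>\<^bsub>R\<^esub> y), smult = (\<lambda>x y. x \<otimes>\<^bsub>R\<^esub> y)\<rparr>"

lemma regular_module_simps [simp]:
  "carrier (regular_module R) = carrier R" "\<zero>\<^bsub>regular_module R\<^esub> = \<zero>\<^bsub>R\<^esub>"
  "x \<oplus>\<^bsub>regular_module R\<^esub> y = x \<oplus>\<^bsub>R\<^esub> y" "x \<odot>\<^bsub>regular_module R\<^esub> y = x \<otimes>\<^bsub>R\<^esub> y"
  by (simp_all add: regular_module_def)

lemma (in cring) module_regular: "module R (regular_module R)"
proof (rule moduleI)
  show "abelian_group (regular_module R)"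
    by (rule abelian_groupI) (auto simp: a_ac intro!: bexI[of _ "\<ominus> x" for x] l_neg)
qed (auto simp: l_distr r_distr m_assoc is_cring)

lemma module_hom_smult_right:
  assumes "module R M" "y \<in> carrier M"
  shows "(\<lambda>r. r \<odot>\<^bsub>M\<^esub> y) \<in> module_hom R (regular_module R) M"
proof -
  interpret M: module R M by fact
  show ?thesis using assms(2) by (auto simp: module_hom_def M.smult_l_distr M.smult_assoc1)
qed


text \<open>The functionals need not be dual to the generators, and the generators may satisfy
  relations: the expansion of every \<open>x\<close> is all that is asked, and the existence of such
  data characterises finitely generated projective modules. A list of pairs spares an index
  type.\<close>

definition dual_basis :: "('a, 'r) ring_scheme \<Rightarrow> ('a, 'm) module \<Rightarrow> ('m \<times> ('m \<Rightarrow> 'a)) list \<Rightarrow> bool" where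
  "dual_basis R M L \<longleftrightarrow>
    (\<forall>l\<in>set L. fst l \<in> carrier M \<and> snd l \<in> module_hom R M (regular_module R)) \<and>
    (\<forall>x\<in>carrier M. x = msum M (\<lambda>l. snd l x \<odot>\<^bsub>M\<^esub> fst l) L)"

definition fgp :: "('a, 'r) ring_scheme \<Rightarrow> ('a, 'm) module \<Rightarrow> bool" where
  "fgp R M \<longleftrightarrow> module R M \<and> (\<exists>L. dual_basis R M L)"

lemma dual_basisD:
  assumes "dual_basis R M L"
  shows "l \<in> set L \<Longrightarrow> fst l \<in> carrier M" "l \<in> set L \<Longrightarrow> snd l \<in> module_hom R M (regular_module R)"
    "x \<in> carrier M \<Longrightarrow> l \<in> set L \<Longrightarrow> snd l x \<in> carrier R"
    "x \<in> carrier M \<Longrightarrow> msum M (\<lambda>l. snd l x \<odot>\<^bsub>M\<^esub> fst l) L = x"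
  using assms module_hom_closed[of _ R M "regular_module R"] by (auto simp: dual_basis_def)

lemma dual_basis_hom_expand:
  assumes "dual_basis R M L" "module R M" "module R N" "f \<in> module_hom R M N" "x \<in> carrier M"
  shows "f x = msum N (\<lambda>l. snd l x \<odot>\<^bsub>N\<^esub> f (fst l)) L"
proof -
  interpret M: module R M by fact
  interpret N: module R N by fact
  note D = dual_basisD[OF assms(1)]
  have "f x = f (msum M (\<lambda>l. snd l x \<odot>\<^bsub>M\<^esub> fst l) L)"
    using D(4)[OF assms(5)] by simp
  also have "\<dots> = msum N (\<lambda>l. f (snd l x \<odot>\<^bsub>M\<^esub> fst l)) L"
    using assms D by (intro module_hom_msum[OF assms(4)]) (auto simp: M.abelian_group_axioms N.abelian_group_axioms)
  also have "\<dots> = msum N (\<lambda>l. snd l x \<odot>\<^bsub>N\<^esub> f (fst l)) L"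
    using assms D by (intro msum_cong) (auto intro!: module_hom_smult)
  finally show ?thesis .
qed

lemma dual_basis_hom_ext:
  assumes "dual_basis R M L" "module R M" "module R N" "f \<in> module_hom R M N" "g \<in> module_hom R M N"
    and "\<And>l. l \<in> set L \<Longrightarrow> f (fst l) = g (fst l)" "x \<in> carrier M"
  shows "f x = g x"
  unfolding dual_basis_hom_expand[OF assms(1-3,4,7)] dual_basis_hom_expand[OF assms(1-3,5,7)]
  using assms(6) by (auto intro: msum_cong)

text \<open>Because the generators may satisfy relations, this map need not send
  \<open>fst l\<close> to \<open>b l\<close>; users have to argue with the whole expansion.\<close>

lemma dual_basis_extend:
  assumes "dual_basis R M L" "module R M" "module R N" "\<And>l. l \<in> set L \<Longrightarrow> b l \<in> carrier N"
  shows "(\<lambda>x. msum N (\<lambda>l. snd l x \<odot>\<^bsub>N\<^esub> b l) L) \<in> module_hom R M N"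
proof (rule module_hom_msum_maps[OF assms(3)])
  fix l assume "l \<in> set L"
  then show "(\<lambda>x. snd l x \<odot>\<^bsub>N\<^esub> b l) \<in> module_hom R M N"
    using module_hom_comp[OF dual_basisD(2)[OF assms(1)] module_hom_smult_right[OF assms(3,4)]]
    by blast
qed

lemma msum_hom_scaled:
  assumes "module R N" "module R C" "g \<in> module_hom R N C"
    "\<And>l. l \<in> set L \<Longrightarrow> b l \<in> carrier N" "\<And>l. l \<in> set L \<Longrightarrow> r l \<in> carrier R"
  shows "g (msum N (\<lambda>l. r l \<odot>\<^bsub>N\<^esub> b l) L) = msum C (\<lambda>l. r l \<odot>\<^bsub>C\<^esub> g (b l)) L"
proof -
  interpret N: module R N by fact
  interpret C: module R C by fact
  show ?thesis
    using module_hom_msum[OF assms(3) N.abelian_group_axioms C.abelian_group_axioms,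
        of L "\<lambda>l. r l \<odot>\<^bsub>N\<^esub> b l"] assms(4,5) module_hom_smult[OF assms(3)]
    by (auto intro!: msum_cong)
qed

text \<open>The chosen preimages may violate the relations among the generators, but
  \<open>g\<close> applied to the combination of the \<open>b l\<close> is the expansion of
  \<open>f x\<close>. \<open>B\<close> and \<open>C\<close> may have elements of any type, unlike
  the test modules of \<open>projective_module\<close>, and \<open>g\<close> has to reach only the
  images of the generators.\<close>

lemma dual_basis_lift:
  assumes L: "dual_basis R M L" and "module R M" "module R B" "module R C"
    and g: "g \<in> module_hom R B C" and f: "f \<in> module_hom R M C"
    and ex: "\<And>l. l \<in> set L \<Longrightarrow> \<exists>b\<in>carrier B. g b = f (fst l)"
  shows "\<exists>h\<in>module_hom R M B. \<forall>x\<in>carrier M. g (h x) = f x"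
proof -
  obtain b where b: "\<And>l. l \<in> set L \<Longrightarrow> b l \<in> carrier B \<and> g (b l) = f (fst l)"
    using ex by metis
  define h where "h = (\<lambda>x. msum B (\<lambda>l. snd l x \<odot>\<^bsub>B\<^esub> b l) L)"
  have "h \<in> module_hom R M B"
    unfolding h_def using b by (intro dual_basis_extend[OF L]) (auto simp: assms)
  moreover have "g (h x) = f x" if x: "x \<in> carrier M" for x
  proof -
    have "g (h x) = msum C (\<lambda>l. snd l x \<odot>\<^bsub>C\<^esub> g (b l)) L"
      unfolding h_def using b dual_basisD[OF L] x
      by (intro msum_hom_scaled[OF _ _ g]) (auto simp: assms)
    also have "\<dots> = f x"
      unfolding dual_basis_hom_expand[OF L assms(2,4) f x] using b by (auto intro: msum_cong)
    finally show ?thesis .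
  qed
  ultimately show ?thesis by blast
qed

text \<open>The identity of \<open>M\<close> factors through the finite sum of the
  \<open>N j\<close>. Dual bases pulled back along \<open>u j\<close> and pushed forward along
  \<open>v j\<close> concatenate to one of \<open>M\<close>; the sum itself is never formed, so no
  type has to accommodate it.\<close>

lemma fgp_sum_of_retracts:
  assumes M: "module R M"
    and N: "\<And>j. j \<in> set J \<Longrightarrow> fgp R (N j)"
    and u: "\<And>j. j \<in> set J \<Longrightarrow> u j \<in> module_hom R M (N j)"
    and v: "\<And>j. j \<in> set J \<Longrightarrow> v j \<in> module_hom R (N j) M"
    and sum: "\<And>x. x \<in> carrier M \<Longrightarrow> x = msum M (\<lambda>j. v j (u j x)) J"
  shows "fgp R M"
proof -
  interpret M: module R M by fact
  obtain K where K: "\<And>j. j \<in> set J \<Longrightarrow> dual_basis R (N j) (K j)"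
    using N unfolding fgp_def by metis
  note D = dual_basisD[OF K]
  define L where "L = concat (map (\<lambda>j. map (\<lambda>l. (v j (fst l), \<lambda>x. snd l (u j x))) (K j)) J)"
  have mem: "fst l \<in> carrier M \<and> snd l \<in> module_hom R M (regular_module R)" if "l \<in> set L" for l
    using that module_hom_closed[OF v D(1)] module_hom_comp[OF u D(2)] by (auto simp: L_def)
  have "x = msum M (\<lambda>l. snd l x \<odot>\<^bsub>M\<^esub> fst l) L" if x: "x \<in> carrier M" for x
  proof -
    have car: "snd l x \<odot>\<^bsub>M\<^esub> fst l \<in> carrier M" if "l \<in> set L" for l
      using mem[OF that] x module_hom_closed[of "snd l" R M "regular_module R" x] by auto
    have "msum M (\<lambda>l. snd l x \<odot>\<^bsub>M\<^esub> fst l) L =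
        msum M (\<lambda>j. msum M (\<lambda>l. snd l (u j x) \<odot>\<^bsub>M\<^esub> v j (fst l)) (K j)) J"
    proof -
      have "msum M (\<lambda>l. snd l x \<odot>\<^bsub>M\<^esub> fst l) L = msum M (msum M (\<lambda>l. snd l x \<odot>\<^bsub>M\<^esub> fst l))
          (map (\<lambda>j. map (\<lambda>l. (v j (fst l), \<lambda>x. snd l (u j x))) (K j)) J)"
        unfolding L_def by (rule M.msum_concat, rule car) (auto simp: L_def)
      then show ?thesis by (simp add: msum_map)
    qed
    also have "\<dots> = msum M (\<lambda>j. v j (u j x)) J"
    proof (rule msum_cong)
      fix j assume j: "j \<in> set J"
      show "msum M (\<lambda>l. snd l (u j x) \<odot>\<^bsub>M\<^esub> v j (fst l)) (K j) = v j (u j x)"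
        using dual_basis_hom_expand[OF K[OF j] _ M v[OF j], of "u j x"] N[OF j]
          module_hom_closed[OF u[OF j] x] by (simp add: fgp_def)
    qed
    also have "\<dots> = x" using sum[OF x] by simp
    finally show ?thesis by simp
  qed
  then show ?thesis using mem M unfolding fgp_def dual_basis_def by blast
qed

lemma fgp_retract:
  assumes "module R M" "fgp R N" "u \<in> module_hom R M N" "v \<in> module_hom R N M"
    "\<And>x. x \<in> carrier M \<Longrightarrow> v (u x) = x"
  shows "fgp R M"
proof -
  interpret M: module R M by fact
  show ?thesis
    by (rule fgp_sum_of_retracts[of R M "[()]" "\<lambda>_. N" "\<lambda>_. u" "\<lambda>_. v"]) (use assms in auto)
qed


text \<open>Transport of structure along an injection \<open>g\<close>. Modules built over function
  types return in this way to the universe \<open>'u\<close>, where projectivity and the derived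
  category are formulated.\<close>

definition transport_module :: "('m \<Rightarrow> 'n) \<Rightarrow> ('a, 'm) module \<Rightarrow> ('a, 'n) module" where
  "transport_module g M = (let k = inv_into (carrier M) g in
    \<lparr>carrier = g ` carrier M, monoid.mult = undefined, monoid.one = undefined,
     ring.zero = g \<zero>\<^bsub>M\<^esub>, ring.add = (\<lambda>x y. g (k x \<oplus>\<^bsub>M\<^esub> k y)),
     smult = (\<lambda>r x. g (r \<odot>\<^bsub>M\<^esub> k x))\<rparr>)"

lemma transport_module_simps [simp]:
  "carrier (transport_module g M) = g ` carrier M"
  "\<zero>\<^bsub>transport_module g M\<^esub> = g \<zero>\<^bsub>M\<^esub>"
  "inj_on g (carrier M) \<Longrightarrow> x \<in> carrier M \<Longrightarrow> y \<in> carrier M \<Longrightarrow>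
    g x \<oplus>\<^bsub>transport_module g M\<^esub> g y = g (x \<oplus>\<^bsub>M\<^esub> y)"
  "inj_on g (carrier M) \<Longrightarrow> x \<in> carrier M \<Longrightarrow> r \<odot>\<^bsub>transport_module g M\<^esub> g x = g (r \<odot>\<^bsub>M\<^esub> x)"
  by (simp_all add: transport_module_def Let_def)

lemma
  assumes "module R M" "inj_on g (carrier M)"
  shows module_transport: "module R (transport_module g M)"
    and transport_hom: "g \<in> module_hom R M (transport_module g M)"
    and transport_inv_hom: "inv_into (carrier M) g \<in> module_hom R (transport_module g M) M"
proof -
  interpret M: module R M by fact
  note [simp] = assms(2)
  show "module R (transport_module g M)"
  proof (rule moduleI)
    show "abelian_group (transport_module g M)"
    proof (rule abelian_groupI)
      fix x assume "x \<in> carrier (transport_module g M)"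
      then obtain y where y: "x = g y" "y \<in> carrier M" by auto
      then have "g (\<ominus>\<^bsub>M\<^esub> y) \<oplus>\<^bsub>transport_module g M\<^esub> x = \<zero>\<^bsub>transport_module g M\<^esub>"
        by (simp add: M.l_neg)
      then show "\<exists>y\<in>carrier (transport_module g M). y \<oplus>\<^bsub>transport_module g M\<^esub> x = \<zero>\<^bsub>transport_module g M\<^esub>"
        using y by auto
    qed (auto simp: M.a_ac)
  qed (auto simp: M.is_cring M.smult_l_distr M.smult_r_distr M.smult_assoc1)
  show "g \<in> module_hom R M (transport_module g M)"
    by (auto simp: module_hom_def)
  show "inv_into (carrier M) g \<in> module_hom R (transport_module g M) M"
    by (auto simp: module_hom_def)
qed

section \<open>Direct sums of modules\<close>

lemma dsum_module_simps [simp]: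
  "carrier (dsum_module I M) = {x \<in> (\<Pi>\<^sub>E i\<in>I. carrier (M i)). finite {i \<in> I. x i \<noteq> \<zero>\<^bsub>M i\<^esub>}}"
  "\<zero>\<^bsub>dsum_module I M\<^esub> = (\<lambda>i\<in>I. \<zero>\<^bsub>M i\<^esub>)"
  "x \<oplus>\<^bsub>dsum_module I M\<^esub> y = (\<lambda>i\<in>I. x i \<oplus>\<^bsub>M i\<^esub> y i)"
  "r \<odot>\<^bsub>dsum_module I M\<^esub> x = (\<lambda>i\<in>I. r \<odot>\<^bsub>M i\<^esub> x i)"
  by (simp_all add: dsum_module_def)

lemma (in abelian_group) a_inv_zero: "\<ominus> \<zero> = \<zero>"
  using minus_equality[of \<zero> \<zero>] by simp

lemma module_dsum:
  assumes R: "cring R" and M: "\<And>i. i \<in> I \<Longrightarrow> module R (M i)"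
  shows "module R (dsum_module I M)"
proof -
  have ag: "abelian_group (M i)" if "i \<in> I" for i
    using M[OF that] by (rule module_abelian_group)
  note ab = ag[THEN abelian_group.axioms(1)]
  have fin2: "finite {i \<in> I. x i \<oplus>\<^bsub>M i\<^esub> y i \<noteq> \<zero>\<^bsub>M i\<^esub>}"
    if "finite {i \<in> I. x i \<noteq> \<zero>\<^bsub>M i\<^esub>}" "finite {i \<in> I. y i \<noteq> \<zero>\<^bsub>M i\<^esub>}" for x y
    by (rule finite_subset[OF _ finite_UnI[OF that]])
      (auto simp: abelian_monoid.l_zero[OF ab] abelian_monoid.zero_closed[OF ab])
  have fin1: "finite {i \<in> I. f i (x i) \<noteq> \<zero>\<^bsub>M i\<^esub>}"
    if "finite {i \<in> I. x i \<noteq> \<zero>\<^bsub>M i\<^esub>}" "\<And>i. i \<in> I \<Longrightarrow> f i \<zero>\<^bsub>M i\<^esub> = \<zero>\<^bsub>M i\<^esub>" for f x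
    by (rule finite_subset[OF _ that(1)]) (use that(2) in auto)
  show ?thesis
  proof (rule moduleI[OF R])
    show "abelian_group (dsum_module I M)"
    proof (rule abelian_groupI, goal_cases)
      case (1 x y)
      then show ?case using fin2 abelian_monoid.a_closed[OF ab] by (auto simp: PiE_iff cong: conj_cong)
    next
      case 2
      then show ?case using abelian_monoid.zero_closed[OF ab] by (auto simp: PiE_iff cong: conj_cong)
    next
      case (3 x y z)
      then show ?case using abelian_monoid.a_assoc[OF ab] by (auto simp: PiE_iff intro!: restrict_ext)
    next
      case (4 x y)
      then show ?case using abelian_monoid.a_comm[OF ab] by (auto simp: PiE_iff intro!: restrict_ext)
    next
      case (5 x)
      then show ?case using abelian_monoid.l_zero[OF ab]
        by (auto simp: PiE_iff extensional_def intro!: ext)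
    next
      case (6 x)
      define y where "y = (\<lambda>i\<in>I. \<ominus>\<^bsub>M i\<^esub> x i)"
      have "finite {i \<in> I. \<ominus>\<^bsub>M i\<^esub> x i \<noteq> \<zero>\<^bsub>M i\<^esub>}"
        by (rule fin1) (use 6 abelian_group.a_inv_zero[OF ag] in auto)
      then have "y \<in> carrier (dsum_module I M)"
        using 6 abelian_group.a_inv_closed[OF ag] by (auto simp: y_def PiE_iff cong: conj_cong)
      moreover have "y \<oplus>\<^bsub>dsum_module I M\<^esub> x = \<zero>\<^bsub>dsum_module I M\<^esub>"
        using 6 abelian_group.l_neg[OF ag] by (auto simp: y_def PiE_iff intro!: restrict_ext)
      ultimately show ?case by blast
    qed
  next
    fix a x assume *: "a \<in> carrier R" "x \<in> carrier (dsum_module I M)"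
    have "finite {i \<in> I. a \<odot>\<^bsub>M i\<^esub> x i \<noteq> \<zero>\<^bsub>M i\<^esub>}"
      by (rule fin1) (use * module.smult_r_null[OF M] in auto)
    then show "a \<odot>\<^bsub>dsum_module I M\<^esub> x \<in> carrier (dsum_module I M)"
      using * module.smult_closed[OF M] by (auto simp: PiE_iff cong: conj_cong)
  next
    fix a b x assume "a \<in> carrier R" "b \<in> carrier R" "x \<in> carrier (dsum_module I M)"
    then show "(a \<oplus>\<^bsub>R\<^esub> b) \<odot>\<^bsub>dsum_module I M\<^esub> x =
        a \<odot>\<^bsub>dsum_module I M\<^esub> x \<oplus>\<^bsub>dsum_module I M\<^esub> b \<odot>\<^bsub>dsum_module I M\<^esub> x"
      using module.smult_l_distr[OF M] by (auto simp: PiE_iff intro!: restrict_ext)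
  next
    fix a x y assume "a \<in> carrier R" "x \<in> carrier (dsum_module I M)" "y \<in> carrier (dsum_module I M)"
    then show "a \<odot>\<^bsub>dsum_module I M\<^esub> (x \<oplus>\<^bsub>dsum_module I M\<^esub> y) =
        a \<odot>\<^bsub>dsum_module I M\<^esub> x \<oplus>\<^bsub>dsum_module I M\<^esub> a \<odot>\<^bsub>dsum_module I M\<^esub> y"
      using module.smult_r_distr[OF M] by (auto simp: PiE_iff intro!: restrict_ext)
  next
    fix a b x assume "a \<in> carrier R" "b \<in> carrier R" "x \<in> carrier (dsum_module I M)"
    then show "(a \<otimes>\<^bsub>R\<^esub> b) \<odot>\<^bsub>dsum_module I M\<^esub> x =
        a \<odot>\<^bsub>dsum_module I M\<^esub> (b \<odot>\<^bsub>dsum_module I M\<^esub> x)"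
      using module.smult_assoc1[OF M] by (auto simp: PiE_iff intro!: restrict_ext)
  next
    fix x assume "x \<in> carrier (dsum_module I M)"
    then show "\<one>\<^bsub>R\<^esub> \<odot>\<^bsub>dsum_module I M\<^esub> x = x"
      using module.smult_one[OF M] by (auto simp: PiE_iff extensional_def intro!: ext)
  qed
qed

lemma dsum_proj_hom: "i \<in> I \<Longrightarrow> (\<lambda>x. x i) \<in> module_hom R (dsum_module I M) (M i)"
  by (auto simp: module_hom_def)

lemma dsum_tuple_hom:
  assumes "\<And>i. i \<in> I \<Longrightarrow> f i \<in> module_hom R N (M i)"
    and "\<And>x. x \<in> carrier N \<Longrightarrow> finite {i \<in> I. f i x \<noteq> \<zero>\<^bsub>M i\<^esub>}"
  shows "(\<lambda>x. \<lambda>i\<in>I. f i x) \<in> module_hom R N (dsum_module I M)"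
proof (rule module_homI)
  show "(\<lambda>i\<in>I. f i x) \<in> carrier (dsum_module I M)" if "x \<in> carrier N" for x
    using assms(2)[OF that] module_hom_closed[OF assms(1) that] by (auto cong: conj_cong)
qed (auto simp: module_hom_add[OF assms(1)] module_hom_smult[OF assms(1)] intro!: restrict_ext)

lemma dsum_incl_hom:
  assumes M: "\<And>i. i \<in> I \<Longrightarrow> module R (M i)"
  shows "(\<lambda>x. \<lambda>j\<in>I. if j = i then x else \<zero>\<^bsub>M j\<^esub>) \<in> module_hom R (M i) (dsum_module I M)"
proof (rule dsum_tuple_hom)
  fix j assume "j \<in> I"
  then show "(\<lambda>x. if j = i then x else \<zero>\<^bsub>M j\<^esub>) \<in> module_hom R (M i) (M j)"
    using module_hom_const_zero[OF M] module_hom_id[of R "M i"] by (cases "j = i") auto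
next
  fix x assume "x \<in> carrier (M i)"
  show "finite {j \<in> I. (if j = i then x else \<zero>\<^bsub>M j\<^esub>) \<noteq> \<zero>\<^bsub>M j\<^esub>}"
    by (rule finite_subset[of _ "{i}"]) auto
qed

section \<open>Embedding finite powers into the universe\<close>

lemma infinite_inj_pair:
  assumes "infinite (UNIV :: 'u set)"
  shows "\<exists>p :: 'u \<times> 'u \<Rightarrow> 'u. inj p"
proof -
  have "ordLeq3 (card_of ((UNIV :: 'u set) \<times> (UNIV :: 'u set))) (card_of (UNIV :: 'u set))"
    using card_of_Times_same_infinite[OF assms] ordIso_iff_ordLeq by blast
  then show ?thesis unfolding card_of_ordLeq[symmetric] by auto
qed

text \<open>Induction on \<open>A\<close> with an injective pairing of the infinite type; functions
  in \<open>A \<rightarrow>\<^sub>E UNIV\<close> are determined by their values on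
  \<open>A\<close>.\<close>

lemma inj_on_PiE_finite:
  assumes "infinite (UNIV :: 'u set)" "finite A"
  shows "\<exists>g :: ('i \<Rightarrow> 'u) \<Rightarrow> 'u. inj_on g (A \<rightarrow>\<^sub>E UNIV)"
  using assms(2)
proof induction
  case empty
  show ?case by (auto simp: inj_on_def)
next
  case (insert a A)
  then obtain g :: "('i \<Rightarrow> 'u) \<Rightarrow> 'u" where g: "inj_on g (A \<rightarrow>\<^sub>E UNIV)" by blast
  obtain p :: "'u \<times> 'u \<Rightarrow> 'u" where p: "inj p" using infinite_inj_pair[OF assms(1)] by blast
  have "inj_on (\<lambda>f. p (f a, g (restrict f A))) (insert a A \<rightarrow>\<^sub>E UNIV)"
  proof (rule inj_onI)
    fix f f' assume f: "f \<in> insert a A \<rightarrow>\<^sub>E (UNIV :: 'u set)" "f' \<in> insert a A \<rightarrow>\<^sub>E (UNIV :: 'u set)"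
      and eq: "p (f a, g (restrict f A)) = p (f' a, g (restrict f' A))"
    then have "f a = f' a" and "g (restrict f A) = g (restrict f' A)"
      using injD[OF p] by blast+
    moreover from this have "restrict f A = restrict f' A"
      by (intro inj_onD[OF g]) auto
    ultimately have "f x = f' x" if "x \<in> insert a A" for x
      using that by (metis insertE restrict_apply')
    then show "f = f'" using f by (auto intro: PiE_ext)
  qed
  then show ?case by blast
qed

lemma inj_on_PiE_finite_lepoll:
  assumes "infinite (UNIV :: 'u set)" "finite A" "C \<lesssim> (UNIV :: 'u set)"
  shows "\<exists>g :: ('i \<Rightarrow> 'a) \<Rightarrow> 'u. inj_on g (A \<rightarrow>\<^sub>E C)"
proof -
  obtain g :: "('i \<Rightarrow> 'u) \<Rightarrow> 'u" where g: "inj_on g (A \<rightarrow>\<^sub>E UNIV)"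
    using inj_on_PiE_finite[OF assms(1,2)] by blast
  obtain k :: "'a \<Rightarrow> 'u" where k: "inj_on k C" using assms(3) by (auto simp: lepoll_def)
  have "inj_on (\<lambda>f. g (\<lambda>i\<in>A. k (f i))) (A \<rightarrow>\<^sub>E C)"
  proof (rule inj_onI)
    fix f f' assume f: "f \<in> A \<rightarrow>\<^sub>E C" "f' \<in> A \<rightarrow>\<^sub>E C"
      and "g (\<lambda>i\<in>A. k (f i)) = g (\<lambda>i\<in>A. k (f' i))"
    then have eq: "(\<lambda>i\<in>A. k (f i)) = (\<lambda>i\<in>A. k (f' i))"
      using g by (auto simp: inj_on_def)
    have "f x = f' x" if "x \<in> A" for x
    proof -
      have "k (f x) = k (f' x)" using fun_cong[OF eq, of x] that by simp
      then show ?thesis using k f that by (auto simp: inj_on_def PiE_iff)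
    qed
    then show "f = f'" using f by (auto intro: PiE_ext)
  qed
  then show ?thesis by blast
qed

text \<open>Projectivity can be applied only to modules in the universe of \<open>M\<close>. The
  free module on a finite generating set is therefore transported there first, which is possible
  because \<open>'u\<close> is infinite and at least as large as \<open>R\<close>.\<close>

lemma fgp_if_fin_gen_projective:
  fixes M :: "('a, 'u) module" and R :: "('a, 'r) ring_scheme"
  assumes R: "cring R" and inf: "infinite (UNIV :: 'u set)" and le: "carrier R \<lesssim> (UNIV :: 'u set)"
    and fg: "fin_gen_module R M" and pr: "projective_module R M"
  shows "fgp R M"
proof -
  interpret R: cring R by fact
  interpret M: module R M using pr by (simp add: projective_module_def)
  note mM = M.module_axioms
  obtain A where A: "finite A" "A \<subseteq> carrier M"
    and span: "\<And>H. submodule H R M \<Longrightarrow> A \<subseteq> H \<Longrightarrow> H = carrier M"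
    using fg by (auto simp: fin_gen_module_def)
  obtain L where L: "set L = A" "distinct L" using finite_distinct_list[OF A(1)] by blast
  define F where "F = dsum_module A (\<lambda>_. regular_module R)"
  have F: "module R F" unfolding F_def using R.module_regular by (intro module_dsum[OF R])
  have carF: "carrier F = A \<rightarrow>\<^sub>E carrier R" using A(1) by (simp add: F_def)
  obtain k :: "('u \<Rightarrow> 'a) \<Rightarrow> 'u" where k: "inj_on k (carrier F)"
    using inj_on_PiE_finite_lepoll[OF inf A(1) le] unfolding carF by blast
  define T where "T = transport_module k F"
  have T: "module R T" unfolding T_def by (rule module_transport[OF F k])
  define k' where "k' = inv_into (carrier F) k"
  have k': "k' \<in> module_hom R T F" unfolding T_def k'_def by (rule transport_inv_hom[OF F k])
  have ev: "(\<lambda>x. x a) \<in> module_hom R F (regular_module R)" if "a \<in> A" for a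
    unfolding F_def using dsum_proj_hom[OF that, of R "\<lambda>_. regular_module R"] by simp
  define s where "s = (\<lambda>x. msum M (\<lambda>a. x a \<odot>\<^bsub>M\<^esub> a) L)"
  have s: "s \<in> module_hom R F M"
    unfolding s_def
  proof (rule module_hom_msum_maps[OF mM])
    fix a assume "a \<in> set L"
    then show "(\<lambda>x. x a \<odot>\<^bsub>M\<^esub> a) \<in> module_hom R F M"
      using module_hom_comp[OF ev[of a] module_hom_smult_right[OF mM, of a]] L A(2) by auto
  qed
  have "submodule (s ` carrier F) R M"
  proof (rule M.submoduleI)
    interpret F: module R F by fact
    note az = F.abelian_group_axioms M.abelian_group_axioms
    show "s ` carrier F \<subseteq> carrier M" using module_hom_closed[OF s] by blast
    show "\<zero>\<^bsub>M\<^esub> \<in> s ` carrier F"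
      using module_hom_zero[OF s az] F.zero_closed by (metis imageI)
    show "\<ominus>\<^bsub>M\<^esub> a \<in> s ` carrier F" if "a \<in> s ` carrier F" for a
      using that by (auto simp flip: module_hom_minus[OF s az])
    show "a \<oplus>\<^bsub>M\<^esub> b \<in> s ` carrier F" if "a \<in> s ` carrier F" "b \<in> s ` carrier F" for a b
      using that by (auto simp flip: module_hom_add[OF s])
    show "r \<odot>\<^bsub>M\<^esub> a \<in> s ` carrier F" if "r \<in> carrier R" "a \<in> s ` carrier F" for a r
      using that by (auto simp flip: module_hom_smult[OF s])
  qed
  moreover have "A \<subseteq> s ` carrier F"
  proof
    fix a assume a: "a \<in> A"
    define x where "x = (\<lambda>b\<in>A. if b = a then \<one>\<^bsub>R\<^esub> else \<zero>\<^bsub>R\<^esub>)"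
    have "x \<in> carrier F" by (auto simp: carF x_def)
    moreover have "s x = a"
    proof -
      have "s x = x a \<odot>\<^bsub>M\<^esub> a"
        unfolding s_def using L a A(2) by (intro M.msum_single) (auto simp: x_def)
      then show ?thesis using a A(2) by (auto simp: x_def)
    qed
    ultimately show "a \<in> s ` carrier F" by blast
  qed
  ultimately have surj: "s ` carrier F = carrier M" by (rule span)
  have sk: "(\<lambda>x. s (k' x)) \<in> module_hom R T M" by (rule module_hom_comp[OF k' s])
  have k'k: "k' (k x) = x" if "x \<in> carrier F" for x using k that by (simp add: k'_def)
  have "(\<lambda>x. s (k' x)) ` carrier T = carrier M"
    using surj k'k by (auto simp: T_def image_image cong: image_cong_simp)
  \<comment> \<open>A section of the surjection from the free module; its coordinates are the
    functionals of the dual basis.\<close>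
  then obtain h where h: "h \<in> module_hom R M T" "\<And>x. x \<in> carrier M \<Longrightarrow> s (k' (h x)) = x"
    using pr T mM sk module_hom_id[of R M] unfolding projective_module_def by meson
  have "dual_basis R M (map (\<lambda>a. (a, \<lambda>x. k' (h x) a)) L)"
    unfolding dual_basis_def
  proof (intro conjI ballI)
    fix l assume "l \<in> set (map (\<lambda>a. (a, \<lambda>x. k' (h x) a)) L)"
    then obtain a where a: "a \<in> A" "l = (a, \<lambda>x. k' (h x) a)" using L by auto
    show "fst l \<in> carrier M" using a A by auto
    show "snd l \<in> module_hom R M (regular_module R)"
      using module_hom_comp[OF module_hom_comp[OF h(1) k'] ev[OF a(1)]] a(2) by simp
  next
    fix x assume "x \<in> carrier M"
    then show "x = msum M (\<lambda>l. snd l x \<odot>\<^bsub>M\<^esub> fst l) (map (\<lambda>a. (a, \<lambda>x. k' (h x) a)) L)"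
      using h(2) by (simp add: msum_map s_def)
  qed
  then show ?thesis using mM by (auto simp: fgp_def)
qed

lemma fgp_fin_gen:
  assumes "fgp R M"
  shows "fin_gen_module R M"
proof -
  obtain L where L: "dual_basis R M L" and M: "module R M" using assms by (auto simp: fgp_def)
  interpret M: module R M by fact
  note D = dual_basisD[OF L]
  have "H = carrier M" if H: "submodule H R M" "fst ` set L \<subseteq> H" for H
  proof
    note E = M.submoduleE[OF H(1)]
    have zero: "\<zero>\<^bsub>M\<^esub> \<in> H" using subgroup.one_closed[OF submodule.axioms(1)[OF H(1)]] by simp
    show "H \<subseteq> carrier M" by (rule E(1))
    show "carrier M \<subseteq> H"
    proof
      fix x assume x: "x \<in> carrier M"
      have "msum M (\<lambda>l. snd l x \<odot>\<^bsub>M\<^esub> fst l) K \<in> H" if "set K \<subseteq> set L" for K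
        using that by (induction K) (use zero E(4,5) D(3)[OF x] H(2) in auto)
      then show "x \<in> H" using D(4)[OF x] by (metis subset_refl)
    qed
  qed
  then show ?thesis unfolding fin_gen_module_def using M D(1)
    by (intro conjI exI[of _ "fst ` set L"]) auto
qed

lemma fgp_projective:
  assumes "fgp R M"
  shows "projective_module R M"
  unfolding projective_module_def
proof (intro conjI allI impI)
  obtain L where L: "dual_basis R M L" and M: "module R M" using assms by (auto simp: fgp_def)
  show "module R M" by fact
  fix B C g f
  assume *: "module R B \<and> module R C \<and> g \<in> module_hom R B C \<and> g ` carrier B = carrier C \<and>
      f \<in> module_hom R M C"
  then have "\<exists>b\<in>carrier B. g b = f (fst l)" if "l \<in> set L" for l
    using dual_basisD(1)[OF L that] module_hom_closed[of f R M C] by (metis imageE)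
  then show "\<exists>h\<in>module_hom R M B. \<forall>x\<in>carrier M. g (h x) = f x"
    using * by (intro dual_basis_lift[OF L M]) auto
qed

section \<open>Chain maps and homotopies\<close>

lemma module_complexD:
  assumes "module_complex R X"
  shows "module R (obj X n)" "diff X n \<in> module_hom R (obj X n) (obj X (n + 1))"
    "x \<in> carrier (obj X n) \<Longrightarrow> diff X (n + 1) (diff X n x) = \<zero>\<^bsub>obj X (n + 2)\<^esub>"
  using assms by (auto simp: module_complex_def)

lemma module_complexD':
  assumes "module_complex R X"
  shows "diff X (n - 1) \<in> module_hom R (obj X (n - 1)) (obj X n)"
    "x \<in> carrier (obj X (n - 1)) \<Longrightarrow> diff X n (diff X (n - 1) x) = \<zero>\<^bsub>obj X (n + 1)\<^esub>"
  using module_complexD[OF assms, where n = "n - 1"] by (simp_all add: add.commute)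

lemma module_complex_closed:
  assumes "module_complex R X"
  shows "x \<in> carrier (obj X n) \<Longrightarrow> diff X n x \<in> carrier (obj X (n + 1))"
    "x \<in> carrier (obj X (n - 1)) \<Longrightarrow> diff X (n - 1) x \<in> carrier (obj X n)"
  using module_hom_closed[OF module_complexD(2)[OF assms]] module_hom_closed[OF module_complexD'(1)[OF assms]]
  by auto

lemma module_complex_group: "module_complex R X \<Longrightarrow> abelian_group (obj X n)"
  by (rule module_abelian_group[OF module_complexD(1)])

lemma chain_mapI:
  assumes "\<And>n. f n \<in> module_hom R (obj X n) (obj Y n)"
    and "\<And>n x. x \<in> carrier (obj X n) \<Longrightarrow> diff Y n (f n x) = f (n + 1) (diff X n x)"
  shows "chain_map R X Y f"
  using assms by (simp add: chain_map_def)

lemma chain_mapD: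
  assumes "chain_map R X Y f"
  shows "f n \<in> module_hom R (obj X n) (obj Y n)"
    "x \<in> carrier (obj X n) \<Longrightarrow> diff Y n (f n x) = f (n + 1) (diff X n x)"
    "x \<in> carrier (obj X n) \<Longrightarrow> f n x \<in> carrier (obj Y n)"
    "x \<in> carrier (obj X (n - 1)) \<Longrightarrow> diff Y (n - 1) (f (n - 1) x) = f n (diff X (n - 1) x)"
  using assms module_hom_closed[of "f n" R "obj X n" "obj Y n"]
  by (auto simp: chain_map_def)

lemma chain_map_id: "chain_map R X X (\<lambda>n x. x)"
  by (rule chain_mapI) (simp_all add: module_hom_id)

lemma chain_map_comp:
  assumes "chain_map R X Y f" "chain_map R Y Z g"
  shows "chain_map R X Z (\<lambda>n x. g n (f n x))"
  by (rule chain_mapI)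
    (simp_all add: module_hom_comp[OF chain_mapD(1)[OF assms(1)] chain_mapD(1)[OF assms(2)]]
      chain_mapD(3)[OF assms(1)] chain_mapD(2)[OF assms(1)] chain_mapD(2)[OF assms(2)])

lemma chain_map_zero:
  assumes "module_complex R X" "module_complex R Y"
  shows "chain_map R X Y (\<lambda>n x. \<zero>\<^bsub>obj Y n\<^esub>)"
  by (rule chain_mapI)
    (simp_all add: module_hom_const_zero[OF module_complexD(1)[OF assms(2)]]
      module_hom_zero[OF module_complexD(2)[OF assms(2)] module_complex_group[OF assms(2)]
        module_complex_group[OF assms(2)]])

lemma chain_map_plus:
  assumes "module_complex R Y" "chain_map R X Y f" "chain_map R X Y g" "module_complex R X"
  shows "chain_map R X Y (\<lambda>n x. f n x \<oplus>\<^bsub>obj Y n\<^esub> g n x)"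
  by (rule chain_mapI)
    (simp_all add: module_hom_plus[OF module_complexD(1)[OF assms(1)]] chain_mapD[OF assms(2)]
      chain_mapD[OF assms(3)] module_hom_add[OF module_complexD(2)[OF assms(1)]])

lemma chain_map_msum:
  assumes "module_complex R X" "module_complex R Y" "\<And>i. i \<in> set L \<Longrightarrow> chain_map R X Y (f i)"
  shows "chain_map R X Y (\<lambda>n x. msum (obj Y n) (\<lambda>i. f i n x) L)"
  using assms(3)
proof (induction L)
  case Nil
  then show ?case using chain_map_zero[OF assms(1,2)] by simp
next
  case (Cons a L)
  then show ?case using chain_map_plus[OF assms(2) _ _ assms(1)] by simp
qed

lemma chain_map_scalar:
  assumes "module_complex R X" "r \<in> carrier R"
  shows "chain_map R X X (\<lambda>n x. r \<odot>\<^bsub>obj X n\<^esub> x)"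
  by (rule chain_mapI)
    (simp_all add: module_hom_scalar[OF module_complexD(1)[OF assms(1)] assms(2)]
      module_hom_smult[OF module_complexD(2)[OF assms(1)] assms(2)])

section \<open>The homotopy relation on chain maps\<close>

lemma (in abelian_group) minus_eq_iff_add:
  "a \<in> carrier G \<Longrightarrow> b \<in> carrier G \<Longrightarrow> c \<in> carrier G \<Longrightarrow> a \<ominus> b = c \<longleftrightarrow> a = b \<oplus> c"
  by (metis a_comm a_minus_def add.inv_closed add.inv_solve_right)

lemma homotopy_term_closed:
  assumes "module_complex R X" "module_complex R Y" "\<And>n. h n \<in> module_hom R (obj X n) (obj Y (n - 1))"
    "x \<in> carrier (obj X n)"
  shows "h n x \<in> carrier (obj Y (n - 1))" "diff Y (n - 1) (h n x) \<in> carrier (obj Y n)"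
    "h (n + 1) (diff X n x) \<in> carrier (obj Y n)"
proof -
  show 1: "h n x \<in> carrier (obj Y (n - 1))" by (rule module_hom_closed[OF assms(3,4)])
  show "diff Y (n - 1) (h n x) \<in> carrier (obj Y n)" by (rule module_complex_closed(2)[OF assms(2) 1])
  show "h (n + 1) (diff X n x) \<in> carrier (obj Y n)"
    using module_hom_closed[OF assms(3)[of "n + 1"]] module_complex_closed(1)[OF assms(1,4)] by simp
qed

text \<open>The relation is solved for \<open>f\<close>, as g + (d h + h d). Without a difference on
  the left, most manipulations of homotopies below reduce to associativity and commutativity in a
  single degree.\<close>

lemma homotopicI:
  assumes "module_complex R X" "module_complex R Y" "\<And>n. f n \<in> module_hom R (obj X n) (obj Y n)"
    "\<And>n. g n \<in> module_hom R (obj X n) (obj Y n)"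
    "\<And>n. h n \<in> module_hom R (obj X n) (obj Y (n - 1))"
    "\<And>n x. x \<in> carrier (obj X n) \<Longrightarrow> f n x =
      g n x \<oplus>\<^bsub>obj Y n\<^esub> (diff Y (n - 1) (h n x) \<oplus>\<^bsub>obj Y n\<^esub> h (n + 1) (diff X n x))"
  shows "homotopic R X Y f g"
  unfolding homotopic_def
proof (intro exI[of _ h] allI conjI ballI)
  fix n x assume x: "x \<in> carrier (obj X n)"
  interpret Y: abelian_group "obj Y n" by (rule module_complex_group[OF assms(2)])
  show "f n x \<ominus>\<^bsub>obj Y n\<^esub> g n x = diff Y (n - 1) (h n x) \<oplus>\<^bsub>obj Y n\<^esub> h (n + 1) (diff X n x)"
    using assms(6)[OF x] homotopy_term_closed[OF assms(1,2,5) x]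
      module_hom_closed[OF assms(3) x] module_hom_closed[OF assms(4) x]
    by (simp add: Y.minus_eq_iff_add)
qed (rule assms(5))

lemma homotopicE:
  assumes "homotopic R X Y f g" "module_complex R X" "module_complex R Y"
    "\<And>n. f n \<in> module_hom R (obj X n) (obj Y n)" "\<And>n. g n \<in> module_hom R (obj X n) (obj Y n)"
  obtains h where "\<And>n. h n \<in> module_hom R (obj X n) (obj Y (n - 1))"
    "\<And>n x. x \<in> carrier (obj X n) \<Longrightarrow> f n x =
      g n x \<oplus>\<^bsub>obj Y n\<^esub> (diff Y (n - 1) (h n x) \<oplus>\<^bsub>obj Y n\<^esub> h (n + 1) (diff X n x))"
proof -
  obtain h where h: "\<And>n. h n \<in> module_hom R (obj X n) (obj Y (n - 1))"
    "\<And>n x. x \<in> carrier (obj X n) \<Longrightarrow>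
      f n x \<ominus>\<^bsub>obj Y n\<^esub> g n x = diff Y (n - 1) (h n x) \<oplus>\<^bsub>obj Y n\<^esub> h (n + 1) (diff X n x)"
    using assms(1) unfolding homotopic_def by metis
  have "f n x = g n x \<oplus>\<^bsub>obj Y n\<^esub> (diff Y (n - 1) (h n x) \<oplus>\<^bsub>obj Y n\<^esub> h (n + 1) (diff X n x))"
    if x: "x \<in> carrier (obj X n)" for n x
  proof -
    interpret Y: abelian_group "obj Y n" by (rule module_complex_group[OF assms(3)])
    show ?thesis
      using h(2)[OF x] homotopy_term_closed[OF assms(2,3) h(1) x]
        module_hom_closed[OF assms(4) x] module_hom_closed[OF assms(5) x]
      by (simp add: Y.minus_eq_iff_add)
  qed
  then show ?thesis using that h(1) by blast
qed

lemma homotopic_refl: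
  assumes "module_complex R X" "module_complex R Y" "\<And>n. f n \<in> module_hom R (obj X n) (obj Y n)"
  shows "homotopic R X Y f f"
proof (rule homotopicI[OF assms(1,2,3,3), where h = "\<lambda>n x. \<zero>\<^bsub>obj Y (n - 1)\<^esub>"])
  fix n x assume x: "x \<in> carrier (obj X n)"
  interpret Y: abelian_group "obj Y n" by (rule module_complex_group[OF assms(2)])
  show "f n x = f n x \<oplus>\<^bsub>obj Y n\<^esub> (diff Y (n - 1) \<zero>\<^bsub>obj Y (n - 1)\<^esub> \<oplus>\<^bsub>obj Y n\<^esub> \<zero>\<^bsub>obj Y (n + 1 - 1)\<^esub>)"
    using module_hom_zero[OF module_complexD'(1)[OF assms(2)]] module_complex_group[OF assms(2)]
      module_hom_closed[OF assms(3) x] by simp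
qed (rule module_hom_const_zero[OF module_complexD(1)[OF assms(2)]])

lemma homotopic_cong:
  assumes "homotopic R X Y f g" "module_complex R X"
    "\<And>n x. x \<in> carrier (obj X n) \<Longrightarrow> f' n x = f n x" "\<And>n x. x \<in> carrier (obj X n) \<Longrightarrow> g' n x = g n x"
  shows "homotopic R X Y f' g'"
  using assms unfolding homotopic_def by metis

lemma homotopic_trans:
  assumes XY: "module_complex R X" "module_complex R Y"
    and f: "\<And>n. f n \<in> module_hom R (obj X n) (obj Y n)" and g: "\<And>n. g n \<in> module_hom R (obj X n) (obj Y n)"
    and k: "\<And>n. k n \<in> module_hom R (obj X n) (obj Y n)"
    and "homotopic R X Y f g" "homotopic R X Y g k"
  shows "homotopic R X Y f k"
proof -
  obtain h where h: "\<And>n. h n \<in> module_hom R (obj X n) (obj Y (n - 1))"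
    "\<And>n x. x \<in> carrier (obj X n) \<Longrightarrow> f n x =
      g n x \<oplus>\<^bsub>obj Y n\<^esub> (diff Y (n - 1) (h n x) \<oplus>\<^bsub>obj Y n\<^esub> h (n + 1) (diff X n x))"
    using homotopicE[OF assms(6) XY f g] by blast
  obtain h' where h': "\<And>n. h' n \<in> module_hom R (obj X n) (obj Y (n - 1))"
    "\<And>n x. x \<in> carrier (obj X n) \<Longrightarrow> g n x =
      k n x \<oplus>\<^bsub>obj Y n\<^esub> (diff Y (n - 1) (h' n x) \<oplus>\<^bsub>obj Y n\<^esub> h' (n + 1) (diff X n x))"
    using homotopicE[OF assms(7) XY g k] by blast
  show ?thesis
  proof (rule homotopicI[OF XY f k, where h = "\<lambda>n x. h n x \<oplus>\<^bsub>obj Y (n - 1)\<^esub> h' n x"])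
    show "(\<lambda>x. h n x \<oplus>\<^bsub>obj Y (n - 1)\<^esub> h' n x) \<in> module_hom R (obj X n) (obj Y (n - 1))" for n
      by (rule module_hom_plus[OF module_complexD(1)[OF XY(2)] h(1) h'(1)])
    fix n x assume x: "x \<in> carrier (obj X n)"
    interpret Y: abelian_group "obj Y n" by (rule module_complex_group[OF XY(2)])
    note c = homotopy_term_closed[OF XY h(1) x] homotopy_term_closed[OF XY h'(1) x]
    show "f n x = k n x \<oplus>\<^bsub>obj Y n\<^esub> (diff Y (n - 1) (h n x \<oplus>\<^bsub>obj Y (n - 1)\<^esub> h' n x) \<oplus>\<^bsub>obj Y n\<^esub>
        (h (n + 1) (diff X n x) \<oplus>\<^bsub>obj Y (n + 1 - 1)\<^esub> h' (n + 1) (diff X n x)))"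
      unfolding h(2)[OF x] h'(2)[OF x]
      using c module_hom_closed[OF k x]
      by (simp add: module_hom_add[OF module_complexD'(1)[OF XY(2)]] Y.a_ac)
  qed
qed

lemma homotopic_sym:
  assumes XY: "module_complex R X" "module_complex R Y"
    and f: "\<And>n. f n \<in> module_hom R (obj X n) (obj Y n)" and g: "\<And>n. g n \<in> module_hom R (obj X n) (obj Y n)"
    and "homotopic R X Y f g"
  shows "homotopic R X Y g f"
proof -
  obtain h where h: "\<And>n. h n \<in> module_hom R (obj X n) (obj Y (n - 1))"
    "\<And>n x. x \<in> carrier (obj X n) \<Longrightarrow> f n x =
      g n x \<oplus>\<^bsub>obj Y n\<^esub> (diff Y (n - 1) (h n x) \<oplus>\<^bsub>obj Y n\<^esub> h (n + 1) (diff X n x))"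
    using homotopicE[OF assms(5) XY f g] by blast
  show ?thesis
  proof (rule homotopicI[OF XY g f, where h = "\<lambda>n x. \<ominus>\<^bsub>obj Y (n - 1)\<^esub> h n x"])
    show "(\<lambda>x. \<ominus>\<^bsub>obj Y (n - 1)\<^esub> h n x) \<in> module_hom R (obj X n) (obj Y (n - 1))" for n
      by (rule module_hom_neg[OF module_complexD(1)[OF XY(2)] h(1)])
    fix n x assume x: "x \<in> carrier (obj X n)"
    interpret Y: abelian_group "obj Y n" by (rule module_complex_group[OF XY(2)])
    note c = homotopy_term_closed[OF XY h(1) x]
    show "g n x = f n x \<oplus>\<^bsub>obj Y n\<^esub> (diff Y (n - 1) (\<ominus>\<^bsub>obj Y (n - 1)\<^esub> h n x) \<oplus>\<^bsub>obj Y n\<^esub>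
        (\<ominus>\<^bsub>obj Y (n + 1 - 1)\<^esub> h (n + 1) (diff X n x)))"
      unfolding h(2)[OF x]
      using c module_hom_closed[OF g x] module_complex_group[OF XY(2)]
      by (simp add: module_hom_minus[OF module_complexD'(1)[OF XY(2)]] Y.a_assoc Y.r_neg
          flip: Y.minus_add)
  qed
qed

lemma homotopic_plus:
  assumes XY: "module_complex R X" "module_complex R Y"
    and f: "\<And>n. f n \<in> module_hom R (obj X n) (obj Y n)" and g: "\<And>n. g n \<in> module_hom R (obj X n) (obj Y n)"
    and f': "\<And>n. f' n \<in> module_hom R (obj X n) (obj Y n)" and g': "\<And>n. g' n \<in> module_hom R (obj X n) (obj Y n)"
    and "homotopic R X Y f g" "homotopic R X Y f' g'"
  shows "homotopic R X Y (\<lambda>n x. f n x \<oplus>\<^bsub>obj Y n\<^esub> f' n x) (\<lambda>n x. g n x \<oplus>\<^bsub>obj Y n\<^esub> g' n x)"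
proof -
  obtain h where h: "\<And>n. h n \<in> module_hom R (obj X n) (obj Y (n - 1))"
    "\<And>n x. x \<in> carrier (obj X n) \<Longrightarrow> f n x =
      g n x \<oplus>\<^bsub>obj Y n\<^esub> (diff Y (n - 1) (h n x) \<oplus>\<^bsub>obj Y n\<^esub> h (n + 1) (diff X n x))"
    using homotopicE[OF assms(7) XY f g] by blast
  obtain h' where h': "\<And>n. h' n \<in> module_hom R (obj X n) (obj Y (n - 1))"
    "\<And>n x. x \<in> carrier (obj X n) \<Longrightarrow> f' n x =
      g' n x \<oplus>\<^bsub>obj Y n\<^esub> (diff Y (n - 1) (h' n x) \<oplus>\<^bsub>obj Y n\<^esub> h' (n + 1) (diff X n x))"
    using homotopicE[OF assms(8) XY f' g'] by blast
  note P = module_hom_plus[OF module_complexD(1)[OF XY(2)]]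
  show ?thesis
  proof (rule homotopicI[OF XY P[OF f f'] P[OF g g'], where h = "\<lambda>n x. h n x \<oplus>\<^bsub>obj Y (n - 1)\<^esub> h' n x"])
    show "(\<lambda>x. h n x \<oplus>\<^bsub>obj Y (n - 1)\<^esub> h' n x) \<in> module_hom R (obj X n) (obj Y (n - 1))" for n
      by (rule P[OF h(1) h'(1)])
    fix n x assume x: "x \<in> carrier (obj X n)"
    interpret Y: abelian_group "obj Y n" by (rule module_complex_group[OF XY(2)])
    note c = homotopy_term_closed[OF XY h(1) x] homotopy_term_closed[OF XY h'(1) x]
    show "f n x \<oplus>\<^bsub>obj Y n\<^esub> f' n x = g n x \<oplus>\<^bsub>obj Y n\<^esub> g' n x \<oplus>\<^bsub>obj Y n\<^esub>
        (diff Y (n - 1) (h n x \<oplus>\<^bsub>obj Y (n - 1)\<^esub> h' n x) \<oplus>\<^bsub>obj Y n\<^esub>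
        (h (n + 1) (diff X n x) \<oplus>\<^bsub>obj Y (n + 1 - 1)\<^esub> h' (n + 1) (diff X n x)))"
      unfolding h(2)[OF x] h'(2)[OF x]
      using c module_hom_closed[OF g x] module_hom_closed[OF g' x]
      by (simp add: module_hom_add[OF module_complexD'(1)[OF XY(2)]] Y.a_ac)
  qed
qed

lemma homotopic_comp_left:
  assumes XYZ: "module_complex R X" "module_complex R Y" "module_complex R Z"
    and f: "\<And>n. f n \<in> module_hom R (obj X n) (obj Y n)" and g: "\<And>n. g n \<in> module_hom R (obj X n) (obj Y n)"
    and k: "chain_map R Y Z k" and "homotopic R X Y f g"
  shows "homotopic R X Z (\<lambda>n x. k n (f n x)) (\<lambda>n x. k n (g n x))"
proof -
  note XY = XYZ(1,2)
  obtain h where h: "\<And>n. h n \<in> module_hom R (obj X n) (obj Y (n - 1))"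
    "\<And>n x. x \<in> carrier (obj X n) \<Longrightarrow> f n x =
      g n x \<oplus>\<^bsub>obj Y n\<^esub> (diff Y (n - 1) (h n x) \<oplus>\<^bsub>obj Y n\<^esub> h (n + 1) (diff X n x))"
    using homotopicE[OF assms(7) XY f g] by blast
  note k1 = chain_mapD(1)[OF k]
  show ?thesis
  proof (rule homotopicI[OF XYZ(1,3) module_hom_comp[OF f k1] module_hom_comp[OF g k1],
        where h = "\<lambda>n x. k (n - 1) (h n x)"])
    show "(\<lambda>x. k (n - 1) (h n x)) \<in> module_hom R (obj X n) (obj Z (n - 1))" for n
      by (rule module_hom_comp[OF h(1) k1])
    fix n x assume x: "x \<in> carrier (obj X n)"
    interpret Y: abelian_group "obj Y n" by (rule module_complex_group[OF XY(2)])
    note c = homotopy_term_closed[OF XY h(1) x]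
    show "k n (f n x) = k n (g n x) \<oplus>\<^bsub>obj Z n\<^esub>
        (diff Z (n - 1) (k (n - 1) (h n x)) \<oplus>\<^bsub>obj Z n\<^esub> k (n + 1 - 1) (h (n + 1) (diff X n x)))"
      unfolding h(2)[OF x]
      using c module_hom_closed[OF g x]
      by (simp add: module_hom_add[OF k1] chain_mapD(4)[OF k])
  qed
qed

lemma homotopic_comp_right:
  assumes XYZ: "module_complex R X" "module_complex R Y" "module_complex R Z"
    and f: "\<And>n. f n \<in> module_hom R (obj Y n) (obj Z n)" and g: "\<And>n. g n \<in> module_hom R (obj Y n) (obj Z n)"
    and k: "chain_map R X Y k" and "homotopic R Y Z f g"
  shows "homotopic R X Z (\<lambda>n x. f n (k n x)) (\<lambda>n x. g n (k n x))"
proof -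
  note YZ = XYZ(2,3)
  obtain h where h: "\<And>n. h n \<in> module_hom R (obj Y n) (obj Z (n - 1))"
    "\<And>n x. x \<in> carrier (obj Y n) \<Longrightarrow> f n x =
      g n x \<oplus>\<^bsub>obj Z n\<^esub> (diff Z (n - 1) (h n x) \<oplus>\<^bsub>obj Z n\<^esub> h (n + 1) (diff Y n x))"
    using homotopicE[OF assms(7) YZ f g] by blast
  note k1 = chain_mapD(1)[OF k]
  show ?thesis
  proof (rule homotopicI[OF XYZ(1,3) module_hom_comp[OF k1 f] module_hom_comp[OF k1 g],
        where h = "\<lambda>n x. h n (k n x)"])
    show "(\<lambda>x. h n (k n x)) \<in> module_hom R (obj X n) (obj Z (n - 1))" for n
      by (rule module_hom_comp[OF k1 h(1)])
    fix n x assume x: "x \<in> carrier (obj X n)"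
    show "f n (k n x) = g n (k n x) \<oplus>\<^bsub>obj Z n\<^esub>
        (diff Z (n - 1) (h n (k n x)) \<oplus>\<^bsub>obj Z n\<^esub> h (n + 1) (k (n + 1) (diff X n x)))"
      using h(2)[OF chain_mapD(3)[OF k x]] by (simp add: chain_mapD(2)[OF k x])
  qed
qed

text \<open>The ideal J(X) of the overview: the kernel of the map from \<open>R\<close> to the
  endomorphisms of \<open>X\<close> in the homotopy category. Unlike the annihilator of the modules
  of \<open>X\<close>, it depends only on the homotopy type.\<close>

definition hann :: "('a, 'r) ring_scheme \<Rightarrow> ('a, 'u) cochain_complex \<Rightarrow> 'a set" where
  "hann R X = {r \<in> carrier R. homotopic R X X (\<lambda>n x. r \<odot>\<^bsub>obj X n\<^esub> x) (\<lambda>n x. \<zero>\<^bsub>obj X n\<^esub>)}"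

lemma homotopic_zero_if_hann_left:
  assumes XY: "module_complex R X" "module_complex R Y" and f: "chain_map R X Y f" and r: "r \<in> hann R X"
  shows "homotopic R X Y (\<lambda>n x. r \<odot>\<^bsub>obj Y n\<^esub> f n x) (\<lambda>n x. \<zero>\<^bsub>obj Y n\<^esub>)"
proof -
  have r': "r \<in> carrier R" "homotopic R X X (\<lambda>n x. r \<odot>\<^bsub>obj X n\<^esub> x) (\<lambda>n x. \<zero>\<^bsub>obj X n\<^esub>)"
    using r by (auto simp: hann_def)
  note S = chain_mapD(1)[OF chain_map_scalar[OF XY(1) r'(1)]] chain_mapD(1)[OF chain_map_zero[OF XY(1) XY(1)]]
  show ?thesis
    by (rule homotopic_cong[OF homotopic_comp_left[OF XY(1,1,2) S f r'(2)] XY(1)])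
      (simp_all add: module_hom_smult[OF chain_mapD(1)[OF f] r'(1)]
        module_hom_zero[OF chain_mapD(1)[OF f]] module_complex_group[OF XY(1)] module_complex_group[OF XY(2)])
qed

lemma homotopic_zero_if_hann_right:
  assumes XY: "module_complex R X" "module_complex R Y" and f: "chain_map R X Y f" and r: "r \<in> hann R Y"
  shows "homotopic R X Y (\<lambda>n x. r \<odot>\<^bsub>obj Y n\<^esub> f n x) (\<lambda>n x. \<zero>\<^bsub>obj Y n\<^esub>)"
proof -
  have r': "r \<in> carrier R" "homotopic R Y Y (\<lambda>n x. r \<odot>\<^bsub>obj Y n\<^esub> x) (\<lambda>n x. \<zero>\<^bsub>obj Y n\<^esub>)"
    using r by (auto simp: hann_def)
  note S = chain_mapD(1)[OF chain_map_scalar[OF XY(2) r'(1)]] chain_mapD(1)[OF chain_map_zero[OF XY(2) XY(2)]]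
  show ?thesis
    by (rule homotopic_comp_right[OF XY(1,2,2) S f r'(2)])
qed

text \<open>Write \<open>f\<close> as r f + s f. The first summand factors through multiplication by
  \<open>r\<close> on \<open>X\<close>, the second through multiplication by \<open>s\<close> on
  \<open>Y\<close>, and both of these are null-homotopic.\<close>

lemma homotopic_zero_if_comaximal:
  assumes XY: "module_complex R X" "module_complex R Y" and f: "chain_map R X Y f"
    and r: "r \<in> hann R X" "s \<in> hann R Y" "r \<oplus>\<^bsub>R\<^esub> s = \<one>\<^bsub>R\<^esub>"
  shows "homotopic R X Y f (\<lambda>n x. \<zero>\<^bsub>obj Y n\<^esub>)"
proof -
  have rs: "r \<in> carrier R" "s \<in> carrier R" using r by (auto simp: hann_def)
  note Z = chain_mapD(1)[OF chain_map_zero[OF XY]]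
  have *: "(\<lambda>x. t \<odot>\<^bsub>obj Y n\<^esub> f n x) \<in> module_hom R (obj X n) (obj Y n)" if "t \<in> carrier R" for t n
    by (rule module_hom_times[OF module_complexD(1)[OF XY(2)] chain_mapD(1)[OF f] that])
  show ?thesis
  proof (rule homotopic_cong[OF homotopic_plus[OF XY *[OF rs(1)] Z *[OF rs(2)] Z
      homotopic_zero_if_hann_left[OF XY f r(1)] homotopic_zero_if_hann_right[OF XY f r(2)]] XY(1)])
    fix n x assume "x \<in> carrier (obj X n)"
    then have fx: "f n x \<in> carrier (obj Y n)" by (rule chain_mapD(3)[OF f])
    interpret Y: module R "obj Y n" by (rule module_complexD(1)[OF XY(2)])
    show "f n x = r \<odot>\<^bsub>obj Y n\<^esub> f n x \<oplus>\<^bsub>obj Y n\<^esub> s \<odot>\<^bsub>obj Y n\<^esub> f n x"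
      using fx rs r(3) Y.smult_one by (simp flip: Y.smult_l_distr)
    show "\<zero>\<^bsub>obj Y n\<^esub> = \<zero>\<^bsub>obj Y n\<^esub> \<oplus>\<^bsub>obj Y n\<^esub> \<zero>\<^bsub>obj Y n\<^esub>" by simp
  qed
qed

text \<open>On a homotopy retract \<open>Y\<close>, multiplication by \<open>r\<close> is homotopic
  to r p v, and r p is null-homotopic. Passing to a summand can thus only enlarge the ideal, which
  is what the noetherian induction relies on.\<close>

lemma hann_retract:
  assumes XY: "module_complex R X" "module_complex R Y"
    and p: "chain_map R X Y p" and v: "chain_map R Y X v"
    and pv: "homotopic R Y Y (\<lambda>n x. p n (v n x)) (\<lambda>n x. x)"
  shows "hann R X \<subseteq> hann R Y"
proof
  fix r assume r: "r \<in> hann R X"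
  then have rR: "r \<in> carrier R" by (simp add: hann_def)
  note Z = chain_mapD(1)[OF chain_map_zero[OF XY(2,2)]]
  note S = chain_map_scalar[OF XY(2) rR]
  note PV = chain_map_comp[OF v p]
  note RPV = chain_map_comp[OF PV S]
  note S1 = chain_mapD(1)[OF S]
  have 1: "homotopic R Y Y (\<lambda>n x. r \<odot>\<^bsub>obj Y n\<^esub> p n (v n x)) (\<lambda>n x. r \<odot>\<^bsub>obj Y n\<^esub> x)"
    by (rule homotopic_comp_left[OF XY(2,2,2) chain_mapD(1)[OF PV] module_hom_id S pv])
  have 2: "homotopic R Y Y (\<lambda>n x. r \<odot>\<^bsub>obj Y n\<^esub> p n (v n x)) (\<lambda>n x. \<zero>\<^bsub>obj Y n\<^esub>)"
    by (rule homotopic_comp_right[OF XY(2,1,2) _ _ v homotopic_zero_if_hann_left[OF XY p r]])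
      (rule module_hom_times[OF module_complexD(1)[OF XY(2)] chain_mapD(1)[OF p] rR],
       rule chain_mapD(1)[OF chain_map_zero[OF XY]])
  show "r \<in> hann R Y"
    unfolding hann_def using rR
      homotopic_trans[OF XY(2,2) S1 chain_mapD(1)[OF RPV] Z
        homotopic_sym[OF XY(2,2) chain_mapD(1)[OF RPV] S1 1] 2] by simp
qed

lemma ideal_hann:
  assumes R: "cring R" and X: "module_complex R X"
  shows "ideal (hann R X) R"
proof -
  interpret R: cring R by fact
  note Z = chain_mapD(1)[OF chain_map_zero[OF X X]]
  note S = chain_mapD(1)[OF chain_map_scalar[OF X]]
  have sm: "r \<otimes>\<^bsub>R\<^esub> s \<in> hann R X" if "r \<in> carrier R" "s \<in> hann R X" for r s
  proof -
    have s: "s \<in> carrier R" using that by (simp add: hann_def)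
    have "homotopic R X X (\<lambda>n x. (r \<otimes>\<^bsub>R\<^esub> s) \<odot>\<^bsub>obj X n\<^esub> x) (\<lambda>n x. \<zero>\<^bsub>obj X n\<^esub>)"
      by (rule homotopic_cong[OF homotopic_zero_if_hann_left[OF X X chain_map_scalar[OF X that(1)] that(2)] X])
        (simp_all add: R.m_comm[OF that(1) s] module.smult_assoc1[OF module_complexD(1)[OF X]] that(1) s)
    then show ?thesis using that(1) s by (simp add: hann_def)
  qed
  have add: "r \<oplus>\<^bsub>R\<^esub> s \<in> hann R X" if "r \<in> hann R X" "s \<in> hann R X" for r s
  proof -
    have rs: "r \<in> carrier R" "s \<in> carrier R" using that by (auto simp: hann_def)
    have "homotopic R X X (\<lambda>n x. (r \<oplus>\<^bsub>R\<^esub> s) \<odot>\<^bsub>obj X n\<^esub> x) (\<lambda>n x. \<zero>\<^bsub>obj X n\<^esub>)"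
    proof (rule homotopic_cong[OF homotopic_plus[OF X X S[OF rs(1)] Z S[OF rs(2)] Z] X])
      show "homotopic R X X (\<lambda>n x. r \<odot>\<^bsub>obj X n\<^esub> x) (\<lambda>n x. \<zero>\<^bsub>obj X n\<^esub>)"
        "homotopic R X X (\<lambda>n x. s \<odot>\<^bsub>obj X n\<^esub> x) (\<lambda>n x. \<zero>\<^bsub>obj X n\<^esub>)"
        using that by (auto simp: hann_def)
      fix n x assume x: "x \<in> carrier (obj X n)"
      interpret M: module R "obj X n" by (rule module_complexD(1)[OF X])
      show "(r \<oplus>\<^bsub>R\<^esub> s) \<odot>\<^bsub>obj X n\<^esub> x = r \<odot>\<^bsub>obj X n\<^esub> x \<oplus>\<^bsub>obj X n\<^esub> s \<odot>\<^bsub>obj X n\<^esub> x"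
        using x rs by (simp add: M.smult_l_distr)
      show "\<zero>\<^bsub>obj X n\<^esub> = \<zero>\<^bsub>obj X n\<^esub> \<oplus>\<^bsub>obj X n\<^esub> \<zero>\<^bsub>obj X n\<^esub>" by simp
    qed
    then show ?thesis using rs by (simp add: hann_def)
  qed
  have zero: "\<zero>\<^bsub>R\<^esub> \<in> hann R X"
    unfolding hann_def
    using homotopic_cong[OF homotopic_refl[OF X X Z] X, of "\<lambda>n x. \<zero>\<^bsub>R\<^esub> \<odot>\<^bsub>obj X n\<^esub> x"]
    by (simp add: module.smult_l_null[OF module_complexD(1)[OF X]])
  show ?thesis
  proof (rule idealI)
    show "ring R" by (rule R.ring_axioms)
    have neg: "\<ominus>\<^bsub>R\<^esub> a \<in> hann R X" if "a \<in> hann R X" for a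
    proof -
      have "a \<in> carrier R" using that by (simp add: hann_def)
      then have "\<ominus>\<^bsub>R\<^esub> a = (\<ominus>\<^bsub>R\<^esub> \<one>\<^bsub>R\<^esub>) \<otimes>\<^bsub>R\<^esub> a" by (simp add: R.l_minus)
      then show ?thesis using sm[OF _ that] by simp
    qed
    show "subgroup (hann R X) (add_monoid R)"
    proof (rule R.add.subgroupI)
      show "hann R X \<subseteq> carrier R" by (auto simp: hann_def)
      show "hann R X \<noteq> {}" using zero by auto
      show "\<ominus>\<^bsub>R\<^esub> a \<in> hann R X" if "a \<in> hann R X" for a
        by (rule neg[OF that])
    qed (simp_all add: add)
    fix a x assume *: "a \<in> hann R X" "x \<in> carrier R"
    then show "x \<otimes>\<^bsub>R\<^esub> a \<in> hann R X" by (simp add: sm)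
    have "a \<in> carrier R" using * by (simp add: hann_def)
    then show "a \<otimes>\<^bsub>R\<^esub> x \<in> hann R X" using sm[OF *(2,1)] *(2) R.m_comm by metis
  qed
qed

section \<open>Cohomology and lifting along quasi-isomorphisms\<close>

text \<open>Complexes of abelian groups. Tensor products are handled by their additive structure,
  and cohomology uses no more than that, so the same lemmas serve complexes of modules and tensor
  complexes.\<close>

definition ab_complex :: "('a, 'u) cochain_complex \<Rightarrow> bool" where
  "ab_complex X \<longleftrightarrow> (\<forall>n. abelian_group (obj X n) \<and>
    (\<forall>x\<in>carrier (obj X n). diff X n x \<in> carrier (obj X (n + 1)) \<and>
      diff X (n + 1) (diff X n x) = \<zero>\<^bsub>obj X (n + 2)\<^esub> \<and>
      (\<forall>y\<in>carrier (obj X n). diff X n (x \<oplus>\<^bsub>obj X n\<^esub> y) = diff X n x \<oplus>\<^bsub>obj X (n + 1)\<^esub> diff X n y)))"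

lemma ab_complexD:
  assumes "ab_complex X"
  shows "abelian_group (obj X n)" "x \<in> carrier (obj X n) \<Longrightarrow> diff X n x \<in> carrier (obj X (n + 1))"
    "x \<in> carrier (obj X n) \<Longrightarrow> diff X (n + 1) (diff X n x) = \<zero>\<^bsub>obj X (n + 2)\<^esub>"
    "x \<in> carrier (obj X n) \<Longrightarrow> y \<in> carrier (obj X n) \<Longrightarrow>
      diff X n (x \<oplus>\<^bsub>obj X n\<^esub> y) = diff X n x \<oplus>\<^bsub>obj X (n + 1)\<^esub> diff X n y"
  using assms by (auto simp: ab_complex_def)

lemma ab_complexD':
  assumes "ab_complex X"
  shows "x \<in> carrier (obj X (n - 1)) \<Longrightarrow> diff X (n - 1) x \<in> carrier (obj X n)"
    "x \<in> carrier (obj X (n - 1)) \<Longrightarrow> diff X n (diff X (n - 1) x) = \<zero>\<^bsub>obj X (n + 1)\<^esub>"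
    "x \<in> carrier (obj X (n - 1)) \<Longrightarrow> y \<in> carrier (obj X (n - 1)) \<Longrightarrow>
      diff X (n - 1) (x \<oplus>\<^bsub>obj X (n - 1)\<^esub> y) = diff X (n - 1) x \<oplus>\<^bsub>obj X n\<^esub> diff X (n - 1) y"
  using ab_complexD(2-4)[OF assms, where n = "n - 1"] by (simp_all add: add.commute)

lemma ab_complex_module: "module_complex R X \<Longrightarrow> ab_complex X"
  unfolding ab_complex_def
  using module_complex_group module_complex_closed(1) module_complexD(3) module_hom_add[OF module_complexD(2)]
  by (metis (no_types, lifting))

lemma additive_zero:
  assumes "abelian_group M" "abelian_group N" "f \<in> carrier M \<rightarrow> carrier N"
    "\<And>x y. x \<in> carrier M \<Longrightarrow> y \<in> carrier M \<Longrightarrow> f (x \<oplus>\<^bsub>M\<^esub> y) = f x \<oplus>\<^bsub>N\<^esub> f y"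
  shows "f \<zero>\<^bsub>M\<^esub> = \<zero>\<^bsub>N\<^esub>" and "x \<in> carrier M \<Longrightarrow> f (\<ominus>\<^bsub>M\<^esub> x) = \<ominus>\<^bsub>N\<^esub> f x"
proof -
  interpret M: abelian_group M by fact
  interpret N: abelian_group N by fact
  have "f \<zero>\<^bsub>M\<^esub> \<oplus>\<^bsub>N\<^esub> f \<zero>\<^bsub>M\<^esub> = f \<zero>\<^bsub>M\<^esub>"
    using assms(4)[of "\<zero>\<^bsub>M\<^esub>" "\<zero>\<^bsub>M\<^esub>"] by simp
  then show z: "f \<zero>\<^bsub>M\<^esub> = \<zero>\<^bsub>N\<^esub>"
    using assms(3) N.add.l_cancel_one by blast
  show "f (\<ominus>\<^bsub>M\<^esub> x) = \<ominus>\<^bsub>N\<^esub> f x" if "x \<in> carrier M"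
  proof -
    have "f (\<ominus>\<^bsub>M\<^esub> x) \<oplus>\<^bsub>N\<^esub> f x = \<zero>\<^bsub>N\<^esub>"
      using assms(4)[of "\<ominus>\<^bsub>M\<^esub> x" x] z that by (simp add: M.l_neg)
    then show ?thesis using assms(3) that N.minus_equality by (metis M.a_inv_closed Pi_mem)
  qed
qed

lemma coboundaries_group:
  assumes "ab_complex X"
  shows "coboundaries X n \<subseteq> cocycles X n" "coboundaries X n \<subseteq> carrier (obj X n)"
    "\<zero>\<^bsub>obj X n\<^esub> \<in> coboundaries X n"
    "b \<in> coboundaries X n \<Longrightarrow> c \<in> coboundaries X n \<Longrightarrow> b \<oplus>\<^bsub>obj X n\<^esub> c \<in> coboundaries X n"
    "b \<in> coboundaries X n \<Longrightarrow> \<ominus>\<^bsub>obj X n\<^esub> b \<in> coboundaries X n"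
proof -
  note D = ab_complexD[OF assms] and D' = ab_complexD'[OF assms]
  interpret W: abelian_group "obj X (n - 1)" by (rule D)
  have ad: "diff X (n - 1) \<in> carrier (obj X (n - 1)) \<rightarrow> carrier (obj X n)" using D'(1) by auto
  show "coboundaries X n \<subseteq> cocycles X n" "coboundaries X n \<subseteq> carrier (obj X n)"
    using D'(1,2) by (auto simp: coboundaries_def cocycles_def)
  show "\<zero>\<^bsub>obj X n\<^esub> \<in> coboundaries X n"
    using additive_zero(1)[OF D(1,1) ad D'(3)] unfolding coboundaries_def
    by (metis W.zero_closed imageI)
  show "b \<oplus>\<^bsub>obj X n\<^esub> c \<in> coboundaries X n" if "b \<in> coboundaries X n" "c \<in> coboundaries X n"
    using that unfolding coboundaries_def by (auto simp flip: D'(3))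
  show "\<ominus>\<^bsub>obj X n\<^esub> b \<in> coboundaries X n" if "b \<in> coboundaries X n"
    using that unfolding coboundaries_def by (auto simp flip: additive_zero(2)[OF D(1,1) ad D'(3)])
qed

lemma cocycles_group:
  assumes "ab_complex X"
  shows "cocycles X n \<subseteq> carrier (obj X n)" "\<zero>\<^bsub>obj X n\<^esub> \<in> cocycles X n"
    "b \<in> cocycles X n \<Longrightarrow> c \<in> cocycles X n \<Longrightarrow> b \<oplus>\<^bsub>obj X n\<^esub> c \<in> cocycles X n"
    "b \<in> cocycles X n \<Longrightarrow> \<ominus>\<^bsub>obj X n\<^esub> b \<in> cocycles X n"
proof -
  note D = ab_complexD[OF assms]
  interpret X: abelian_group "obj X n" by (rule D)
  interpret Y: abelian_group "obj X (n + 1)" by (rule D)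
  have ad: "diff X n \<in> carrier (obj X n) \<rightarrow> carrier (obj X (n + 1))" using D(2) by auto
  show "cocycles X n \<subseteq> carrier (obj X n)" by (auto simp: cocycles_def)
  show "\<zero>\<^bsub>obj X n\<^esub> \<in> cocycles X n"
    using additive_zero(1)[OF D(1,1) ad D(4)] by (auto simp: cocycles_def)
  show "b \<oplus>\<^bsub>obj X n\<^esub> c \<in> cocycles X n" if "b \<in> cocycles X n" "c \<in> cocycles X n"
    using that by (auto simp: cocycles_def D(4))
  show "\<ominus>\<^bsub>obj X n\<^esub> b \<in> cocycles X n" if "b \<in> cocycles X n"
    using that additive_zero(2)[OF D(1,1) ad D(4)] Y.a_inv_zero by (auto simp: cocycles_def)
qed

text \<open>Written with the coboundary on the left, as in the cosets of \<open>Mod\<close>, so that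
  the elements of \<open>cohomology\<close> are literally these sets.\<close>

definition coclass :: "('a, 'u) cochain_complex \<Rightarrow> int \<Rightarrow> 'u \<Rightarrow> 'u set" where
  "coclass X n z = (\<lambda>b. b \<oplus>\<^bsub>obj X n\<^esub> z) ` coboundaries X n"

lemma carrier_cohomology: "carrier (cohomology X n) = coclass X n ` cocycles X n"
  by (auto simp: cohomology_def FactGroup_def RCOSETS_def r_coset_def coclass_def)

lemma coclass_mult:
  assumes "ab_complex X" "z \<in> cocycles X n" "w \<in> cocycles X n"
  shows "coclass X n z \<otimes>\<^bsub>cohomology X n\<^esub> coclass X n w = coclass X n (z \<oplus>\<^bsub>obj X n\<^esub> w)"
proof -
  note B = coboundaries_group[OF assms(1)] and Z = cocycles_group[OF assms(1)]
  interpret X: abelian_group "obj X n" by (rule ab_complexD[OF assms(1)])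
  have zw: "z \<in> carrier (obj X n)" "w \<in> carrier (obj X n)" using assms Z by auto
  have B': "b \<in> carrier (obj X n)" if "b \<in> coboundaries X n" for b using B(2) that by blast
  have "coclass X n z \<otimes>\<^bsub>cohomology X n\<^esub> coclass X n w =
      {(b \<oplus>\<^bsub>obj X n\<^esub> z) \<oplus>\<^bsub>obj X n\<^esub> (c \<oplus>\<^bsub>obj X n\<^esub> w) | b c. b \<in> coboundaries X n \<and> c \<in> coboundaries X n}"
    by (auto simp: cohomology_def FactGroup_def set_mult_def coclass_def)
  also have "\<dots> = {(b \<oplus>\<^bsub>obj X n\<^esub> c) \<oplus>\<^bsub>obj X n\<^esub> (z \<oplus>\<^bsub>obj X n\<^esub> w) | b c. b \<in> coboundaries X n \<and> c \<in> coboundaries X n}"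
  proof -
    have "(b \<oplus>\<^bsub>obj X n\<^esub> z) \<oplus>\<^bsub>obj X n\<^esub> (c \<oplus>\<^bsub>obj X n\<^esub> w) =
        (b \<oplus>\<^bsub>obj X n\<^esub> c) \<oplus>\<^bsub>obj X n\<^esub> (z \<oplus>\<^bsub>obj X n\<^esub> w)"
      if "b \<in> coboundaries X n" "c \<in> coboundaries X n" for b c
      using B'[OF that(1)] B'[OF that(2)] zw by (simp add: X.a_ac)
    then show ?thesis by (metis (no_types, lifting))
  qed
  also have "\<dots> = coclass X n (z \<oplus>\<^bsub>obj X n\<^esub> w)"
  proof -
    have "\<exists>b' c. b \<oplus>\<^bsub>obj X n\<^esub> (z \<oplus>\<^bsub>obj X n\<^esub> w) = (b' \<oplus>\<^bsub>obj X n\<^esub> c) \<oplus>\<^bsub>obj X n\<^esub> (z \<oplus>\<^bsub>obj X n\<^esub> w) \<and>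
        b' \<in> coboundaries X n \<and> c \<in> coboundaries X n" if "b \<in> coboundaries X n" for b
      using that B(3) B'[OF that] X.r_zero by metis
    then show ?thesis using B(4) unfolding coclass_def by blast
  qed
  finally show ?thesis .
qed

lemma coclass_eq_iff:
  assumes "ab_complex X" "z \<in> cocycles X n" "w \<in> cocycles X n"
  shows "coclass X n z = coclass X n w \<longleftrightarrow> (\<exists>b\<in>coboundaries X n. z = b \<oplus>\<^bsub>obj X n\<^esub> w)"
proof -
  note B = coboundaries_group[OF assms(1)] and Z = cocycles_group[OF assms(1)]
  interpret X: abelian_group "obj X n" by (rule ab_complexD[OF assms(1)])
  have zw: "z \<in> carrier (obj X n)" "w \<in> carrier (obj X n)" using assms Z by auto
  have B': "b \<in> carrier (obj X n)" if "b \<in> coboundaries X n" for b using B(2) that by blast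
  show ?thesis
  proof
    assume eq: "coclass X n z = coclass X n w"
    have "z \<in> coclass X n z" unfolding coclass_def using B(3) zw X.l_zero by (metis imageI)
    then show "\<exists>b\<in>coboundaries X n. z = b \<oplus>\<^bsub>obj X n\<^esub> w" unfolding eq by (auto simp: coclass_def)
  next
    assume "\<exists>b\<in>coboundaries X n. z = b \<oplus>\<^bsub>obj X n\<^esub> w"
    then obtain b where b: "b \<in> coboundaries X n" "z = b \<oplus>\<^bsub>obj X n\<^esub> w" by blast
    have "c \<oplus>\<^bsub>obj X n\<^esub> z \<in> coclass X n w" if "c \<in> coboundaries X n" for c
      unfolding coclass_def using b B(4)[OF that b(1)] B'[OF that] B'[OF b(1)] zw
      by (auto simp: X.a_assoc intro!: image_eqI[of _ _ "c \<oplus>\<^bsub>obj X n\<^esub> b"])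
    moreover have "c \<oplus>\<^bsub>obj X n\<^esub> w \<in> coclass X n z" if "c \<in> coboundaries X n" for c
      unfolding coclass_def using b B(4)[OF that B(5)[OF b(1)]] B'[OF that] B'[OF b(1)] zw
      by (auto simp: X.a_assoc X.r_neg1 intro!: image_eqI[of _ _ "c \<oplus>\<^bsub>obj X n\<^esub> \<ominus>\<^bsub>obj X n\<^esub> b"])
    ultimately show "coclass X n z = coclass X n w" by (auto simp: coclass_def)
  qed
qed

text \<open>With \<open>coh_surj\<close>, the two halves of a quasi-isomorphism stated on elements.
  After \<open>quasi_iso_iff\<close> no cosets occur any more, and the halves can be cancelled
  separately in compositions.\<close>

definition coh_inj :: "('a, 'u) cochain_complex \<Rightarrow> ('a, 'v) cochain_complex \<Rightarrow> (int \<Rightarrow> 'u \<Rightarrow> 'v) \<Rightarrow> bool" where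
  "coh_inj X Y f \<longleftrightarrow> (\<forall>n. \<forall>x\<in>cocycles X n. f n x \<in> coboundaries Y n \<longrightarrow> x \<in> coboundaries X n)"

definition coh_surj :: "('a, 'u) cochain_complex \<Rightarrow> ('a, 'v) cochain_complex \<Rightarrow> (int \<Rightarrow> 'u \<Rightarrow> 'v) \<Rightarrow> bool" where
  "coh_surj X Y f \<longleftrightarrow> (\<forall>n. \<forall>y\<in>cocycles Y n. \<exists>x\<in>cocycles X n. \<exists>b\<in>coboundaries Y n.
    y = b \<oplus>\<^bsub>obj Y n\<^esub> f n x)"

lemma chain_map_cocycles:
  assumes "ab_complex X" "ab_complex Y" "chain_map R X Y f"
  shows "x \<in> cocycles X n \<Longrightarrow> f n x \<in> cocycles Y n"
    "x \<in> coboundaries X n \<Longrightarrow> f n x \<in> coboundaries Y n"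
    "f n \<zero>\<^bsub>obj X n\<^esub> = \<zero>\<^bsub>obj Y n\<^esub>"
proof -
  note f = chain_mapD[OF assms(3)]
  show z: "f n \<zero>\<^bsub>obj X n\<^esub> = \<zero>\<^bsub>obj Y n\<^esub>" for n
    by (rule module_hom_zero[OF f(1) ab_complexD(1)[OF assms(1)] ab_complexD(1)[OF assms(2)]])
  show "f n x \<in> cocycles Y n" if "x \<in> cocycles X n"
    using that z by (auto simp: cocycles_def f)
  show "f n x \<in> coboundaries Y n" if "x \<in> coboundaries X n"
    using that f(3) by (auto simp: coboundaries_def simp flip: f(4))
qed

lemma cohomology_map_coclass:
  assumes "ab_complex X" "ab_complex Y" "chain_map R X Y f" "x \<in> cocycles X n"
  shows "cohomology_map Y f n (coclass X n x) = coclass Y n (f n x)"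
proof -
  note f = chain_mapD[OF assms(3)] and g = chain_map_cocycles[OF assms(1-3)]
  note BX = coboundaries_group[OF assms(1)] and B = coboundaries_group[OF assms(2)]
  interpret Y: abelian_group "obj Y n" by (rule ab_complexD[OF assms(2)])
  have x: "x \<in> carrier (obj X n)" using assms(4) by (simp add: cocycles_def)
  have B': "b \<in> carrier (obj Y n)" if "b \<in> coboundaries Y n" for b using B(2) that by blast
  have "cohomology_map Y f n (coclass X n x) =
      {b \<oplus>\<^bsub>obj Y n\<^esub> f n (c \<oplus>\<^bsub>obj X n\<^esub> x) | b c. b \<in> coboundaries Y n \<and> c \<in> coboundaries X n}"
    by (auto simp: cohomology_map_def coclass_def set_add_def set_mult_def)
  also have "\<dots> = {(b \<oplus>\<^bsub>obj Y n\<^esub> f n c) \<oplus>\<^bsub>obj Y n\<^esub> f n x | b c. b \<in> coboundaries Y n \<and> c \<in> coboundaries X n}"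
  proof -
    have "b \<oplus>\<^bsub>obj Y n\<^esub> f n (c \<oplus>\<^bsub>obj X n\<^esub> x) = (b \<oplus>\<^bsub>obj Y n\<^esub> f n c) \<oplus>\<^bsub>obj Y n\<^esub> f n x"
      if "b \<in> coboundaries Y n" "c \<in> coboundaries X n" for b c
    proof -
      have "c \<in> carrier (obj X n)" using BX(2) that by blast
      then show ?thesis using B'[OF that(1)] x f(3) by (simp add: module_hom_add[OF f(1)] Y.a_assoc)
    qed
    then show ?thesis by (metis (no_types, lifting))
  qed
  also have "\<dots> = coclass Y n (f n x)"
  proof -
    have "\<exists>b' c. b \<oplus>\<^bsub>obj Y n\<^esub> f n x = (b' \<oplus>\<^bsub>obj Y n\<^esub> f n c) \<oplus>\<^bsub>obj Y n\<^esub> f n x \<and>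
        b' \<in> coboundaries Y n \<and> c \<in> coboundaries X n" if "b \<in> coboundaries Y n" for b
      using that BX(3) g(3) B'[OF that] Y.r_zero by metis
    then show ?thesis using B(4) g(2) unfolding coclass_def by blast
  qed
  finally show ?thesis .
qed

lemma quasi_iso_iff:
  assumes "ab_complex X" "ab_complex Y"
  shows "quasi_iso R X Y f \<longleftrightarrow> chain_map R X Y f \<and> coh_inj X Y f \<and> coh_surj X Y f"
proof (cases "chain_map R X Y f")
  case True
  note f = chain_mapD[OF True] and g = chain_map_cocycles[OF assms True]
  note C = cohomology_map_coclass[OF assms True]
  note ZX = cocycles_group[OF assms(1)] and ZY = cocycles_group[OF assms(2)]
  note BX = coboundaries_group[OF assms(1)] and BY = coboundaries_group[OF assms(2)]
  have hom: "cohomology_map Y f n \<in> hom (cohomology X n) (cohomology Y n)" for n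
  proof (rule homI)
    show "cohomology_map Y f n c \<in> carrier (cohomology Y n)" if "c \<in> carrier (cohomology X n)" for c
      using that C g(1) by (auto simp: carrier_cohomology)
    fix c c' assume "c \<in> carrier (cohomology X n)" "c' \<in> carrier (cohomology X n)"
    then obtain x y where xy: "x \<in> cocycles X n" "y \<in> cocycles X n" "c = coclass X n x" "c' = coclass X n y"
      by (auto simp: carrier_cohomology)
    have "f n (x \<oplus>\<^bsub>obj X n\<^esub> y) = f n x \<oplus>\<^bsub>obj Y n\<^esub> f n y"
      using xy by (intro module_hom_add[OF f(1)]) (auto simp: cocycles_def)
    then show "cohomology_map Y f n (c \<otimes>\<^bsub>cohomology X n\<^esub> c') =
        cohomology_map Y f n c \<otimes>\<^bsub>cohomology Y n\<^esub> cohomology_map Y f n c'"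
      using xy by (simp add: coclass_mult[OF assms(1)] coclass_mult[OF assms(2)] C ZX g(1))
  qed
  have eqX: "coclass X n x = coclass X n \<zero>\<^bsub>obj X n\<^esub> \<longleftrightarrow> x \<in> coboundaries X n" if "x \<in> cocycles X n" for n x
  proof -
    interpret X: abelian_group "obj X n" by (rule ab_complexD[OF assms(1)])
    show ?thesis using coclass_eq_iff[OF assms(1) that ZX(2)] BX(2) by (metis X.r_zero subsetD)
  qed
  have eqY: "coclass Y n x = coclass Y n \<zero>\<^bsub>obj Y n\<^esub> \<longleftrightarrow> x \<in> coboundaries Y n" if "x \<in> cocycles Y n" for n x
  proof -
    interpret Y: abelian_group "obj Y n" by (rule ab_complexD[OF assms(2)])
    show ?thesis using coclass_eq_iff[OF assms(2) that ZY(2)] BY(2) by (metis Y.r_zero subsetD)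
  qed
  have inj: "(\<forall>n. inj_on (cohomology_map Y f n) (carrier (cohomology X n))) \<longleftrightarrow> coh_inj X Y f"
  proof
    assume inj: "\<forall>n. inj_on (cohomology_map Y f n) (carrier (cohomology X n))"
    show "coh_inj X Y f"
      unfolding coh_inj_def
    proof (intro allI ballI impI)
      fix n x assume x: "x \<in> cocycles X n" "f n x \<in> coboundaries Y n"
      have "cohomology_map Y f n (coclass X n x) = cohomology_map Y f n (coclass X n \<zero>\<^bsub>obj X n\<^esub>)"
        using C[OF x(1)] C[OF ZX(2)] eqY[OF g(1)[OF x(1)]] x(2) g(3) by simp
      then have "coclass X n x = coclass X n \<zero>\<^bsub>obj X n\<^esub>"
        using inj x(1) ZX(2) unfolding inj_on_def carrier_cohomology by blast
      then show "x \<in> coboundaries X n" using eqX[OF x(1)] by simp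
    qed
  next
    assume inj: "coh_inj X Y f"
    show "\<forall>n. inj_on (cohomology_map Y f n) (carrier (cohomology X n))"
    proof (intro allI inj_onI)
      fix n c c' assume "c \<in> carrier (cohomology X n)" "c' \<in> carrier (cohomology X n)"
        and eq: "cohomology_map Y f n c = cohomology_map Y f n c'"
      then obtain x y where xy: "x \<in> cocycles X n" "y \<in> cocycles X n" "c = coclass X n x" "c' = coclass X n y"
        by (auto simp: carrier_cohomology)
      interpret X: abelian_group "obj X n" by (rule ab_complexD[OF assms(1)])
      interpret Y: abelian_group "obj Y n" by (rule ab_complexD[OF assms(2)])
      have xy': "x \<in> carrier (obj X n)" "y \<in> carrier (obj X n)" using xy ZX(1) by auto
      have "coclass Y n (f n x) = coclass Y n (f n y)" using eq C xy by simp
      then obtain b where b: "b \<in> coboundaries Y n" "f n x = b \<oplus>\<^bsub>obj Y n\<^esub> f n y"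
        using coclass_eq_iff[OF assms(2) g(1)[OF xy(1)] g(1)[OF xy(2)]] by blast
      have bc: "b \<in> carrier (obj Y n)" using b(1) BY(2) by blast
      have "f n (x \<ominus>\<^bsub>obj X n\<^esub> y) = f n x \<ominus>\<^bsub>obj Y n\<^esub> f n y"
        by (rule module_hom_diff[OF f(1) X.abelian_group_axioms Y.abelian_group_axioms xy'])
      also have "\<dots> = b"
        unfolding b(2) using bc f(3)[OF xy'(2)] by (simp add: a_minus_def Y.a_assoc Y.r_neg)
      finally have "f n (x \<ominus>\<^bsub>obj X n\<^esub> y) \<in> coboundaries Y n" using b(1) by simp
      moreover have "x \<ominus>\<^bsub>obj X n\<^esub> y \<in> cocycles X n"
        unfolding a_minus_def by (intro ZX xy)
      ultimately have "x \<ominus>\<^bsub>obj X n\<^esub> y \<in> coboundaries X n" using inj unfolding coh_inj_def by blast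
      moreover have "x = (x \<ominus>\<^bsub>obj X n\<^esub> y) \<oplus>\<^bsub>obj X n\<^esub> y"
        using xy' by (simp add: a_minus_def X.a_assoc X.l_neg)
      ultimately show "c = c'" using coclass_eq_iff[OF assms(1) xy(1,2)] xy(3,4) by blast
    qed
  qed
  have surj: "(\<forall>n. cohomology_map Y f n ` carrier (cohomology X n) = carrier (cohomology Y n)) \<longleftrightarrow> coh_surj X Y f"
  proof -
    have "cohomology_map Y f n ` carrier (cohomology X n) = carrier (cohomology Y n) \<longleftrightarrow>
      (\<forall>y\<in>cocycles Y n. \<exists>x\<in>cocycles X n. \<exists>b\<in>coboundaries Y n. y = b \<oplus>\<^bsub>obj Y n\<^esub> f n x)" for n
    proof -
      have "cohomology_map Y f n ` carrier (cohomology X n) = (\<lambda>x. coclass Y n (f n x)) ` cocycles X n"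
        unfolding carrier_cohomology image_image using C by (rule image_cong[OF refl])
      then have "cohomology_map Y f n ` carrier (cohomology X n) = carrier (cohomology Y n) \<longleftrightarrow>
        coclass Y n ` cocycles Y n \<subseteq> (\<lambda>x. coclass Y n (f n x)) ` cocycles X n"
        using g(1) by (auto simp: carrier_cohomology)
      also have "\<dots> \<longleftrightarrow> (\<forall>y\<in>cocycles Y n. \<exists>x\<in>cocycles X n. coclass Y n y = coclass Y n (f n x))"
        by (auto simp: image_subset_iff image_iff)
      also have "\<dots> \<longleftrightarrow> (\<forall>y\<in>cocycles Y n. \<exists>x\<in>cocycles X n. \<exists>b\<in>coboundaries Y n. y = b \<oplus>\<^bsub>obj Y n\<^esub> f n x)"
        using coclass_eq_iff[OF assms(2) _ g(1)] by (metis (no_types, lifting))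
      finally show ?thesis .
    qed
    then show ?thesis unfolding coh_surj_def by simp
  qed
  show ?thesis
    unfolding quasi_iso_def iso_def bij_betw_def mem_Collect_eq using True hom inj surj by blast
qed (simp add: quasi_iso_def)

text \<open>On a cocycle the part \<open>h (n + 1) (diff X n x)\<close> of the homotopy vanishes,
  and what is left is a coboundary.\<close>

lemma homotopic_cocycle:
  assumes X: "ab_complex X" and Y: "ab_complex Y" and fg: "homotopic R X Y f g" "f n \<in> module_hom R (obj X n) (obj Y n)"
    "g n \<in> module_hom R (obj X n) (obj Y n)" and x: "x \<in> cocycles X n"
  shows "\<exists>b\<in>coboundaries Y n. f n x = b \<oplus>\<^bsub>obj Y n\<^esub> g n x"
proof -
  obtain h where h: "\<And>n. h n \<in> module_hom R (obj X n) (obj Y (n - 1))"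
    "\<And>n x. x \<in> carrier (obj X n) \<Longrightarrow>
      f n x \<ominus>\<^bsub>obj Y n\<^esub> g n x = diff Y (n - 1) (h n x) \<oplus>\<^bsub>obj Y n\<^esub> h (n + 1) (diff X n x)"
    using fg(1) unfolding homotopic_def by metis
  interpret Y: abelian_group "obj Y n" by (rule ab_complexD[OF Y])
  have xc: "x \<in> carrier (obj X n)" "diff X n x = \<zero>\<^bsub>obj X (n + 1)\<^esub>" using x by (auto simp: cocycles_def)
  have z: "h (n + 1) \<zero>\<^bsub>obj X (n + 1)\<^esub> = \<zero>\<^bsub>obj Y n\<^esub>"
    using module_hom_zero[OF h(1) ab_complexD(1)[OF X] ab_complexD(1)[OF Y], of "n + 1"] by simp
  have hx: "h n x \<in> carrier (obj Y (n - 1))" by (rule module_hom_closed[OF h(1) xc(1)])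
  have b: "diff Y (n - 1) (h n x) \<in> coboundaries Y n" using hx by (auto simp: coboundaries_def)
  then have bc: "diff Y (n - 1) (h n x) \<in> carrier (obj Y n)" using coboundaries_group(2)[OF Y] by blast
  have "f n x \<ominus>\<^bsub>obj Y n\<^esub> g n x = diff Y (n - 1) (h n x)"
    using h(2)[OF xc(1)] xc(2) z bc by simp
  then have "f n x = diff Y (n - 1) (h n x) \<oplus>\<^bsub>obj Y n\<^esub> g n x"
    using Y.minus_eq_iff_add[OF module_hom_closed[OF fg(2) xc(1)] module_hom_closed[OF fg(3) xc(1)] bc]
      bc module_hom_closed[OF fg(3) xc(1)] Y.a_comm by simp
  then show ?thesis using b by blast
qed

lemma coh_homotopic:
  assumes X: "ab_complex X" and Y: "ab_complex Y" and fg: "homotopic R X Y f g"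
    and f: "chain_map R X Y f" and g: "chain_map R X Y g"
  shows "coh_inj X Y f \<longleftrightarrow> coh_inj X Y g" "coh_surj X Y f \<longleftrightarrow> coh_surj X Y g"
proof -
  note B = coboundaries_group[OF Y]
  have key: "\<exists>b\<in>coboundaries Y n. f n x = b \<oplus>\<^bsub>obj Y n\<^esub> g n x" "\<exists>b\<in>coboundaries Y n. g n x = b \<oplus>\<^bsub>obj Y n\<^esub> f n x"
    if x: "x \<in> cocycles X n" for n x
  proof -
    interpret Y: abelian_group "obj Y n" by (rule ab_complexD[OF Y])
    have xc: "x \<in> carrier (obj X n)" using x by (auto simp: cocycles_def)
    show *: "\<exists>b\<in>coboundaries Y n. f n x = b \<oplus>\<^bsub>obj Y n\<^esub> g n x"
      by (rule homotopic_cocycle[OF X Y fg chain_mapD(1)[OF f] chain_mapD(1)[OF g] x])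
    then obtain b where b: "b \<in> coboundaries Y n" "f n x = b \<oplus>\<^bsub>obj Y n\<^esub> g n x" by blast
    have "g n x = (\<ominus>\<^bsub>obj Y n\<^esub> b) \<oplus>\<^bsub>obj Y n\<^esub> f n x"
      unfolding b(2) using subsetD[OF B(2) b(1)] chain_mapD(3)[OF g xc] by (simp add: Y.r_neg1)
    then show "\<exists>b\<in>coboundaries Y n. g n x = b \<oplus>\<^bsub>obj Y n\<^esub> f n x" using B(5)[OF b(1)] by blast
  qed
  show "coh_inj X Y f \<longleftrightarrow> coh_inj X Y g"
    unfolding coh_inj_def using key B(4) by metis
  have assoc: "b \<oplus>\<^bsub>obj Y n\<^esub> (c \<oplus>\<^bsub>obj Y n\<^esub> k n x) = (b \<oplus>\<^bsub>obj Y n\<^esub> c) \<oplus>\<^bsub>obj Y n\<^esub> k n x"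
    if "b \<in> coboundaries Y n" "c \<in> coboundaries Y n" "x \<in> cocycles X n" "chain_map R X Y k" for b c x k n
  proof -
    interpret Y: abelian_group "obj Y n" by (rule ab_complexD[OF Y])
    show ?thesis using that subsetD[OF B(2)] chain_mapD(3)[OF that(4)] by (simp add: Y.a_assoc cocycles_def)
  qed
  show "coh_surj X Y f \<longleftrightarrow> coh_surj X Y g"
    unfolding coh_surj_def using key B(4) assoc[OF _ _ _ f] assoc[OF _ _ _ g] by (metis (full_types))
qed

section \<open>Two-out-of-three on cohomology\<close>

lemma coh_inj_comp:
  assumes "ab_complex X" "ab_complex Y" "chain_map R X Y f" "coh_inj X Y f" "coh_inj Y Z g"
  shows "coh_inj X Z (\<lambda>n x. g n (f n x))"
  using assms(4,5) chain_map_cocycles(1)[OF assms(1-3)] unfolding coh_inj_def by blast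

lemma coh_inj_cancel:
  assumes "ab_complex Y" "ab_complex Z" "chain_map R Y Z g" "coh_inj X Z (\<lambda>n x. g n (f n x))"
  shows "coh_inj X Y f"
  using assms(4) chain_map_cocycles(2)[OF assms(1-3)] unfolding coh_inj_def by blast

lemma coh_surj_cancel:
  assumes "ab_complex X" "ab_complex Y" "chain_map R X Y f" "coh_surj X Z (\<lambda>n x. g n (f n x))"
  shows "coh_surj Y Z g"
  using assms(4) chain_map_cocycles(1)[OF assms(1-3)] unfolding coh_surj_def by blast

lemma coh_surj_comp:
  assumes "ab_complex Y" "ab_complex Z" "chain_map R Y Z g" "chain_map R X Y f" "ab_complex X"
    "coh_surj X Y f" "coh_surj Y Z g"
  shows "coh_surj X Z (\<lambda>n x. g n (f n x))"
  unfolding coh_surj_def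
proof (intro allI ballI)
  fix n z assume "z \<in> cocycles Z n"
  then obtain y b where y: "y \<in> cocycles Y n" "b \<in> coboundaries Z n" "z = b \<oplus>\<^bsub>obj Z n\<^esub> g n y"
    using assms(7) unfolding coh_surj_def by meson
  obtain x c where x: "x \<in> cocycles X n" "c \<in> coboundaries Y n" "y = c \<oplus>\<^bsub>obj Y n\<^esub> f n x"
    using assms(6) y(1) unfolding coh_surj_def by meson
  interpret Z: abelian_group "obj Z n" by (rule ab_complexD[OF assms(2)])
  have car: "b \<in> carrier (obj Z n)" "c \<in> carrier (obj Y n)" "x \<in> carrier (obj X n)"
    using y x coboundaries_group(2)[OF assms(2)] coboundaries_group(2)[OF assms(1)] by (auto simp: cocycles_def)
  have "z = (b \<oplus>\<^bsub>obj Z n\<^esub> g n c) \<oplus>\<^bsub>obj Z n\<^esub> g n (f n x)"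
    unfolding y(3) x(3) using car chain_mapD(3)[OF assms(4)] chain_mapD(3)[OF assms(3)]
    by (simp add: module_hom_add[OF chain_mapD(1)[OF assms(3)]] Z.a_assoc)
  then show "\<exists>x\<in>cocycles X n. \<exists>b\<in>coboundaries Z n. z = b \<oplus>\<^bsub>obj Z n\<^esub> g n (f n x)"
    using x(1) coboundaries_group(4)[OF assms(2) y(2) chain_map_cocycles(2)[OF assms(1-3) x(2)]] by blast
qed

lemma coh_inj_cancel_right:
  assumes "ab_complex X" "ab_complex Y" "ab_complex Z" "chain_map R X Y f" "chain_map R Y Z g"
    "coh_surj X Y f" "coh_inj X Z (\<lambda>n x. g n (f n x))"
  shows "coh_inj Y Z g"
  unfolding coh_inj_def
proof (intro allI ballI impI)
  fix n y assume y: "y \<in> cocycles Y n" "g n y \<in> coboundaries Z n"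
  note BY = coboundaries_group[OF assms(2)] and BZ = coboundaries_group[OF assms(3)]
  obtain x c where x: "x \<in> cocycles X n" "c \<in> coboundaries Y n" "y = c \<oplus>\<^bsub>obj Y n\<^esub> f n x"
    using assms(6) y(1) unfolding coh_surj_def by meson
  interpret Z: abelian_group "obj Z n" by (rule ab_complexD[OF assms(3)])
  have car: "c \<in> carrier (obj Y n)" "x \<in> carrier (obj X n)"
    using x BY(2) by (auto simp: cocycles_def)
  have gc: "g n c \<in> coboundaries Z n" by (rule chain_map_cocycles(2)[OF assms(2,3,5) x(2)])
  have "g n (f n x) = (\<ominus>\<^bsub>obj Z n\<^esub> g n c) \<oplus>\<^bsub>obj Z n\<^esub> g n y"
    unfolding x(3) using car chain_mapD(3)[OF assms(4)] chain_mapD(3)[OF assms(5)]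
    by (simp add: module_hom_add[OF chain_mapD(1)[OF assms(5)]] Z.r_neg1)
  then have "g n (f n x) \<in> coboundaries Z n" using BZ(4)[OF BZ(5)[OF gc] y(2)] by simp
  then have "x \<in> coboundaries X n" using assms(7) x(1) unfolding coh_inj_def by blast
  then show "y \<in> coboundaries Y n"
    unfolding x(3) by (intro BY(4) x(2) chain_map_cocycles(2)[OF assms(1,2,4)])
qed

lemma coh_surj_cancel_left:
  assumes "ab_complex X" "ab_complex Y" "ab_complex Z" "chain_map R X Y f" "chain_map R Y Z g"
    "coh_inj Y Z g" "coh_surj X Z (\<lambda>n x. g n (f n x))"
  shows "coh_surj X Y f"
  unfolding coh_surj_def
proof (intro allI ballI)
  fix n y assume y: "y \<in> cocycles Y n"
  note ZY = cocycles_group[OF assms(2)]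
  obtain x b where x: "x \<in> cocycles X n" "b \<in> coboundaries Z n" "g n y = b \<oplus>\<^bsub>obj Z n\<^esub> g n (f n x)"
    using assms(7) chain_map_cocycles(1)[OF assms(2,3,5) y] unfolding coh_surj_def by meson
  interpret Z: abelian_group "obj Z n" by (rule ab_complexD[OF assms(3)])
  interpret Y: abelian_group "obj Y n" by (rule ab_complexD[OF assms(2)])
  have car: "y \<in> carrier (obj Y n)" "f n x \<in> carrier (obj Y n)" "b \<in> carrier (obj Z n)"
    using y x(1,2) chain_mapD(3)[OF assms(4)] coboundaries_group(2)[OF assms(3)] by (auto simp: cocycles_def)
  have fx: "f n x \<in> cocycles Y n" by (rule chain_map_cocycles(1)[OF assms(1,2,4) x(1)])
  have "g n (y \<ominus>\<^bsub>obj Y n\<^esub> f n x) = b"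
    using module_hom_diff[OF chain_mapD(1)[OF assms(5)] Y.abelian_group_axioms Z.abelian_group_axioms car(1,2)]
      x(3) car chain_mapD(3)[OF assms(5)] by (simp add: a_minus_def Z.a_assoc Z.r_neg)
  moreover have "y \<ominus>\<^bsub>obj Y n\<^esub> f n x \<in> cocycles Y n"
    unfolding a_minus_def by (intro ZY y fx)
  ultimately have "y \<ominus>\<^bsub>obj Y n\<^esub> f n x \<in> coboundaries Y n"
    using assms(6) x(2) unfolding coh_inj_def by metis
  moreover have "y = (y \<ominus>\<^bsub>obj Y n\<^esub> f n x) \<oplus>\<^bsub>obj Y n\<^esub> f n x"
    using car by (simp add: a_minus_def Y.a_assoc Y.l_neg)
  ultimately show "\<exists>x\<in>cocycles X n. \<exists>b\<in>coboundaries Y n. y = b \<oplus>\<^bsub>obj Y n\<^esub> f n x"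
    using x(1) by blast
qed

lemma coh_id: "ab_complex X \<Longrightarrow> coh_inj X X (\<lambda>n x. x)" "ab_complex X \<Longrightarrow> coh_surj X X (\<lambda>n x. x)"
proof -
  assume X: "ab_complex X"
  show "coh_inj X X (\<lambda>n x. x)" by (simp add: coh_inj_def)
  show "coh_surj X X (\<lambda>n x. x)"
    unfolding coh_surj_def
  proof (intro allI ballI)
    fix n y assume "y \<in> cocycles X n"
    moreover interpret Y: abelian_group "obj X n" by (rule ab_complexD[OF X])
    have "y = \<zero>\<^bsub>obj X n\<^esub> \<oplus>\<^bsub>obj X n\<^esub> y" using \<open>y \<in> cocycles X n\<close> by (simp add: cocycles_def)
    ultimately show "\<exists>x\<in>cocycles X n. \<exists>b\<in>coboundaries X n. y = b \<oplus>\<^bsub>obj X n\<^esub> x"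
      using coboundaries_group(3)[OF X] by blast
  qed
qed

section \<open>Lifting maps out of bounded projective complexes\<close>

definition fgp_complex :: "('a, 'r) ring_scheme \<Rightarrow> ('a, 'u) cochain_complex \<Rightarrow> bool" where
  "fgp_complex R X \<longleftrightarrow> module_complex R X \<and> (\<forall>n. fgp R (obj X n)) \<and>
    (\<exists>a b. \<forall>n. n < a \<or> b < n \<longrightarrow> carrier (obj X n) = {\<zero>\<^bsub>obj X n\<^esub>})"

lemma perfect_iff_fgp_complex:
  fixes X :: "('a, 'u) cochain_complex"
  assumes "cring R" "infinite (UNIV :: 'u set)" "carrier R \<lesssim> (UNIV :: 'u set)"
  shows "perfect_complex R X \<longleftrightarrow> fgp_complex R X"
  unfolding perfect_complex_def fgp_complex_def
  using fgp_if_fin_gen_projective[OF assms] fgp_fin_gen fgp_projective by blast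

text \<open>Dependent choice running down the integers, with the prescribed values \<open>z\<close>
  above \<open>b\<close>. \<open>P\<close> is an invariant of one degree and \<open>Q\<close> links
  neighbouring degrees; a chain map out of a complex that vanishes above \<open>b\<close> is
  constructed in this way.\<close>

lemma descending_choice:
  fixes b :: int
  assumes base: "\<And>n. n > b \<Longrightarrow> P n (z n)" "\<And>n. n > b \<Longrightarrow> Q n (z n) (z (n + 1))"
    and step: "\<And>n y. n \<le> b \<Longrightarrow> P (n + 1) y \<Longrightarrow> \<exists>x. P n x \<and> Q n x y"
  shows "\<exists>f. \<forall>n. P n (f n) \<and> Q n (f n) (f (n + 1))"
proof -
  \<comment> \<open>The clause for \<open>k = 0\<close> ties the sequence to
    \<open>z (b + 1)\<close>, so that the two halves of \<open>f\<close> fit together at the seam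
    between \<open>b\<close> and \<open>b + 1\<close>.\<close>
  have "\<exists>F. \<forall>k. (P (b + 1 - int k) (F k) \<and> (k = 0 \<longrightarrow> F k = z (b + 1))) \<and> Q (b - int k) (F (Suc k)) (F k)"
  proof (rule dependent_nat_choice)
    show "\<exists>x. P (b + 1 - int 0) x \<and> (0 = 0 \<longrightarrow> x = z (b + 1))" using base(1)[of "b + 1"] by auto
  next
    fix x k assume "P (b + 1 - int k) x \<and> (k = 0 \<longrightarrow> x = z (b + 1))"
    then show "\<exists>y. (P (b + 1 - int (Suc k)) y \<and> (Suc k = 0 \<longrightarrow> y = z (b + 1))) \<and> Q (b - int k) y x"
      using step[of "b - int k" x] by (auto simp: algebra_simps)
  qed
  then obtain F where F: "\<And>k. P (b + 1 - int k) (F k)" "F 0 = z (b + 1)" "\<And>k. Q (b - int k) (F (Suc k)) (F k)"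
    by blast
  define f where "f n = (if n > b then z n else F (nat (b + 1 - n)))" for n
  have "P n (f n) \<and> Q n (f n) (f (n + 1))" for n
  proof (cases "n > b")
    case True
    then show ?thesis using base by (simp add: f_def)
  next
    case False
    define k where "k = nat (b - n)"
    have k: "n = b - int k" "nat (b + 1 - n) = Suc k" using False by (auto simp: k_def)
    have "f (n + 1) = F k"
    proof (cases "n = b")
      case True
      then show ?thesis using F(2) k by (simp add: f_def)
    next
      case False
      then have "nat (b + 1 - (n + 1)) = k" "\<not> n + 1 > b" using k \<open>\<not> n > b\<close> by auto
      then show ?thesis by (simp add: f_def)
    qed
    moreover have "f n = F (Suc k)" using False k by (simp add: f_def)
    moreover have "P n (F (Suc k))" using F(1)[of "Suc k"] k(1) by simp
    ultimately show ?thesis using F(3)[of k] k(1) by simp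
  qed
  then show ?thesis by blast
qed

text \<open>\<open>g\<close> and the homotopy are built together, from the top degree of
  \<open>P\<close> downwards. Injectivity of \<open>s\<close> on cohomology yields a candidate
  value, surjectivity corrects it until a homotopy exists, and dual bases turn the choices into
  linear maps. \<open>A\<close> and \<open>B\<close> may be unbounded and of any element
  type.\<close>

lemma lift_along_quasi_iso:
  fixes P :: "('a, 'p) cochain_complex" and A :: "('a, 'u) cochain_complex" and B :: "('a, 'v) cochain_complex"
  assumes P: "fgp_complex R P" and A: "module_complex R A" and B: "module_complex R B"
    and s: "chain_map R A B s" "coh_inj A B s" "coh_surj A B s" and f: "chain_map R P B f"
  shows "\<exists>g. chain_map R P A g \<and> homotopic R P B (\<lambda>n x. s n (g n x)) f"
proof -
  have Pm: "module_complex R P" using P by (simp add: fgp_complex_def)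
  obtain b where b: "\<And>n. n > b \<Longrightarrow> carrier (obj P n) = {\<zero>\<^bsub>obj P n\<^esub>}" using P by (auto simp: fgp_complex_def)
  note MP = module_complexD(1)[OF Pm] and MA = module_complexD(1)[OF A] and MB = module_complexD(1)[OF B]
  note GP = module_complex_group[OF Pm] and GA = module_complex_group[OF A] and GB = module_complex_group[OF B]
  note dP = module_complexD(2)[OF Pm] module_complexD'(1)[OF Pm]
    and dA = module_complexD(2)[OF A] module_complexD'(1)[OF A]
    and dB = module_complexD(2)[OF B] module_complexD'(1)[OF B]
  note s1 = chain_mapD[OF s(1)] and f1 = chain_mapD[OF f]
  define Rel where "Rel = (\<lambda>n (g :: 'p \<Rightarrow> 'u, l :: 'p \<Rightarrow> 'v) (g' :: 'p \<Rightarrow> 'u, l' :: 'p \<Rightarrow> 'v).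
    \<forall>x\<in>carrier (obj P n). diff A n (g x) = g' (diff P n x) \<and>
      s n (g x) = f n x \<oplus>\<^bsub>obj B n\<^esub> (diff B (n - 1) (l x) \<oplus>\<^bsub>obj B n\<^esub> l' (diff P n x)))"
  \<comment> \<open>What degree \<open>n\<close> must guarantee to degree \<open>n - 1\<close>. It
    is \<open>Rel\<close> restricted to boundaries, where d d = 0 removes the data of degree
    \<open>n + 1\<close>, so the invariant mentions the maps of a single degree.\<close>
  define Inv where "Inv = (\<lambda>n (g :: 'p \<Rightarrow> 'u, l :: 'p \<Rightarrow> 'v).
    g \<in> module_hom R (obj P n) (obj A n) \<and> l \<in> module_hom R (obj P n) (obj B (n - 1)) \<and>
    (\<forall>w\<in>carrier (obj P (n - 1)). diff A n (g (diff P (n - 1) w)) = \<zero>\<^bsub>obj A (n + 1)\<^esub> \<and>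
      s n (g (diff P (n - 1) w)) =
        f n (diff P (n - 1) w) \<oplus>\<^bsub>obj B n\<^esub> diff B (n - 1) (l (diff P (n - 1) w))))"
  have InvI: "Inv n (g, l)" if "g \<in> module_hom R (obj P n) (obj A n)" "l \<in> module_hom R (obj P n) (obj B (n - 1))"
    "Rel n (g, l) (g', l')" "g' \<in> module_hom R (obj P (n + 1)) (obj A (n + 1))"
    "l' \<in> module_hom R (obj P (n + 1)) (obj B n)" for n g l g' l'
  proof -
    have z: "g' \<zero>\<^bsub>obj P (n + 1)\<^esub> = \<zero>\<^bsub>obj A (n + 1)\<^esub>" "l' \<zero>\<^bsub>obj P (n + 1)\<^esub> = \<zero>\<^bsub>obj B n\<^esub>"
      using module_hom_zero[OF that(4) GP GA] module_hom_zero[OF that(5) GP GB] by auto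
    note l = that(2) and rel = that(3)
    interpret B: abelian_group "obj B n" by (rule GB)
    have "diff A n (g (diff P (n - 1) w)) = \<zero>\<^bsub>obj A (n + 1)\<^esub> \<and>
      s n (g (diff P (n - 1) w)) =
        f n (diff P (n - 1) w) \<oplus>\<^bsub>obj B n\<^esub> diff B (n - 1) (l (diff P (n - 1) w))"
      if w: "w \<in> carrier (obj P (n - 1))" for w
    proof -
      have dw: "diff P (n - 1) w \<in> carrier (obj P n)" using module_complex_closed(2)[OF Pm w] .
      have "diff B (n - 1) (l (diff P (n - 1) w)) \<in> carrier (obj B n)"
        by (intro module_complex_closed(2)[OF B] module_hom_closed[OF l] dw)
      then show ?thesis
        using rel dw unfolding Rel_def by (simp add: module_complexD'(2)[OF Pm w] z)
    qed
    then show ?thesis using that(1,2) by (simp add: Inv_def)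
  qed
  have "\<exists>F. \<forall>n. Inv n (F n) \<and> Rel n (F n) (F (n + 1))"
  proof (rule descending_choice[where b = b and z = "\<lambda>n. (\<lambda>x. \<zero>\<^bsub>obj A n\<^esub>, \<lambda>x. \<zero>\<^bsub>obj B (n - 1)\<^esub>)"])
    show R: "Rel n (\<lambda>x. \<zero>\<^bsub>obj A n\<^esub>, \<lambda>x. \<zero>\<^bsub>obj B (n - 1)\<^esub>) (\<lambda>x. \<zero>\<^bsub>obj A (n + 1)\<^esub>, \<lambda>x. \<zero>\<^bsub>obj B (n + 1 - 1)\<^esub>)"
      if "n > b" for n
    proof -
      interpret B: abelian_group "obj B n" by (rule GB)
      show ?thesis unfolding Rel_def using b[OF that]
        by (simp add: module_hom_zero[OF dA(1) GA GA] module_hom_zero[OF dB(2) GB GB]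
            module_hom_zero[OF s1(1) GA GB] module_hom_zero[OF f1(1) GP GB])
    qed
    show "Inv n (\<lambda>x. \<zero>\<^bsub>obj A n\<^esub>, \<lambda>x. \<zero>\<^bsub>obj B (n - 1)\<^esub>)" if "n > b" for n
      by (rule InvI[OF module_hom_const_zero[OF MA] module_hom_const_zero[OF MB] R[OF that]])
        (use module_hom_const_zero[OF MA] module_hom_const_zero[OF MB] in auto)
  next
    fix n y assume "Inv (n + 1) y"
    then obtain g' l' where y: "y = (g', l')" and I: "Inv (n + 1) (g', l')" by (cases y) auto
    have g': "g' \<in> module_hom R (obj P (n + 1)) (obj A (n + 1))" and l': "l' \<in> module_hom R (obj P (n + 1)) (obj B n)"
      and I1: "\<And>w. w \<in> carrier (obj P n) \<Longrightarrow> diff A (n + 1) (g' (diff P n w)) = \<zero>\<^bsub>obj A (n + 2)\<^esub>"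
      and I2: "\<And>w. w \<in> carrier (obj P n) \<Longrightarrow> s (n + 1) (g' (diff P n w)) =
        f (n + 1) (diff P n w) \<oplus>\<^bsub>obj B (n + 1)\<^esub> diff B n (l' (diff P n w))"
      using I unfolding Inv_def by (auto simp: add.commute)
    obtain L where L: "dual_basis R (obj P n) L" using P unfolding fgp_complex_def fgp_def by blast
    interpret An: abelian_group "obj A n" by (rule GA)
    interpret Bn: abelian_group "obj B n" by (rule GB)
    interpret Bn1: abelian_group "obj B (n + 1)" by (rule GB)
    have ex: "\<exists>c d. c \<in> carrier (obj A n) \<and> d \<in> carrier (obj B (n - 1)) \<and> diff A n c = g' (diff P n x) \<and>
      s n c = f n x \<oplus>\<^bsub>obj B n\<^esub> (diff B (n - 1) d \<oplus>\<^bsub>obj B n\<^esub> l' (diff P n x))"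
      if x: "x \<in> carrier (obj P n)" for x
    proof -
      have dx: "diff P n x \<in> carrier (obj P (n + 1))" by (rule module_complex_closed(1)[OF Pm x])
      \<comment> \<open>Up to a coboundary, the value that \<open>s\<close> has to take on the new
        element. By \<open>I2\<close> its differential is
        \<open>s (n + 1) (g' (diff P n x))\<close>; so \<open>g' (diff P n x)\<close> becomes a
        coboundary in \<open>B\<close>, and hence is one in \<open>A\<close>.\<close>
      define w where "w = f n x \<oplus>\<^bsub>obj B n\<^esub> l' (diff P n x)"
      have w: "w \<in> carrier (obj B n)"
        unfolding w_def using f1(3)[OF x] module_hom_closed[OF l' dx] by simp
      have dw: "diff B n w = s (n + 1) (g' (diff P n x))"
        unfolding w_def I2[OF x]
        using module_hom_add[OF dB(1) f1(3)[OF x] module_hom_closed[OF l' dx]] f1(2)[OF x] by simp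
      have ga: "g' (diff P n x) \<in> carrier (obj A (n + 1))" by (rule module_hom_closed[OF g' dx])
      have "g' (diff P n x) \<in> cocycles A (n + 1)"
        unfolding cocycles_def using ga I1[OF x] by (simp add: add.commute)
      moreover have "s (n + 1) (g' (diff P n x)) \<in> coboundaries B (n + 1)"
        unfolding dw[symmetric] coboundaries_def using w by simp
      ultimately have "g' (diff P n x) \<in> coboundaries A (n + 1)" using s(2) unfolding coh_inj_def by blast
      then obtain a where a: "a \<in> carrier (obj A n)" "diff A n a = g' (diff P n x)"
        by (auto simp: coboundaries_def)
      have sa: "s n a \<in> carrier (obj B n)" by (rule s1(3)[OF a(1)])
      \<comment> \<open>The remaining error is a cocycle of \<open>B\<close>. It agrees up to a
        coboundary with the image of a cocycle \<open>z\<close> of \<open>A\<close>; subtracting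
        \<open>z\<close> from \<open>a\<close> keeps the differential, and the coboundary provides
        the value of the homotopy.\<close>
      have "diff B n (s n a \<ominus>\<^bsub>obj B n\<^esub> w) = \<zero>\<^bsub>obj B (n + 1)\<^esub>"
        using module_hom_diff[OF dB(1) GB GB sa w] s1(2)[OF a(1)] a(2) dw
          s1(3)[OF ga] by (simp add: Bn1.r_neg a_minus_def)
      then have "s n a \<ominus>\<^bsub>obj B n\<^esub> w \<in> cocycles B n" using sa w by (simp add: cocycles_def)
      then obtain z c where z: "z \<in> cocycles A n" "c \<in> coboundaries B n" "s n a \<ominus>\<^bsub>obj B n\<^esub> w = c \<oplus>\<^bsub>obj B n\<^esub> s n z"
        using s(3) unfolding coh_surj_def by meson
      obtain d where d: "d \<in> carrier (obj B (n - 1))" "c = diff B (n - 1) d" using z(2) by (auto simp: coboundaries_def)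
      have c: "c \<in> carrier (obj B n)" using module_complex_closed(2)[OF B d(1)] d(2) by simp
      have zc: "z \<in> carrier (obj A n)" "diff A n z = \<zero>\<^bsub>obj A (n + 1)\<^esub>" using z(1) by (auto simp: cocycles_def)
      have sz: "s n z \<in> carrier (obj B n)" by (rule s1(3)[OF zc(1)])
      have "s n a = w \<oplus>\<^bsub>obj B n\<^esub> (c \<oplus>\<^bsub>obj B n\<^esub> s n z)"
        using z(3) sa w c sz Bn.minus_eq_iff_add by simp
      then have "s n a \<ominus>\<^bsub>obj B n\<^esub> s n z = w \<oplus>\<^bsub>obj B n\<^esub> c"
        using w c sz by (simp add: a_minus_def Bn.a_assoc Bn.r_neg)
      then have 1: "s n (a \<ominus>\<^bsub>obj A n\<^esub> z) = f n x \<oplus>\<^bsub>obj B n\<^esub> (diff B (n - 1) d \<oplus>\<^bsub>obj B n\<^esub> l' (diff P n x))"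
        using module_hom_diff[OF s1(1) GA GB a(1) zc(1)] c f1(3)[OF x] module_hom_closed[OF l' dx]
        unfolding w_def d(2) by (simp add: Bn.a_ac)
      interpret An1: abelian_group "obj A (n + 1)" by (rule GA)
      have 2: "diff A n (a \<ominus>\<^bsub>obj A n\<^esub> z) = g' (diff P n x)"
        using module_hom_diff[OF dA(1) GA GA a(1) zc(1)] zc(2) a(2) ga
        by (simp add: a_minus_def An1.a_inv_zero)
      show ?thesis using 1 2 d(1) a(1) zc(1) by (intro exI[of _ "a \<ominus>\<^bsub>obj A n\<^esub> z"] exI[of _ d]) auto
    qed
    obtain c d where cd: "\<And>x. x \<in> carrier (obj P n) \<Longrightarrow> c x \<in> carrier (obj A n) \<and> d x \<in> carrier (obj B (n - 1)) \<and>
      diff A n (c x) = g' (diff P n x) \<and>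
      s n (c x) = f n x \<oplus>\<^bsub>obj B n\<^esub> (diff B (n - 1) (d x) \<oplus>\<^bsub>obj B n\<^esub> l' (diff P n x))"
      using ex by metis
    note D = dual_basisD[OF L]
    \<comment> \<open>Only the choices at the generators are used. \<open>g\<close> may differ from
      \<open>c\<close> there, but the two required identities are linear and survive expansion in
      the dual basis.\<close>
    define g where "g = (\<lambda>x. msum (obj A n) (\<lambda>l. snd l x \<odot>\<^bsub>obj A n\<^esub> c (fst l)) L)"
    define l where "l = (\<lambda>x. msum (obj B (n - 1)) (\<lambda>l. snd l x \<odot>\<^bsub>obj B (n - 1)\<^esub> d (fst l)) L)"
    have g: "g \<in> module_hom R (obj P n) (obj A n)"
      unfolding g_def using cd D(1) by (intro dual_basis_extend[OF L MP MA]) auto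
    have l: "l \<in> module_hom R (obj P n) (obj B (n - 1))"
      unfolding l_def using cd D(1) by (intro dual_basis_extend[OF L MP MB]) auto
    have l'd: "(\<lambda>x. l' (diff P n x)) \<in> module_hom R (obj P n) (obj B n)"
      by (rule module_hom_comp[OF dP(1) l'])
    have dl: "(\<lambda>x. diff B (n - 1) (l x)) \<in> module_hom R (obj P n) (obj B n)"
      by (rule module_hom_comp[OF l dB(2)])
    have "Rel n (g, l) (g', l')"
      unfolding Rel_def case_prod_conv
    proof (intro ballI conjI)
      fix x assume x: "x \<in> carrier (obj P n)"
      have "diff A n (g x) = msum (obj A (n + 1)) (\<lambda>l. snd l x \<odot>\<^bsub>obj A (n + 1)\<^esub> diff A n (c (fst l))) L"
        unfolding g_def using cd D(1) D(3)[OF x] by (intro msum_hom_scaled[OF MA MA dA(1)]) auto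
      also have "\<dots> = g' (diff P n x)"
        unfolding dual_basis_hom_expand[OF L MP MA module_hom_comp[OF dP(1) g'] x]
        using cd D(1) by (auto intro: msum_cong)
      finally show "diff A n (g x) = g' (diff P n x)" .
      have sg: "s n (g x) = msum (obj B n) (\<lambda>l. snd l x \<odot>\<^bsub>obj B n\<^esub> s n (c (fst l))) L"
        unfolding g_def using cd D(1) D(3)[OF x] by (intro msum_hom_scaled[OF MA MB s1(1)]) auto
      have dlx: "diff B (n - 1) (l x) = msum (obj B n) (\<lambda>l. snd l x \<odot>\<^bsub>obj B n\<^esub> diff B (n - 1) (d (fst l))) L"
        unfolding l_def using cd D(1) D(3)[OF x] by (intro msum_hom_scaled[OF MB MB dB(2)]) auto
      interpret BM: module R "obj B n" by (rule MB)
      have car: "f n (fst k) \<in> carrier (obj B n)" "diff B (n - 1) (d (fst k)) \<in> carrier (obj B n)"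
        "l' (diff P n (fst k)) \<in> carrier (obj B n)" if "k \<in> set L" for k
        using that D(1) f1(3) module_hom_closed[OF dB(2)] cd module_hom_closed[OF l'd] by auto
      have "s n (g x) = msum (obj B n) (\<lambda>l. snd l x \<odot>\<^bsub>obj B n\<^esub> f n (fst l) \<oplus>\<^bsub>obj B n\<^esub>
          (snd l x \<odot>\<^bsub>obj B n\<^esub> diff B (n - 1) (d (fst l)) \<oplus>\<^bsub>obj B n\<^esub> snd l x \<odot>\<^bsub>obj B n\<^esub> l' (diff P n (fst l)))) L"
        unfolding sg using cd D(1) D(3)[OF x] car by (intro msum_cong) (auto simp: BM.smult_r_distr)
      also have "\<dots> = msum (obj B n) (\<lambda>l. snd l x \<odot>\<^bsub>obj B n\<^esub> f n (fst l)) L \<oplus>\<^bsub>obj B n\<^esub>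
          (msum (obj B n) (\<lambda>l. snd l x \<odot>\<^bsub>obj B n\<^esub> diff B (n - 1) (d (fst l))) L \<oplus>\<^bsub>obj B n\<^esub>
           msum (obj B n) (\<lambda>l. snd l x \<odot>\<^bsub>obj B n\<^esub> l' (diff P n (fst l))) L)"
        using car D(3)[OF x] by (simp add: Bn.msum_add)
      also have "\<dots> = f n x \<oplus>\<^bsub>obj B n\<^esub> (diff B (n - 1) (l x) \<oplus>\<^bsub>obj B n\<^esub> l' (diff P n x))"
        unfolding dlx dual_basis_hom_expand[OF L MP MB f1(1) x] dual_basis_hom_expand[OF L MP MB l'd x] ..
      finally show "s n (g x) = f n x \<oplus>\<^bsub>obj B n\<^esub> (diff B (n - 1) (l x) \<oplus>\<^bsub>obj B n\<^esub> l' (diff P n x))" .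
    qed
    then show "\<exists>x. Inv n x \<and> Rel n x y" using InvI[OF g l _ g' l'] y by blast
  qed
  then obtain F where F: "\<And>n. Inv n (F n)" "\<And>n. Rel n (F n) (F (n + 1))" by blast
  define g where "g n = fst (F n)" for n
  define l where "l n = snd (F n)" for n
  have Fn: "F n = (g n, l n)" for n by (simp add: g_def l_def)
  have g: "\<And>n. g n \<in> module_hom R (obj P n) (obj A n)" and l: "\<And>n. l n \<in> module_hom R (obj P n) (obj B (n - 1))"
    using F(1) unfolding Fn Inv_def by auto
  have dg: "\<And>n x. x \<in> carrier (obj P n) \<Longrightarrow> diff A n (g n x) = g (n + 1) (diff P n x)"
    and sg: "\<And>n x. x \<in> carrier (obj P n) \<Longrightarrow> s n (g n x) =
      f n x \<oplus>\<^bsub>obj B n\<^esub> (diff B (n - 1) (l n x) \<oplus>\<^bsub>obj B n\<^esub> l (n + 1) (diff P n x))"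
    using F(2) unfolding Fn Rel_def by auto
  have "chain_map R P A g" by (rule chain_mapI[OF g dg])
  moreover have "homotopic R P B (\<lambda>n x. s n (g n x)) f"
    by (rule homotopicI[OF Pm B module_hom_comp[OF g s1(1)] f1(1) l sg])
  ultimately show ?thesis by blast
qed

section \<open>Isomorphisms in the derived category\<close>

text \<open>On cohomology the composite of the two roofs is the identity, so the right leg of the
  first is injective and that of the second surjective. The argument is two-out-of-three throughout
  and works for \<open>ab_complex\<close>, because one of the objects will be a tensor
  complex.\<close>

lemma roof_comp_id_coh:
  assumes ab: "ab_complex X" "ab_complex Y"
    and \<alpha>: "is_roof R X Y (Z, s, f)" and \<beta>: "is_roof R Y X (Z', t, g)"
    and comp: "roof_comp R X Y X (Z, s, f) (Z', t, g) (id_roof X)"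
  shows "coh_inj Z Y f" "coh_surj Z' X g"
proof -
  have Z: "ab_complex Z" "ab_complex Z'" using \<alpha> \<beta> ab_complex_module by (auto simp: is_roof_def)
  have s: "chain_map R Z X s" "coh_inj Z X s" "coh_surj Z X s" and f: "chain_map R Z Y f"
    using \<alpha> quasi_iso_iff[OF Z(1) ab(1)] by (auto simp: is_roof_def)
  have t: "chain_map R Z' Y t" "coh_inj Z' Y t" "coh_surj Z' Y t" and g: "chain_map R Z' X g"
    using \<beta> quasi_iso_iff[OF Z(2) ab(2)] by (auto simp: is_roof_def)
  obtain W :: "('a, 'b) cochain_complex" and p q where W: "module_complex R W" "quasi_iso R W Z p" "chain_map R W Z' q"
    and fp: "homotopic R W Y (\<lambda>n x. f n (p n x)) (\<lambda>n x. t n (q n x))"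
    and eq: "roof_equiv R X X (W, \<lambda>n. s n \<circ> p n, \<lambda>n. g n \<circ> q n) (id_roof X)"
    using comp by (auto simp: roof_comp_def comp_def)
  have Wab: "ab_complex W" by (rule ab_complex_module[OF W(1)])
  have p: "chain_map R W Z p" "coh_inj W Z p" "coh_surj W Z p"
    using W(2) quasi_iso_iff[OF Wab Z(1)] by auto
  obtain V :: "('a, 'b) cochain_complex" and r r' where V: "module_complex R V" and r: "chain_map R V W r"
    and r': "chain_map R V X r'"
    and qi: "quasi_iso R V X (\<lambda>n x. s n (p n (r n x)))"
    and h1: "homotopic R V X (\<lambda>n x. s n (p n (r n x))) r'"
    and h2: "homotopic R V X (\<lambda>n x. g n (q n (r n x))) r'"
    using eq by (auto simp: roof_equiv_def id_roof_def comp_def)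
  have Vab: "ab_complex V" by (rule ab_complex_module[OF V])
  have sp: "chain_map R W X (\<lambda>n x. s n (p n x))" "coh_inj W X (\<lambda>n x. s n (p n x))" "coh_surj W X (\<lambda>n x. s n (p n x))"
    by (rule chain_map_comp[OF p(1) s(1)], rule coh_inj_comp[OF Wab Z(1) p(1,2) s(2)],
        rule coh_surj_comp[OF Z(1) ab(1) s(1) p(1) Wab p(3) s(3)])
  have spr: "coh_inj V X (\<lambda>n x. s n (p n (r n x)))" "coh_surj V X (\<lambda>n x. s n (p n (r n x)))"
    "chain_map R V X (\<lambda>n x. s n (p n (r n x)))"
    using qi quasi_iso_iff[OF Vab ab(1)] by auto
  \<comment> \<open>An equivalence of roofs requires only the composite from \<open>V\<close> to
    \<open>X\<close> to be a quasi-isomorphism. Surjectivity of \<open>r\<close> follows by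
    cancelling the injective map induced by \<open>s\<close> after \<open>p\<close>.\<close>
  have rs: "coh_surj V W r"
    by (rule coh_surj_cancel_left[OF Vab Wab ab(1) r sp(1,2) spr(2)])
  have gq: "chain_map R W X (\<lambda>n x. g n (q n x))" by (rule chain_map_comp[OF W(3) g])
  have gqr: "chain_map R V X (\<lambda>n x. g n (q n (r n x)))" by (rule chain_map_comp[OF r gq])
  have gqr': "coh_inj V X (\<lambda>n x. g n (q n (r n x)))" "coh_surj V X (\<lambda>n x. g n (q n (r n x)))"
    using spr(1,2) coh_homotopic[OF Vab ab(1) h1 spr(3) r'] coh_homotopic[OF Vab ab(1) h2 gqr r'] by auto
  show "coh_surj Z' X g"
    by (rule coh_surj_cancel[OF Vab Z(2) chain_map_comp[OF r W(3)] gqr'(2)])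
  have gqi: "coh_inj W X (\<lambda>n x. g n (q n x))"
    by (rule coh_inj_cancel_right[OF Vab Wab ab(1) r gq rs gqr'(1)])
  have qi: "coh_inj W Z' q" by (rule coh_inj_cancel[OF Z(2) ab(1) g gqi])
  have tq: "coh_inj W Y (\<lambda>n x. t n (q n x))" by (rule coh_inj_comp[OF Wab Z(2) W(3) qi t(2)])
  have "coh_inj W Y (\<lambda>n x. f n (p n x))"
    using tq coh_homotopic(1)[OF Wab ab(2) fp chain_map_comp[OF p(1) f] chain_map_comp[OF W(3) t(1)]] by simp
  then show "coh_inj Z Y f"
    by (rule coh_inj_cancel_right[OF Wab Z(1) ab(2) p(1) f p(3)])
qed

text \<open>The quasi-isomorphism \<open>s\<close> of a roof has a section up to homotopy, because
  \<open>X\<close> is bounded and projective. Following the section by the other leg replaces the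
  roof by an honest chain map.\<close>

lemma quasi_iso_if_derived_iso:
  assumes X: "fgp_complex R X" and S: "module_complex R S" and iso: "derived_iso R X S"
  shows "\<exists>u. chain_map R X S u \<and> coh_inj X S u \<and> coh_surj X S u"
proof -
  have Xm: "module_complex R X" using X by (simp add: fgp_complex_def)
  note ab = ab_complex_module[OF Xm] ab_complex_module[OF S]
  obtain Z s f Z' t g where roofs: "is_roof R X S (Z, s, f)" "is_roof R S X (Z', t, g)"
    "roof_comp R X S X (Z, s, f) (Z', t, g) (id_roof X)" "roof_comp R S X S (Z', t, g) (Z, s, f) (id_roof S)"
    using iso unfolding derived_iso_def by (metis prod_cases3)
  have Z: "module_complex R Z" using roofs by (simp add: is_roof_def)
  note Zab = ab_complex_module[OF Z]
  have s: "chain_map R Z X s" "coh_inj Z X s" "coh_surj Z X s" and f: "chain_map R Z S f"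
    using roofs(1) quasi_iso_iff[OF Zab ab(1)] by (auto simp: is_roof_def)
  have fi: "coh_inj Z S f" by (rule roof_comp_id_coh(1)[OF ab roofs(1-3)])
  have fs: "coh_surj Z S f" by (rule roof_comp_id_coh(2)[OF ab(2,1) roofs(2,1,4)])
  obtain l where l: "chain_map R X Z l" "homotopic R X X (\<lambda>n x. s n (l n x)) (\<lambda>n x. x)"
    using lift_along_quasi_iso[OF X Z Xm s chain_map_id] by blast
  have sl: "coh_inj X X (\<lambda>n x. s n (l n x))" "coh_surj X X (\<lambda>n x. s n (l n x))"
    using coh_homotopic[OF ab(1,1) l(2) chain_map_comp[OF l(1) s(1)] chain_map_id] coh_id[OF ab(1)] by auto
  have li: "coh_inj X Z l" by (rule coh_inj_cancel[OF Zab ab(1) s(1) sl(1)])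
  have ls: "coh_surj X Z l" by (rule coh_surj_cancel_left[OF ab(1) Zab ab(1) l(1) s(1,2) sl(2)])
  show ?thesis
    using chain_map_comp[OF l(1) f] coh_inj_comp[OF ab(1) Zab l(1) li fi]
      coh_surj_comp[OF Zab ab(2) f l(1) ab(1) ls fs] by blast
qed

text \<open>A chain map is a roof with identity left leg, and the given homotopies are the
  dominations demanded by \<open>roof_equiv\<close>; every apex can be taken to be one of the two
  complexes.\<close>

lemma derived_iso_if_homotopy_equiv:
  assumes X: "module_complex R X" and Y: "module_complex R Y" and u: "chain_map R X Y u" and v: "chain_map R Y X v"
    and vu: "homotopic R X X (\<lambda>n x. v n (u n x)) (\<lambda>n x. x)" and uv: "homotopic R Y Y (\<lambda>n x. u n (v n x)) (\<lambda>n x. x)"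
  shows "derived_iso R X Y"
proof -
  have qid: "quasi_iso R A A (\<lambda>n x. x)" if "module_complex R A" for A :: "('a, 'c) cochain_complex"
    using quasi_iso_iff[OF ab_complex_module[OF that] ab_complex_module[OF that]] chain_map_id
      coh_id[OF ab_complex_module[OF that]] by blast
  have comp: "roof_comp R A B A (A, \<lambda>_. id, u) (B, \<lambda>_. id, v) (id_roof A)"
    if A: "module_complex R A" and B: "module_complex R B" and u: "chain_map R A B u" and v: "chain_map R B A v"
      and vu: "homotopic R A A (\<lambda>n x. v n (u n x)) (\<lambda>n x. x)" for A B :: "('a, 'c) cochain_complex" and u v
  proof -
    have id: "(\<lambda>_::int. id :: 'c \<Rightarrow> 'c) = (\<lambda>n x. x)" by (simp add: fun_eq_iff)
    have "roof_equiv R A A (A, \<lambda>n x. x, \<lambda>n x. v n (u n x)) (A, \<lambda>n x. x, \<lambda>n x. x)"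
      unfolding roof_equiv_def case_prod_conv comp_def
      using A chain_map_id[of R A] qid[OF A] vu homotopic_refl[OF A A module_hom_id]
      by (intro exI[of _ A] exI[of _ "\<lambda>n x. x"]) simp
    then show ?thesis
      unfolding roof_comp_def id_roof_def case_prod_conv comp_def id
      using A qid[OF A] u homotopic_refl[OF A B chain_mapD(1)[OF u]]
      by (intro exI[of _ A] exI[of _ "\<lambda>n x. x"] exI[of _ u]) simp
  qed
  have id: "(\<lambda>_::int. id :: 'c \<Rightarrow> 'c) = (\<lambda>n x. x)" for x :: 'c by (simp add: fun_eq_iff)
  have "is_roof R X Y (X, \<lambda>_. id, u)" "is_roof R Y X (Y, \<lambda>_. id, v)"
    using X Y u v qid[OF X] qid[OF Y] by (simp_all add: is_roof_def id_def)
  then show ?thesis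
    unfolding derived_iso_def using comp[OF X Y u v vu] comp[OF Y X v u uv] by blast
qed

section \<open>The zero object of the derived category\<close>

lemma zero_module_simps [simp]:
  "carrier zero_module = {undefined}" "\<zero>\<^bsub>zero_module\<^esub> = undefined"
  "x \<oplus>\<^bsub>zero_module\<^esub> y = undefined" "r \<odot>\<^bsub>zero_module\<^esub> x = undefined"
  by (simp_all add: zero_module_def)

lemma module_complex_zero:
  assumes "cring R"
  shows "module_complex R (zero_complex :: ('a, 'u) cochain_complex)"
proof -
  have "module R (zero_module :: ('a, 'u) module)"
    by (rule moduleI[OF assms]) (auto intro!: abelian_groupI)
  then show ?thesis by (simp add: module_complex_def zero_complex_def module_hom_def)
qed

text \<open>\<open>T\<close> need not be a complex of modules, so it cannot be the apex of a roof;
  the zero complex takes that place. If \<open>T\<close> is acyclic, the zero map into it is a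
  quasi-isomorphism, linear thanks to \<open>sm\<close>. Conversely, \<open>T\<close> receives a map
  that is surjective on cohomology from a complex whose cohomology injects into zero.\<close>

lemma derived_iso_zero_iff:
  fixes T :: "('a, 'u) cochain_complex"
  assumes R: "cring R" and T: "ab_complex T"
    and sm: "\<And>n r. r \<in> carrier R \<Longrightarrow> r \<odot>\<^bsub>obj T n\<^esub> \<zero>\<^bsub>obj T n\<^esub> = \<zero>\<^bsub>obj T n\<^esub>"
  shows "derived_iso R T zero_complex \<longleftrightarrow> (\<forall>n. cocycles T n \<subseteq> coboundaries T n)"
proof
  let ?O = "zero_complex :: ('a, 'u) cochain_complex"
  have O: "module_complex R ?O" by (rule module_complex_zero[OF R])
  note Oab = ab_complex_module[OF O]
  note BT = coboundaries_group[OF T]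
  have Oc: "carrier (obj ?O n) = {undefined}" "\<zero>\<^bsub>obj ?O n\<^esub> = undefined" for n
    by (simp_all add: zero_complex_def)
  have Oz: "cocycles ?O n \<subseteq> coboundaries ?O n" for n
    by (auto simp: cocycles_def coboundaries_def zero_complex_def)
  show "\<forall>n. cocycles T n \<subseteq> coboundaries T n" if iso: "derived_iso R T ?O"
  proof -
    obtain \<alpha> \<beta> where \<alpha>\<beta>: "is_roof R T ?O \<alpha>" "is_roof R ?O T \<beta>" "roof_comp R T ?O T \<alpha> \<beta> (id_roof T)"
      using iso unfolding derived_iso_def by blast
    obtain Z s f Z' t g where "\<alpha> = (Z, s, f)" "\<beta> = (Z', t, g)" by (cases \<alpha>, cases \<beta>)
    note roofs = \<alpha>\<beta>[unfolded this]
    have gs: "coh_surj Z' T g" by (rule roof_comp_id_coh(2)[OF T Oab roofs])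
    have Z: "ab_complex Z'" using roofs ab_complex_module by (auto simp: is_roof_def)
    have t: "chain_map R Z' ?O t" "coh_inj Z' ?O t" and g: "chain_map R Z' T g"
      using roofs(2) quasi_iso_iff[OF Z Oab] by (auto simp: is_roof_def)
    show ?thesis
    proof (intro allI subsetI)
      fix n c assume "c \<in> cocycles T n"
      then obtain z b where z: "z \<in> cocycles Z' n" "b \<in> coboundaries T n" "c = b \<oplus>\<^bsub>obj T n\<^esub> g n z"
        using gs unfolding coh_surj_def by meson
      have "t n z \<in> coboundaries ?O n"
        using chain_map_cocycles(1)[OF Z Oab t(1) z(1)] Oz by blast
      then have "z \<in> coboundaries Z' n" using t(2) z(1) unfolding coh_inj_def by blast
      then show "c \<in> coboundaries T n"
        unfolding z(3) by (intro BT(4) z(2) chain_map_cocycles(2)[OF Z T g])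
    qed
  qed
  assume ac: "\<forall>n. cocycles T n \<subseteq> coboundaries T n"
  define j where "j n (x :: 'u) = \<zero>\<^bsub>obj T n\<^esub>" for n x
  define k where "k (n :: int) (x :: 'u) = x" for n x
  have Tz: "diff T n \<zero>\<^bsub>obj T n\<^esub> = \<zero>\<^bsub>obj T (n + 1)\<^esub>" "\<zero>\<^bsub>obj T n\<^esub> \<in> carrier (obj T n)"
    "\<zero>\<^bsub>obj T n\<^esub> \<oplus>\<^bsub>obj T n\<^esub> \<zero>\<^bsub>obj T n\<^esub> = \<zero>\<^bsub>obj T n\<^esub>" "\<zero>\<^bsub>obj T n\<^esub> \<ominus>\<^bsub>obj T n\<^esub> \<zero>\<^bsub>obj T n\<^esub> = \<zero>\<^bsub>obj T n\<^esub>" for n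
  proof -
    interpret A: abelian_group "obj T n" by (rule ab_complexD[OF T])
    interpret B: abelian_group "obj T (n - 1)" by (rule ab_complexD[OF T])
    have "\<zero>\<^bsub>obj T n\<^esub> \<in> cocycles T n" by (rule cocycles_group(2)[OF T])
    then show "diff T n \<zero>\<^bsub>obj T n\<^esub> = \<zero>\<^bsub>obj T (n + 1)\<^esub>" by (simp add: cocycles_def)
  qed (use ab_complexD(1)[OF T, THEN abelian_group.axioms(1)] in
      \<open>auto simp: abelian_monoid.l_zero abelian_monoid.zero_closed
        abelian_group.a_inv_zero[OF ab_complexD(1)[OF T]] a_minus_def\<close>)
  have j: "chain_map R ?O T j"
    by (rule chain_mapI) (auto simp: j_def module_hom_def Tz sm)
  have jq: "quasi_iso R ?O T j"
    unfolding quasi_iso_iff[OF Oab T]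
  proof (intro conjI)
    show "coh_inj ?O T j" using Oz by (auto simp: coh_inj_def)
    show "coh_surj ?O T j"
      unfolding coh_surj_def
    proof (intro allI ballI)
      fix n y assume y: "y \<in> cocycles T n"
      interpret A: abelian_group "obj T n" by (rule ab_complexD[OF T])
      have "y = y \<oplus>\<^bsub>obj T n\<^esub> j n undefined" using y by (simp add: j_def cocycles_def)
      moreover have "undefined \<in> cocycles ?O n" by (auto simp: cocycles_def zero_complex_def)
      ultimately show "\<exists>x\<in>cocycles ?O n. \<exists>b\<in>coboundaries T n. y = b \<oplus>\<^bsub>obj T n\<^esub> j n x"
        using ac y by blast
    qed
  qed (rule j)
  have k: "chain_map R ?O ?O k" unfolding k_def by (rule chain_map_id)
  have kq: "quasi_iso R ?O ?O k"
    using quasi_iso_iff[OF Oab Oab] k coh_id[OF Oab] unfolding k_def by blast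
  have hj: "homotopic R ?O T j j"
    unfolding homotopic_def
    by (rule exI[of _ "\<lambda>n x. \<zero>\<^bsub>obj T (n - 1)\<^esub>"])
      (use Tz(1)[of "n - 1" for n] in \<open>auto simp: j_def module_hom_def Tz sm\<close>)
  have hk: "homotopic R ?O ?O k k" by (rule homotopic_refl[OF O O chain_mapD(1)[OF k]])
  have jk: "(\<lambda>n. j n \<circ> k n) = j" "(\<lambda>n. k n \<circ> k n) = k" "(\<lambda>n. j n \<circ> id) = j" "(\<lambda>n. id \<circ> j n) = j" "(\<lambda>n. id \<circ> k n) = k"
    by (simp_all add: j_def k_def fun_eq_iff)
  have "roof_equiv R T T (?O, j, j) (id_roof T)"
    unfolding roof_equiv_def id_roof_def case_prod_conv
    using O j k jq hj by (intro exI[of _ ?O] exI[of _ k] exI[of _ j]) (simp add: jk)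
  then have 1: "roof_comp R T ?O T (?O, j, k) (?O, k, j) (id_roof T)"
    unfolding roof_comp_def case_prod_conv
    using O k kq hk by (intro exI[of _ ?O] exI[of _ k]) (simp add: jk)
  have "roof_equiv R ?O ?O (?O, k, k) (id_roof ?O)"
    unfolding roof_equiv_def id_roof_def case_prod_conv
    using O k kq hk by (intro exI[of _ ?O] exI[of _ k]) (simp add: jk)
  then have 2: "roof_comp R ?O T ?O (?O, k, j) (?O, j, k) (id_roof ?O)"
    unfolding roof_comp_def case_prod_conv
    using O k kq hj by (intro exI[of _ ?O] exI[of _ k]) (simp add: jk)
  have "is_roof R T ?O (?O, j, k)" "is_roof R ?O T (?O, k, j)"
    using O jq kq j k by (simp_all add: is_roof_def)
  then show "derived_iso R T ?O" unfolding derived_iso_def using 1 2 by blast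
qed

section \<open>Residue fields and tensor products\<close>

context domain
begin

abbreviation frac :: "'a \<Rightarrow> 'a \<Rightarrow> ('a \<times> 'a) set" where
  "frac a b \<equiv> fraction_rel R `` {(a, b)}"

lemma mem_frac:
  "(c, d) \<in> frac a b \<longleftrightarrow> a \<in> carrier R \<and> c \<in> carrier R \<and> b \<in> carrier R - {\<zero>} \<and>
    d \<in> carrier R - {\<zero>} \<and> a \<otimes> d = c \<otimes> b"
  by (auto simp: fraction_rel_def)

text \<open>Transitivity of the equality of fractions: everything is multiplied by the middle
  denominator \<open>d\<close>, which is then cancelled.\<close>

lemma cross_trans:
  assumes "a \<in> carrier R" "b \<in> carrier R" "c \<in> carrier R" "d \<in> carrier R" "e \<in> carrier R" "f \<in> carrier R"
    "d \<noteq> \<zero>" "a \<otimes> d = c \<otimes> b" "c \<otimes> f = e \<otimes> d"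
  shows "a \<otimes> f = e \<otimes> b"
proof -
  have "d \<otimes> (a \<otimes> f) = (a \<otimes> d) \<otimes> f" using assms(1-6) by (simp add: m_ac)
  also have "\<dots> = (c \<otimes> f) \<otimes> b" using assms(1-6) by (simp add: assms(8) m_ac)
  also have "\<dots> = d \<otimes> (e \<otimes> b)" using assms(1-6) by (simp add: assms(9) m_ac)
  finally show ?thesis using assms(1-7) m_lcancel by (metis m_closed)
qed

lemma frac_eq_iff:
  assumes "a \<in> carrier R" "b \<in> carrier R - {\<zero>}" "c \<in> carrier R" "d \<in> carrier R - {\<zero>}"
  shows "frac a b = frac c d \<longleftrightarrow> a \<otimes> d = c \<otimes> b"
proof
  assume "frac a b = frac c d"
  moreover have "(c, d) \<in> frac c d" using assms by (simp add: fraction_rel_def)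
  ultimately show "a \<otimes> d = c \<otimes> b" using mem_frac by blast
next
  assume eq: "a \<otimes> d = c \<otimes> b"
  have sub: "frac a b \<subseteq> frac c d" if "a \<in> carrier R" "b \<in> carrier R - {\<zero>}" "c \<in> carrier R"
    "d \<in> carrier R - {\<zero>}" "a \<otimes> d = c \<otimes> b" for a b c d
  proof (rule subrelI)
    fix e f assume "(e, f) \<in> frac a b"
    then have *: "e \<in> carrier R" "f \<in> carrier R - {\<zero>}" "a \<otimes> f = e \<otimes> b" unfolding mem_frac by auto
    have "c \<otimes> f = e \<otimes> d" by (rule cross_trans[of c d a b e f]) (use that * in auto)
    then show "(e, f) \<in> frac c d" unfolding mem_frac using that * by blast
  qed
  show "frac a b = frac c d" using sub[OF assms eq] sub[OF assms(3,4,1,2)] eq by auto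
qed

lemma fraction_field_carrier:
  "carrier (fraction_field R) = {frac a b | a b. a \<in> carrier R \<and> b \<in> carrier R - {\<zero>}}"
  by (auto simp: fraction_field_def quotient_def)

text \<open>The field operations are unions over all pairs of representatives; such a union
  collapses to one class as soon as every pair yields the same one.\<close>

lemma frac_UN:
  assumes "a \<in> carrier R" "b \<in> carrier R - {\<zero>}" "c \<in> carrier R" "d \<in> carrier R - {\<zero>}"
    and F: "\<And>a' b' c' d'. (a', b') \<in> frac a b \<Longrightarrow> (c', d') \<in> frac c d \<Longrightarrow> F a' b' c' d' = V"
  shows "(\<Union>(a', b')\<in>frac a b. \<Union>(c', d')\<in>frac c d. F a' b' c' d') = V"
proof -
  have "(a, b) \<in> frac a b" "(c, d) \<in> frac c d" using assms by (auto simp: fraction_rel_def)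
  then show ?thesis using F by fastforce
qed

lemma frac_add:
  assumes "a \<in> carrier R" "b \<in> carrier R - {\<zero>}" "c \<in> carrier R" "d \<in> carrier R - {\<zero>}"
  shows "frac a b \<oplus>\<^bsub>fraction_field R\<^esub> frac c d = frac (a \<otimes> d \<oplus> c \<otimes> b) (b \<otimes> d)"
proof -
  have "(\<Union>(a', b')\<in>frac a b. \<Union>(c', d')\<in>frac c d. frac (a' \<otimes> d' \<oplus> c' \<otimes> b') (b' \<otimes> d')) =
      frac (a \<otimes> d \<oplus> c \<otimes> b) (b \<otimes> d)"
  proof (rule frac_UN[OF assms])
    fix a' b' c' d' assume "(a', b') \<in> frac a b" "(c', d') \<in> frac c d"
    then have *: "a' \<in> carrier R" "b' \<in> carrier R" "c' \<in> carrier R" "d' \<in> carrier R" "b' \<noteq> \<zero>" "d' \<noteq> \<zero>"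
      "a \<otimes> b' = a' \<otimes> b" "c \<otimes> d' = c' \<otimes> d" by (auto simp: fraction_rel_def)
    have **: "b \<in> carrier R" "d \<in> carrier R" using assms by auto
    have "(a' \<otimes> d' \<oplus> c' \<otimes> b') \<otimes> (b \<otimes> d) = (a' \<otimes> b) \<otimes> (d' \<otimes> d) \<oplus> (c' \<otimes> d) \<otimes> (b' \<otimes> b)"
      using *(1-4) ** by algebra
    also have "\<dots> = (a \<otimes> d \<oplus> c \<otimes> b) \<otimes> (b' \<otimes> d')"
      unfolding *(7,8)[symmetric] using *(1-4) ** assms(1,3) by algebra
    finally show "frac (a' \<otimes> d' \<oplus> c' \<otimes> b') (b' \<otimes> d') = frac (a \<otimes> d \<oplus> c \<otimes> b) (b \<otimes> d)"
      using assms * ** by (subst frac_eq_iff) (auto simp: integral_iff)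
  qed
  then show ?thesis by (simp add: fraction_field_def)
qed

lemma frac_mult:
  assumes "a \<in> carrier R" "b \<in> carrier R - {\<zero>}" "c \<in> carrier R" "d \<in> carrier R - {\<zero>}"
  shows "frac a b \<otimes>\<^bsub>fraction_field R\<^esub> frac c d = frac (a \<otimes> c) (b \<otimes> d)"
proof -
  have "(\<Union>(a', b')\<in>frac a b. \<Union>(c', d')\<in>frac c d. frac (a' \<otimes> c') (b' \<otimes> d')) =
      frac (a \<otimes> c) (b \<otimes> d)"
  proof (rule frac_UN[OF assms])
    fix a' b' c' d' assume "(a', b') \<in> frac a b" "(c', d') \<in> frac c d"
    then have *: "a' \<in> carrier R" "b' \<in> carrier R" "c' \<in> carrier R" "d' \<in> carrier R" "b' \<noteq> \<zero>" "d' \<noteq> \<zero>"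
      "a \<otimes> b' = a' \<otimes> b" "c \<otimes> d' = c' \<otimes> d" by (auto simp: fraction_rel_def)
    have **: "b \<in> carrier R" "d \<in> carrier R" using assms by auto
    have "(a' \<otimes> c') \<otimes> (b \<otimes> d) = (a' \<otimes> b) \<otimes> (c' \<otimes> d)"
      using *(1-4) ** by algebra
    also have "\<dots> = (a \<otimes> c) \<otimes> (b' \<otimes> d')"
      unfolding *(7,8)[symmetric] using *(1-4) ** assms(1,3) by algebra
    finally show "frac (a' \<otimes> c') (b' \<otimes> d') = frac (a \<otimes> c) (b \<otimes> d)"
      using assms * ** by (subst frac_eq_iff) (auto simp: integral_iff)
  qed
  then show ?thesis by (simp add: fraction_field_def)
qed

end

text \<open>\<open>qfrac R p r s\<close> is the element \<open>r / s\<close> of \<open>K(p)\<close>.\<close>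

definition qfrac :: "('a, 'r) ring_scheme \<Rightarrow> 'a set \<Rightarrow> 'a \<Rightarrow> 'a \<Rightarrow> ('a set \<times> 'a set) set" where
  "qfrac R p r s = fraction_rel (R Quot p) `` {(p +>\<^bsub>R\<^esub> r, p +>\<^bsub>R\<^esub> s)}"

section \<open>The residue field at a prime\<close>

context primeideal
begin

lemma quot_zero_iff: "r \<in> carrier R \<Longrightarrow> I +> r = \<zero>\<^bsub>R Quot I\<^esub> \<longleftrightarrow> r \<in> I"
  unfolding FactRing_def using a_rcos_const[of r] a_rcos_self[of r] by (simp, metis)

lemma quot_eq_iff:
  assumes "x \<in> carrier R" "y \<in> carrier R"
  shows "I +> x = I +> y \<longleftrightarrow> x \<ominus> y \<in> I"
proof -
  have "x \<ominus> y \<in> I \<longleftrightarrow> x \<in> I +> y"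
    unfolding a_minus_def using a_rcos_module assms by blast
  then show ?thesis using a_rcos_self[OF assms(1)] a_repr_independence' assms by metis
qed

lemma quot_carrier: "carrier (R Quot I) = (\<lambda>r. I +> r) ` carrier R"
  by (auto simp: FactRing_def A_RCOSETS_def RCOSETS_def a_r_coset_def)

lemma quot_nonzero: "s \<in> carrier R - I \<Longrightarrow> I +> s \<in> carrier (R Quot I) - {\<zero>\<^bsub>R Quot I\<^esub>}"
  using quot_zero_iff quot_carrier by auto

lemma one_notin: "\<one> \<in> carrier R - I"
  using I_notcarr one_imp_carrier by auto

lemma prime_mult: "s \<in> carrier R - I \<Longrightarrow> t \<in> carrier R - I \<Longrightarrow> s \<otimes> t \<in> carrier R - I"
  using I_prime by auto

text \<open>Numerators and denominators are taken in \<open>R\<close> itself. With these rules the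
  cosets of the quotient ring and the classes of fractions stay hidden, and all conditions become
  membership in \<open>I\<close>.\<close>

lemma
  shows residue_field_carrier:
    "carrier (residue_field R I) = {qfrac R I r s | r s. r \<in> carrier R \<and> s \<in> carrier R - I}"
    and qfrac_eq_iff: "r \<in> carrier R \<Longrightarrow> s \<in> carrier R - I \<Longrightarrow> r' \<in> carrier R \<Longrightarrow> s' \<in> carrier R - I \<Longrightarrow>
      qfrac R I r s = qfrac R I r' s' \<longleftrightarrow> r \<otimes> s' \<ominus> r' \<otimes> s \<in> I"
    and qfrac_add: "r \<in> carrier R \<Longrightarrow> s \<in> carrier R - I \<Longrightarrow> r' \<in> carrier R \<Longrightarrow> s' \<in> carrier R - I \<Longrightarrow>
      qfrac R I r s \<oplus>\<^bsub>residue_field R I\<^esub> qfrac R I r' s' = qfrac R I (r \<otimes> s' \<oplus> r' \<otimes> s) (s \<otimes> s')"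
    and qfrac_smult: "t \<in> carrier R \<Longrightarrow> r \<in> carrier R \<Longrightarrow> s \<in> carrier R - I \<Longrightarrow>
      t \<odot>\<^bsub>residue_field R I\<^esub> qfrac R I r s = qfrac R I (t \<otimes> r) s"
    and qfrac_zero: "\<zero>\<^bsub>residue_field R I\<^esub> = qfrac R I \<zero> \<one>"
proof -
  interpret D: domain "R Quot I" by (rule quotient_is_domain)
  interpret h: ring_hom_cring R "R Quot I" "(+>) I" by (rule rcos_ring_hom_cring)
  note rf = residue_field_def Let_def
  note carD = quot_carrier
  have neD: "carrier (R Quot I) - {\<zero>\<^bsub>R Quot I\<^esub>} = (+>) I ` (carrier R - I)"
    using quot_zero_iff carD by auto
  have c: "I +> r \<in> carrier (R Quot I)" if "r \<in> carrier R" for r using that carD by auto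
  show "carrier (residue_field R I) = {qfrac R I r s | r s. r \<in> carrier R \<and> s \<in> carrier R - I}"
  proof -
    have "carrier (residue_field R I) = carrier (fraction_field (R Quot I))" by (simp add: rf)
    then show ?thesis unfolding D.fraction_field_carrier neD unfolding carD qfrac_def by blast
  qed
  show "qfrac R I r s = qfrac R I r' s' \<longleftrightarrow> r \<otimes> s' \<ominus> r' \<otimes> s \<in> I"
    if *: "r \<in> carrier R" "s \<in> carrier R - I" "r' \<in> carrier R" "s' \<in> carrier R - I"
  proof -
    have "qfrac R I r s = qfrac R I r' s' \<longleftrightarrow> I +> (r \<otimes> s') = I +> (r' \<otimes> s)"
      unfolding qfrac_def D.frac_eq_iff[OF c[OF *(1)] quot_nonzero[OF *(2)] c[OF *(3)] quot_nonzero[OF *(4)]]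
      using * by simp
    also have "\<dots> \<longleftrightarrow> r \<otimes> s' \<ominus> r' \<otimes> s \<in> I" using * by (intro quot_eq_iff) auto
    finally show ?thesis .
  qed
  show "qfrac R I r s \<oplus>\<^bsub>residue_field R I\<^esub> qfrac R I r' s' = qfrac R I (r \<otimes> s' \<oplus> r' \<otimes> s) (s \<otimes> s')"
    if *: "r \<in> carrier R" "s \<in> carrier R - I" "r' \<in> carrier R" "s' \<in> carrier R - I"
    unfolding rf qfrac_def
    using D.frac_add[OF c[OF *(1)] quot_nonzero[OF *(2)] c[OF *(3)] quot_nonzero[OF *(4)]] * by simp
  show "t \<odot>\<^bsub>residue_field R I\<^esub> qfrac R I r s = qfrac R I (t \<otimes> r) s"
    if *: "t \<in> carrier R" "r \<in> carrier R" "s \<in> carrier R - I"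
    unfolding rf qfrac_def
    using D.frac_mult[OF c[OF *(1)] quot_nonzero[OF one_notin] c[OF *(2)] quot_nonzero[OF *(3)]] * by simp
  show "\<zero>\<^bsub>residue_field R I\<^esub> = qfrac R I \<zero> \<one>"
    unfolding rf qfrac_def by (simp add: fraction_field_def)
qed

lemma qfrac_closed: "r \<in> carrier R \<Longrightarrow> s \<in> carrier R - I \<Longrightarrow> qfrac R I r s \<in> carrier (residue_field R I)"
  by (auto simp: residue_field_carrier)

lemma qfrac_eq_zero_iff: "r \<in> carrier R \<Longrightarrow> s \<in> carrier R - I \<Longrightarrow> qfrac R I r s = \<zero>\<^bsub>residue_field R I\<^esub> \<longleftrightarrow> r \<in> I"
  unfolding qfrac_zero using one_notin by (subst qfrac_eq_iff) (auto simp: a_minus_def)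

lemma module_residue_field: "module R (residue_field R I)"
proof (rule moduleI[OF is_cring])
  note C = residue_field_carrier and A = qfrac_add and cl = prime_mult one_notin
  show "abelian_group (residue_field R I)"
  proof (rule abelian_groupI, goal_cases)
    case (1 x y)
    then obtain a b c d where x: "x = qfrac R I a b" "a \<in> carrier R" "b \<in> carrier R - I"
      and y: "y = qfrac R I c d" "c \<in> carrier R" "d \<in> carrier R - I" by (auto simp: C)
    have "qfrac R I (a \<otimes> d \<oplus> c \<otimes> b) (b \<otimes> d) \<in> carrier (residue_field R I)"
      unfolding C using x y cl(1)[OF x(3) y(3)] by auto
    then show ?case using x y by (simp add: A)
  next
    case 2
    show ?case using one_notin by (auto simp: C qfrac_zero)
  next
    case (3 x y z)
    then obtain a b c d e f where x: "x = qfrac R I a b" "a \<in> carrier R" "b \<in> carrier R - I"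
      and y: "y = qfrac R I c d" "c \<in> carrier R" "d \<in> carrier R - I"
      and z: "z = qfrac R I e f" "e \<in> carrier R" "f \<in> carrier R - I" by (auto simp: C)
    have car: "b \<in> carrier R" "d \<in> carrier R" "f \<in> carrier R" using x y z by auto
    have "(a \<otimes> d \<oplus> c \<otimes> b) \<otimes> f \<oplus> e \<otimes> (b \<otimes> d) = a \<otimes> (d \<otimes> f) \<oplus> (c \<otimes> f \<oplus> e \<otimes> d) \<otimes> b"
      using car x(2) y(2) z(2) by algebra
    moreover have "b \<otimes> d \<otimes> f = b \<otimes> (d \<otimes> f)" using car by (rule m_assoc)
    ultimately show ?case using x y z cl(1) car by (simp add: A)
  next
    case (4 x y)
    then obtain a b c d where x: "x = qfrac R I a b" "a \<in> carrier R" "b \<in> carrier R - I"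
      and y: "y = qfrac R I c d" "c \<in> carrier R" "d \<in> carrier R - I" by (auto simp: C)
    then show ?case by (simp add: A a_comm m_comm)
  next
    case (5 x)
    then obtain a b where x: "x = qfrac R I a b" "a \<in> carrier R" "b \<in> carrier R - I" by (auto simp: C)
    then show ?case using one_notin by (simp add: A qfrac_zero)
  next
    case (6 x)
    then obtain a b where x: "x = qfrac R I a b" "a \<in> carrier R" "b \<in> carrier R - I" by (auto simp: C)
    have "qfrac R I (\<ominus> a) b \<oplus>\<^bsub>residue_field R I\<^esub> x = qfrac R I (\<ominus> a \<otimes> b \<oplus> a \<otimes> b) (b \<otimes> b)"
      using x by (simp add: A)
    also have "\<ominus> a \<otimes> b \<oplus> a \<otimes> b = \<zero>" using x by (simp add: l_minus l_neg)
    finally have "qfrac R I (\<ominus> a) b \<oplus>\<^bsub>residue_field R I\<^esub> x = \<zero>\<^bsub>residue_field R I\<^esub>"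
      using qfrac_eq_zero_iff[of \<zero> "b \<otimes> b"] cl(1)[OF x(3) x(3)]
        additive_subgroup.zero_closed[OF is_additive_subgroup] by simp
    then show ?case using x qfrac_closed by (metis a_inv_closed)
  qed
  show "a \<odot>\<^bsub>residue_field R I\<^esub> x \<in> carrier (residue_field R I)"
    if *: "a \<in> carrier R" "x \<in> carrier (residue_field R I)" for a x
  proof -
    obtain r s where x: "x = qfrac R I r s" "r \<in> carrier R" "s \<in> carrier R - I" using * by (auto simp: C)
    then show ?thesis using qfrac_closed[OF _ x(3), of "a \<otimes> r"] * by (simp add: qfrac_smult)
  qed
  show "\<one> \<odot>\<^bsub>residue_field R I\<^esub> x = x" if "x \<in> carrier (residue_field R I)" for x
    using that by (auto simp: C qfrac_smult)
  show "a \<otimes> b \<odot>\<^bsub>residue_field R I\<^esub> x = a \<odot>\<^bsub>residue_field R I\<^esub> (b \<odot>\<^bsub>residue_field R I\<^esub> x)"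
    if "a \<in> carrier R" "b \<in> carrier R" "x \<in> carrier (residue_field R I)" for a b x
    using that by (auto simp: C qfrac_smult m_assoc)
  show "(a \<oplus> b) \<odot>\<^bsub>residue_field R I\<^esub> x = a \<odot>\<^bsub>residue_field R I\<^esub> x \<oplus>\<^bsub>residue_field R I\<^esub> b \<odot>\<^bsub>residue_field R I\<^esub> x"
    if *: "a \<in> carrier R" "b \<in> carrier R" "x \<in> carrier (residue_field R I)" for a b x
  proof -
    obtain r s where x: "x = qfrac R I r s" "r \<in> carrier R" "s \<in> carrier R - I" using * by (auto simp: C)
    have s: "s \<in> carrier R" using x by simp
    have "(a \<oplus> b) \<otimes> r \<otimes> (s \<otimes> s) \<ominus> (a \<otimes> r \<otimes> s \<oplus> b \<otimes> r \<otimes> s) \<otimes> s = \<zero>"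
      using * x(2) s by algebra
    then have "qfrac R I ((a \<oplus> b) \<otimes> r) s = qfrac R I (a \<otimes> r \<otimes> s \<oplus> b \<otimes> r \<otimes> s) (s \<otimes> s)"
      using * x s cl(1)[OF x(3) x(3)] additive_subgroup.zero_closed[OF is_additive_subgroup]
      by (subst qfrac_eq_iff) (auto simp: a_minus_def r_neg)
    then show ?thesis using * x by (simp add: qfrac_smult A)
  qed
  show "a \<odot>\<^bsub>residue_field R I\<^esub> (x \<oplus>\<^bsub>residue_field R I\<^esub> y) =
      a \<odot>\<^bsub>residue_field R I\<^esub> x \<oplus>\<^bsub>residue_field R I\<^esub> a \<odot>\<^bsub>residue_field R I\<^esub> y"
    if *: "a \<in> carrier R" "x \<in> carrier (residue_field R I)" "y \<in> carrier (residue_field R I)" for a x y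
  proof -
    obtain r s r' s' where x: "x = qfrac R I r s" "r \<in> carrier R" "s \<in> carrier R - I"
      and y: "y = qfrac R I r' s'" "r' \<in> carrier R" "s' \<in> carrier R - I" using * by (auto simp: C)
    have s: "s \<in> carrier R" "s' \<in> carrier R" using x y by auto
    have "a \<otimes> (r \<otimes> s' \<oplus> r' \<otimes> s) = a \<otimes> r \<otimes> s' \<oplus> a \<otimes> r' \<otimes> s"
      using * x(2) y(2) s by algebra
    then show ?thesis using * x y s cl(1)[OF x(3) y(3)] by (simp add: qfrac_smult A)
  qed
qed

end

section \<open>Tensor products and their maps\<close>

lemma tensor_relations_keys:
  assumes "module R M" "module R N" "a \<in> tensor_relations R M N"
  shows "Poly_Mapping.keys a \<subseteq> carrier M \<times> carrier N"
proof -
  interpret M: module R M by fact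
  interpret N: module R N by fact
  have 1: "Poly_Mapping.keys (frag_of p - frag_of q) \<subseteq> {p, q}" for p q :: "'c \<times> 'd"
    using keys_diff[of "frag_of p" "frag_of q"] by auto
  have 2: "Poly_Mapping.keys (frag_of p - frag_of q - frag_of r) \<subseteq> {p, q, r}" for p q r :: "'c \<times> 'd"
    using keys_diff[of "frag_of p - frag_of q" "frag_of r"] 1[of p q] by auto
  show ?thesis
    using assms(3) unfolding tensor_relations_def
    by (elim UnE CollectE exE conjE) (use subset_trans[OF 1] subset_trans[OF 2] in auto)
qed

lemma
  assumes "module R M" "module R N"
  shows tensor_kernel_zero: "0 \<in> tensor_kernel R M N"
    and tensor_kernel_add: "a \<in> tensor_kernel R M N \<Longrightarrow> b \<in> tensor_kernel R M N \<Longrightarrow> a + b \<in> tensor_kernel R M N"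
    and tensor_kernel_neg: "a \<in> tensor_kernel R M N \<Longrightarrow> - a \<in> tensor_kernel R M N"
    and tensor_kernel_relations: "tensor_relations R M N \<subseteq> tensor_kernel R M N"
    and tensor_kernel_subgroup: "subgroup (tensor_kernel R M N) (free_Abelian_group (carrier M \<times> carrier N))"
proof -
  let ?F = "free_Abelian_group (carrier M \<times> carrier N)"
  interpret F: group ?F by simp
  have "tensor_relations R M N \<subseteq> carrier ?F" using tensor_relations_keys[OF assms] by auto
  then show S: "subgroup (tensor_kernel R M N) ?F"
    unfolding tensor_kernel_def by (rule F.generate_is_subgroup)
  have k: "Poly_Mapping.keys a \<subseteq> carrier M \<times> carrier N" if "a \<in> tensor_kernel R M N" for a
    using subgroup.mem_carrier[OF S that] by simp
  show "0 \<in> tensor_kernel R M N" using subgroup.one_closed[OF S] by simp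
  show "a + b \<in> tensor_kernel R M N" if "a \<in> tensor_kernel R M N" "b \<in> tensor_kernel R M N" for a b
    using subgroup.m_closed[OF S that] by simp
  show "- a \<in> tensor_kernel R M N" if "a \<in> tensor_kernel R M N" for a
    using subgroup.m_inv_closed[OF S that] k[OF that] by simp
  show "tensor_relations R M N \<subseteq> tensor_kernel R M N"
    unfolding tensor_kernel_def by (auto intro: generate.incl)
qed

lemma tensor_kernel_least:
  assumes "module R M" "module R N" "\<And>a. a \<in> tensor_relations R M N \<Longrightarrow> P a" "P 0"
    "\<And>a b. Poly_Mapping.keys a \<subseteq> carrier M \<times> carrier N \<Longrightarrow> Poly_Mapping.keys b \<subseteq> carrier M \<times> carrier N \<Longrightarrow>
      P a \<Longrightarrow> P b \<Longrightarrow> P (a + b)"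
    "\<And>a. Poly_Mapping.keys a \<subseteq> carrier M \<times> carrier N \<Longrightarrow> P a \<Longrightarrow> P (- a)"
    and a: "a \<in> tensor_kernel R M N"
  shows "P a"
proof -
  have "Poly_Mapping.keys a \<subseteq> carrier M \<times> carrier N \<and> P a"
    using a unfolding tensor_kernel_def
  proof (induction a rule: generate.induct)
    case (inv h)
    then show ?case using tensor_relations_keys[OF assms(1,2)] assms(3,6) by simp
  next
    case (eng h1 h2)
    then show ?case using assms(5) keys_add[of h1 h2] by (simp, blast)
  qed (use tensor_relations_keys[OF assms(1,2)] assms(3,4) in auto)
  then show ?thesis ..
qed

definition tclass :: "('a, 'r) ring_scheme \<Rightarrow> ('a, 'm) module \<Rightarrow> ('a, 'n) module \<Rightarrow>
    ('m \<times> 'n \<Rightarrow>\<^sub>0 int) \<Rightarrow> ('m \<times> 'n \<Rightarrow>\<^sub>0 int) set" where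
  "tclass R M N a = tensor_kernel R M N #>\<^bsub>free_Abelian_group (carrier M \<times> carrier N)\<^esub> a"

abbreviation tens :: "('a, 'r) ring_scheme \<Rightarrow> ('a, 'm) module \<Rightarrow> ('a, 'n) module \<Rightarrow> 'm \<Rightarrow> 'n \<Rightarrow>
    ('m \<times> 'n \<Rightarrow>\<^sub>0 int) set" where
  "tens R M N x c \<equiv> tclass R M N (frag_of (x, c))"

lemma tclass_eq_image: "tclass R M N a = (\<lambda>k. k + a) ` tensor_kernel R M N"
  by (auto simp: tclass_def r_coset_def)

lemma tclass_eq_iff:
  assumes "module R M" "module R N"
  shows "tclass R M N a = tclass R M N b \<longleftrightarrow> a - b \<in> tensor_kernel R M N"
proof
  note K = tensor_kernel_zero[OF assms] tensor_kernel_add[OF assms] tensor_kernel_neg[OF assms]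
  assume "tclass R M N a = tclass R M N b"
  moreover have "a \<in> tclass R M N a" unfolding tclass_eq_image using K(1) by force
  ultimately show "a - b \<in> tensor_kernel R M N" unfolding tclass_eq_image by auto
next
  note K = tensor_kernel_zero[OF assms] tensor_kernel_add[OF assms] tensor_kernel_neg[OF assms]
  have *: "tclass R M N a \<subseteq> tclass R M N b" if "a - b \<in> tensor_kernel R M N" for a b
    unfolding tclass_eq_image using K(2)[OF _ that]
      by (auto simp: algebra_simps intro!: image_eqI[of _ _ "k + (a - b)" for k])
  assume "a - b \<in> tensor_kernel R M N"
  then show "tclass R M N a = tclass R M N b" using *[of a b] *[of b a] K(3)[of "a - b"] by auto
qed

lemma
  assumes "module R M" "module R N"
  shows tensor_carrier: "carrier (tensor_module R M N) =
      {tclass R M N a | a. Poly_Mapping.keys a \<subseteq> carrier M \<times> carrier N}"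
    and tensor_zero: "\<zero>\<^bsub>tensor_module R M N\<^esub> = tclass R M N 0"
    and tensor_add: "tclass R M N a \<oplus>\<^bsub>tensor_module R M N\<^esub> tclass R M N b = tclass R M N (a + b)"
    and abelian_group_tensor: "abelian_group (tensor_module R M N)"
proof -
  let ?F = "free_Abelian_group (carrier M \<times> carrier N)"
  let ?K = "tensor_kernel R M N"
  interpret F: comm_group ?F by (rule abelian_free_Abelian_group)
  note S = tensor_kernel_subgroup[OF assms]
  note K = tensor_kernel_zero[OF assms] tensor_kernel_add[OF assms] tensor_kernel_neg[OF assms]
  show "carrier (tensor_module R M N) = {tclass R M N a | a. Poly_Mapping.keys a \<subseteq> carrier M \<times> carrier N}"
    by (auto simp: tensor_module_def Let_def carrier_FactGroup tclass_def)
  show "\<zero>\<^bsub>tensor_module R M N\<^esub> = tclass R M N 0"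
    by (simp add: tensor_module_def Let_def tclass_eq_image)
  show "tclass R M N a \<oplus>\<^bsub>tensor_module R M N\<^esub> tclass R M N b = tclass R M N (a + b)"
  proof -
    have "\<exists>k1\<in>?K. \<exists>k2\<in>?K. k + (a + b) = (k1 + a) + (k2 + b)" if "k \<in> ?K" for k
      using that K(1) by (intro bexI[of _ k] bexI[of _ 0]) (auto simp: algebra_simps)
    moreover have "(k1 + a) + (k2 + b) \<in> (\<lambda>k. k + (a + b)) ` ?K" if "k1 \<in> ?K" "k2 \<in> ?K" for k1 k2
      using K(2)[OF that] by (intro image_eqI[of _ _ "k1 + k2"]) (auto simp: algebra_simps)
    ultimately show ?thesis
      by (auto simp: tensor_module_def Let_def tclass_eq_image set_mult_def)
  qed
  interpret Q: comm_group "?F Mod ?K" by (rule F.abelian_FactGroup[OF S])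
  have eq: "carrier (tensor_module R M N) = carrier (?F Mod ?K)" "\<zero>\<^bsub>tensor_module R M N\<^esub> = \<one>\<^bsub>?F Mod ?K\<^esub>"
    "x \<oplus>\<^bsub>tensor_module R M N\<^esub> y = x \<otimes>\<^bsub>?F Mod ?K\<^esub> y" for x y
    by (simp_all add: tensor_module_def Let_def)
  show "abelian_group (tensor_module R M N)"
    by (rule abelian_groupI; unfold eq)
      (fact Q.m_closed Q.one_closed Q.m_assoc Q.m_comm Q.l_one | rule Q.l_inv_ex, assumption)+
qed

lemma
  assumes "module R M" "module R N"
  shows tens_closed: "x \<in> carrier M \<Longrightarrow> c \<in> carrier N \<Longrightarrow> tens R M N x c \<in> carrier (tensor_module R M N)"
    and tens_add_left: "x \<in> carrier M \<Longrightarrow> x' \<in> carrier M \<Longrightarrow> c \<in> carrier N \<Longrightarrow>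
      tens R M N (x \<oplus>\<^bsub>M\<^esub> x') c = tens R M N x c \<oplus>\<^bsub>tensor_module R M N\<^esub> tens R M N x' c"
    and tens_add_right: "x \<in> carrier M \<Longrightarrow> c \<in> carrier N \<Longrightarrow> c' \<in> carrier N \<Longrightarrow>
      tens R M N x (c \<oplus>\<^bsub>N\<^esub> c') = tens R M N x c \<oplus>\<^bsub>tensor_module R M N\<^esub> tens R M N x c'"
    and tens_balanced: "r \<in> carrier R \<Longrightarrow> x \<in> carrier M \<Longrightarrow> c \<in> carrier N \<Longrightarrow>
      tens R M N (r \<odot>\<^bsub>M\<^esub> x) c = tens R M N x (r \<odot>\<^bsub>N\<^esub> c)"
proof -
  note rel = subsetD[OF tensor_kernel_relations[OF assms]]
  show "x \<in> carrier M \<Longrightarrow> c \<in> carrier N \<Longrightarrow> tens R M N x c \<in> carrier (tensor_module R M N)"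
    unfolding tensor_carrier[OF assms] by (auto intro!: exI[of _ "frag_of (x, c)"])
  show "tens R M N (x \<oplus>\<^bsub>M\<^esub> x') c = tens R M N x c \<oplus>\<^bsub>tensor_module R M N\<^esub> tens R M N x' c"
    if "x \<in> carrier M" "x' \<in> carrier M" "c \<in> carrier N"
    unfolding tensor_add[OF assms] tclass_eq_iff[OF assms]
    by (rule rel) (use that in \<open>auto simp: tensor_relations_def algebra_simps\<close>)
  show "tens R M N x (c \<oplus>\<^bsub>N\<^esub> c') = tens R M N x c \<oplus>\<^bsub>tensor_module R M N\<^esub> tens R M N x c'"
    if "x \<in> carrier M" "c \<in> carrier N" "c' \<in> carrier N"
    unfolding tensor_add[OF assms] tclass_eq_iff[OF assms]
    by (rule rel) (use that in \<open>auto simp: tensor_relations_def algebra_simps\<close>)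
  show "tens R M N (r \<odot>\<^bsub>M\<^esub> x) c = tens R M N x (r \<odot>\<^bsub>N\<^esub> c)"
    if "r \<in> carrier R" "x \<in> carrier M" "c \<in> carrier N"
    unfolding tclass_eq_iff[OF assms]
    by (rule rel) (use that in \<open>auto simp: tensor_relations_def\<close>)
qed

lemma
  assumes MN: "module R M" "module R N"
  shows tens_zero_left: "c \<in> carrier N \<Longrightarrow> tens R M N \<zero>\<^bsub>M\<^esub> c = \<zero>\<^bsub>tensor_module R M N\<^esub>"
    and tens_zero_right: "x \<in> carrier M \<Longrightarrow> tens R M N x \<zero>\<^bsub>N\<^esub> = \<zero>\<^bsub>tensor_module R M N\<^esub>"
    and tens_minus_left: "x \<in> carrier M \<Longrightarrow> c \<in> carrier N \<Longrightarrow>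
      tens R M N (\<ominus>\<^bsub>M\<^esub> x) c = \<ominus>\<^bsub>tensor_module R M N\<^esub> tens R M N x c"
proof -
  note T = abelian_group_tensor[OF MN] and c = tens_closed[OF MN]
  show "tens R M N \<zero>\<^bsub>M\<^esub> c = \<zero>\<^bsub>tensor_module R M N\<^esub>" if "c \<in> carrier N"
    by (rule additive_zero(1)[OF module_abelian_group[OF MN(1)] T]) (use c that tens_add_left[OF MN] in auto)
  show "tens R M N x \<zero>\<^bsub>N\<^esub> = \<zero>\<^bsub>tensor_module R M N\<^esub>" if "x \<in> carrier M"
    by (rule additive_zero(1)[OF module_abelian_group[OF MN(2)] T]) (use c that tens_add_right[OF MN] in auto)
  show "tens R M N (\<ominus>\<^bsub>M\<^esub> x) c = \<ominus>\<^bsub>tensor_module R M N\<^esub> tens R M N x c" if "x \<in> carrier M" "c \<in> carrier N"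
    by (rule additive_zero(2)[OF module_abelian_group[OF MN(1)] T]) (use c that tens_add_left[OF MN] in auto)
qed

text \<open>The case for composite tensors is a difference and not a sum, since in the free abelian
  group subtraction alone generates everything, negatives included.\<close>

lemma tensor_induct:
  assumes MN: "module R M" "module R N" and t: "t \<in> carrier (tensor_module R M N)"
    and zero: "P \<zero>\<^bsub>tensor_module R M N\<^esub>"
    and gen: "\<And>x c. x \<in> carrier M \<Longrightarrow> c \<in> carrier N \<Longrightarrow> P (tens R M N x c)"
    and diff: "\<And>t u. t \<in> carrier (tensor_module R M N) \<Longrightarrow> u \<in> carrier (tensor_module R M N) \<Longrightarrow> P t \<Longrightarrow> P u \<Longrightarrow>
      P (t \<ominus>\<^bsub>tensor_module R M N\<^esub> u)"
  shows "P t"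
proof -
  interpret T: abelian_group "tensor_module R M N" by (rule abelian_group_tensor[OF MN])
  obtain a where a: "t = tclass R M N a" "Poly_Mapping.keys a \<subseteq> carrier M \<times> carrier N"
    using t by (auto simp: tensor_carrier[OF MN])
  have "P (tclass R M N a)"
  proof (rule free_Abelian_group_induct[OF a(2), where P = "\<lambda>a. P (tclass R M N a)"])
    show "P (tclass R M N 0)" using zero by (simp add: tensor_zero[OF MN])
    show "P (tclass R M N (frag_of p))" if "p \<in> carrier M \<times> carrier N" for p
      using gen that by (cases p) auto
    fix a b assume *: "Poly_Mapping.keys a \<subseteq> carrier M \<times> carrier N" "Poly_Mapping.keys b \<subseteq> carrier M \<times> carrier N"
      "P (tclass R M N a)" "P (tclass R M N b)"
    have ab: "tclass R M N a \<in> carrier (tensor_module R M N)" "tclass R M N b \<in> carrier (tensor_module R M N)"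
      using * by (auto simp: tensor_carrier[OF MN])
    have "Poly_Mapping.keys (a - b) \<subseteq> carrier M \<times> carrier N" using * keys_diff[of a b] by blast
    then have "tclass R M N (a - b) \<in> carrier (tensor_module R M N)" by (auto simp: tensor_carrier[OF MN])
    moreover have "tclass R M N a = tclass R M N b \<oplus>\<^bsub>tensor_module R M N\<^esub> tclass R M N (a - b)"
      by (simp add: tensor_add[OF MN])
    ultimately have "tclass R M N (a - b) = tclass R M N a \<ominus>\<^bsub>tensor_module R M N\<^esub> tclass R M N b"
      using T.minus_eq_iff_add[OF ab, of "tclass R M N (a - b)"] by blast
    then show "P (tclass R M N (a - b))" using diff[OF ab] * by simp
  qed
  then show ?thesis using a(1) by simp
qed

text \<open>The part of the universal property that is wanted: a balanced map into an abelian group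
  vanishes wherever the pure tensor does. It serves to show that tensors are nonzero.\<close>

lemma tensor_lift:
  assumes MN: "module R M" "module R N" and G: "abelian_group G"
    and B: "\<And>x c. x \<in> carrier M \<Longrightarrow> c \<in> carrier N \<Longrightarrow> \<psi> x c \<in> carrier G"
    "\<And>x x' c. x \<in> carrier M \<Longrightarrow> x' \<in> carrier M \<Longrightarrow> c \<in> carrier N \<Longrightarrow> \<psi> (x \<oplus>\<^bsub>M\<^esub> x') c = \<psi> x c \<oplus>\<^bsub>G\<^esub> \<psi> x' c"
    "\<And>x c c'. x \<in> carrier M \<Longrightarrow> c \<in> carrier N \<Longrightarrow> c' \<in> carrier N \<Longrightarrow> \<psi> x (c \<oplus>\<^bsub>N\<^esub> c') = \<psi> x c \<oplus>\<^bsub>G\<^esub> \<psi> x c'"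
    "\<And>r x c. r \<in> carrier R \<Longrightarrow> x \<in> carrier M \<Longrightarrow> c \<in> carrier N \<Longrightarrow> \<psi> (r \<odot>\<^bsub>M\<^esub> x) c = \<psi> x (r \<odot>\<^bsub>N\<^esub> c)"
    and xc: "x \<in> carrier M" "c \<in> carrier N" and zero: "tens R M N x c = \<zero>\<^bsub>tensor_module R M N\<^esub>"
  shows "\<psi> x c = \<zero>\<^bsub>G\<^esub>"
proof -
  interpret M: module R M by fact
  interpret N: module R N by fact
  interpret G: abelian_group G by fact
  let ?F = "free_Abelian_group (carrier M \<times> carrier N)"
  have "(\<lambda>p. \<psi> (fst p) (snd p)) ` (carrier M \<times> carrier N) \<subseteq> carrier (add_monoid G)" using B(1) by auto
  then obtain h where h: "h \<in> hom ?F (add_monoid G)" "\<And>p. p \<in> carrier M \<times> carrier N \<Longrightarrow> h (frag_of p) = \<psi> (fst p) (snd p)"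
    using comm_group.free_Abelian_group_universal[OF G.a_comm_group] by blast
  have hc: "h a \<in> carrier G" if "Poly_Mapping.keys a \<subseteq> carrier M \<times> carrier N" for a
    using h(1) that by (auto simp: hom_def Pi_def)
  have hadd: "h (a + b) = h a \<oplus>\<^bsub>G\<^esub> h b"
    if "Poly_Mapping.keys a \<subseteq> carrier M \<times> carrier N" "Poly_Mapping.keys b \<subseteq> carrier M \<times> carrier N" for a b
    using h(1) that by (auto simp: hom_def)
  have h0: "h 0 = \<zero>\<^bsub>G\<^esub>" using hadd[of 0 0] hc[of 0] by (metis G.add.l_cancel_one' add_0 empty_subsetI keys_zero)
  have hneg: "h (- a) = \<ominus>\<^bsub>G\<^esub> h a" if "Poly_Mapping.keys a \<subseteq> carrier M \<times> carrier N" for a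
    using hadd[of "- a" a] that hc[of a] hc[of "- a"] h0 by (simp add: keys_minus G.minus_equality)
  have hdiff: "h (a - b) = h a \<ominus>\<^bsub>G\<^esub> h b"
    if "Poly_Mapping.keys a \<subseteq> carrier M \<times> carrier N" "Poly_Mapping.keys b \<subseteq> carrier M \<times> carrier N" for a b
    using hadd[of a "- b"] hneg[of b] that by (simp add: keys_minus a_minus_def)
  have kd: "Poly_Mapping.keys (frag_of p - frag_of q) \<subseteq> carrier M \<times> carrier N"
    if "p \<in> carrier M \<times> carrier N" "q \<in> carrier M \<times> carrier N" for p q
    using keys_diff[of "frag_of p" "frag_of q"] that by auto
  have canc: "u \<oplus>\<^bsub>G\<^esub> v \<ominus>\<^bsub>G\<^esub> u \<ominus>\<^bsub>G\<^esub> v = \<zero>\<^bsub>G\<^esub>" if "u \<in> carrier G" "v \<in> carrier G" for u v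
  proof -
    have "u \<oplus>\<^bsub>G\<^esub> v \<ominus>\<^bsub>G\<^esub> u \<ominus>\<^bsub>G\<^esub> v = (u \<oplus>\<^bsub>G\<^esub> v) \<oplus>\<^bsub>G\<^esub> \<ominus>\<^bsub>G\<^esub> (u \<oplus>\<^bsub>G\<^esub> v)"
      using that by (simp add: a_minus_def G.minus_add G.a_assoc)
    then show ?thesis using that by (simp add: G.r_neg)
  qed
  have "h a = \<zero>\<^bsub>G\<^esub>" if "a \<in> tensor_kernel R M N" for a
  proof (rule tensor_kernel_least[OF MN _ _ _ _ that, where P = "\<lambda>a. h a = \<zero>\<^bsub>G\<^esub>"])
    fix a assume "a \<in> tensor_relations R M N"
    then consider (1) x x' y where "a = frag_of (x \<oplus>\<^bsub>M\<^esub> x', y) - frag_of (x, y) - frag_of (x', y)"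
        "x \<in> carrier M" "x' \<in> carrier M" "y \<in> carrier N"
      | (2) x y y' where "a = frag_of (x, y \<oplus>\<^bsub>N\<^esub> y') - frag_of (x, y) - frag_of (x, y')"
        "x \<in> carrier M" "y \<in> carrier N" "y' \<in> carrier N"
      | (3) r x y where "a = frag_of (r \<odot>\<^bsub>M\<^esub> x, y) - frag_of (x, r \<odot>\<^bsub>N\<^esub> y)"
        "r \<in> carrier R" "x \<in> carrier M" "y \<in> carrier N"
      unfolding tensor_relations_def by blast
    then show "h a = \<zero>\<^bsub>G\<^esub>"
    proof cases
      case 1
      then show ?thesis using canc B(1) by (simp add: hdiff kd h(2) B(2))
    next
      case 2
      then show ?thesis using canc B(1) by (simp add: hdiff kd h(2) B(3))
    next
      case 3
      then show ?thesis using B(1) by (simp add: hdiff h(2) B(4) a_minus_def G.r_neg)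
    qed
  qed (simp_all add: h0 hadd hneg G.a_inv_zero)
  moreover have "frag_of (x, c) \<in> tensor_kernel R M N"
    using zero tclass_eq_iff[OF MN, of "frag_of (x, c)" 0] by (simp add: tensor_zero[OF MN])
  ultimately show ?thesis using h(2)[of "(x, c)"] xc by simp
qed

lemma
  fixes N :: "('a, 'n) module"
  assumes M: "module R M" and M': "module R M'" and N: "module R N" and f: "f \<in> module_hom R M M'"
  shows tensor_map_tens: "x \<in> carrier M \<Longrightarrow> c \<in> carrier N \<Longrightarrow> tensor_map R M' N f (tens R M N x c) = tens R M' N (f x) c"
    and tensor_map_closed: "t \<in> carrier (tensor_module R M N) \<Longrightarrow> tensor_map R M' N f t \<in> carrier (tensor_module R M' N)"
    and tensor_map_add: "t \<in> carrier (tensor_module R M N) \<Longrightarrow> u \<in> carrier (tensor_module R M N) \<Longrightarrow>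
      tensor_map R M' N f (t \<oplus>\<^bsub>tensor_module R M N\<^esub> u) =
      tensor_map R M' N f t \<oplus>\<^bsub>tensor_module R M' N\<^esub> tensor_map R M' N f u"
proof -
  interpret M: module R M by fact
  interpret M': module R M' by fact
  interpret N: module R N by fact
  define \<phi> where "\<phi> = frag_extend (\<lambda>(x, y). frag_of (f x, y :: 'n))"
  note K' = tensor_kernel_zero[OF M' N] tensor_kernel_add[OF M' N] tensor_kernel_neg[OF M' N]
    subsetD[OF tensor_kernel_relations[OF M' N]]
  have \<phi>: "\<phi> 0 = 0" "\<phi> (a + b) = \<phi> a + \<phi> b" "\<phi> (- a) = - \<phi> a" "\<phi> (a - b) = \<phi> a - \<phi> b"
    "\<phi> (frag_of (x, y)) = frag_of (f x, y)" for a b x y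
    by (simp_all add: \<phi>_def frag_extend_add frag_extend_minus frag_extend_diff)
  have \<phi>K: "\<phi> a \<in> tensor_kernel R M' N" if "a \<in> tensor_kernel R M N" for a
  proof (rule tensor_kernel_least[OF M N _ _ _ _ that, where P = "\<lambda>a. \<phi> a \<in> tensor_kernel R M' N"])
    fix a assume "a \<in> tensor_relations R M N"
    then have "\<phi> a \<in> tensor_relations R M' N"
      unfolding tensor_relations_def
      by (elim UnE CollectE exE conjE)
        (simp_all only: \<phi> module_hom_add[OF f] module_hom_smult[OF f], (use module_hom_closed[OF f] in blast)+)
    then show "\<phi> a \<in> tensor_kernel R M' N" by (rule K')
  qed (simp_all add: \<phi> K')
  have \<phi>k: "Poly_Mapping.keys (\<phi> a) \<subseteq> carrier M' \<times> carrier N" if "Poly_Mapping.keys a \<subseteq> carrier M \<times> carrier N" for a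
    unfolding \<phi>_def by (rule order_trans[OF keys_frag_extend]) (use that module_hom_closed[OF f] in auto)
  \<comment> \<open>\<open>tensor_map\<close> adds the kernel to the image of a whole coset. Since
    \<open>\<phi>\<close> maps the kernel into the kernel, that set is again a single coset, the one
    of \<open>\<phi> a\<close>.\<close>
  have cls: "tensor_map R M' N f (tclass R M N a) = tclass R M' N (\<phi> a)" for a
  proof -
    have "tensor_map R M' N f (tclass R M N a) = {k' + \<phi> (k + a) | k k'. k \<in> tensor_kernel R M N \<and>
      k' \<in> tensor_kernel R M' N}"
      by (auto simp: tensor_map_def tclass_eq_image set_mult_def \<phi>_def)
    also have "\<dots> = (\<lambda>k. k + \<phi> a) ` tensor_kernel R M' N"
    proof -
      have "k' + \<phi> (k + a) \<in> (\<lambda>k. k + \<phi> a) ` tensor_kernel R M' N"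
        if "k \<in> tensor_kernel R M N" "k' \<in> tensor_kernel R M' N" for k k'
        using K'(2)[OF that(2) \<phi>K[OF that(1)]] by (intro image_eqI[of _ _ "k' + \<phi> k"]) (auto simp: \<phi> algebra_simps)
      moreover have "\<exists>k k'. k'' + \<phi> a = k' + \<phi> (k + a) \<and> k \<in> tensor_kernel R M N \<and> k' \<in> tensor_kernel R M' N"
        if "k'' \<in> tensor_kernel R M' N" for k''
        using that tensor_kernel_zero[OF M N] by (intro exI[of _ 0] exI[of _ k'']) simp
      ultimately show ?thesis by blast
    qed
    finally show ?thesis by (simp add: tclass_eq_image)
  qed
  show "tensor_map R M' N f (tens R M N x c) = tens R M' N (f x) c" if "x \<in> carrier M" "c \<in> carrier N"
    by (simp add: cls \<phi>)
  show "tensor_map R M' N f t \<in> carrier (tensor_module R M' N)" if "t \<in> carrier (tensor_module R M N)"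
  proof -
    obtain a where a: "t = tclass R M N a" "Poly_Mapping.keys a \<subseteq> carrier M \<times> carrier N"
      using \<open>t \<in> carrier (tensor_module R M N)\<close> by (auto simp: tensor_carrier[OF M N])
    show ?thesis unfolding a(1) cls tensor_carrier[OF M' N] using \<phi>k[OF a(2)] by blast
  qed
  show "tensor_map R M' N f (t \<oplus>\<^bsub>tensor_module R M N\<^esub> u) =
      tensor_map R M' N f t \<oplus>\<^bsub>tensor_module R M' N\<^esub> tensor_map R M' N f u"
    if "t \<in> carrier (tensor_module R M N)" "u \<in> carrier (tensor_module R M N)"
    using that by (auto simp: tensor_carrier[OF M N] cls tensor_add[OF M N] tensor_add[OF M' N] \<phi>)
qed

lemma tensor_smult: "r \<odot>\<^bsub>tensor_module R M N\<^esub> t = tensor_map R M N (\<lambda>x. r \<odot>\<^bsub>M\<^esub> x) t"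
  by (simp add: tensor_module_def Let_def)

text \<open>The second conclusion is the linearity condition under which
  \<open>derived_iso_zero_iff\<close> applies.\<close>

lemma ab_complex_tensor:
  assumes X: "module_complex R X" and N: "module R N"
  shows "ab_complex (tensor_complex R X N)"
    and "r \<in> carrier R \<Longrightarrow>
      r \<odot>\<^bsub>obj (tensor_complex R X N) n\<^esub> \<zero>\<^bsub>obj (tensor_complex R X N) n\<^esub> = \<zero>\<^bsub>obj (tensor_complex R X N) n\<^esub>"
proof -
  note M = module_complexD(1)[OF X] and d = module_complexD(2)[OF X]
  note A = abelian_group_tensor[OF M N]
  have hz: "tensor_map R M' N f \<zero>\<^bsub>tensor_module R M N\<^esub> = \<zero>\<^bsub>tensor_module R M' N\<^esub>"
    if "module R M" "module R M'" "f \<in> module_hom R M M'" for M M' :: "('a, 'c) module" and f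
  proof (rule additive_zero(1)[OF abelian_group_tensor[OF that(1) N] abelian_group_tensor[OF that(2) N]])
    show "tensor_map R M' N f \<in> carrier (tensor_module R M N) \<rightarrow> carrier (tensor_module R M' N)"
      using tensor_map_closed[OF that(1,2) N that(3)] by blast
  qed (rule tensor_map_add[OF that(1,2) N that(3)])
  have hm: "tensor_map R M' N f (\<ominus>\<^bsub>tensor_module R M N\<^esub> t) = \<ominus>\<^bsub>tensor_module R M' N\<^esub> tensor_map R M' N f t"
    if "module R M" "module R M'" "f \<in> module_hom R M M'" "t \<in> carrier (tensor_module R M N)"
      for M M' :: "('a, 'c) module" and f t
  proof (rule additive_zero(2)[OF abelian_group_tensor[OF that(1) N] abelian_group_tensor[OF that(2) N] _ _ that(4)])
    show "tensor_map R M' N f \<in> carrier (tensor_module R M N) \<rightarrow> carrier (tensor_module R M' N)"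
      using tensor_map_closed[OF that(1,2) N that(3)] by blast
  qed (rule tensor_map_add[OF that(1,2) N that(3)])
  have hs: "tensor_map R M' N f (t \<ominus>\<^bsub>tensor_module R M N\<^esub> u) =
      tensor_map R M' N f t \<ominus>\<^bsub>tensor_module R M' N\<^esub> tensor_map R M' N f u"
    if "module R M" "module R M'" "f \<in> module_hom R M M'" "t \<in> carrier (tensor_module R M N)"
      "u \<in> carrier (tensor_module R M N)" for M M' :: "('a, 'c) module" and f t u
    unfolding a_minus_def hm[OF that(1-3,5), symmetric]
    by (intro tensor_map_add[OF that(1,2) N that(3,4)]
      abelian_group.a_inv_closed[OF abelian_group_tensor[OF that(1) N] that(5)])
  show "ab_complex (tensor_complex R X N)"
    unfolding ab_complex_def tensor_complex_def cochain_complex.simps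
  proof (intro allI conjI ballI)
    fix n
    let ?T = "\<lambda>n. tensor_module R (obj X n) N" and ?d = "\<lambda>n. tensor_map R (obj X (n + 1)) N (diff X n)"
    show "abelian_group (?T n)" by (rule A)
    fix t assume t: "t \<in> carrier (?T n)"
    show "?d n t \<in> carrier (?T (n + 1))" by (rule tensor_map_closed[OF M M N d t])
    show "?d n (t \<oplus>\<^bsub>?T n\<^esub> u) = ?d n t \<oplus>\<^bsub>?T (n + 1)\<^esub> ?d n u" if "u \<in> carrier (?T n)" for u
      by (rule tensor_map_add[OF M M N d t that])
    interpret T2: abelian_group "?T (n + 1 + 1)" by (rule A)
    interpret T1: abelian_group "?T (n + 1)" by (rule A)
    interpret T0: abelian_group "?T n" by (rule A)
    have "?d (n + 1) (?d n t) = \<zero>\<^bsub>?T (n + 1 + 1)\<^esub>"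
      using t
    proof (rule tensor_induct[OF M N])
      show "?d (n + 1) (?d n \<zero>\<^bsub>?T n\<^esub>) = \<zero>\<^bsub>?T (n + 1 + 1)\<^esub>"
        by (simp only: hz[OF M M d])
      show "?d (n + 1) (?d n (tens R (obj X n) N x c)) = \<zero>\<^bsub>?T (n + 1 + 1)\<^esub>"
        if "x \<in> carrier (obj X n)" "c \<in> carrier N" for x c
      proof -
        have "?d (n + 1) (?d n (tens R (obj X n) N x c)) = tens R (obj X (n + 1 + 1)) N \<zero>\<^bsub>obj X (n + 1 + 1)\<^esub> c"
          using that module_complexD(3)[OF X that(1)] module_complex_closed(1)[OF X that(1)]
          by (simp only: tensor_map_tens[OF M M N d]) (simp add: add.assoc)
        then show ?thesis using tens_zero_left[OF M N that(2)] by simp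
      qed
      show "?d (n + 1) (?d n (t \<ominus>\<^bsub>?T n\<^esub> u)) = \<zero>\<^bsub>?T (n + 1 + 1)\<^esub>"
        if "t \<in> carrier (?T n)" "u \<in> carrier (?T n)" "?d (n + 1) (?d n t) = \<zero>\<^bsub>?T (n + 1 + 1)\<^esub>"
          "?d (n + 1) (?d n u) = \<zero>\<^bsub>?T (n + 1 + 1)\<^esub>" for t u
        unfolding hs[OF M M d that(1,2)] hs[OF M M d tensor_map_closed[OF M M N d that(1)]
          tensor_map_closed[OF M M N d that(2)]] that(3,4)
        by (simp only: a_minus_def T2.a_inv_zero T2.l_zero T2.zero_closed)
    qed
    then show "?d (n + 1) (?d n t) = \<zero>\<^bsub>?T (n + 2)\<^esub>" by (simp add: add.assoc)
  qed
  show "r \<odot>\<^bsub>obj (tensor_complex R X N) n\<^esub> \<zero>\<^bsub>obj (tensor_complex R X N) n\<^esub> = \<zero>\<^bsub>obj (tensor_complex R X N) n\<^esub>"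
    if "r \<in> carrier R"
    using hz[OF M M module_hom_scalar[OF M that]] by (simp add: tensor_complex_def tensor_smult)
qed

section \<open>Supports of perfect complexes\<close>

text \<open>\<open>residual p M\<close> is \<open>pM\<close> when \<open>M\<close> is finitely generated projective.\<close>

definition residual :: "('a, 'r) ring_scheme \<Rightarrow> 'a set \<Rightarrow> ('a, 'm) module \<Rightarrow> 'm set" where
  "residual R p M = {x \<in> carrier M. \<forall>\<phi>\<in>module_hom R M (regular_module R). \<phi> x \<in> p}"

lemma residual_hom:
  assumes "f \<in> module_hom R M N" "x \<in> residual R p M"
  shows "f x \<in> residual R p N"
  unfolding residual_def
proof (intro CollectI conjI ballI)
  show "f x \<in> carrier N" using assms module_hom_closed[OF assms(1)] by (auto simp: residual_def)
  fix \<phi> assume "\<phi> \<in> module_hom R N (regular_module R)"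
  then have "(\<lambda>x. \<phi> (f x)) \<in> module_hom R M (regular_module R)" by (rule module_hom_comp[OF assms(1)])
  then show "\<phi> (f x) \<in> p" using assms(2) by (auto simp: residual_def)
qed

section \<open>Tensoring with the residue field\<close>

context primeideal
begin

abbreviation K where "K \<equiv> residue_field R I"

text \<open>A factor outside \<open>I\<close> moves across the tensor sign and cancels against the
  denominator; this brings two tensors to a common denominator.\<close>

lemma tens_residue_scale:
  assumes M: "module R M" and x: "x \<in> carrier M" and s: "s \<in> carrier R - I" and t: "t \<in> carrier R - I"
  shows "tens R M K (t \<odot>\<^bsub>M\<^esub> x) (qfrac R I \<one> (t \<otimes> s)) = tens R M K x (qfrac R I \<one> s)"
proof -
  have ts: "t \<otimes> s \<in> carrier R - I" by (rule prime_mult[OF t s])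
  have "tens R M K (t \<odot>\<^bsub>M\<^esub> x) (qfrac R I \<one> (t \<otimes> s)) = tens R M K x (t \<odot>\<^bsub>K\<^esub> qfrac R I \<one> (t \<otimes> s))"
    using tens_balanced[OF M module_residue_field _ x] t qfrac_closed[OF _ ts] by blast
  also have "t \<odot>\<^bsub>K\<^esub> qfrac R I \<one> (t \<otimes> s) = qfrac R I t (t \<otimes> s)"
    using qfrac_smult[OF _ _ ts, of t \<one>] t by simp
  also have "\<dots> = qfrac R I \<one> s"
    using s t ts additive_subgroup.zero_closed[OF is_additive_subgroup]
    by (subst qfrac_eq_iff) (auto simp: a_minus_def r_neg)
  finally show ?thesis .
qed

text \<open>Common denominators make every tensor pure with second factor 1/s: the tensor product is
  the localisation of \<open>M\<close> at the prime, taken modulo the prime.\<close>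

lemma tensor_residue_elem:
  assumes M: "module R M" and t: "t \<in> carrier (tensor_module R M K)"
  shows "\<exists>x\<in>carrier M. \<exists>s\<in>carrier R - I. t = tens R M K x (qfrac R I \<one> s)"
  using t
proof (rule tensor_induct[OF M module_residue_field])
  interpret M: module R M by fact
  note T = abelian_group_tensor[OF M module_residue_field]
  show "\<exists>x\<in>carrier M. \<exists>s\<in>carrier R - I. \<zero>\<^bsub>tensor_module R M K\<^esub> = tens R M K x (qfrac R I \<one> s)"
    using tens_zero_left[OF M module_residue_field qfrac_closed[OF one_closed one_notin]] one_notin M.zero_closed
      by metis
  show "\<exists>x\<in>carrier M. \<exists>s\<in>carrier R - I. tens R M K y c = tens R M K x (qfrac R I \<one> s)"
    if y: "y \<in> carrier M" and c: "c \<in> carrier K" for y c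
  proof -
    obtain r s where rs: "c = qfrac R I r s" "r \<in> carrier R" "s \<in> carrier R - I" using c
      by (auto simp: residue_field_carrier)
    have "c = r \<odot>\<^bsub>K\<^esub> qfrac R I \<one> s" using rs by (simp add: qfrac_smult)
    then have "tens R M K y c = tens R M K (r \<odot>\<^bsub>M\<^esub> y) (qfrac R I \<one> s)"
      using tens_balanced[OF M module_residue_field rs(2) y qfrac_closed[OF one_closed rs(3)]] by simp
    then show ?thesis using rs(2,3) y by blast
  qed
  fix t u assume "\<exists>x\<in>carrier M. \<exists>s\<in>carrier R - I. t = tens R M K x (qfrac R I \<one> s)"
    "\<exists>x\<in>carrier M. \<exists>s\<in>carrier R - I. u = tens R M K x (qfrac R I \<one> s)"
  then obtain x s y r where x: "x \<in> carrier M" "s \<in> carrier R - I" "t = tens R M K x (qfrac R I \<one> s)"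
    and y: "y \<in> carrier M" "r \<in> carrier R - I" "u = tens R M K y (qfrac R I \<one> r)" by blast
  have rs: "r \<otimes> s \<in> carrier R - I" "r \<otimes> s = s \<otimes> r" using prime_mult[OF y(2) x(2)] x y by (auto simp: m_comm)
  note q = qfrac_closed[OF one_closed rs(1)]
  have t: "t = tens R M K (r \<odot>\<^bsub>M\<^esub> x) (qfrac R I \<one> (r \<otimes> s))"
    unfolding x(3) by (rule tens_residue_scale[OF M x(1,2) y(2), symmetric])
  have u: "u = tens R M K (s \<odot>\<^bsub>M\<^esub> y) (qfrac R I \<one> (r \<otimes> s))"
    unfolding y(3) rs(2) by (rule tens_residue_scale[OF M y(1,2) x(2), symmetric])
  have "t \<ominus>\<^bsub>tensor_module R M K\<^esub> u = tens R M K (r \<odot>\<^bsub>M\<^esub> x \<ominus>\<^bsub>M\<^esub> s \<odot>\<^bsub>M\<^esub> y) (qfrac R I \<one> (r \<otimes> s))"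
    unfolding t u a_minus_def using x y q tens_add_left[OF M module_residue_field]
      tens_minus_left[OF M module_residue_field]
    by simp
  moreover have "r \<odot>\<^bsub>M\<^esub> x \<ominus>\<^bsub>M\<^esub> s \<odot>\<^bsub>M\<^esub> y \<in> carrier M" using x y by simp
  ultimately show "\<exists>x\<in>carrier M. \<exists>s\<in>carrier R - I. t \<ominus>\<^bsub>tensor_module R M K\<^esub> u = tens R M K x (qfrac R I \<one> s)"
    using rs(1) by blast
qed

lemma tens_msum_zero:
  assumes M: "module R M" and N: "module R N" and c: "c \<in> carrier N"
    and g: "\<And>l. l \<in> set L \<Longrightarrow> g l \<in> carrier M" "\<And>l. l \<in> set L \<Longrightarrow> tens R M N (g l) c = \<zero>\<^bsub>tensor_module R M N\<^esub>"
  shows "tens R M N (msum M g L) c = \<zero>\<^bsub>tensor_module R M N\<^esub>"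
  using g
proof (induction L)
  case Nil
  show ?case using tens_zero_left[OF M N c] by simp
next
  case (Cons a L)
  interpret M: module R M by fact
  interpret T: abelian_group "tensor_module R M N" by (rule abelian_group_tensor[OF M N])
  show ?case using Cons tens_add_left[OF M N _ _ c] by (simp add: M.msum_closed)
qed

text \<open>If the tensor vanishes, every functional \<open>\<phi>\<close> induces a balanced map to
  the residue field, whose value \<phi>(x)/s must be zero. Conversely, the coordinates of a residual
  \<open>x\<close> lie in \<open>I\<close> and kill the residue field.\<close>

lemma tens_residue_eq_zero_iff:
  assumes M: "fgp R M" and x: "x \<in> carrier M" and s: "s \<in> carrier R - I"
  shows "tens R M K x (qfrac R I \<one> s) = \<zero>\<^bsub>tensor_module R M K\<^esub> \<longleftrightarrow> x \<in> residual R I M"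
proof
  have Mm: "module R M" using M by (simp add: fgp_def)
  interpret M: module R M by fact
  interpret K: module R K by (rule module_residue_field)
  note q = qfrac_closed[OF one_closed s]
  show "x \<in> residual R I M" if z: "tens R M K x (qfrac R I \<one> s) = \<zero>\<^bsub>tensor_module R M K\<^esub>"
    unfolding residual_def
  proof (intro CollectI conjI ballI x)
    fix \<phi> assume \<phi>: "\<phi> \<in> module_hom R M (regular_module R)"
    note \<phi>c = module_hom_closed[OF \<phi>, simplified] and \<phi>a = module_hom_add[OF \<phi>, simplified]
      and \<phi>s = module_hom_smult[OF \<phi>, simplified]
    have "\<phi> x \<odot>\<^bsub>K\<^esub> qfrac R I \<one> s = \<zero>\<^bsub>K\<^esub>"
    proof (rule tensor_lift[OF Mm module_residue_field K.abelian_group_axioms _ _ _ _ x q z,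
      where \<psi> = "\<lambda>x c. \<phi> x \<odot>\<^bsub>K\<^esub> c"])
      fix r y c assume *: "r \<in> carrier R" "y \<in> carrier M" "c \<in> carrier K"
      show "\<phi> (r \<odot>\<^bsub>M\<^esub> y) \<odot>\<^bsub>K\<^esub> c = \<phi> y \<odot>\<^bsub>K\<^esub> (r \<odot>\<^bsub>K\<^esub> c)"
        using * \<phi>c by (simp add: \<phi>s m_comm flip: K.smult_assoc1)
    qed (simp_all add: \<phi>c \<phi>a K.smult_l_distr K.smult_r_distr)
    moreover have "\<phi> x \<odot>\<^bsub>K\<^esub> qfrac R I \<one> s = qfrac R I (\<phi> x) s" using s \<phi>c[OF x] by (simp add: qfrac_smult)
    ultimately show "\<phi> x \<in> I" using qfrac_eq_zero_iff[OF \<phi>c[OF x] s] by simp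
  qed
  show "tens R M K x (qfrac R I \<one> s) = \<zero>\<^bsub>tensor_module R M K\<^esub>" if r: "x \<in> residual R I M"
  proof -
    obtain L where L: "dual_basis R M L" using M by (auto simp: fgp_def)
    note D = dual_basisD[OF L]
    have "tens R M K (msum M (\<lambda>l. snd l x \<odot>\<^bsub>M\<^esub> fst l) L) (qfrac R I \<one> s) = \<zero>\<^bsub>tensor_module R M K\<^esub>"
    proof (rule tens_msum_zero[OF Mm module_residue_field q])
      fix l assume l: "l \<in> set L"
      note lx = D(3)[OF x l] D(1)[OF l]
      show "snd l x \<odot>\<^bsub>M\<^esub> fst l \<in> carrier M" using lx by simp
      have "snd l x \<odot>\<^bsub>K\<^esub> qfrac R I \<one> s = \<zero>\<^bsub>K\<^esub>"
        using qfrac_smult[OF lx(1) one_closed s] qfrac_eq_zero_iff[OF lx(1) s] lx(1) r D(2)[OF l]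
        by (auto simp: residual_def)
      then show "tens R M K (snd l x \<odot>\<^bsub>M\<^esub> fst l) (qfrac R I \<one> s) = \<zero>\<^bsub>tensor_module R M K\<^esub>"
        using tens_balanced[OF Mm module_residue_field lx q] tens_zero_right[OF Mm module_residue_field lx(2)] by simp
    qed
    then show ?thesis using D(4)[OF x] by simp
  qed
qed

text \<open>Nakayama's lemma at the prime \<open>I\<close>, with denominators outside \<open>I\<close> instead of a localisation: the
  \<open>z l\<close> are eliminated one after the other.\<close>

lemma elimination:
  fixes M :: "('a, 'm) module"
  assumes M: "module R M" and B: "\<zero>\<^bsub>M\<^esub> \<in> B" "B \<subseteq> carrier M" "\<And>x y. x \<in> B \<Longrightarrow> y \<in> B \<Longrightarrow> x \<oplus>\<^bsub>M\<^esub> y \<in> B"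
    "\<And>r x. r \<in> carrier R \<Longrightarrow> x \<in> B \<Longrightarrow> r \<odot>\<^bsub>M\<^esub> x \<in> B"
    and z: "\<And>l. l \<in> set L \<Longrightarrow> z l \<in> carrier M"
    and rel: "\<And>l. l \<in> set L \<Longrightarrow> \<exists>w\<in>carrier R - I. \<exists>b\<in>B. \<exists>c. (\<forall>k. c k \<in> I) \<and>
      w \<odot>\<^bsub>M\<^esub> z l = b \<oplus>\<^bsub>M\<^esub> msum M (\<lambda>k. c k \<odot>\<^bsub>M\<^esub> z k) L"
  shows "\<exists>t\<in>carrier R - I. \<forall>l\<in>set L. t \<odot>\<^bsub>M\<^esub> z l \<in> B"
  using z rel
proof (induction L)
  case Nil
  show ?case using one_notin by auto
next
  case (Cons a L)
  interpret M: module R M by fact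
  have za: "z a \<in> carrier M" and zl: "\<And>l. l \<in> set L \<Longrightarrow> z l \<in> carrier M" using Cons.prems(1) by auto
  have Icar: "\<And>x. x \<in> I \<Longrightarrow> x \<in> carrier R" by (rule a_Hcarr)
  have Bc: "\<And>b. b \<in> B \<Longrightarrow> b \<in> carrier M" using B(2) by blast
  define S where "S c = msum M (\<lambda>k. c k \<odot>\<^bsub>M\<^esub> z k) L" for c
  have Sc: "S c \<in> carrier M" if "\<forall>k. c k \<in> I" for c
    unfolding S_def using that zl Icar by (intro M.msum_closed) auto
  have Sadd: "S c \<oplus>\<^bsub>M\<^esub> S d = S (\<lambda>k. c k \<oplus> d k)" if "\<forall>k. c k \<in> I" "\<forall>k. d k \<in> I" for c d
  proof -
    have "S (\<lambda>k. c k \<oplus> d k) = msum M (\<lambda>k. c k \<odot>\<^bsub>M\<^esub> z k \<oplus>\<^bsub>M\<^esub> d k \<odot>\<^bsub>M\<^esub> z k) L"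
      unfolding S_def using that zl Icar by (intro msum_cong) (simp add: M.smult_l_distr)
    also have "\<dots> = S c \<oplus>\<^bsub>M\<^esub> S d"
      unfolding S_def using that zl Icar by (intro M.msum_add) auto
    finally show ?thesis by simp
  qed
  have Ssm: "r \<odot>\<^bsub>M\<^esub> S c = S (\<lambda>k. r \<otimes> c k)" if "\<forall>k. c k \<in> I" "r \<in> carrier R" for c r
  proof -
    have "r \<odot>\<^bsub>M\<^esub> S c = msum M (\<lambda>k. r \<odot>\<^bsub>M\<^esub> (c k \<odot>\<^bsub>M\<^esub> z k)) L"
      unfolding S_def using that zl Icar
      by (intro module_hom_msum[OF module_hom_scalar[OF M that(2)]]) (auto simp: M.abelian_group_axioms)
    also have "\<dots> = S (\<lambda>k. r \<otimes> c k)"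
      unfolding S_def using that zl Icar by (intro msum_cong) (simp add: M.smult_assoc1)
    finally show ?thesis .
  qed
  obtain w b c where w: "w \<in> carrier R - I" "b \<in> B" "\<forall>k. c k \<in> I" "w \<odot>\<^bsub>M\<^esub> z a = b \<oplus>\<^bsub>M\<^esub> (c a \<odot>\<^bsub>M\<^esub> z a \<oplus>\<^bsub>M\<^esub> S c)"
    using Cons.prems(2)[of a] unfolding S_def by auto
  \<comment> \<open>\<open>c a\<close> lies in \<open>I\<close> and \<open>w\<close> does not, so
    \<open>v\<close> is again an admissible denominator, and the relation for \<open>z a\<close> can
    be solved for \<open>v\<close> times \<open>z a\<close>.\<close>
  define v where "v = w \<ominus> c a"
  have ca: "c a \<in> carrier R" using w Icar by blast
  have vR: "v \<in> carrier R" using w ca by (simp add: v_def)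
  have "v \<oplus> c a = w" using w ca by (simp add: v_def a_minus_def a_assoc l_neg)
  then have v: "v \<in> carrier R - I"
    using vR w(1,3) additive_subgroup.a_closed[OF is_additive_subgroup] by blast
  have va: "v \<odot>\<^bsub>M\<^esub> z a = b \<oplus>\<^bsub>M\<^esub> S c"
  proof -
    have "v \<odot>\<^bsub>M\<^esub> z a = w \<odot>\<^bsub>M\<^esub> z a \<oplus>\<^bsub>M\<^esub> \<ominus>\<^bsub>M\<^esub> (c a \<odot>\<^bsub>M\<^esub> z a)"
      unfolding v_def a_minus_def using w ca za by (simp add: M.smult_l_distr M.smult_l_minus)
    then show ?thesis
      unfolding w(4) using Bc[OF w(2)] ca za Sc[OF w(3)] by (simp add: M.a_ac M.r_neg)
  qed
  have "\<exists>t\<in>carrier R - I. \<forall>l\<in>set L. t \<odot>\<^bsub>M\<^esub> z l \<in> B"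
  proof (rule Cons.IH[OF zl])
    fix l assume l: "l \<in> set L"
    obtain u e d where u: "u \<in> carrier R - I" "e \<in> B" "\<forall>k. d k \<in> I" "u \<odot>\<^bsub>M\<^esub> z l = e \<oplus>\<^bsub>M\<^esub> (d a \<odot>\<^bsub>M\<^esub> z a \<oplus>\<^bsub>M\<^esub> S d)"
      using Cons.prems(2)[of l] l unfolding S_def by auto
    have da: "d a \<in> carrier R" using u Icar by blast
    have cI: "\<forall>k. d a \<otimes> c k \<in> I" "\<forall>k. v \<otimes> d k \<in> I" using w(3) u(3) da vR I_l_closed by auto
    \<comment> \<open>Multiplying by \<open>v\<close> allows the substitution of \<open>va\<close>;
      the resulting relation no longer involves \<open>z a\<close>, and its coefficients stay in
      \<open>I\<close>.\<close>
    have "(v \<otimes> u) \<odot>\<^bsub>M\<^esub> z l = v \<odot>\<^bsub>M\<^esub> (e \<oplus>\<^bsub>M\<^esub> (d a \<odot>\<^bsub>M\<^esub> z a \<oplus>\<^bsub>M\<^esub> S d))"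
      using u(1,4) vR zl[OF l] by (simp add: M.smult_assoc1)
    also have "\<dots> = v \<odot>\<^bsub>M\<^esub> e \<oplus>\<^bsub>M\<^esub> (d a \<odot>\<^bsub>M\<^esub> (v \<odot>\<^bsub>M\<^esub> z a) \<oplus>\<^bsub>M\<^esub> S (\<lambda>k. v \<otimes> d k))"
      using vR da za Bc[OF u(2)] Sc[OF u(3)] by (simp add: M.smult_r_distr Ssm[OF u(3) vR] m_comm flip: M.smult_assoc1)
    also have "\<dots> = (v \<odot>\<^bsub>M\<^esub> e \<oplus>\<^bsub>M\<^esub> d a \<odot>\<^bsub>M\<^esub> b) \<oplus>\<^bsub>M\<^esub> (S (\<lambda>k. d a \<otimes> c k) \<oplus>\<^bsub>M\<^esub> S (\<lambda>k. v \<otimes> d k))"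
      unfolding va using vR da za Bc[OF u(2)] Bc[OF w(2)] Sc[OF w(3)] Sc[OF cI(1)] Sc[OF cI(2)]
      by (simp add: M.smult_r_distr Ssm[OF w(3) da] M.a_assoc)
    also have "S (\<lambda>k. d a \<otimes> c k) \<oplus>\<^bsub>M\<^esub> S (\<lambda>k. v \<otimes> d k) = S (\<lambda>k. d a \<otimes> c k \<oplus> v \<otimes> d k)"
      by (rule Sadd[OF cI])
    finally have eq: "(v \<otimes> u) \<odot>\<^bsub>M\<^esub> z l = (v \<odot>\<^bsub>M\<^esub> e \<oplus>\<^bsub>M\<^esub> d a \<odot>\<^bsub>M\<^esub> b) \<oplus>\<^bsub>M\<^esub> S (\<lambda>k. d a \<otimes> c k \<oplus> v \<otimes> d k)" .
    have "\<forall>k. d a \<otimes> c k \<oplus> v \<otimes> d k \<in> I" using cI additive_subgroup.a_closed[OF is_additive_subgroup] by blast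
    then have "(\<forall>k. d a \<otimes> c k \<oplus> v \<otimes> d k \<in> I) \<and> (v \<otimes> u) \<odot>\<^bsub>M\<^esub> z l =
        (v \<odot>\<^bsub>M\<^esub> e \<oplus>\<^bsub>M\<^esub> d a \<odot>\<^bsub>M\<^esub> b) \<oplus>\<^bsub>M\<^esub> msum M (\<lambda>k. (d a \<otimes> c k \<oplus> v \<otimes> d k) \<odot>\<^bsub>M\<^esub> z k) L"
      using eq unfolding S_def by simp
    moreover have "v \<odot>\<^bsub>M\<^esub> e \<oplus>\<^bsub>M\<^esub> d a \<odot>\<^bsub>M\<^esub> b \<in> B" by (intro B(3,4) vR da u(2) w(2))
    ultimately show "\<exists>w\<in>carrier R - I. \<exists>b\<in>B. \<exists>c. (\<forall>k. c k \<in> I) \<and> w \<odot>\<^bsub>M\<^esub> z l = b \<oplus>\<^bsub>M\<^esub> msum M (\<lambda>k. c k \<odot>\<^bsub>M\<^esub> z k) L"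
      using prime_mult[OF v u(1)] by (intro bexI exI)
  qed
  then obtain t where t: "t \<in> carrier R - I" "\<And>l. l \<in> set L \<Longrightarrow> t \<odot>\<^bsub>M\<^esub> z l \<in> B" by blast
  have tR: "t \<in> carrier R" using t by blast
  have St: "t \<odot>\<^bsub>M\<^esub> S c \<in> B"
  proof -
    have "msum M (\<lambda>k. c k \<odot>\<^bsub>M\<^esub> (t \<odot>\<^bsub>M\<^esub> z k)) L' \<in> B" if "set L' \<subseteq> set L" for L'
      using that by (induction L') (use B t(2) w(3) Icar in auto)
    moreover have "t \<odot>\<^bsub>M\<^esub> S c = msum M (\<lambda>k. c k \<odot>\<^bsub>M\<^esub> (t \<odot>\<^bsub>M\<^esub> z k)) L"
      unfolding Ssm[OF w(3) tR] unfolding S_def using w(3) Icar tR zl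
      by (intro msum_cong) (simp add: m_comm flip: M.smult_assoc1)
    ultimately show ?thesis by simp
  qed
  have "(t \<otimes> v) \<odot>\<^bsub>M\<^esub> z l \<in> B" if "l \<in> set (a # L)" for l
  proof (cases "l \<in> set L")
    case True
    then have "(t \<otimes> v) \<odot>\<^bsub>M\<^esub> z l = v \<odot>\<^bsub>M\<^esub> (t \<odot>\<^bsub>M\<^esub> z l)"
      using tR vR zl by (simp add: m_comm flip: M.smult_assoc1)
    then show ?thesis using B(4)[OF vR t(2)[OF True]] by simp
  next
    case False
    then have "(t \<otimes> v) \<odot>\<^bsub>M\<^esub> z l = t \<odot>\<^bsub>M\<^esub> b \<oplus>\<^bsub>M\<^esub> t \<odot>\<^bsub>M\<^esub> S c"
      using that tR vR za va Bc[OF w(2)] Sc[OF w(3)] by (simp add: M.smult_assoc1 M.smult_r_distr)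
    then show ?thesis using B(3)[OF B(4)[OF tR w(2)] St] by simp
  qed
  then show ?case using prime_mult[OF t(1) v] by blast
qed

end

section \<open>Acyclicity at a prime and null-homotopic scalars\<close>

context primeideal
begin

text \<open>Together with \<open>tensor_residue_elem\<close> this removes tensors from the cocycle
  condition: the differential has to vanish modulo the prime.\<close>

lemma tensor_cocycle_iff:
  assumes X: "fgp_complex R X" and y: "y \<in> carrier (obj X n)" and s: "s \<in> carrier R - I"
  shows "tens R (obj X n) K y (qfrac R I \<one> s) \<in> cocycles (tensor_complex R X K) n \<longleftrightarrow>
    diff X n y \<in> residual R I (obj X (n + 1))"
proof -
  have Xm: "module_complex R X" and F: "fgp R (obj X (n + 1))" using X by (auto simp: fgp_complex_def)
  note M = module_complexD(1)[OF Xm]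
  note q = qfrac_closed[OF one_closed s]
  show ?thesis
    using tens_closed[OF M module_residue_field y q] tensor_map_tens[OF M M module_residue_field
      module_complexD(2)[OF Xm] y q]
      tens_residue_eq_zero_iff[OF F module_complex_closed(1)[OF Xm y] s]
    by (simp add: cocycles_def tensor_complex_def)
qed

text \<open>An element outside \<open>I\<close> is invertible in the residue field, so a
  null-homotopy of \<open>s\<close> becomes a contraction of the tensor complex. On elements, s y is
  d h y + h d y, and the tensor of h d y vanishes because d y is residual.\<close>

lemma acyclic_tensor_if_hann:
  assumes X: "fgp_complex R X" and s: "s \<in> hann R X" "s \<notin> I"
  shows "cocycles (tensor_complex R X K) n \<subseteq> coboundaries (tensor_complex R X K) n"
proof
  have Xm: "module_complex R X" and F: "fgp R (obj X n)" using X by (auto simp: fgp_complex_def)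
  note M = module_complexD(1)[OF Xm]
  have sR: "s \<in> carrier R" using s by (simp add: hann_def)
  have hom: "homotopic R X X (\<lambda>n x. s \<odot>\<^bsub>obj X n\<^esub> x) (\<lambda>n x. \<zero>\<^bsub>obj X n\<^esub>)" using s(1) by (simp add: hann_def)
  obtain h where h: "\<And>n. h n \<in> module_hom R (obj X n) (obj X (n - 1))"
    "\<And>n x. x \<in> carrier (obj X n) \<Longrightarrow> s \<odot>\<^bsub>obj X n\<^esub> x =
      \<zero>\<^bsub>obj X n\<^esub> \<oplus>\<^bsub>obj X n\<^esub> (diff X (n - 1) (h n x) \<oplus>\<^bsub>obj X n\<^esub> h (n + 1) (diff X n x))"
    using homotopicE[OF hom Xm Xm module_hom_scalar[OF M sR] module_hom_const_zero[OF M]] by blast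
  fix c assume c: "c \<in> cocycles (tensor_complex R X K) n"
  then have "c \<in> carrier (tensor_module R (obj X n) K)" by (simp add: cocycles_def tensor_complex_def)
  then obtain y t where y: "y \<in> carrier (obj X n)" "t \<in> carrier R - I" "c = tens R (obj X n) K y (qfrac R I \<one> t)"
    using tensor_residue_elem[OF M] by blast
  have dy: "diff X n y \<in> residual R I (obj X (n + 1))"
    using c unfolding y(3) tensor_cocycle_iff[OF X y(1,2)] .
  have h1: "h (n + 1) \<in> module_hom R (obj X (n + 1)) (obj X n)" using h(1)[of "n + 1"] by simp
  have hdy: "h (n + 1) (diff X n y) \<in> residual R I (obj X n)" by (rule residual_hom[OF h1 dy])
  have hc: "h n y \<in> carrier (obj X (n - 1))" "diff X (n - 1) (h n y) \<in> carrier (obj X n)"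
    "h (n + 1) (diff X n y) \<in> carrier (obj X n)"
    using homotopy_term_closed[OF Xm Xm h(1) y(1)] by auto
  have st: "s \<otimes> t \<in> carrier R - I" using prime_mult[of s t] s(2) sR y(2) by blast
  note q = qfrac_closed[OF one_closed st]
  interpret T: abelian_group "tensor_module R (obj X n) K" by (rule abelian_group_tensor[OF M module_residue_field])
  interpret A: module R "obj X n" by (rule M)
  note tc = tens_closed[OF M module_residue_field _ q]
  have "c = tens R (obj X n) K (s \<odot>\<^bsub>obj X n\<^esub> y) (qfrac R I \<one> (s \<otimes> t))"
    unfolding y(3) by (rule tens_residue_scale[OF M y(1,2), symmetric]) (use s(2) sR in blast)
  also have "\<dots> = tens R (obj X n) K (diff X (n - 1) (h n y)) (qfrac R I \<one> (s \<otimes> t)) \<oplus>\<^bsub>tensor_module R (obj X n) K\<^esub>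
      tens R (obj X n) K (h (n + 1) (diff X n y)) (qfrac R I \<one> (s \<otimes> t))"
    unfolding h(2)[OF y(1)] using hc q by (simp add: tens_add_left[OF M module_residue_field])
  also have "\<dots> = tens R (obj X n) K (diff X (n - 1) (h n y)) (qfrac R I \<one> (s \<otimes> t))"
    using tens_residue_eq_zero_iff[OF F hc(3) st] hdy tc[OF hc(2)] by simp
  also have "\<dots> = tensor_map R (obj X n) K (diff X (n - 1)) (tens R (obj X (n - 1)) K (h n y) (qfrac R I \<one> (s \<otimes> t)))"
    by (rule tensor_map_tens[OF M M module_residue_field module_complexD'(1)[OF Xm] hc(1) q, symmetric])
  finally show "c \<in> coboundaries (tensor_complex R X K) n"
    using tens_closed[OF M module_residue_field hc(1) q] by (auto simp: coboundaries_def tensor_complex_def)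
qed

text \<open>Exactness of the tensor complex with the denominators cleared: some factor outside
  \<open>I\<close> turns a cocycle into a coboundary up to a residual element.\<close>

lemma cocycle_lifts_mod_residual:
  assumes X: "fgp_complex R X" and ac: "\<And>n. cocycles (tensor_complex R X K) n \<subseteq> coboundaries (tensor_complex R X K) n"
    and z: "z \<in> cocycles X n"
  shows "\<exists>u\<in>carrier R - I. \<exists>w\<in>carrier (obj X (n - 1)). u \<odot>\<^bsub>obj X n\<^esub> z \<ominus>\<^bsub>obj X n\<^esub> diff X (n - 1) w \<in> residual R I (obj X n)"
proof -
  have Xm: "module_complex R X" and F: "fgp R (obj X n)" using X by (auto simp: fgp_complex_def)
  note M = module_complexD(1)[OF Xm]
  note d = module_complexD'(1)[OF Xm]
  have zc: "z \<in> carrier (obj X n)" "diff X n z = \<zero>\<^bsub>obj X (n + 1)\<^esub>" using z by (auto simp: cocycles_def)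
  interpret A1: module R "obj X (n + 1)" by (rule M)
  have "\<zero>\<^bsub>obj X (n + 1)\<^esub> \<in> residual R I (obj X (n + 1))"
    unfolding residual_def
  proof (intro CollectI conjI ballI)
    fix \<phi> assume "\<phi> \<in> module_hom R (obj X (n + 1)) (regular_module R)"
    then have "\<phi> \<zero>\<^bsub>obj X (n + 1)\<^esub> = \<zero>\<^bsub>regular_module R\<^esub>"
      by (rule module_hom_zero[OF _ A1.abelian_group_axioms module_abelian_group[OF module_regular]])
    then show "\<phi> \<zero>\<^bsub>obj X (n + 1)\<^esub> \<in> I"
      using additive_subgroup.zero_closed[OF is_additive_subgroup] by simp
  qed simp
  then have "tens R (obj X n) K z (qfrac R I \<one> \<one>) \<in> cocycles (tensor_complex R X K) n"
    unfolding tensor_cocycle_iff[OF X zc(1) one_notin] zc(2) .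
  then obtain t where t: "t \<in> carrier (tensor_module R (obj X (n - 1)) K)"
    "tens R (obj X n) K z (qfrac R I \<one> \<one>) = tensor_map R (obj X n) K (diff X (n - 1)) t"
    using ac by (force simp: coboundaries_def tensor_complex_def)
  obtain w u where w: "w \<in> carrier (obj X (n - 1))" "u \<in> carrier R - I" "t = tens R (obj X (n - 1)) K w (qfrac R I \<one> u)"
    using tensor_residue_elem[OF M t(1)] by blast
  note q = qfrac_closed[OF one_closed w(2)]
  interpret A: module R "obj X n" by (rule M)
  interpret T: abelian_group "tensor_module R (obj X n) K" by (rule abelian_group_tensor[OF M module_residue_field])
  have dw: "diff X (n - 1) w \<in> carrier (obj X n)" by (rule module_complex_closed(2)[OF Xm w(1)])
  have uz: "u \<odot>\<^bsub>obj X n\<^esub> z \<in> carrier (obj X n)" using w(2) zc(1) by simp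
  have "tens R (obj X n) K (u \<odot>\<^bsub>obj X n\<^esub> z) (qfrac R I \<one> u) = tens R (obj X n) K z (qfrac R I \<one> \<one>)"
    using tens_residue_scale[OF M zc(1) one_notin w(2)] w(2) by simp
  also have "\<dots> = tens R (obj X n) K (diff X (n - 1) w) (qfrac R I \<one> u)"
    unfolding t(2) w(3) by (rule tensor_map_tens[OF M M module_residue_field d w(1) q])
  finally have eq: "tens R (obj X n) K (u \<odot>\<^bsub>obj X n\<^esub> z) (qfrac R I \<one> u) =
    tens R (obj X n) K (diff X (n - 1) w) (qfrac R I \<one> u)" .
  have "tens R (obj X n) K (u \<odot>\<^bsub>obj X n\<^esub> z \<ominus>\<^bsub>obj X n\<^esub> diff X (n - 1) w) (qfrac R I \<one> u) =
      tens R (obj X n) K (u \<odot>\<^bsub>obj X n\<^esub> z) (qfrac R I \<one> u) \<ominus>\<^bsub>tensor_module R (obj X n) K\<^esub>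
      tens R (obj X n) K (diff X (n - 1) w) (qfrac R I \<one> u)"
    unfolding a_minus_def using uz dw q
    by (simp add: tens_add_left[OF M module_residue_field] tens_minus_left[OF M module_residue_field])
  also have "\<dots> = \<zero>\<^bsub>tensor_module R (obj X n) K\<^esub>"
    unfolding eq using tens_closed[OF M module_residue_field dw q] by (simp add: a_minus_def T.r_neg)
  finally have "u \<odot>\<^bsub>obj X n\<^esub> z \<ominus>\<^bsub>obj X n\<^esub> diff X (n - 1) w \<in> residual R I (obj X n)"
    using tens_residue_eq_zero_iff[OF F _ w(2)] uz dw by simp
  then show ?thesis using w by blast
qed

text \<open>The map \<open>s - h d\<close> sends degree \<open>n\<close> into the cocycles, and by acyclicity a multiple of it, with
  a factor outside \<open>I\<close>, lifts along \<open>d\<close>.\<close>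

lemma contraction_step:
  assumes X: "fgp_complex R X" and ac: "\<And>n. cocycles (tensor_complex R X K) n \<subseteq> coboundaries (tensor_complex R X K) n"
    and s: "s \<in> carrier R - I" and h: "\<And>m. h m \<in> module_hom R (obj X m) (obj X (m - 1))"
    and contr: "\<And>m x. m > n \<Longrightarrow> x \<in> carrier (obj X m) \<Longrightarrow>
      s \<odot>\<^bsub>obj X m\<^esub> x = diff X (m - 1) (h m x) \<oplus>\<^bsub>obj X m\<^esub> h (m + 1) (diff X m x)"
  shows "\<exists>s'\<in>carrier R - I. \<exists>h'. (\<forall>m. h' m \<in> module_hom R (obj X m) (obj X (m - 1))) \<and>
    (\<forall>m x. m \<ge> n \<and> x \<in> carrier (obj X m) \<longrightarrow>
      s' \<odot>\<^bsub>obj X m\<^esub> x = diff X (m - 1) (h' m x) \<oplus>\<^bsub>obj X m\<^esub> h' (m + 1) (diff X m x))"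
proof -
  have Xm: "module_complex R X" and F: "fgp R (obj X n)" using X by (auto simp: fgp_complex_def)
  note M = module_complexD(1)[OF Xm] and G = module_complex_group[OF Xm]
  note d = module_complexD(2)[OF Xm] module_complexD'(1)[OF Xm]
  note dc = module_complex_closed[OF Xm]
  note AB = ab_complex_module[OF Xm]
  have sR: "s \<in> carrier R" using s by blast
  obtain L where L: "dual_basis R (obj X n) L" using F by (auto simp: fgp_def)
  note D = dual_basisD[OF L]
  interpret A: module R "obj X n" by (rule M)
  interpret A1: module R "obj X (n + 1)" by (rule M)
  have h1: "h (n + 1) \<in> module_hom R (obj X (n + 1)) (obj X n)" using h[of "n + 1"] by simp
  have hd: "(\<lambda>x. h (n + 1) (diff X n x)) \<in> module_hom R (obj X n) (obj X n)"
    by (rule module_hom_comp[OF d(1) h1])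
  define \<pi> where "\<pi> = (\<lambda>x. s \<odot>\<^bsub>obj X n\<^esub> x \<ominus>\<^bsub>obj X n\<^esub> h (n + 1) (diff X n x))"
  have \<pi>: "\<pi> \<in> module_hom R (obj X n) (obj X n)"
    unfolding \<pi>_def a_minus_def
    by (rule module_hom_plus[OF M module_hom_scalar[OF M sR] module_hom_neg[OF M hd]])
  have split: "s \<odot>\<^bsub>obj X n\<^esub> x = \<pi> x \<oplus>\<^bsub>obj X n\<^esub> h (n + 1) (diff X n x)" if "x \<in> carrier (obj X n)" for x
    unfolding \<pi>_def using that sR module_hom_closed[OF hd that] by (simp add: a_minus_def A.a_assoc A.l_neg)
  have \<pi>Z: "\<pi> x \<in> cocycles X n" if x: "x \<in> carrier (obj X n)" for x
  proof -
    have dx: "diff X n x \<in> carrier (obj X (n + 1))" by (rule dc(1)[OF x])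
    interpret A2: module R "obj X (n + 2)" by (rule M)
    have "h (n + 2) \<in> module_hom R (obj X (n + 2)) (obj X (n + 1))" using h[of "n + 2"] by (simp add: add.commute)
    then have hz: "h (n + 2) \<zero>\<^bsub>obj X (n + 2)\<^esub> = \<zero>\<^bsub>obj X (n + 1)\<^esub>" by (rule module_hom_zero[OF _ G G])
    \<comment> \<open>The contraction in degree \<open>n + 1\<close>, applied to
      \<open>diff X n x\<close>, loses its second term because d d = 0.\<close>
    have "s \<odot>\<^bsub>obj X (n + 1)\<^esub> diff X n x = diff X n (h (n + 1) (diff X n x))"
    proof -
      have "s \<odot>\<^bsub>obj X (n + 1)\<^esub> diff X n x = diff X n (h (n + 1) (diff X n x)) \<oplus>\<^bsub>obj X (n + 1)\<^esub> h (n + 2) \<zero>\<^bsub>obj X (n + 2)\<^esub>"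
        using contr[of "n + 1" "diff X n x"] dx module_complexD(3)[OF Xm x] by (simp add: add.assoc)
      then show ?thesis unfolding hz using dc(1)[OF module_hom_closed[OF hd x]] by simp
    qed
    moreover have "diff X n (\<pi> x) = s \<odot>\<^bsub>obj X (n + 1)\<^esub> diff X n x \<ominus>\<^bsub>obj X (n + 1)\<^esub> diff X n (h (n + 1) (diff X n x))"
      unfolding \<pi>_def using module_hom_diff[OF d(1) G G _ module_hom_closed[OF hd x]] sR x
        module_hom_smult[OF d(1) sR x] by simp
    ultimately have "diff X n (\<pi> x) = \<zero>\<^bsub>obj X (n + 1)\<^esub>"
      using dx sR A1.smult_closed[OF sR dx] by (simp add: a_minus_def A1.r_neg)
    then show ?thesis using module_hom_closed[OF \<pi> x] by (simp add: cocycles_def)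
  qed
  have \<pi>s: "\<pi> x = s \<odot>\<^bsub>obj X n\<^esub> x" if "x \<in> cocycles X n" for x
    using that sR module_hom_zero[OF h1 G G] by (simp add: \<pi>_def cocycles_def a_minus_def A.a_inv_zero)
  \<comment> \<open>The coboundaries take the part of the submodule \<open>B\<close>, and the images
    of the generators under \<open>\<pi>\<close> are the unknowns to be eliminated.\<close>
  have "\<exists>t\<in>carrier R - I. \<forall>l\<in>set L. t \<odot>\<^bsub>obj X n\<^esub> \<pi> (fst l) \<in> coboundaries X n"
  proof (rule elimination[OF M])
    note B = coboundaries_group[OF AB]
    show "\<zero>\<^bsub>obj X n\<^esub> \<in> coboundaries X n" "coboundaries X n \<subseteq> carrier (obj X n)" by (rule B)+
    show "x \<oplus>\<^bsub>obj X n\<^esub> y \<in> coboundaries X n" if "x \<in> coboundaries X n" "y \<in> coboundaries X n" for x y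
      by (rule B(4)[OF that])
    interpret A': module R "obj X (n - 1)" by (rule M)
    show sB: "r \<odot>\<^bsub>obj X n\<^esub> x \<in> coboundaries X n" if "r \<in> carrier R" "x \<in> coboundaries X n" for r x
      using that unfolding coboundaries_def by (auto simp flip: module_hom_smult[OF d(2)])
    fix l assume l: "l \<in> set L"
    show "\<pi> (fst l) \<in> carrier (obj X n)" by (rule module_hom_closed[OF \<pi> D(1)[OF l]])
    define z where "z = \<pi> (fst l)"
    have z: "z \<in> cocycles X n" unfolding z_def by (rule \<pi>Z[OF D(1)[OF l]])
    have zc: "z \<in> carrier (obj X n)" using z by (simp add: cocycles_def)
    obtain u w where u: "u \<in> carrier R - I" and w: "w \<in> carrier (obj X (n - 1))"
      and v: "u \<odot>\<^bsub>obj X n\<^esub> z \<ominus>\<^bsub>obj X n\<^esub> diff X (n - 1) w \<in> residual R I (obj X n)"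
      using cocycle_lifts_mod_residual[OF X ac z] by blast
    define v where "v = u \<odot>\<^bsub>obj X n\<^esub> z \<ominus>\<^bsub>obj X n\<^esub> diff X (n - 1) w"
    have uR: "u \<in> carrier R" using u by blast
    have dw: "diff X (n - 1) w \<in> coboundaries X n" using w by (auto simp: coboundaries_def)
    have dwc: "diff X (n - 1) w \<in> carrier (obj X n)" by (rule dc(2)[OF w])
    have vc: "v \<in> carrier (obj X n)" unfolding v_def using uR zc dwc by simp
    have uz: "u \<odot>\<^bsub>obj X n\<^esub> z = diff X (n - 1) w \<oplus>\<^bsub>obj X n\<^esub> v"
      using A.minus_eq_iff_add[of "u \<odot>\<^bsub>obj X n\<^esub> z" "diff X (n - 1) w" v] vc dwc uR zc v_def by simp
    \<comment> \<open>The residual error \<open>v\<close> is fed into \<open>\<pi>\<close>, which is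
      multiplication by \<open>s\<close> on cocycles. Expanding \<open>\<pi> v\<close> in the dual
      basis gives a combination of the \<open>\<pi> (fst k)\<close> with coefficients in
      \<open>I\<close>, which is a relation for \<open>elimination\<close>.\<close>
    have "(u \<otimes> s) \<odot>\<^bsub>obj X n\<^esub> z = \<pi> (u \<odot>\<^bsub>obj X n\<^esub> z)"
      using module_hom_smult[OF \<pi> uR zc] \<pi>s[OF z] uR sR zc by (simp add: A.smult_assoc1)
    also have "\<dots> = s \<odot>\<^bsub>obj X n\<^esub> diff X (n - 1) w \<oplus>\<^bsub>obj X n\<^esub> \<pi> v"
      unfolding uz module_hom_add[OF \<pi> dwc vc] using \<pi>s[OF subsetD[OF B(1) dw]] by simp
    also have "\<pi> v = msum (obj X n) (\<lambda>k. snd k v \<odot>\<^bsub>obj X n\<^esub> \<pi> (fst k)) L"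
      by (rule dual_basis_hom_expand[OF L M M \<pi> vc])
    \<comment> \<open>\<open>elimination\<close> wants coefficients in \<open>I\<close> for every
      index, so they are set to zero outside the list.\<close>
    also have "\<dots> = msum (obj X n) (\<lambda>k. (if k \<in> set L then snd k v else \<zero>) \<odot>\<^bsub>obj X n\<^esub> \<pi> (fst k)) L"
      by (rule msum_cong) simp
    finally have "(u \<otimes> s) \<odot>\<^bsub>obj X n\<^esub> \<pi> (fst l) = s \<odot>\<^bsub>obj X n\<^esub> diff X (n - 1) w \<oplus>\<^bsub>obj X n\<^esub>
      msum (obj X n) (\<lambda>k. (if k \<in> set L then snd k v else \<zero>) \<odot>\<^bsub>obj X n\<^esub> \<pi> (fst k)) L"
      unfolding z_def .
    moreover have "\<forall>k. (if k \<in> set L then snd k v else \<zero>) \<in> I"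
      using v D(2) additive_subgroup.zero_closed[OF is_additive_subgroup] unfolding v_def[symmetric] residual_def
        by auto
    ultimately show "\<exists>w\<in>carrier R - I. \<exists>b\<in>coboundaries X n. \<exists>c. (\<forall>k. c k \<in> I) \<and>
        w \<odot>\<^bsub>obj X n\<^esub> \<pi> (fst l) = b \<oplus>\<^bsub>obj X n\<^esub> msum (obj X n) (\<lambda>k. c k \<odot>\<^bsub>obj X n\<^esub> \<pi> (fst k)) L"
      using prime_mult[OF u s] sB[OF sR dw]
      by (intro bexI[of _ "u \<otimes> s"] bexI[of _ "s \<odot>\<^bsub>obj X n\<^esub> diff X (n - 1) w"]
          exI[of _ "\<lambda>k. if k \<in> set L then snd k v else \<zero>"] conjI) auto
  qed
  then obtain t where t: "t \<in> carrier R - I" "\<And>l. l \<in> set L \<Longrightarrow> t \<odot>\<^bsub>obj X n\<^esub> \<pi> (fst l) \<in> coboundaries X n" by blast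
  have tR: "t \<in> carrier R" using t by blast
  have "\<exists>b\<in>carrier (obj X (n - 1)). diff X (n - 1) b = t \<odot>\<^bsub>obj X n\<^esub> \<pi> (fst l)" if "l \<in> set L" for l
    using t(2)[OF that] unfolding coboundaries_def by (metis imageE)
  then obtain g where g: "g \<in> module_hom R (obj X n) (obj X (n - 1))"
    "\<And>x. x \<in> carrier (obj X n) \<Longrightarrow> diff X (n - 1) (g x) = t \<odot>\<^bsub>obj X n\<^esub> \<pi> x"
    using dual_basis_lift[OF L M M M d(2) module_hom_times[OF M \<pi> tR]] by blast
  \<comment> \<open>The old homotopy is scaled by \<open>t\<close> to match the new factor
    \<open>t \<otimes> s\<close>; the values below \<open>n\<close> are placeholders, about which
    the conclusion says nothing.\<close>
  define h' where "h' m = (if m > n then (\<lambda>x. t \<odot>\<^bsub>obj X (m - 1)\<^esub> h m x) else if m =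
    n then g else (\<lambda>x. \<zero>\<^bsub>obj X (m - 1)\<^esub>))" for m
  have h': "h' m \<in> module_hom R (obj X m) (obj X (m - 1))" for m
    unfolding h'_def using module_hom_times[OF M h tR] g(1) module_hom_const_zero[OF M] by auto
  have "(t \<otimes> s) \<odot>\<^bsub>obj X m\<^esub> x = diff X (m - 1) (h' m x) \<oplus>\<^bsub>obj X m\<^esub> h' (m + 1) (diff X m x)"
    if m: "m \<ge> n" and x: "x \<in> carrier (obj X m)" for m x
  proof (cases "m = n")
    case True
    have "(t \<otimes> s) \<odot>\<^bsub>obj X n\<^esub> x = t \<odot>\<^bsub>obj X n\<^esub> \<pi> x \<oplus>\<^bsub>obj X n\<^esub> t \<odot>\<^bsub>obj X n\<^esub> h (n + 1) (diff X n x)"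
      using x True tR sR split[of x] module_hom_closed[OF \<pi>, of x] module_hom_closed[OF hd, of x]
      by (simp add: A.smult_assoc1 A.smult_r_distr)
    then show ?thesis using True x g(2) by (simp add: h'_def)
  next
    case False
    interpret B: module R "obj X m" by (rule M)
    have "(t \<otimes> s) \<odot>\<^bsub>obj X m\<^esub> x = t \<odot>\<^bsub>obj X m\<^esub> (diff X (m - 1) (h m x) \<oplus>\<^bsub>obj X m\<^esub> h (m + 1) (diff X m x))"
      using contr[of m x] False m x tR sR by (simp add: B.smult_assoc1)
    then show ?thesis
      using False m homotopy_term_closed[OF Xm Xm h x] tR
      by (simp add: h'_def B.smult_r_distr module_hom_smult[OF d(2)])
  qed
  then show ?thesis using prime_mult[OF t(1) s] h' by blast
qed

text \<open>\<open>P n\<close> says that some factor outside \<open>I\<close> is contracted in all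
  degrees above \<open>n\<close>. It is trivial at the upper bound \<open>b\<close>, each use of
  \<open>contraction_step\<close> lowers \<open>n\<close> by one, and below \<open>a\<close> nothing
  is left to do. So finitely many steps give one factor for all degrees.\<close>

lemma hann_if_acyclic_tensor:
  assumes X: "fgp_complex R X" and ac: "\<And>n. cocycles (tensor_complex R X K) n \<subseteq> coboundaries (tensor_complex R X K) n"
  shows "\<exists>s\<in>hann R X. s \<notin> I"
proof -
  have Xm: "module_complex R X" using X by (simp add: fgp_complex_def)
  note M = module_complexD(1)[OF Xm] and G = module_complex_group[OF Xm]
  obtain a b where ab: "\<And>n. n < a \<or> b < n \<Longrightarrow> carrier (obj X n) = {\<zero>\<^bsub>obj X n\<^esub>}"
    using X unfolding fgp_complex_def by blast
  define P where "P n \<longleftrightarrow> (\<exists>s\<in>carrier R - I. \<exists>h. (\<forall>m. h m \<in> module_hom R (obj X m) (obj X (m - 1))) \<and>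
    (\<forall>m x. m > n \<and> x \<in> carrier (obj X m) \<longrightarrow>
      s \<odot>\<^bsub>obj X m\<^esub> x = diff X (m - 1) (h m x) \<oplus>\<^bsub>obj X m\<^esub> h (m + 1) (diff X m x)))" for n
  have triv: "r \<odot>\<^bsub>obj X m\<^esub> x = diff X (m - 1) (h m x) \<oplus>\<^bsub>obj X m\<^esub> h (m + 1) (diff X m x)"
    if "\<And>m. h m \<in> module_hom R (obj X m) (obj X (m - 1))" "m < a \<or> b < m" "x \<in> carrier (obj X m)" "r \<in> carrier R"
      for h m x r
  proof -
    interpret B: module R "obj X m" by (rule M)
    have "r \<odot>\<^bsub>obj X m\<^esub> x \<in> {\<zero>\<^bsub>obj X m\<^esub>}" "diff X (m - 1) (h m x) \<oplus>\<^bsub>obj X m\<^esub> h (m + 1) (diff X m x) \<in> {\<zero>\<^bsub>obj X m\<^esub>}"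
      unfolding ab[OF that(2), symmetric] using homotopy_term_closed[OF Xm Xm that(1,3)] that(3,4) by auto
    then show ?thesis by simp
  qed
  have step: "P (n - 1)" if P: "P n" for n
  proof -
    obtain s h where s: "s \<in> carrier R - I" and h: "\<And>m. h m \<in> module_hom R (obj X m) (obj X (m - 1))"
      and c: "\<And>m x. m > n \<Longrightarrow> x \<in> carrier (obj X m) \<Longrightarrow>
        s \<odot>\<^bsub>obj X m\<^esub> x = diff X (m - 1) (h m x) \<oplus>\<^bsub>obj X m\<^esub> h (m + 1) (diff X m x)"
      using P unfolding P_def by blast
    show ?thesis using contraction_step[OF X ac s h c] unfolding P_def
      by (simp add: int_one_le_iff_zero_less Suc_le_eq zle_diff1_eq[symmetric] flip: zle_diff1_eq)
  qed
  have "P b"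
    unfolding P_def using one_notin module_hom_const_zero[OF M] triv[of "\<lambda>m x. \<zero>\<^bsub>obj X (m - 1)\<^esub>"] one_closed
    by (intro bexI[of _ \<one>] exI[of _ "\<lambda>m x. \<zero>\<^bsub>obj X (m - 1)\<^esub>"]) auto
  then have "P (b - int k)" for k
  proof (induction k)
    case (Suc k)
    then show ?case using step[of "b - int k"] by (simp add: algebra_simps)
  qed simp
  \<comment> \<open>This lowers the threshold to \<open>a - 1\<close>, or leaves it at
    \<open>b\<close> when the interval is empty; in both cases the remaining degrees carry zero
    modules.\<close>
  from this[of "nat (b - a + 1)"] have "P (b - int (nat (b - a + 1)))" .
  then obtain s h where s: "s \<in> carrier R - I" and h: "\<And>m. h m \<in> module_hom R (obj X m) (obj X (m - 1))"
    and c: "\<And>m x. m > b - int (nat (b - a + 1)) \<Longrightarrow> x \<in> carrier (obj X m) \<Longrightarrow>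
      s \<odot>\<^bsub>obj X m\<^esub> x = diff X (m - 1) (h m x) \<oplus>\<^bsub>obj X m\<^esub> h (m + 1) (diff X m x)"
    unfolding P_def by blast
  have sR: "s \<in> carrier R" using s by blast
  have all: "s \<odot>\<^bsub>obj X m\<^esub> x = diff X (m - 1) (h m x) \<oplus>\<^bsub>obj X m\<^esub> h (m + 1) (diff X m x)"
    if x: "x \<in> carrier (obj X m)" for m x
  proof (cases "m > b - int (nat (b - a + 1))")
    case False
    then have "m < a \<or> b < m" by linarith
    then show ?thesis by (rule triv[OF h _ x sR])
  qed (rule c[OF _ x])
  have "homotopic R X X (\<lambda>n x. s \<odot>\<^bsub>obj X n\<^esub> x) (\<lambda>n x. \<zero>\<^bsub>obj X n\<^esub>)"
  proof (rule homotopicI[OF Xm Xm module_hom_scalar[OF M sR] module_hom_const_zero[OF M] h])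
    fix n x assume x: "x \<in> carrier (obj X n)"
    interpret B: module R "obj X n" by (rule M)
    show "s \<odot>\<^bsub>obj X n\<^esub> x = \<zero>\<^bsub>obj X n\<^esub> \<oplus>\<^bsub>obj X n\<^esub> (diff X (n - 1) (h n x) \<oplus>\<^bsub>obj X n\<^esub> h (n + 1) (diff X n x))"
      unfolding all[OF x] using homotopy_term_closed[OF Xm Xm h x] by simp
  qed
  then show ?thesis using s by (auto simp: hann_def)
qed

end

definition vanishing :: "('a, 'r) ring_scheme \<Rightarrow> 'a set \<Rightarrow> 'a set set" where
  "vanishing R J = {p \<in> Spec R. J \<subseteq> p}"

text \<open>By \<open>derived_iso_zero_iff\<close> a prime is in the support when the tensor complex
  fails to be acyclic, and acyclicity means that some element of the ideal lies outside the
  prime.\<close>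

lemma Supp_eq_vanishing:
  assumes R: "cring R" and X: "fgp_complex R X"
  shows "Supp R X = vanishing R (hann R X)"
proof -
  have Xm: "module_complex R X" using X by (simp add: fgp_complex_def)
  have "\<not> derived_iso R (tensor_complex R X (residue_field R p)) zero_complex \<longleftrightarrow> hann R X \<subseteq> p" if "p \<in> Spec R" for p
  proof -
    interpret p: primeideal p R using that by (simp add: Spec_def)
    have "derived_iso R (tensor_complex R X (residue_field R p)) zero_complex \<longleftrightarrow>
        (\<forall>n. cocycles (tensor_complex R X (residue_field R p)) n \<subseteq> coboundaries
          (tensor_complex R X (residue_field R p)) n)"
      by (rule derived_iso_zero_iff[OF R ab_complex_tensor(1)[OF Xm p.module_residue_field]])
        (rule ab_complex_tensor(2)[OF Xm p.module_residue_field])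
    then show ?thesis
      using p.acyclic_tensor_if_hann[OF X] p.hann_if_acyclic_tensor[OF X] by blast
  qed
  then show ?thesis unfolding Supp_def vanishing_def by auto
qed

section \<open>Splitting homotopy idempotents\<close>

text \<open>The isomorphism is returned as a pair of mutually inverse chain maps, so that maps and
  homotopies can be carried across in both directions.\<close>

lemma complex_transport:
  fixes T :: "('a, 'v) cochain_complex" and g :: "int \<Rightarrow> 'v \<Rightarrow> 'u"
  assumes T: "module_complex R T" and g: "\<And>n. inj_on (g n) (carrier (obj T n))"
  obtains T' :: "('a, 'u) cochain_complex" and \<phi> \<psi> where
    "module_complex R T'" "fgp_complex R T \<longrightarrow> fgp_complex R T'" "chain_map R T T' \<phi>" "chain_map R T' T \<psi>"
    "\<And>n x. x \<in> carrier (obj T n) \<Longrightarrow> \<psi> n (\<phi> n x) = x" "\<And>n y. y \<in> carrier (obj T' n) \<Longrightarrow> \<phi> n (\<psi> n y) = y"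
proof
  define k where "k n = inv_into (carrier (obj T n)) (g n)" for n
  define T' where "T' = \<lparr>obj = (\<lambda>n. transport_module (g n) (obj T n)), diff = (\<lambda>n y. g (n + 1) (diff T n (k n y)))\<rparr>"
  note M = module_complexD(1)[OF T]
  have gh: "g n \<in> module_hom R (obj T n) (obj T' n)" for n
    unfolding T'_def by (simp add: transport_hom[OF M g])
  have kh: "k n \<in> module_hom R (obj T' n) (obj T n)" for n
    unfolding T'_def k_def by (simp add: transport_inv_hom[OF M g])
  have kg: "k n (g n x) = x" if "x \<in> carrier (obj T n)" for n x
    using g that by (simp add: k_def)
  have gk: "g n (k n y) = y" if "y \<in> carrier (obj T' n)" for n y
    using that kg by (auto simp: T'_def)
  have M': "module R (obj T' n)" for n by (simp add: T'_def module_transport[OF M g])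
  have dT': "diff T' n y = g (n + 1) (diff T n (k n y))" for n y by (simp add: T'_def)
  show T'm: "module_complex R T'"
    unfolding module_complex_def
  proof (intro allI conjI ballI)
    fix n
    show "module R (obj T' n)" by (rule M')
    show "diff T' n \<in> module_hom R (obj T' n) (obj T' (n + 1))"
      using module_hom_comp[OF module_hom_comp[OF kh module_complexD(2)[OF T]] gh] by (simp add: dT'[abs_def])
    fix y assume "y \<in> carrier (obj T' n)"
    then have ky: "k n y \<in> carrier (obj T n)" by (rule module_hom_closed[OF kh])
    have "diff T' (n + 1) (diff T' n y) = g (n + 1 + 1) \<zero>\<^bsub>obj T (n + 2)\<^esub>"
      using ky module_complexD(3)[OF T ky] by (simp add: dT' kg module_complex_closed(1)[OF T])
    then show "diff T' (n + 1) (diff T' n y) = \<zero>\<^bsub>obj T' (n + 2)\<^esub>"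
      by (simp add: T'_def add.assoc)
  qed
  show g': "chain_map R T T' g"
    by (rule chain_mapI[OF gh]) (simp add: dT' kg)
  show k': "chain_map R T' T k"
    by (rule chain_mapI[OF kh]) (simp add: dT' kg module_complex_closed(1)[OF T] module_hom_closed[OF kh])
  show "\<And>n x. x \<in> carrier (obj T n) \<Longrightarrow> k n (g n x) = x" by (rule kg)
  show "\<And>n y. y \<in> carrier (obj T' n) \<Longrightarrow> g n (k n y) = y" by (rule gk)
  have "fgp_complex R T'" if F: "fgp_complex R T"
    unfolding fgp_complex_def
  proof (intro conjI allI T'm)
    show "fgp R (obj T' n)" for n
      by (rule fgp_retract[OF M' _ kh gh gk]) (use F in \<open>auto simp: fgp_complex_def\<close>)
    obtain a b where "\<forall>n. n < a \<or> b < n \<longrightarrow> carrier (obj T n) = {\<zero>\<^bsub>obj T n\<^esub>}" using F unfolding fgp_complex_def by blast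
    then show "\<exists>a b. \<forall>n. n < a \<or> b < n \<longrightarrow> carrier (obj T' n) = {\<zero>\<^bsub>obj T' n\<^esub>}"
      by (intro exI[of _ a] exI[of _ b]) (auto simp: T'_def)
  qed
  then show "fgp_complex R T \<longrightarrow> fgp_complex R T'" ..
qed

text \<open>\<open>dh\<close> makes \<open>e\<close> idempotent up to homotopy. Together with
  \<open>hh\<close> and d d = 0 it says that the map d + h on the total module squares to
  multiplication by e(1 - e).\<close>

locale homotopy_idempotent =
  fixes R (structure) and X :: "('a, 'u) cochain_complex" and e :: 'a and h :: "int \<Rightarrow> 'u \<Rightarrow> 'u" and a b :: int
  assumes R: "cring R" and X: "fgp_complex R X"
    and bounded: "\<And>n. n < a \<or> b < n \<Longrightarrow> carrier (obj X n) = {\<zero>\<^bsub>obj X n\<^esub>}"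
    and e: "e \<in> carrier R"
    and h: "\<And>n. h n \<in> module_hom R (obj X n) (obj X (n - 1))"
    and hh: "\<And>n x. x \<in> carrier (obj X n) \<Longrightarrow> h (n - 1) (h n x) = \<zero>\<^bsub>obj X (n - 2)\<^esub>"
    and dh: "\<And>n x. x \<in> carrier (obj X n) \<Longrightarrow>
      (e \<otimes> (\<one> \<ominus> e)) \<odot>\<^bsub>obj X n\<^esub> x = diff X (n - 1) (h n x) \<oplus>\<^bsub>obj X n\<^esub> h (n + 1) (diff X n x)"
begin

section \<open>Tridiagonal matrices on the total module\<close>

sublocale R: cring R by (rule R)

abbreviation C :: "int \<Rightarrow> ('a, 'u) module" where "C \<equiv> obj X"

lemma Xm: "module_complex R X" using X by (simp add: fgp_complex_def)

lemmas M = module_complexD(1)[OF Xm]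
lemmas G = module_complex_group[OF Xm]
lemmas d = module_complexD'(1)[OF Xm]

lemma h': "h (n + 1) \<in> module_hom R (C (n + 1)) (C n)"
  using h[of "n + 1"] by simp

lemma hh': "x \<in> carrier (C (n + 1)) \<Longrightarrow> h n (h (n + 1) x) = \<zero>\<^bsub>C (n - 1)\<^esub>"
  using hh[of x "n + 1"] by simp

definition sgr :: "int \<Rightarrow> 'a" where "sgr n = (if even n then \<one> else \<ominus> \<one>)"

text \<open>The sign lets d + h enter every matrix with the same sign: passing from \<open>n\<close>
  to \<open>n + 1\<close> negates the diagonal and exchanges e with 1 - e, so the mixed terms of the
  product cancel.\<close>

definition coef :: "int \<Rightarrow> int \<Rightarrow> 'a" where
  "coef n i = sgr n \<otimes> (if even (i - n) then e else \<one> \<ominus> e)"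

lemma sgr_closed [simp]: "sgr n \<in> carrier R" by (simp add: sgr_def)

lemma sgr_sgr [simp]: "sgr n \<otimes> sgr n = \<one>" by (simp add: sgr_def R.l_minus R.r_minus)

lemma sgr_Suc: "sgr (n + 1) = \<ominus> sgr n" "sgr (n - 1) = \<ominus> sgr n" by (simp_all add: sgr_def)

lemma coef_closed [simp]: "coef n i \<in> carrier R" using e by (simp add: coef_def)

lemma coef_shift: "coef (n + 1) i = \<ominus> coef n (i - 1)" "coef n (i + 1) = coef n (i - 1)"
  using e by (simp_all add: coef_def sgr_Suc R.l_minus)

lemma coef_mult: "coef n (i - 1) \<otimes> coef n i = e \<otimes> (\<one> \<ominus> e)"
proof -
  have "(sgr n \<otimes> u) \<otimes> (sgr n \<otimes> v) = u \<otimes> v" if "u \<in> carrier R" "v \<in> carrier R" for u v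
  proof -
    have "(sgr n \<otimes> u) \<otimes> (sgr n \<otimes> v) = (sgr n \<otimes> sgr n) \<otimes> (u \<otimes> v)"
      using that sgr_closed[of n] by algebra
    then show ?thesis using that by simp
  qed
  then show ?thesis using e R.m_comm[of "\<one> \<ominus> e" e] by (simp add: coef_def)
qed

lemma coef_diff: "coef n i \<oplus> coef n (i - 1) = sgr n"
proof -
  have "e \<oplus> (\<one> \<ominus> e) = \<one>" "(\<one> \<ominus> e) \<oplus> e = \<one>" using e by algebra+
  then have "sgr n \<otimes> e \<oplus> sgr n \<otimes> (\<one> \<ominus> e) = sgr n" "sgr n \<otimes> (\<one> \<ominus> e) \<oplus> sgr n \<otimes> e = sgr n"
    using e by (simp_all flip: R.r_distr)
  then show ?thesis by (simp add: coef_def)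
qed

lemma coef_diag: "coef n n = sgr n \<otimes> e" by (simp add: coef_def)

text \<open>All integers index the sum, which removes the boundary cases at the ends of the complex;
  by boundedness finite support is automatic, and elements are plain functions.\<close>

definition Q :: "('a, int \<Rightarrow> 'u) module" where "Q = dsum_module UNIV C"

lemma finite_support:
  assumes "\<And>i. x i \<in> carrier (C i)"
  shows "finite {i. x i \<noteq> \<zero>\<^bsub>C i\<^esub>}"
  by (rule finite_subset[of _ "{a..b}"]) (use assms bounded in force)+

lemma Q_simps [simp]:
  "carrier Q = {x. \<forall>i. x i \<in> carrier (C i)}" "\<zero>\<^bsub>Q\<^esub> = (\<lambda>i. \<zero>\<^bsub>C i\<^esub>)"
  "x \<oplus>\<^bsub>Q\<^esub> y = (\<lambda>i. x i \<oplus>\<^bsub>C i\<^esub> y i)" "r \<odot>\<^bsub>Q\<^esub> x = (\<lambda>i. r \<odot>\<^bsub>C i\<^esub> x i)"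
  using finite_support by (auto simp: Q_def PiE_def)

lemma Qm: "module R Q"
  unfolding Q_def by (rule module_dsum[OF R M])

lemma Q_coord: "(\<lambda>x. x i) \<in> module_hom R Q (C i)"
  by (simp add: module_hom_def)

lemma Q_tuple:
  assumes "\<And>i. g i \<in> module_hom R N (C i)"
  shows "(\<lambda>x i. g i x) \<in> module_hom R N Q"
  by (rule module_homI) (simp_all add: module_hom_closed[OF assms] module_hom_add[OF assms] module_hom_smult[OF assms])

text \<open>A tridiagonal matrix: \<open>coef n\<close> on the diagonal, the differential below it
  and the homotopy above it. It mixes degrees, so \<open>Q\<close> is treated as an ungraded
  module.\<close>

definition F :: "int \<Rightarrow> (int \<Rightarrow> 'u) \<Rightarrow> int \<Rightarrow> 'u" where
  "F n x = (\<lambda>i. coef n i \<odot>\<^bsub>C i\<^esub> x i \<oplus>\<^bsub>C i\<^esub> (diff X (i - 1) (x (i - 1)) \<oplus>\<^bsub>C i\<^esub> h (i + 1) (x (i + 1))))"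

definition cut :: "int \<Rightarrow> (int \<Rightarrow> 'u) \<Rightarrow> int \<Rightarrow> 'u" where
  "cut n x = (\<lambda>i. if i < n then \<zero>\<^bsub>C i\<^esub> else x i)"

definition single :: "int \<Rightarrow> 'u \<Rightarrow> int \<Rightarrow> 'u" where
  "single n y = (\<lambda>i. if i = n then y else \<zero>\<^bsub>C i\<^esub>)"

lemma F_hom: "F n \<in> module_hom R Q Q"
  unfolding F_def[abs_def]
  by (intro Q_tuple module_hom_plus[OF M] module_hom_times[OF M Q_coord] module_hom_comp[OF Q_coord d]
    module_hom_comp[OF Q_coord h'] coef_closed)

lemma cut_hom: "cut n \<in> module_hom R Q Q"
proof -
  have "(\<lambda>x i. if i < n then \<zero>\<^bsub>C i\<^esub> else x i) \<in> module_hom R Q Q"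
  proof (rule Q_tuple)
    fix i
    show "(\<lambda>x. if i < n then \<zero>\<^bsub>C i\<^esub> else x i) \<in> module_hom R Q (C i)"
      using module_hom_const_zero[OF M] Q_coord by (cases "i < n") auto
  qed
  then show ?thesis by (simp add: cut_def[abs_def])
qed

lemma single_hom: "single n \<in> module_hom R (C n) Q"
proof -
  have "(\<lambda>x i. if i = n then x else \<zero>\<^bsub>C i\<^esub>) \<in> module_hom R (C n) Q"
  proof (rule Q_tuple)
    fix i
    show "(\<lambda>x. if i = n then x else \<zero>\<^bsub>C i\<^esub>) \<in> module_hom R (C n) (C i)"
      using module_hom_const_zero[OF M] module_hom_id[of R "C n"] by (cases "i = n") auto
  qed
  then show ?thesis by (simp add: single_def[abs_def])
qed

lemmas F_closed = module_hom_closed[OF F_hom]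

lemma Qc: "x \<in> carrier Q \<Longrightarrow> x i \<in> carrier (C i)" by simp

lemma F_terms_closed:
  assumes "x \<in> carrier Q"
  shows "diff X (i - 1) (x (i - 1)) \<in> carrier (C i)" "h (i + 1) (x (i + 1)) \<in> carrier (C i)"
  using module_hom_closed[OF d Qc[OF assms]] module_hom_closed[OF h' Qc[OF assms]] by auto

text \<open>One row of the product of two consecutive matrices, with the indices abstracted away:
  \<open>k\<close> and \<open>m\<close> are neighbouring diagonal entries, \<open>u\<close> and
  \<open>v\<close> the contributions of the neighbours through d and h, and \<open>A\<close>,
  \<open>B\<close> the terms d h x and h d x.\<close>

lemma (in module) matrix_square_term:
  assumes "k \<in> carrier R" "m \<in> carrier R" "p \<in> carrier M" "u \<in> carrier M" "v \<in> carrier M" "A \<in> carrier M"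
    "B \<in> carrier M"
    and "(k \<otimes> m) \<odot>\<^bsub>M\<^esub> p = A \<oplus>\<^bsub>M\<^esub> B"
  shows "(\<ominus> k) \<odot>\<^bsub>M\<^esub> (m \<odot>\<^bsub>M\<^esub> p \<oplus>\<^bsub>M\<^esub> (u \<oplus>\<^bsub>M\<^esub> v)) \<oplus>\<^bsub>M\<^esub> ((k \<odot>\<^bsub>M\<^esub> u \<oplus>\<^bsub>M\<^esub> A) \<oplus>\<^bsub>M\<^esub> (k \<odot>\<^bsub>M\<^esub> v \<oplus>\<^bsub>M\<^esub> B)) = \<zero>\<^bsub>M\<^esub>"
proof -
  have "(k \<odot>\<^bsub>M\<^esub> u \<oplus>\<^bsub>M\<^esub> A) \<oplus>\<^bsub>M\<^esub> (k \<odot>\<^bsub>M\<^esub> v \<oplus>\<^bsub>M\<^esub> B) = (A \<oplus>\<^bsub>M\<^esub> B) \<oplus>\<^bsub>M\<^esub> (k \<odot>\<^bsub>M\<^esub> u \<oplus>\<^bsub>M\<^esub> k \<odot>\<^bsub>M\<^esub> v)"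
    using assms(1-7) by (simp add: M.a_ac)
  also have "\<dots> = k \<odot>\<^bsub>M\<^esub> (m \<odot>\<^bsub>M\<^esub> p \<oplus>\<^bsub>M\<^esub> (u \<oplus>\<^bsub>M\<^esub> v))"
    using assms(1-7) by (simp add: smult_r_distr smult_assoc1 flip: assms(8))
  finally show ?thesis using assms(1-7) by (simp add: smult_l_minus M.l_neg)
qed

text \<open>In row \<open>i\<close> the terms d d and h h vanish, the mixed terms cancel by the
  sign, and the product of the diagonal entries, e(1 - e), cancels d h + h d.\<close>

lemma FF_zero:
  assumes x: "x \<in> carrier Q"
  shows "F (n + 1) (F n x) = (\<lambda>i. \<zero>\<^bsub>C i\<^esub>)"
proof
  fix i
  interpret A: module R "C i" by (rule M)
  interpret B: abelian_group "C (i - 1)" by (rule G)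
  interpret B': abelian_group "C (i + 1)" by (rule G)
  note xc = Qc[OF x]
  note tc = F_terms_closed[OF x]
  note tc1 = tc[of "i - 1", simplified] and tc2 = tc(2)[of "i + 1", unfolded add.assoc one_add_one]
  have hx: "h i (x i) \<in> carrier (C (i - 1))" by (rule module_hom_closed[OF h xc])
  have dx: "diff X i (x i) \<in> carrier (C (i + 1))" by (rule module_complex_closed(1)[OF Xm xc])
  interpret B1: module R "C (i - 1)" by (rule M)
  interpret B2: module R "C (i + 1)" by (rule M)
  have 1: "diff X (i - 1) (F n x (i - 1)) = coef n (i - 1) \<odot>\<^bsub>C i\<^esub> diff X (i - 1) (x (i - 1)) \<oplus>\<^bsub>C i\<^esub>
    diff X (i - 1) (h i (x i))"
  proof -
    have "diff X (i - 1) (diff X (i - 2) (x (i - 2))) = \<zero>\<^bsub>C i\<^esub>"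
      using module_complexD(3)[OF Xm xc[of "i - 2"]] by (simp add: algebra_simps)
    then show ?thesis
      using tc1 hx xc[of "i - 1"] module_complex_closed(2)[OF Xm hx]
      by (simp add: F_def module_hom_add[OF d] module_hom_smult[OF d])
  qed
  have 2: "h (i + 1) (F n x (i + 1)) = coef n (i - 1) \<odot>\<^bsub>C i\<^esub> h (i + 1) (x (i + 1)) \<oplus>\<^bsub>C i\<^esub> h (i + 1) (diff X i (x i))"
  proof -
    have "h (i + 1) (h (i + 2) (x (i + 2))) = \<zero>\<^bsub>C i\<^esub>"
      using hh'[of "x (i + 2)" "i + 1"] xc[of "i + 2"] by (simp add: add.assoc)
    then show ?thesis
      using tc2 dx xc[of "i + 1"] module_hom_closed[OF h' dx]
      by (simp add: F_def module_hom_add[OF h'] module_hom_smult[OF h'] coef_shift(2) add.assoc)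
  qed
  have "F (n + 1) (F n x) i = \<ominus> coef n (i - 1) \<odot>\<^bsub>C i\<^esub> (coef n i \<odot>\<^bsub>C i\<^esub> x i \<oplus>\<^bsub>C i\<^esub>
      (diff X (i - 1) (x (i - 1)) \<oplus>\<^bsub>C i\<^esub> h (i + 1) (x (i + 1)))) \<oplus>\<^bsub>C i\<^esub>
      (diff X (i - 1) (F n x (i - 1)) \<oplus>\<^bsub>C i\<^esub> h (i + 1) (F n x (i + 1)))"
    by (simp add: F_def coef_shift(1))
  also have "\<dots> = \<zero>\<^bsub>C i\<^esub>"
    unfolding 1 2
    by (rule A.matrix_square_term[OF coef_closed coef_closed xc tc])
      (use module_complex_closed(2)[OF Xm hx] module_hom_closed[OF h' dx] in \<open>auto simp: coef_mult dh[OF xc]\<close>)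
  finally show "F (n + 1) (F n x) i = \<zero>\<^bsub>C i\<^esub>" .
qed

text \<open>The off-diagonal parts of the two matrices agree, and their diagonals differ by e + (1 -
  e) = 1 up to sign.\<close>

lemma F_shift:
  assumes x: "x \<in> carrier Q"
  shows "F n x i = F (n + 1) x i \<oplus>\<^bsub>C i\<^esub> sgr n \<odot>\<^bsub>C i\<^esub> x i"
proof -
  interpret A: module R "C i" by (rule M)
  note xc = Qc[OF x] and tc = F_terms_closed[OF x]
  have "coef n i = coef (n + 1) i \<oplus> sgr n"
  proof -
    have "coef (n + 1) i \<oplus> sgr n = \<ominus> coef n (i - 1) \<oplus> (coef n i \<oplus> coef n (i - 1))"
      by (simp add: coef_shift(1) coef_diff)
    also have "\<dots> = coef n i" using coef_closed[of n i] coef_closed[of n "i - 1"] by algebra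
    finally show ?thesis by simp
  qed
  then show ?thesis using xc[of i] tc by (simp add: F_def A.smult_l_distr A.a_ac)
qed

text \<open>By \<open>F_shift\<close>, \<open>F (n - 1)\<close> differs from \<open>F n\<close> by a
  scalar sign, so the vanishing of \<open>F n\<close> after \<open>F (n - 1)\<close> turns into
  idempotency up to sign.\<close>

lemma F_idem:
  assumes x: "x \<in> carrier Q"
  shows "F n (F n x) = (\<lambda>i. sgr n \<odot>\<^bsub>C i\<^esub> F n x i)"
proof
  fix i
  interpret A: module R "C i" by (rule M)
  interpret Q: module R Q by (rule Qm)
  define y where "y = F (n - 1) x"
  have y: "y \<in> carrier Q" unfolding y_def by (rule F_closed[OF x])
  have Fx: "F n x \<in> carrier Q" by (rule F_closed[OF x])
  have "y = F n x \<oplus>\<^bsub>Q\<^esub> sgr (n - 1) \<odot>\<^bsub>Q\<^esub> x"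
    using F_shift[OF x, of "n - 1"] by (auto simp: y_def)
  then have "F n y = F n (F n x) \<oplus>\<^bsub>Q\<^esub> sgr (n - 1) \<odot>\<^bsub>Q\<^esub> F n x"
    using module_hom_add[OF F_hom Fx Q.smult_closed[OF sgr_closed x]] module_hom_smult[OF F_hom sgr_closed x] by metis
  moreover have "F n y = (\<lambda>i. \<zero>\<^bsub>C i\<^esub>)" unfolding y_def using FF_zero[OF x, of "n - 1"] by simp
  ultimately have "F n (F n x) i \<oplus>\<^bsub>C i\<^esub> sgr (n - 1) \<odot>\<^bsub>C i\<^esub> F n x i = \<zero>\<^bsub>C i\<^esub>"
    by (simp add: fun_eq_iff)
  then have "F n (F n x) i = \<ominus>\<^bsub>C i\<^esub> (sgr (n - 1) \<odot>\<^bsub>C i\<^esub> F n x i)"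
    using Qc[OF Fx] Qc[OF F_closed[OF Fx]] A.minus_equality by (metis A.smult_closed sgr_closed)
  then show "F n (F n x) i = sgr n \<odot>\<^bsub>C i\<^esub> F n x i"
    using Qc[OF Fx] by (simp add: sgr_Suc A.smult_l_minus)
qed

end

section \<open>The truncated complex as a summand\<close>

context homotopy_idempotent
begin

text \<open>Below degree \<open>a\<close> an untruncated complex would repeat \<open>Q\<close>
  forever, with differentials that are complementary idempotents up to sign. The image of
  \<open>F a\<close> is the cokernel of \<open>F (a - 1)\<close>, so putting it in degree
  \<open>a\<close> and zero below loses no cohomology and keeps the complex bounded.\<close>

definition \<rho> :: "int \<Rightarrow> (int \<Rightarrow> 'u) \<Rightarrow> int \<Rightarrow> 'u" where
  "\<rho> n x = (if n > a then x else if n = a then sgr n \<odot>\<^bsub>Q\<^esub> F n x else \<zero>\<^bsub>Q\<^esub>)"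

lemma \<rho>_hom: "\<rho> n \<in> module_hom R Q Q"
proof -
  interpret Q: module R Q by (rule Qm)
  consider "n > a" | "n = a" | "n < a" by linarith
  then show ?thesis
  proof cases
    case 1
    then show ?thesis using module_hom_id[of R Q] by (simp add: \<rho>_def[abs_def])
  next
    case 2
    then show ?thesis using module_hom_times[OF Qm F_hom sgr_closed] by (simp add: \<rho>_def[abs_def] del: Q_simps)
  next
    case 3
    then show ?thesis using module_hom_const_zero[OF Qm] by (simp add: \<rho>_def[abs_def] del: Q_simps)
  qed
qed

lemma F_\<rho>:
  assumes x: "x \<in> carrier Q" and n: "n \<ge> a"
  shows "F n (\<rho> n x) = F n x"
proof (cases "n = a")
  case True
  interpret Q: module R Q by (rule Qm)
  have "F n (\<rho> n x) = sgr n \<odot>\<^bsub>Q\<^esub> F n (F n x)"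
    using True module_hom_smult[OF F_hom sgr_closed F_closed[OF x]] by (simp add: \<rho>_def del: Q_simps)
  also have "F n (F n x) = sgr n \<odot>\<^bsub>Q\<^esub> F n x"
    using F_idem[OF x] by simp
  also have "sgr n \<odot>\<^bsub>Q\<^esub> (sgr n \<odot>\<^bsub>Q\<^esub> F n x) = F n x"
    using F_closed[OF x] by (simp del: Q_simps flip: Q.smult_assoc1)
  finally show ?thesis .
qed (use n in \<open>simp add: \<rho>_def\<close>)

lemma \<rho>_closed: "x \<in> carrier Q \<Longrightarrow> \<rho> n x \<in> carrier Q"
  by (rule module_hom_closed[OF \<rho>_hom])

lemma \<rho>_idem: "x \<in> carrier Q \<Longrightarrow> \<rho> n (\<rho> n x) = \<rho> n x"
proof -
  assume x: "x \<in> carrier Q"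
  interpret Q: module R Q by (rule Qm)
  show ?thesis
  proof (cases "n = a")
    case True
    then have "\<rho> n (\<rho> n x) = sgr n \<odot>\<^bsub>Q\<^esub> F n (\<rho> n x)" by (simp add: \<rho>_def del: Q_simps)
    then show ?thesis using F_\<rho>[OF x, of n] True by (simp add: \<rho>_def del: Q_simps)
  qed (auto simp: \<rho>_def)
qed

text \<open>The tail \<open>{x \<in> Q. x\<^sub>i = 0 for i < n}\<close> in degrees \<open>n > a\<close>, replaced in degree \<open>a\<close> by the image of the
  idempotent \<open>\<plusminus> F a\<close>.\<close>

definition part :: "int \<Rightarrow> (int \<Rightarrow> 'u) set" where
  "part n = {x \<in> carrier Q. (\<forall>i<n. x i = \<zero>\<^bsub>C i\<^esub>) \<and> \<rho> n x = x}"

text \<open>Only the carrier of \<open>Q\<close> changes with the degree. \<open>F n\<close> leads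
  out of the next tail, because h lowers the index and the diagonal keeps it; the cut discards these
  components.\<close>

definition T :: "('a, int \<Rightarrow> 'u) cochain_complex" where
  "T = \<lparr>obj = (\<lambda>n. Q\<lparr>carrier := part n\<rparr>), diff = (\<lambda>n x. cut (n + 1) (F n x))\<rparr>"

lemma T_simps [simp]:
  "carrier (obj T n) = part n" "\<zero>\<^bsub>obj T n\<^esub> = \<zero>\<^bsub>Q\<^esub>" "x \<oplus>\<^bsub>obj T n\<^esub> y = x \<oplus>\<^bsub>Q\<^esub> y" "r \<odot>\<^bsub>obj T n\<^esub> x = r \<odot>\<^bsub>Q\<^esub> x"
  "diff T n = (\<lambda>x. cut (n + 1) (F n x))"
  by (simp_all add: T_def)

lemma part_Q: "x \<in> part n \<Longrightarrow> x \<in> carrier Q"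
  by (simp add: part_def)

lemma below_bound: "n < a \<Longrightarrow> y \<in> carrier (C n) \<Longrightarrow> y = \<zero>\<^bsub>C n\<^esub>"
  using bounded by auto

lemma part_zero: "n < a \<Longrightarrow> x \<in> part n \<Longrightarrow> x = \<zero>\<^bsub>Q\<^esub>"
  by (auto simp: part_def \<rho>_def)

lemma \<rho>_part:
  assumes x: "x \<in> carrier Q" and low: "\<And>i. i < n \<Longrightarrow> x i = \<zero>\<^bsub>C i\<^esub>"
  shows "\<rho> n x \<in> part n"
proof -
  have c: "\<rho> n x \<in> carrier Q" by (rule \<rho>_closed[OF x])
  have "\<rho> n x i = \<zero>\<^bsub>C i\<^esub>" if i: "i < n" for i
  proof (cases "n > a")
    case True
    then show ?thesis using low i by (simp add: \<rho>_def)
  next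
    case False
    then show ?thesis using below_bound[of i "\<rho> n x i"] i Qc[OF c, of i] by simp
  qed
  then show ?thesis using c \<rho>_idem[OF x] by (simp add: part_def del: Q_simps)
qed

lemma part_module: "module R (Q\<lparr>carrier := part n\<rparr>)"
proof -
  interpret Q: module R Q by (rule Qm)
  note az = Q.abelian_group_axioms
  have "submodule (part n) R Q"
  proof (rule Q.submoduleI)
    show "part n \<subseteq> carrier Q" by (auto simp: part_def)
    show "\<zero>\<^bsub>Q\<^esub> \<in> part n"
      using module_hom_zero[OF \<rho>_hom az az] Q.zero_closed by (simp add: part_def)
    have lo: "x i = \<zero>\<^bsub>C i\<^esub>" if "x \<in> part n" "i < n" for x i using that by (simp add: part_def)
    have fx: "\<rho> n x = x" if "x \<in> part n" for x using that by (simp add: part_def)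
    show "\<ominus>\<^bsub>Q\<^esub> x \<in> part n" if x: "x \<in> part n" for x
    proof -
      have xc: "x \<in> carrier Q" by (rule part_Q[OF x])
      have "(\<ominus>\<^bsub>Q\<^esub> x) i = \<zero>\<^bsub>C i\<^esub>" if "i < n" for i
        using module_hom_minus[OF Q_coord az G xc, of i] lo[OF x that] abelian_group.a_inv_zero[OF G] by simp
      then show ?thesis using Q.a_inv_closed[OF xc] module_hom_minus[OF \<rho>_hom az az xc] fx[OF x]
        by (simp add: part_def del: Q_simps)
    qed
    show "x \<oplus>\<^bsub>Q\<^esub> y \<in> part n" if x: "x \<in> part n" and y: "y \<in> part n" for x y
    proof -
      note xc = part_Q[OF x] and yc = part_Q[OF y]
      have "(x \<oplus>\<^bsub>Q\<^esub> y) i = \<zero>\<^bsub>C i\<^esub>" if "i < n" for i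
      proof -
        interpret A: abelian_group "C i" by (rule G)
        show ?thesis using lo[OF x that] lo[OF y that] by simp
      qed
      then show ?thesis using Q.a_closed[OF xc yc] module_hom_add[OF \<rho>_hom xc yc] fx[OF x] fx[OF y]
        unfolding part_def by simp
    qed
    show "r \<odot>\<^bsub>Q\<^esub> x \<in> part n" if r: "r \<in> carrier R" and x: "x \<in> part n" for r x
    proof -
      note xc = part_Q[OF x]
      have "(r \<odot>\<^bsub>Q\<^esub> x) i = \<zero>\<^bsub>C i\<^esub>" if "i < n" for i
        using lo[OF x that] module.smult_r_null[OF M r] by simp
      then show ?thesis using Q.smult_closed[OF r xc] module_hom_smult[OF \<rho>_hom r xc] fx[OF x]
        unfolding part_def by simp
    qed
  qed
  then show ?thesis by (rule submodule.submodule_is_module[OF _ Qm])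
qed

lemma T_obj_module: "module R (obj T n)"
  using part_module by (simp add: T_def)

lemma hom_into_part:
  assumes "f \<in> module_hom R N Q" "\<And>x. x \<in> carrier N \<Longrightarrow> f x \<in> part n"
  shows "f \<in> module_hom R N (obj T n)"
  using assms by (auto simp: module_hom_def)

lemma hom_from_part:
  assumes "f \<in> module_hom R Q N"
  shows "f \<in> module_hom R (obj T n) N"
  using assms part_Q by (auto simp: module_hom_def)

lemma cut_low: "i < n \<Longrightarrow> cut n x i = \<zero>\<^bsub>C i\<^esub>" and cut_high: "i \<ge> n \<Longrightarrow> cut n x i = x i"
  by (simp_all add: cut_def)

lemma cut_closed: "x \<in> carrier Q \<Longrightarrow> cut n x \<in> carrier Q"
  by (rule module_hom_closed[OF cut_hom])

lemma T_diff_part: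
  assumes x: "x \<in> part n"
  shows "cut (n + 1) (F n x) \<in> part (n + 1)"
proof (cases "n < a")
  case True
  interpret Q: module R Q by (rule Qm)
  note az = Q.abelian_group_axioms
  have "cut (n + 1) (F n x) = \<zero>\<^bsub>Q\<^esub>"
    unfolding part_zero[OF True x] using module_hom_zero[OF F_hom az az] module_hom_zero[OF cut_hom az az] by simp
  moreover have "\<zero>\<^bsub>obj T (n + 1)\<^esub> \<in> carrier (obj T (n + 1))"
    using abelian_monoid.zero_closed[OF abelian_group.axioms(1)[OF module_abelian_group[OF T_obj_module]]] .
  ultimately show ?thesis by simp
next
  case False
  then have "\<rho> (n + 1) y = y" for y by (simp add: \<rho>_def)
  then show ?thesis using cut_closed[OF F_closed[OF part_Q[OF x]]] cut_low by (simp add: part_def del: Q_simps)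
qed

lemma T_diff_hom: "(\<lambda>x. cut (n + 1) (F n x)) \<in> module_hom R (obj T n) (obj T (n + 1))"
  by (rule hom_into_part[OF hom_from_part[OF module_hom_comp[OF F_hom cut_hom]]]) (simp add: T_diff_part)

text \<open>\<open>F\<close> is tridiagonal, so cutting off below \<open>n + 1\<close> changes the coordinates of \<open>F (n + 1) x\<close>
  only up to degree \<open>n + 1\<close>.\<close>

lemma F_cut:
  assumes z: "z \<in> carrier Q"
  shows "i > n + 1 \<Longrightarrow> F m (cut (n + 1) z) i = F m z i"
    and "F m z (n + 1) = F m (cut (n + 1) z) (n + 1) \<oplus>\<^bsub>C (n + 1)\<^esub> diff X n (z n)"
proof -
  show "F m (cut (n + 1) z) i = F m z i" if "i > n + 1"
    using that by (simp add: F_def cut_high)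
  interpret A: module R "C (n + 1)" by (rule M)
  have "diff X n \<zero>\<^bsub>C n\<^esub> = \<zero>\<^bsub>C (n + 1)\<^esub>" by (rule module_hom_zero[OF module_complexD(2)[OF Xm] G G])
  then show "F m z (n + 1) = F m (cut (n + 1) z) (n + 1) \<oplus>\<^bsub>C (n + 1)\<^esub> diff X n (z n)"
    using Qc[OF z] F_terms_closed[OF z, of "n + 1"] by (simp add: F_def cut_low cut_high A.a_ac)
qed

lemma T_complex: "module_complex R T"
  unfolding module_complex_def
proof (intro allI conjI ballI)
  fix n
  show "module R (obj T n)" by (rule T_obj_module)
  show "diff T n \<in> module_hom R (obj T n) (obj T (n + 1))" using T_diff_hom by simp
  fix x assume "x \<in> carrier (obj T n)"
  then have x: "x \<in> carrier Q" using part_Q by simp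
  \<comment> \<open>Rows from \<open>n + 2\<close> on do not see the cut at \<open>n + 1\<close>, so
    \<open>FF_zero\<close> applies to them; all lower rows are cut off.\<close>
  have "cut (n + 2) (F (n + 1) (cut (n + 1) (F n x))) i = \<zero>\<^bsub>C i\<^esub>" for i
    using F_cut(1)[OF F_closed[OF x], of n i "n + 1" n] FF_zero[OF x, of n]
    by (cases "i < n + 2") (simp_all add: cut_low cut_high)
  then show "diff T (n + 1) (diff T n x) = \<zero>\<^bsub>obj T (n + 2)\<^esub>" by (simp add: add.assoc fun_eq_iff)
qed

lemma msum_Q_apply:
  "(\<And>l. l \<in> set L \<Longrightarrow> f l \<in> carrier Q) \<Longrightarrow> msum Q f L i = msum (C i) (\<lambda>l. f l i) L"
  using module_hom_msum[OF Q_coord module_abelian_group[OF Qm] G] by blast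

text \<open>In each degree the components from \<open>n\<close> to \<open>b\<close> exhibit the
  module as a retract of finitely many modules of \<open>X\<close>. After \<open>single\<close> the
  projection \<open>\<rho>\<close> is applied once more, since in degree \<open>a\<close> a single
  component need not lie in the image of the idempotent.\<close>

lemma T_fgp: "fgp_complex R T"
  unfolding fgp_complex_def
proof (intro conjI allI T_complex)
  fix n
  interpret Q: module R Q by (rule Qm)
  show "fgp R (obj T n)"
  proof (rule fgp_sum_of_retracts[OF T_obj_module, where N = C and J = "[n..b]" and u = "\<lambda>j x. x j"
    and v = "\<lambda>j y. \<rho> n (single j y)"])
    fix j assume j: "j \<in> set [n..b]"
    show "fgp R (C j)" using X by (simp add: fgp_complex_def)
    show "(\<lambda>x. x j) \<in> module_hom R (obj T n) (C j)" by (rule hom_from_part[OF Q_coord])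
    show "(\<lambda>y. \<rho> n (single j y)) \<in> module_hom R (C j) (obj T n)"
      by (rule hom_into_part[OF module_hom_comp[OF single_hom \<rho>_hom]], rule \<rho>_part)
        (use j module_hom_closed[OF single_hom] in \<open>auto simp: single_def simp del: Q_simps\<close>)
  next
    fix x assume "x \<in> carrier (obj T n)"
    then have x: "x \<in> part n" by simp
    have xc: "x \<in> carrier Q" by (rule part_Q[OF x])
    have sc: "single j (x j) \<in> carrier Q" for j by (rule module_hom_closed[OF single_hom Qc[OF xc]])
    have "msum Q (\<lambda>j. single j (x j)) [n..b] i = x i" for i
    proof -
      interpret A: abelian_group "C i" by (rule G)
      show ?thesis
      proof (cases "n \<le> i \<and> i \<le> b")
        case True
        then have "msum (C i) (\<lambda>j. single j (x j) i) [n..b] = single i (x i) i"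
          using Qc[OF xc] by (intro A.msum_single) (auto simp: single_def simp del: Q_simps)
        then show ?thesis using msum_Q_apply[of "[n..b]" "\<lambda>j. single j (x j)" i] sc by (simp add: single_def[of i])
      next
        case False
        then have "msum (C i) (\<lambda>j. single j (x j) i) [n..b] = \<zero>\<^bsub>C i\<^esub>"
          by (intro A.msum_zero) (auto simp: single_def)
        moreover have "x i = \<zero>\<^bsub>C i\<^esub>"
        proof (cases "i < n")
          case False
          then have "carrier (C i) = {\<zero>\<^bsub>C i\<^esub>}" using \<open>\<not> (n \<le> i \<and> i \<le> b)\<close> by (intro bounded) auto
          then show ?thesis using Qc[OF xc, of i] by blast
        qed (use x in \<open>simp add: part_def\<close>)
        ultimately show ?thesis using msum_Q_apply[of "[n..b]" "\<lambda>j. single j (x j)" i] sc by simp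
      qed
    qed
    then have "msum Q (\<lambda>j. single j (x j)) [n..b] = x" by (rule ext)
    then have "x = \<rho> n (msum Q (\<lambda>j. single j (x j)) [n..b])"
      using x by (simp add: part_def)
    also have "\<dots> = msum Q (\<lambda>j. \<rho> n (single j (x j))) [n..b]"
      by (rule module_hom_msum[OF \<rho>_hom Q.abelian_group_axioms Q.abelian_group_axioms sc])
    also have "\<dots> = msum (obj T n) (\<lambda>j. \<rho> n (single j (x j))) [n..b]"
      by (simp add: msum_def T_def)
    finally show "x = msum (obj T n) (\<lambda>j. \<rho> n (single j (x j))) [n..b]" .
  qed
next
  show "\<exists>a b. \<forall>n. n < a \<or> b < n \<longrightarrow> carrier (obj T n) = {\<zero>\<^bsub>obj T n\<^esub>}"
  proof (rule exI[of _ a], rule exI[of _ b], intro allI impI)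
    fix n assume n: "n < a \<or> b < n"
    have "x = \<zero>\<^bsub>Q\<^esub>" if x: "x \<in> part n" for x
    proof (cases "n < a")
      case False
      then have "x i = \<zero>\<^bsub>C i\<^esub>" for i
        using n x bounded[of i] Qc[OF part_Q[OF x], of i] by (cases "i < n") (auto simp: part_def)
      then show ?thesis by (simp add: fun_eq_iff)
    qed (rule part_zero[OF _ x])
    moreover have "\<zero>\<^bsub>obj T n\<^esub> \<in> carrier (obj T n)"
      by (rule abelian_monoid.zero_closed[OF abelian_group.axioms(1)[OF module_abelian_group[OF T_obj_module]]])
    ultimately show "carrier (obj T n) = {\<zero>\<^bsub>obj T n\<^esub>}" unfolding T_simps by blast
  qed
qed

definition inc :: "int \<Rightarrow> 'u \<Rightarrow> int \<Rightarrow> 'u" where "inc n y = \<rho> n (single n y)"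

definition ret :: "int \<Rightarrow> (int \<Rightarrow> 'u) \<Rightarrow> 'u" where "ret n x = sgr n \<odot>\<^bsub>C n\<^esub> F n x n"

lemma single_closed: "y \<in> carrier (C n) \<Longrightarrow> single n y \<in> carrier Q"
  by (rule module_hom_closed[OF single_hom])

lemma single_same: "single n y n = y" and single_other: "i \<noteq> n \<Longrightarrow> single n y i = \<zero>\<^bsub>C i\<^esub>"
  by (simp_all add: single_def)

lemma inc_hom: "inc n \<in> module_hom R (C n) (obj T n)"
proof -
  have "(\<lambda>y. \<rho> n (single n y)) \<in> module_hom R (C n) (obj T n)"
    by (rule hom_into_part[OF module_hom_comp[OF single_hom \<rho>_hom] \<rho>_part])
      (simp_all add: single_closed single_other del: Q_simps)
  then show ?thesis by (simp add: inc_def[abs_def])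
qed

lemma ret_hom_Q: "ret n \<in> module_hom R Q (C n)"
  unfolding ret_def[abs_def]
  by (rule module_hom_times[OF M module_hom_comp[OF F_hom Q_coord] sgr_closed])

lemma F_single:
  assumes y: "y \<in> carrier (C n)"
  shows "F n (single n y) n = coef n n \<odot>\<^bsub>C n\<^esub> y" "F m (single n y) (n + 1) = diff X n y"
    "i > n + 1 \<Longrightarrow> F m (single n y) i = \<zero>\<^bsub>C i\<^esub>"
proof -
  have dz: "diff X (i - 1) \<zero>\<^bsub>C (i - 1)\<^esub> = \<zero>\<^bsub>C i\<^esub>" "h (i + 1) \<zero>\<^bsub>C (i + 1)\<^esub> = \<zero>\<^bsub>C i\<^esub>"
    "r \<in> carrier R \<Longrightarrow> r \<odot>\<^bsub>C i\<^esub> \<zero>\<^bsub>C i\<^esub> = \<zero>\<^bsub>C i\<^esub>" for i r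
    using module_hom_zero[OF d G G] module_hom_zero[OF h' G G] module.smult_r_null[OF M] by auto
  interpret A: module R "C n" by (rule M)
  show "F n (single n y) n = coef n n \<odot>\<^bsub>C n\<^esub> y" using y by (simp add: F_def single_def dz)
  interpret B: module R "C (n + 1)" by (rule M)
  show "F m (single n y) (n + 1) = diff X n y"
    using dz(2)[of "n + 1"] module_complex_closed(1)[OF Xm y] by (simp add: F_def single_def dz(3))
  interpret D: module R "C i" by (rule M)
  show "F m (single n y) i = \<zero>\<^bsub>C i\<^esub>" if "i > n + 1"
    using that by (simp add: F_def single_def dz)
qed

lemma inc_chain: "chain_map R X T inc"
proof (rule chain_mapI[OF inc_hom])
  fix n y assume y: "y \<in> carrier (C n)"
  note sc = single_closed[OF y]
  have dy: "diff X n y \<in> carrier (C (n + 1))" by (rule module_complex_closed(1)[OF Xm y])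
  show "diff T n (inc n y) = inc (n + 1) (diff X n y)"
  proof (cases "n \<ge> a")
    case True
    \<comment> \<open>The column of \<open>F n\<close> at index \<open>n\<close> has entries only at
      \<open>n - 1\<close>, \<open>n\<close> and \<open>n + 1\<close>, and the cut leaves the last
      one, the differential of \<open>X\<close>.\<close>
    have "cut (n + 1) (F n (single n y)) = single (n + 1) (diff X n y)"
    proof
      fix i
      show "cut (n + 1) (F n (single n y)) i = single (n + 1) (diff X n y) i"
        using F_single(2,3)[OF y, where m = n]
        by (cases "i < n + 1"; cases "i = n + 1") (auto simp: cut_low cut_high single_same single_other)
    qed
    then show ?thesis using True F_\<rho>[OF sc True] by (simp add: inc_def \<rho>_def[of "n + 1"])
  next
    case False
    note G' = module_complex_group[OF T_complex]
    have y0: "y = \<zero>\<^bsub>C n\<^esub>" using below_bound[OF _ y] False by simp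
    have "diff T n (inc n y) = \<zero>\<^bsub>obj T (n + 1)\<^esub>"
      unfolding y0 module_hom_zero[OF inc_hom G G'] by (rule module_hom_zero[OF module_complexD(2)[OF T_complex] G' G'])
    moreover have "inc (n + 1) (diff X n y) = \<zero>\<^bsub>obj T (n + 1)\<^esub>"
      unfolding y0 module_hom_zero[OF module_complexD(2)[OF Xm] G G] by (rule module_hom_zero[OF inc_hom G G'])
    ultimately show ?thesis by simp
  qed
qed

text \<open>Row \<open>n + 1\<close> of the product \<open>F (n + 1)\<close> after
  \<open>F n\<close> is zero. It sees the component \<open>n\<close> removed by the cut only through
  \<open>diff X n\<close>, so that term survives with a minus sign, which the change from
  \<open>sgr n\<close> to \<open>sgr (n + 1)\<close> absorbs.\<close>

lemma ret_chain: "chain_map R T X ret"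
proof (rule chain_mapI[OF hom_from_part[OF ret_hom_Q]])
  fix n x assume "x \<in> carrier (obj T n)"
  then have x: "x \<in> carrier Q" using part_Q by simp
  interpret A: module R "C (n + 1)" by (rule M)
  have Fx: "F n x \<in> carrier Q" by (rule F_closed[OF x])
  have cF: "F (n + 1) (cut (n + 1) (F n x)) (n + 1) \<in> carrier (C (n + 1))"
    by (rule Qc[OF F_closed[OF cut_closed[OF Fx]]])
  have dF: "diff X n (F n x n) \<in> carrier (C (n + 1))" by (rule module_complex_closed(1)[OF Xm Qc[OF Fx]])
  have "F (n + 1) (cut (n + 1) (F n x)) (n + 1) \<oplus>\<^bsub>C (n + 1)\<^esub> diff X n (F n x n) = \<zero>\<^bsub>C (n + 1)\<^esub>"
    using F_cut(2)[OF Fx, of "n + 1" n] FF_zero[OF x, of n] by simp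
  then have "F (n + 1) (cut (n + 1) (F n x)) (n + 1) = \<ominus>\<^bsub>C (n + 1)\<^esub> diff X n (F n x n)"
    using A.minus_equality cF dF by metis
  then have "ret (n + 1) (diff T n x) = sgr n \<odot>\<^bsub>C (n + 1)\<^esub> diff X n (F n x n)"
    using dF by (simp add: ret_def sgr_Suc A.smult_l_minus A.smult_r_minus)
  then show "diff X n (ret n x) = ret (n + 1) (diff T n x)"
    using module_hom_smult[OF module_complexD(2)[OF Xm] sgr_closed Qc[OF Fx]] by (simp add: ret_def)
qed

text \<open>The diagonal entry of \<open>F n\<close> at \<open>n\<close> is \<open>e\<close> up to
  the sign that \<open>ret\<close> removes.\<close>

lemma ret_inc:
  assumes y: "y \<in> carrier (C n)"
  shows "ret n (inc n y) = e \<odot>\<^bsub>C n\<^esub> y"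
proof (cases "n \<ge> a")
  case True
  interpret A: module R "C n" by (rule M)
  have "ret n (inc n y) = sgr n \<odot>\<^bsub>C n\<^esub> ((sgr n \<otimes> e) \<odot>\<^bsub>C n\<^esub> y)"
    using F_\<rho>[OF single_closed[OF y] True] F_single(1)[OF y] by (simp add: ret_def inc_def coef_diag)
  also have "\<dots> = (sgr n \<otimes> sgr n \<otimes> e) \<odot>\<^bsub>C n\<^esub> y"
    using y e by (simp add: A.smult_assoc1 R.m_assoc del: sgr_sgr)
  finally show ?thesis using e by simp
next
  case False
  interpret A: module R "C n" by (rule M)
  have "ret n (inc n y) \<in> carrier (C n)" by (rule module_hom_closed[OF ret_hom_Q part_Q])
    (use module_hom_closed[OF inc_hom y] in simp)
  then show ?thesis using below_bound False y A.smult_closed[OF e y] by (metis not_le)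
qed

text \<open>The tail starting at \<open>n\<close> is contained in the one starting at
  \<open>n - 1\<close>; up to sign and truncation this inclusion is the homotopy between the
  identity and \<open>inc\<close> after \<open>ret\<close>.\<close>

definition shift :: "int \<Rightarrow> (int \<Rightarrow> 'u) \<Rightarrow> int \<Rightarrow> 'u" where
  "shift n x = sgr (n - 1) \<odot>\<^bsub>Q\<^esub> \<rho> (n - 1) x"

lemma shift_hom: "shift n \<in> module_hom R (obj T n) (obj T (n - 1))"
proof -
  interpret T1: module R "obj T (n - 1)" by (rule T_obj_module)
  have "\<rho> (n - 1) \<in> module_hom R (obj T n) (obj T (n - 1))"
    by (rule hom_into_part[OF hom_from_part[OF \<rho>_hom]], rule \<rho>_part) (auto simp: part_def)
  from module_hom_times[OF T_obj_module this sgr_closed] show ?thesis by (simp add: shift_def[abs_def])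
qed

text \<open>Two neighbouring signed matrices are complementary idempotents: this is
  \<open>F_shift\<close> multiplied by the sign.\<close>

lemma sgr_F_sum:
  assumes x: "x \<in> carrier Q"
  shows "sgr n \<odot>\<^bsub>C i\<^esub> F n x i \<oplus>\<^bsub>C i\<^esub> sgr (n - 1) \<odot>\<^bsub>C i\<^esub> F (n - 1) x i = x i"
proof -
  interpret A: module R "C i" by (rule M)
  note xc = Qc[OF x] and Fc = Qc[OF F_closed[OF x]]
  have "sgr (n - 1) \<odot>\<^bsub>C i\<^esub> F (n - 1) x i = sgr (n - 1) \<odot>\<^bsub>C i\<^esub> F n x i \<oplus>\<^bsub>C i\<^esub> x i"
    using F_shift[OF x, of "n - 1" i] xc Fc by (simp add: A.smult_r_distr flip: A.smult_assoc1)
  then show ?thesis using xc[of i] Fc[of n i] by (simp add: sgr_Suc A.smult_l_minus A.r_neg1 A.r_neg2)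
qed

text \<open>Above degree \<open>a\<close> this is \<open>sgr_F_sum\<close> read off row by row: row
  \<open>n\<close> is shared by \<open>inc\<close> after \<open>ret\<close> and the first homotopy
  term, every later row by the two homotopy terms. At the truncated end the identity has to come
  from the idempotent instead.\<close>

lemma inc_ret:
  assumes x: "x \<in> part n"
  shows "x = inc n (ret n x) \<oplus>\<^bsub>Q\<^esub> (cut n (F (n - 1) (shift n x)) \<oplus>\<^bsub>Q\<^esub> shift (n + 1) (cut (n + 1) (F n x)))"
proof -
  have xc: "x \<in> carrier Q" by (rule part_Q[OF x])
  interpret Q: module R Q by (rule Qm)
  note az = Q.abelian_group_axioms
  note Fc = Qc[OF F_closed[OF xc]]
  have rc: "ret n x \<in> carrier (C n)" by (rule module_hom_closed[OF ret_hom_Q xc])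
  consider "n > a" | "n = a" | "n < a" by linarith
  then show ?thesis
  proof cases
    case 1
    have c: "cut n (F (n - 1) (shift n x)) = cut n (sgr (n - 1) \<odot>\<^bsub>Q\<^esub> F (n - 1) x)"
      using 1 F_\<rho>[OF xc, of "n - 1"] module_hom_smult[OF F_hom sgr_closed \<rho>_closed[OF xc]]
        by (simp add: shift_def del: Q_simps)
    have s: "shift (n + 1) (cut (n + 1) (F n x)) = sgr n \<odot>\<^bsub>Q\<^esub> cut (n + 1) (F n x)"
      using 1 by (simp add: shift_def \<rho>_def)
    show ?thesis
    proof
      fix i
      interpret A: module R "C i" by (rule M)
      note sum = sgr_F_sum[OF xc, where n = n and i = i] and Fi = Fc[of n i] Fc[of "n - 1" i]
      show "x i = (inc n (ret n x) \<oplus>\<^bsub>Q\<^esub> (cut n (F (n - 1) (shift n x)) \<oplus>\<^bsub>Q\<^esub> shift (n + 1) (cut (n + 1) (F n x)))) i"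
      proof (cases "i = n")
        case True
        have "ret n x = sgr n \<odot>\<^bsub>C i\<^esub> F n x i" using True by (simp add: ret_def)
        then show ?thesis unfolding c s using 1 sum Fi True[symmetric]
          by (simp add: inc_def \<rho>_def single_def cut_def A.a_assoc)
      next
        case False
        then show ?thesis unfolding c s using 1 sum Fi x
          by (cases "i < n") (auto simp: inc_def \<rho>_def[of n] single_def cut_def part_def A.a_comm)
      qed
    qed
  next
    case 2
    \<comment> \<open>Elements in degree \<open>a\<close> are fixed by the idempotent, and the
      homotopy into degree \<open>a - 1\<close> is zero. What remains is the splitting of
      \<open>x\<close> into its component \<open>n\<close> and the rest, projected by
      \<open>\<rho>\<close>.\<close>
    have Fx: "sgr n \<odot>\<^bsub>Q\<^esub> F n x = x" using x 2 by (simp add: part_def \<rho>_def)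
    have s0: "shift n x = \<zero>\<^bsub>Q\<^esub>"
      unfolding shift_def using 2 Q.smult_r_null[OF sgr_closed] by (simp add: \<rho>_def del: Q_simps)
    have c: "cut n (F (n - 1) (shift n x)) = \<zero>\<^bsub>Q\<^esub>"
      unfolding s0 using module_hom_zero[OF F_hom az az] module_hom_zero[OF cut_hom az az] by simp
    have "F n x = sgr n \<odot>\<^bsub>Q\<^esub> x"
    proof -
      have "sgr n \<odot>\<^bsub>Q\<^esub> (sgr n \<odot>\<^bsub>Q\<^esub> F n x) = F n x"
        using F_closed[OF xc] by (simp del: Q_simps flip: Q.smult_assoc1)
      then show ?thesis unfolding Fx by simp
    qed
    then have cF: "cut (n + 1) (F n x) = sgr n \<odot>\<^bsub>Q\<^esub> cut (n + 1) x"
      using module_hom_smult[OF cut_hom sgr_closed xc] by metis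
    have s: "shift (n + 1) (cut (n + 1) (F n x)) = \<rho> n (cut (n + 1) x)"
    proof -
      have "shift (n + 1) (cut (n + 1) (F n x)) = sgr n \<odot>\<^bsub>Q\<^esub> (sgr n \<odot>\<^bsub>Q\<^esub> \<rho> n (cut (n + 1) x))"
        unfolding cF shift_def using module_hom_smult[OF \<rho>_hom sgr_closed cut_closed[OF xc]] by (simp del: Q_simps)
      then show ?thesis using \<rho>_closed[OF cut_closed[OF xc]] by (simp del: Q_simps flip: Q.smult_assoc1)
    qed
    have rx: "ret n x = x n" using fun_cong[OF Fx, of n] by (simp add: ret_def)
    have sum: "single n (x n) \<oplus>\<^bsub>Q\<^esub> cut (n + 1) x = x"
    proof
      fix i
      interpret A: abelian_group "C i" by (rule G)
      interpret An: abelian_group "C n" by (rule G)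
      show "(single n (x n) \<oplus>\<^bsub>Q\<^esub> cut (n + 1) x) i = x i"
        using x Qc[OF xc, of i] Qc[OF xc, of n]
          by (cases "i < n"; cases "i = n") (auto simp: single_def cut_def part_def)
    qed
    have "inc n (ret n x) \<oplus>\<^bsub>Q\<^esub> \<rho> n (cut (n + 1) x) = \<rho> n x"
      unfolding inc_def rx module_hom_add[OF \<rho>_hom single_closed[OF Qc[OF xc]] cut_closed[OF xc], symmetric] sum ..
    then show ?thesis unfolding c s using x Q.l_zero[OF \<rho>_closed[OF cut_closed[OF xc]]] by (simp add: part_def)
  next
    case 3
    note G' = module_complex_group[OF T_complex]
    have x0: "x = \<zero>\<^bsub>Q\<^esub>" by (rule part_zero[OF 3 x])
    have z: "shift m \<zero>\<^bsub>Q\<^esub> = \<zero>\<^bsub>Q\<^esub>" for m using module_hom_zero[OF shift_hom G' G'] by simp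
    have "inc n (ret n x) = \<zero>\<^bsub>Q\<^esub>"
      unfolding x0 module_hom_zero[OF ret_hom_Q az G] using module_hom_zero[OF inc_hom G G'] by simp
    then show ?thesis
      unfolding x0 by (simp only: z module_hom_zero[OF F_hom az az] module_hom_zero[OF cut_hom az az] Q.l_zero
        Q.zero_closed)
  qed
qed

lemma inc_ret_homotopic: "homotopic R T T (\<lambda>n x. inc n (ret n x)) (\<lambda>n x. x)"
proof -
  note T = T_complex
  have ir: "(\<lambda>x. inc n (ret n x)) \<in> module_hom R (obj T n) (obj T n)" for n
    by (rule module_hom_comp[OF hom_from_part[OF ret_hom_Q] inc_hom])
  have "homotopic R T T (\<lambda>n x. x) (\<lambda>n x. inc n (ret n x))"
    by (rule homotopicI[OF T T module_hom_id ir shift_hom]) (use inc_ret in \<open>simp del: Q_simps\<close>)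
  then show ?thesis by (rule homotopic_sym[OF T T module_hom_id ir])
qed

end

section \<open>Summands cut out by an idempotent up to homotopy\<close>

lemma homotopic_diff_zero:
  assumes Y: "module_complex R Y" and f: "chain_map R X Y f" and g: "chain_map R X Y g" and fg: "homotopic R X Y f g"
  shows "homotopic R X Y (\<lambda>n x. f n x \<ominus>\<^bsub>obj Y n\<^esub> g n x) (\<lambda>n x. \<zero>\<^bsub>obj Y n\<^esub>)"
proof -
  have "(f n x \<ominus>\<^bsub>obj Y n\<^esub> g n x) \<ominus>\<^bsub>obj Y n\<^esub> \<zero>\<^bsub>obj Y n\<^esub> = f n x \<ominus>\<^bsub>obj Y n\<^esub> g n x"
    if x: "x \<in> carrier (obj X n)" for n x
  proof -
    interpret Y: abelian_group "obj Y n" by (rule module_complex_group[OF Y])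
    show ?thesis using chain_mapD(3)[OF f x] chain_mapD(3)[OF g x] by (simp add: a_minus_def Y.a_inv_zero)
  qed
  then show ?thesis using fg unfolding homotopic_def by simp
qed

text \<open>Up to homotopy the composite i q i q is the identity, since i q is. On the other hand q
  i is multiplication by \<open>e\<close>, so the same composite is \<open>e\<close> times i q.
  Hence \<open>e\<close> acts as 1 on \<open>T\<close>.\<close>

lemma hann_of_idempotent_retract:
  assumes R: "cring R" and X: "module_complex R X" and T: "module_complex R T" and i: "chain_map R X T i"
    and q: "chain_map R T X q"
    and e: "e \<in> carrier R" and qi: "\<And>n x. x \<in> carrier (obj X n) \<Longrightarrow> q n (i n x) = e \<odot>\<^bsub>obj X n\<^esub> x"
    and iq: "homotopic R T T (\<lambda>n x. i n (q n x)) (\<lambda>n x. x)"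
  shows "\<one>\<^bsub>R\<^esub> \<ominus>\<^bsub>R\<^esub> e \<in> hann R T"
proof -
  interpret R: cring R by fact
  note IQ = chain_map_comp[OF q i] and E = chain_map_scalar[OF T e] and id = chain_map_id[of R T]
  note IQIQ = chain_map_comp[OF IQ IQ]
  have 1: "homotopic R T T (\<lambda>n x. i n (q n (i n (q n x)))) (\<lambda>n x. i n (q n x))"
    by (rule homotopic_comp_right[OF T T T chain_mapD(1)[OF IQ] module_hom_id IQ iq])
  have 2: "homotopic R T T (\<lambda>n x. e \<odot>\<^bsub>obj T n\<^esub> i n (q n x)) (\<lambda>n x. e \<odot>\<^bsub>obj T n\<^esub> x)"
    by (rule homotopic_comp_left[OF T T T chain_mapD(1)[OF IQ] module_hom_id E iq])
  have 3: "homotopic R T T (\<lambda>n x. i n (q n (i n (q n x)))) (\<lambda>n x. e \<odot>\<^bsub>obj T n\<^esub> x)"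
    by (rule homotopic_cong[OF 2 T])
      (simp_all add: qi chain_mapD(3)[OF q] module_hom_smult[OF chain_mapD(1)[OF i] e])
  note m = chain_mapD(1)[OF IQ] chain_mapD(1)[OF IQIQ] chain_mapD(1)[OF E] chain_mapD(1)[OF id]
  have "homotopic R T T (\<lambda>n x. x) (\<lambda>n x. e \<odot>\<^bsub>obj T n\<^esub> x)"
    by (rule homotopic_trans[OF T T m(4,1,3) homotopic_sym[OF T T m(1,4) iq]
          homotopic_trans[OF T T m(1,2,3) homotopic_sym[OF T T m(2,1) 1] 3]])
  from homotopic_diff_zero[OF T id E this]
  have "homotopic R T T (\<lambda>n x. (\<one>\<^bsub>R\<^esub> \<ominus>\<^bsub>R\<^esub> e) \<odot>\<^bsub>obj T n\<^esub> x) (\<lambda>n x. \<zero>\<^bsub>obj T n\<^esub>)"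
  proof (rule homotopic_cong[OF _ T])
    fix n x assume x: "x \<in> carrier (obj T n)"
    interpret M: module R "obj T n" by (rule module_complexD(1)[OF T])
    show "(\<one>\<^bsub>R\<^esub> \<ominus>\<^bsub>R\<^esub> e) \<odot>\<^bsub>obj T n\<^esub> x = x \<ominus>\<^bsub>obj T n\<^esub> e \<odot>\<^bsub>obj T n\<^esub> x"
      using x e by (simp add: a_minus_def M.smult_l_distr M.smult_l_minus)
  qed simp
  then show ?thesis using e by (simp add: hann_def)
qed

text \<open>If \<open>h\<close> is a null-homotopy of \<open>f\<close>, then \<open>h d h\<close> is one of \<open>f\<^sup>2\<close>, and it squares to zero.\<close>

lemma square_zero_nullhomotopy:
  assumes X: "module_complex R X" and f: "f \<in> hann R X"
  obtains h where "\<And>n. h n \<in> module_hom R (obj X n) (obj X (n - 1))"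
    "\<And>n x. x \<in> carrier (obj X n) \<Longrightarrow> h (n - 1) (h n x) = \<zero>\<^bsub>obj X (n - 2)\<^esub>"
    "\<And>n x. x \<in> carrier (obj X n) \<Longrightarrow>
      (f \<otimes>\<^bsub>R\<^esub> f) \<odot>\<^bsub>obj X n\<^esub> x = diff X (n - 1) (h n x) \<oplus>\<^bsub>obj X n\<^esub> h (n + 1) (diff X n x)"
proof -
  note M = module_complexD(1)[OF X] and G = module_complex_group[OF X]
  note d = module_complexD(2)[OF X] module_complexD'(1)[OF X]
  note dc = module_complex_closed[OF X]
  have fR: "f \<in> carrier R" using f by (simp add: hann_def)
  have "homotopic R X X (\<lambda>n x. f \<odot>\<^bsub>obj X n\<^esub> x) (\<lambda>n x. \<zero>\<^bsub>obj X n\<^esub>)" using f by (simp add: hann_def)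
  then obtain k where k: "\<And>n. k n \<in> module_hom R (obj X n) (obj X (n - 1))"
    "\<And>n x. x \<in> carrier (obj X n) \<Longrightarrow> f \<odot>\<^bsub>obj X n\<^esub> x =
      \<zero>\<^bsub>obj X n\<^esub> \<oplus>\<^bsub>obj X n\<^esub> (diff X (n - 1) (k n x) \<oplus>\<^bsub>obj X n\<^esub> k (n + 1) (diff X n x))"
    using homotopicE[OF _ X X module_hom_scalar[OF M fR] module_hom_const_zero[OF M]] by blast
  note kc = homotopy_term_closed[OF X X k(1)]
  have k2: "f \<odot>\<^bsub>obj X n\<^esub> x = diff X (n - 1) (k n x) \<oplus>\<^bsub>obj X n\<^esub> k (n + 1) (diff X n x)" if "x \<in> carrier (obj X n)" for n x
  proof -
    interpret A: abelian_group "obj X n" by (rule G)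
    show ?thesis using k(2)[OF that] kc[OF that] by simp
  qed
  have kz: "k n \<zero>\<^bsub>obj X n\<^esub> = \<zero>\<^bsub>obj X (n - 1)\<^esub>" "diff X n \<zero>\<^bsub>obj X n\<^esub> = \<zero>\<^bsub>obj X (n + 1)\<^esub>" for n
    using module_hom_zero[OF k(1) G G] module_hom_zero[OF d(1) G G] by auto
  \<comment> \<open>Multiplication by \<open>f\<close> is d k + k d; evaluated on
    \<open>diff X n x\<close>, its second term dies because d d = 0.\<close>
  have dkd: "diff X n (k (n + 1) (diff X n x)) = f \<odot>\<^bsub>obj X (n + 1)\<^esub> diff X n x" if x: "x \<in> carrier (obj X n)" for n x
  proof -
    interpret A: module R "obj X (n + 1)" by (rule M)
    have "k (n + 2) \<zero>\<^bsub>obj X (n + 2)\<^esub> = \<zero>\<^bsub>obj X (n + 1)\<^esub>" using kz(1)[of "n + 2"] by (simp add: add.commute)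
    then have "k (n + 1 + 1) (diff X (n + 1) (diff X n x)) = \<zero>\<^bsub>obj X (n + 1)\<^esub>"
      using module_complexD(3)[OF X x] by (simp add: add.assoc)
    then show ?thesis using k2[OF dc(1)[OF x]] kc(2)[OF dc(1)[OF x]] by simp
  qed
  define h where "h n x = k n (diff X (n - 1) (k n x))" for n x
  have h: "h n \<in> module_hom R (obj X n) (obj X (n - 1))" for n
    unfolding h_def[abs_def] by (rule module_hom_comp[OF module_hom_comp[OF k(1) d(2)] k(1)])
  moreover have "h (n - 1) (h n x) = \<zero>\<^bsub>obj X (n - 2)\<^esub>" if x: "x \<in> carrier (obj X n)" for n x
  proof -
    define y where "y = k n x"
    have y: "y \<in> carrier (obj X (n - 1))" unfolding y_def by (rule kc(1)[OF x])
    define z where "z = k n (diff X (n - 1) y)"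
    interpret A: module R "obj X (n - 1)" by (rule M)
    have kd: "(\<lambda>y. k n (diff X (n - 1) y)) \<in> module_hom R (obj X (n - 1)) (obj X (n - 1))"
      by (rule module_hom_comp[OF d(2) k(1)])
    have z: "z \<in> carrier (obj X (n - 1))" unfolding z_def by (rule module_hom_closed[OF kd y])
    have dz: "diff X (n - 1) z = f \<odot>\<^bsub>obj X n\<^esub> diff X (n - 1) y"
      using dkd[OF y] by (simp add: z_def)
    have "k n (diff X (n - 1) z) = f \<odot>\<^bsub>obj X (n - 1)\<^esub> z"
      unfolding dz unfolding z_def by (rule module_hom_smult[OF k(1) fR dc(2)[OF y]])
    \<comment> \<open>Comparing this with k d z = f z forces d k z = 0, and \<open>k\<close> applied
      to that is the square of the new homotopy.\<close>
    moreover have "f \<odot>\<^bsub>obj X (n - 1)\<^esub> z = diff X (n - 1 - 1) (k (n - 1) z) \<oplus>\<^bsub>obj X (n - 1)\<^esub> k n (diff X (n - 1) z)"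
      using k2[OF z] by simp
    ultimately have "diff X (n - 1 - 1) (k (n - 1) z) \<oplus>\<^bsub>obj X (n - 1)\<^esub> f \<odot>\<^bsub>obj X (n - 1)\<^esub> z =
        \<zero>\<^bsub>obj X (n - 1)\<^esub> \<oplus>\<^bsub>obj X (n - 1)\<^esub> f \<odot>\<^bsub>obj X (n - 1)\<^esub> z"
      using A.smult_closed[OF fR z] by simp
    then have "diff X (n - 1 - 1) (k (n - 1) z) = \<zero>\<^bsub>obj X (n - 1)\<^esub>"
      by (subst (asm) A.add.right_cancel) (use kc(2)[OF z] A.smult_closed[OF fR z] in simp_all)
    then have "h (n - 1) (h n x) = k (n - 1) \<zero>\<^bsub>obj X (n - 1)\<^esub>"
      by (simp only: h_def y_def[symmetric] z_def[symmetric])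
    then show ?thesis using kz(1)[of "n - 1"] by simp
  qed
  moreover have "(f \<otimes>\<^bsub>R\<^esub> f) \<odot>\<^bsub>obj X n\<^esub> x = diff X (n - 1) (h n x) \<oplus>\<^bsub>obj X n\<^esub> h (n + 1) (diff X n x)"
    if x: "x \<in> carrier (obj X n)" for n x
  proof -
    interpret A: module R "obj X n" by (rule M)
    have 1: "diff X (n - 1) (h n x) = f \<odot>\<^bsub>obj X n\<^esub> diff X (n - 1) (k n x)"
      using dkd[OF kc(1)[OF x]] by (simp add: h_def)
    have k1: "k (n + 1) \<in> module_hom R (obj X (n + 1)) (obj X n)" using k(1)[of "n + 1"] by simp
    have 2: "h (n + 1) (diff X n x) = f \<odot>\<^bsub>obj X n\<^esub> k (n + 1) (diff X n x)"
      using dkd[OF x] module_hom_smult[OF k1 fR dc(1)[OF x]] by (simp add: h_def)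
    have "(f \<otimes>\<^bsub>R\<^esub> f) \<odot>\<^bsub>obj X n\<^esub> x = f \<odot>\<^bsub>obj X n\<^esub> (f \<odot>\<^bsub>obj X n\<^esub> x)" using fR x by (simp add: A.smult_assoc1)
    also have "\<dots> = f \<odot>\<^bsub>obj X n\<^esub> diff X (n - 1) (k n x) \<oplus>\<^bsub>obj X n\<^esub> f \<odot>\<^bsub>obj X n\<^esub> k (n + 1) (diff X n x)"
      unfolding k2[OF x] using fR kc[OF x] by (simp add: A.smult_r_distr)
    finally show ?thesis unfolding 1 2 .
  qed
  ultimately show ?thesis by (rule that)
qed

lemma idempotent_retract:
  fixes X :: "('a, 'u) cochain_complex"
  assumes inf: "infinite (UNIV :: 'u set)" and H: "homotopy_idempotent R X e h a b"
  obtains T :: "('a, 'u) cochain_complex" and i q where "fgp_complex R T" "chain_map R X T i" "chain_map R T X q"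
    "\<And>n x. x \<in> carrier (obj X n) \<Longrightarrow> q n (i n x) = e \<odot>\<^bsub>obj X n\<^esub> x"
    "homotopic R T T (\<lambda>n x. i n (q n x)) (\<lambda>n x. x)"
proof -
  interpret homotopy_idempotent R X e h a b by fact
  obtain g0 :: "(int \<Rightarrow> 'u) \<Rightarrow> 'u" where g0: "inj_on g0 ({a..b} \<rightarrow>\<^sub>E UNIV)"
    using inj_on_PiE_finite[OF inf, of "{a..b}"] by auto
  \<comment> \<open>The components outside \<open>{a..b}\<close> are zero, so finitely many
    components determine an element of \<open>Q\<close>; this is what makes it fit into
    \<open>'u\<close>.\<close>
  define g where "g n x = g0 (restrict x {a..b})" for n :: int and x
  have g: "inj_on (g n) (carrier (obj T n))" for n
  proof (rule inj_onI)
    fix x y assume "x \<in> carrier (obj T n)" "y \<in> carrier (obj T n)" and "g n x = g n y"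
    then have x: "x \<in> carrier Q" and y: "y \<in> carrier Q"
      and eq: "g0 (restrict x {a..b}) = g0 (restrict y {a..b})"
      using part_Q by (auto simp: g_def)
    have r: "restrict x {a..b} = restrict y {a..b}" by (rule inj_onD[OF g0, OF eq]) auto
    show "x = y"
    proof
      fix i
      show "x i = y i"
      proof (cases "i \<in> {a..b}")
        case True
        then show ?thesis using fun_cong[OF r, of i] by simp
      next
        case False
        then have "carrier (C i) = {\<zero>\<^bsub>C i\<^esub>}" by (intro bounded) auto
        then show ?thesis using Qc[OF x, of i] Qc[OF y, of i] by (metis singletonD)
      qed
    qed
  qed
  obtain T' :: "('a, 'u) cochain_complex" and \<phi> \<psi> where T': "module_complex R T'" "fgp_complex R T \<longrightarrow> fgp_complex R T'"
    and \<phi>: "chain_map R T T' \<phi>" and \<psi>: "chain_map R T' T \<psi>"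
    and inv: "\<And>n x. x \<in> carrier (obj T n) \<Longrightarrow> \<psi> n (\<phi> n x) = x" "\<And>n y. y \<in> carrier (obj T' n) \<Longrightarrow> \<phi> n (\<psi> n y) = y"
    by (rule complex_transport[OF T_complex g]) (rule that)
  show ?thesis
  proof (rule that)
    show "fgp_complex R T'" using T'(2) T_fgp by blast
    show "chain_map R X T' (\<lambda>n x. \<phi> n (inc n x))" by (rule chain_map_comp[OF inc_chain \<phi>])
    show "chain_map R T' X (\<lambda>n y. ret n (\<psi> n y))" by (rule chain_map_comp[OF \<psi> ret_chain])
    show "ret n (\<psi> n (\<phi> n (inc n x))) = e \<odot>\<^bsub>C n\<^esub> x" if "x \<in> carrier (C n)" for n x
      using inv(1)[OF chain_mapD(3)[OF inc_chain that]] ret_inc[OF that] by simp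
    note ir = chain_map_comp[OF ret_chain inc_chain]
    have "homotopic R T' T (\<lambda>n y. inc n (ret n (\<psi> n y))) (\<lambda>n y. \<psi> n y)"
      by (rule homotopic_comp_right[OF T'(1) T_complex T_complex chain_mapD(1)[OF ir] module_hom_id \<psi>
        inc_ret_homotopic])
    from homotopic_comp_left[OF T'(1) T_complex T'(1) chain_mapD(1)[OF chain_map_comp[OF \<psi> ir]]
      chain_mapD(1)[OF \<psi>] \<phi> this]
    show "homotopic R T' T' (\<lambda>n y. \<phi> n (inc n (ret n (\<psi> n y)))) (\<lambda>n y. y)"
      by (rule homotopic_cong[OF _ T'(1)]) (simp_all add: inv(2))
  qed
qed

text \<open>The two summands are built independently, from an element \<open>c\<close> congruent to
  \<open>e\<close> and from 1 - c. The composites through them are multiplication by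
  \<open>c\<close> and by 1 - c, so the sum condition holds exactly and not merely up to
  homotopy.\<close>

lemma idempotent_splitting:
  fixes X :: "('a, 'u) cochain_complex"
  assumes R: "cring R" and inf: "infinite (UNIV :: 'u set)" and X: "fgp_complex R X"
    and e: "e \<in> carrier R" "e \<otimes>\<^bsub>R\<^esub> (\<one>\<^bsub>R\<^esub> \<ominus>\<^bsub>R\<^esub> e) \<in> hann R X"
  obtains X1 X2 :: "('a, 'u) cochain_complex" and i1 q1 i2 q2 where
    "fgp_complex R X1" "chain_map R X X1 i1" "chain_map R X1 X q1" "homotopic R X1 X1 (\<lambda>n x. i1 n (q1 n x)) (\<lambda>n x. x)"
    "fgp_complex R X2" "chain_map R X X2 i2" "chain_map R X2 X q2" "homotopic R X2 X2 (\<lambda>n x. i2 n (q2 n x)) (\<lambda>n x. x)"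
    "\<And>n x. x \<in> carrier (obj X n) \<Longrightarrow> q1 n (i1 n x) \<oplus>\<^bsub>obj X n\<^esub> q2 n (i2 n x) = x"
    "\<one>\<^bsub>R\<^esub> \<ominus>\<^bsub>R\<^esub> e \<in> hann R X1" "e \<in> hann R X2"
proof -
  interpret R: cring R by fact
  have Xm: "module_complex R X" using X by (simp add: fgp_complex_def)
  note M = module_complexD(1)[OF Xm]
  obtain a b where bd: "\<And>n. n < a \<or> b < n \<Longrightarrow> carrier (obj X n) = {\<zero>\<^bsub>obj X n\<^esub>}"
    using X unfolding fgp_complex_def by blast
  define f where "f = e \<otimes>\<^bsub>R\<^esub> (\<one>\<^bsub>R\<^esub> \<ominus>\<^bsub>R\<^esub> e)"
  \<comment> \<open>\<open>c\<close> is 3 e^2 - 2 e^3, the polynomial that lifts idempotents: it is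
    divisible by e^2 and 1 - c by (1 - e)^2, with cofactors 3 - 2 e and t = 1 + 2 e. Hence c(1 - c)
    is \<open>s\<close> times the square of \<open>f\<close>, the form for which a null-homotopy of
    square zero exists, while \<open>c\<close> differs from \<open>e\<close> only by a multiple of
    \<open>f\<close>.\<close>
  define t where "t = \<one>\<^bsub>R\<^esub> \<oplus>\<^bsub>R\<^esub> e \<oplus>\<^bsub>R\<^esub> e"
  define s where "s = t \<otimes>\<^bsub>R\<^esub> (\<one>\<^bsub>R\<^esub> \<oplus>\<^bsub>R\<^esub> \<one>\<^bsub>R\<^esub> \<oplus>\<^bsub>R\<^esub> \<one>\<^bsub>R\<^esub> \<ominus>\<^bsub>R\<^esub> (e \<oplus>\<^bsub>R\<^esub> e))"
  define c where "c = e \<otimes>\<^bsub>R\<^esub> e \<otimes>\<^bsub>R\<^esub> (\<one>\<^bsub>R\<^esub> \<oplus>\<^bsub>R\<^esub> \<one>\<^bsub>R\<^esub> \<oplus>\<^bsub>R\<^esub> \<one>\<^bsub>R\<^esub> \<ominus>\<^bsub>R\<^esub> (e \<oplus>\<^bsub>R\<^esub> e))"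
  have car: "f \<in> carrier R" "s \<in> carrier R" "c \<in> carrier R" using e(1) by (simp_all add: f_def s_def c_def t_def)
  have cc: "c \<otimes>\<^bsub>R\<^esub> (\<one>\<^bsub>R\<^esub> \<ominus>\<^bsub>R\<^esub> c) = s \<otimes>\<^bsub>R\<^esub> (f \<otimes>\<^bsub>R\<^esub> f)"
  proof -
    define u where "u = \<one>\<^bsub>R\<^esub> \<ominus>\<^bsub>R\<^esub> e"
    define w where "w = \<one>\<^bsub>R\<^esub> \<oplus>\<^bsub>R\<^esub> \<one>\<^bsub>R\<^esub> \<oplus>\<^bsub>R\<^esub> \<one>\<^bsub>R\<^esub> \<ominus>\<^bsub>R\<^esub> (e \<oplus>\<^bsub>R\<^esub> e)"
    have uw: "u \<in> carrier R" "w \<in> carrier R" "t \<in> carrier R" using e(1) by (simp_all add: u_def w_def t_def)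
    have "\<one>\<^bsub>R\<^esub> \<ominus>\<^bsub>R\<^esub> c = u \<otimes>\<^bsub>R\<^esub> u \<otimes>\<^bsub>R\<^esub> t"
      unfolding c_def u_def t_def using e(1) by algebra
    then show ?thesis
      unfolding s_def f_def u_def[symmetric] w_def[symmetric] unfolding c_def w_def[symmetric]
      using uw e(1) by (simp add: R.m_ac)
  qed
  have cc': "(\<one>\<^bsub>R\<^esub> \<ominus>\<^bsub>R\<^esub> c) \<otimes>\<^bsub>R\<^esub> (\<one>\<^bsub>R\<^esub> \<ominus>\<^bsub>R\<^esub> (\<one>\<^bsub>R\<^esub> \<ominus>\<^bsub>R\<^esub> c)) = c \<otimes>\<^bsub>R\<^esub> (\<one>\<^bsub>R\<^esub> \<ominus>\<^bsub>R\<^esub> c)"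
    using car(3) by algebra
  have ce: "c = e \<ominus>\<^bsub>R\<^esub> (\<one>\<^bsub>R\<^esub> \<ominus>\<^bsub>R\<^esub> (e \<oplus>\<^bsub>R\<^esub> e)) \<otimes>\<^bsub>R\<^esub> f"
    unfolding c_def f_def using e(1) by algebra
  obtain k where k: "\<And>n. k n \<in> module_hom R (obj X n) (obj X (n - 1))"
    "\<And>n x. x \<in> carrier (obj X n) \<Longrightarrow> k (n - 1) (k n x) = \<zero>\<^bsub>obj X (n - 2)\<^esub>"
    "\<And>n x. x \<in> carrier (obj X n) \<Longrightarrow>
      (f \<otimes>\<^bsub>R\<^esub> f) \<odot>\<^bsub>obj X n\<^esub> x = diff X (n - 1) (k n x) \<oplus>\<^bsub>obj X n\<^esub> k (n + 1) (diff X n x)"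
    using square_zero_nullhomotopy[OF Xm e(2)] unfolding f_def by blast
  define h where "h n x = s \<odot>\<^bsub>obj X (n - 1)\<^esub> k n x" for n x
  have h: "h n \<in> module_hom R (obj X n) (obj X (n - 1))" for n
    unfolding h_def[abs_def] by (rule module_hom_times[OF M k(1) car(2)])
  have hh: "h (n - 1) (h n x) = \<zero>\<^bsub>obj X (n - 2)\<^esub>" if x: "x \<in> carrier (obj X n)" for n x
    using module_hom_smult[OF k(1) car(2) module_hom_closed[OF k(1) x]] k(2)[OF x]
      module.smult_r_null[OF M car(2), of "n - 2"] by (simp add: h_def)
  have dh: "(s \<otimes>\<^bsub>R\<^esub> (f \<otimes>\<^bsub>R\<^esub> f)) \<odot>\<^bsub>obj X n\<^esub> x = diff X (n - 1) (h n x) \<oplus>\<^bsub>obj X n\<^esub> h (n + 1) (diff X n x)"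
    if x: "x \<in> carrier (obj X n)" for n x
  proof -
    interpret A: module R "obj X n" by (rule M)
    note kc = homotopy_term_closed[OF Xm Xm k(1) x]
    have "(s \<otimes>\<^bsub>R\<^esub> (f \<otimes>\<^bsub>R\<^esub> f)) \<odot>\<^bsub>obj X n\<^esub> x = s \<odot>\<^bsub>obj X n\<^esub> ((f \<otimes>\<^bsub>R\<^esub> f) \<odot>\<^bsub>obj X n\<^esub> x)"
      using car x by (simp add: A.smult_assoc1)
    also have "\<dots> = diff X (n - 1) (h n x) \<oplus>\<^bsub>obj X n\<^esub> h (n + 1) (diff X n x)"
      unfolding k(3)[OF x] using kc car(2)
      by (simp add: A.smult_r_distr h_def module_hom_smult[OF module_complexD'(1)[OF Xm] car(2)])
    finally show ?thesis .
  qed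
  have H1: "homotopy_idempotent R X c h a b"
    by unfold_locales (use R X bd car h hh dh cc in \<open>auto simp: homotopy_idempotent_def\<close>)
  \<comment> \<open>The condition is symmetric under exchanging \<open>c\<close> and 1 - c, so one
    homotopy serves both.\<close>
  have H2: "homotopy_idempotent R X (\<one>\<^bsub>R\<^esub> \<ominus>\<^bsub>R\<^esub> c) h a b"
    by unfold_locales (use R X bd car h hh dh cc cc' in \<open>auto simp: homotopy_idempotent_def\<close>)
  obtain X1 :: "('a, 'u) cochain_complex" and i1 q1 where 1: "fgp_complex R X1" "chain_map R X X1 i1"
    "chain_map R X1 X q1"
    "\<And>n x. x \<in> carrier (obj X n) \<Longrightarrow> q1 n (i1 n x) = c \<odot>\<^bsub>obj X n\<^esub> x"
    "homotopic R X1 X1 (\<lambda>n x. i1 n (q1 n x)) (\<lambda>n x. x)"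
    by (rule idempotent_retract[OF inf H1]) (rule that)
  obtain X2 :: "('a, 'u) cochain_complex" and i2 q2 where 2: "fgp_complex R X2" "chain_map R X X2 i2"
    "chain_map R X2 X q2"
    "\<And>n x. x \<in> carrier (obj X n) \<Longrightarrow> q2 n (i2 n x) = (\<one>\<^bsub>R\<^esub> \<ominus>\<^bsub>R\<^esub> c) \<odot>\<^bsub>obj X n\<^esub> x"
    "homotopic R X2 X2 (\<lambda>n x. i2 n (q2 n x)) (\<lambda>n x. x)"
    by (rule idempotent_retract[OF inf H2]) (rule that)
  have m: "module_complex R X1" "module_complex R X2" using 1(1) 2(1) by (auto simp: fgp_complex_def)
  interpret h1: ideal "hann R X1" R by (rule ideal_hann[OF R m(1)])
  interpret h2: ideal "hann R X2" R by (rule ideal_hann[OF R m(2)])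
  have c1: "\<one>\<^bsub>R\<^esub> \<ominus>\<^bsub>R\<^esub> c \<in> hann R X1"
    by (rule hann_of_idempotent_retract[OF R Xm m(1) 1(2,3) car(3) 1(4,5)])
  have "\<one>\<^bsub>R\<^esub> \<ominus>\<^bsub>R\<^esub> (\<one>\<^bsub>R\<^esub> \<ominus>\<^bsub>R\<^esub> c) \<in> hann R X2"
    by (rule hann_of_idempotent_retract[OF R Xm m(2) 2(2,3) _ 2(4,5)]) (use car in simp)
  moreover have "\<one>\<^bsub>R\<^esub> \<ominus>\<^bsub>R\<^esub> (\<one>\<^bsub>R\<^esub> \<ominus>\<^bsub>R\<^esub> c) = c" using car(3) by algebra
  ultimately have c2: "c \<in> hann R X2" by simp
  have f1: "f \<in> hann R X1" using hann_retract[OF Xm m(1) 1(2,3,5)] e(2) unfolding f_def by blast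
  have f2: "f \<in> hann R X2" using hann_retract[OF Xm m(2) 2(2,3,5)] e(2) unfolding f_def by blast
  \<comment> \<open>\<open>f\<close> lies in the ideals of both summands because they are homotopy
    retracts of \<open>X\<close>; this brings the two conditions back from \<open>c\<close> to
    \<open>e\<close>.\<close>
  define r where "r = \<one>\<^bsub>R\<^esub> \<ominus>\<^bsub>R\<^esub> (e \<oplus>\<^bsub>R\<^esub> e)"
  have r: "r \<in> carrier R" using e(1) by (simp add: r_def)
  have e2: "e = c \<oplus>\<^bsub>R\<^esub> r \<otimes>\<^bsub>R\<^esub> f" and e1: "\<one>\<^bsub>R\<^esub> \<ominus>\<^bsub>R\<^esub> e = (\<one>\<^bsub>R\<^esub> \<ominus>\<^bsub>R\<^esub> c) \<oplus>\<^bsub>R\<^esub> (\<ominus>\<^bsub>R\<^esub> r) \<otimes>\<^bsub>R\<^esub> f"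
    unfolding ce[folded r_def] using e(1) r car(1) by algebra+
  show ?thesis
  proof (rule that[OF 1(1-3,5) 2(1-3,5)])
    show "q1 n (i1 n x) \<oplus>\<^bsub>obj X n\<^esub> q2 n (i2 n x) = x" if x: "x \<in> carrier (obj X n)" for n x
    proof -
      interpret A: module R "obj X n" by (rule M)
      have "c \<oplus>\<^bsub>R\<^esub> (\<one>\<^bsub>R\<^esub> \<ominus>\<^bsub>R\<^esub> c) = \<one>\<^bsub>R\<^esub>" using car(3) by algebra
      then show ?thesis using 1(4)[OF x] 2(4)[OF x] x car(3) by (simp flip: A.smult_l_distr)
    qed
    show "e \<in> hann R X2" unfolding e2 by (intro h2.a_closed c2 h2.I_l_closed f2 r)
    show "\<one>\<^bsub>R\<^esub> \<ominus>\<^bsub>R\<^esub> e \<in> hann R X1"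
      unfolding e1 by (intro h1.a_closed c1 h1.I_l_closed f1 R.a_inv_closed r)
  qed
qed

section \<open>Decomposable supports\<close>

text \<open>Zorn's lemma for a family of ideals: in a noetherian ring every nonempty chain contains
  its own union, so the bound stays in the family.\<close>

lemma (in noetherian_ring) maximal_ideal_in:
  assumes "\<I> \<noteq> {}" "\<And>I. I \<in> \<I> \<Longrightarrow> ideal I R"
  shows "\<exists>M\<in>\<I>. \<forall>I\<in>\<I>. M \<subseteq> I \<longrightarrow> I = M"
proof (rule subset_Zorn)
  fix \<C> assume C: "subset.chain \<I> \<C>"
  show "\<exists>U\<in>\<I>. \<forall>X\<in>\<C>. X \<subseteq> U"
  proof (cases "\<C> = {}")
    case True
    then show ?thesis using assms(1) by blast
  next
    case False
    have "subset.chain {I. ideal I R} \<C>" using C assms(2) unfolding pred_on.chain_def by blast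
    then have "\<Union>\<C> \<in> \<C>" by (rule ideal_chain_is_trivial[OF False])
    moreover have "\<C> \<subseteq> \<I>" using C by (simp add: pred_on.chain_def)
    ultimately show ?thesis by (intro bexI[of _ "\<Union>\<C>"]) auto
  qed
qed

lemma (in noetherian_ring) ideal_induct:
  assumes J: "ideal J R" and step: "\<And>J. ideal J R \<Longrightarrow> (\<And>K. ideal K R \<Longrightarrow> J \<subset> K \<Longrightarrow> P K) \<Longrightarrow> P J"
  shows "P J"
proof (rule ccontr)
  assume "\<not> P J"
  then have "{K. ideal K R \<and> \<not> P K} \<noteq> {}" using J by blast
  from maximal_ideal_in[OF this] obtain M where "ideal M R" "\<not> P M" "\<And>I. ideal I R \<Longrightarrow> \<not> P I \<Longrightarrow> M \<subseteq> I \<Longrightarrow> I = M"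
    by blast
  then show False using step[of M] by blast
qed

lemma prime_above_proper:
  assumes "cring R" "noetherian_ring R" "ideal J R" "J \<noteq> carrier R"
  shows "\<exists>p. primeideal p R \<and> J \<subseteq> p"
proof -
  interpret cring R by fact
  interpret noetherian_ring R by fact
  define \<I> where "\<I> = {K. ideal K R \<and> J \<subseteq> K \<and> K \<noteq> carrier R}"
  have "\<exists>M\<in>\<I>. \<forall>K\<in>\<I>. M \<subseteq> K \<longrightarrow> K = M"
    by (rule maximal_ideal_in) (use assms in \<open>auto simp: \<I>_def\<close>)
  then obtain M where "M \<in> \<I>" and max: "\<And>K. K \<in> \<I> \<Longrightarrow> M \<subseteq> K \<Longrightarrow> K = M" by auto
  then have M: "ideal M R" "J \<subseteq> M" "M \<noteq> carrier R"
    and M': "\<And>K. ideal K R \<Longrightarrow> K \<noteq> carrier R \<Longrightarrow> M \<subseteq> K \<Longrightarrow> K = M"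
    by (auto simp: \<I>_def)
  have "maximalideal M R"
  proof (rule maximalidealI)
    show "K = M \<or> K = carrier R" if "ideal K R" "M \<subseteq> K" for K using M' that by blast
  qed (use M in auto)
  then show ?thesis using maximalideal_prime M(2) by blast
qed

text \<open>A prime above the sum of the two ideals would lie in both closed sets, so the sum is the
  unit ideal.\<close>

lemma comaximal_if_vanishing_disjoint:
  assumes "cring R" "noetherian_ring R" "ideal A R" "ideal B R" "vanishing R A \<inter> vanishing R B = {}"
  shows "\<exists>x\<in>A. \<exists>y\<in>B. x \<oplus>\<^bsub>R\<^esub> y = \<one>\<^bsub>R\<^esub>"
proof -
  interpret cring R by fact
  interpret A: ideal A R by fact
  interpret B: ideal B R by fact
  have AB: "ideal (A <+>\<^bsub>R\<^esub> B) R" by (rule add_ideals[OF assms(3,4)])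
  have sub: "A \<subseteq> A <+>\<^bsub>R\<^esub> B" "B \<subseteq> A <+>\<^bsub>R\<^esub> B"
  proof -
    show "A \<subseteq> A <+>\<^bsub>R\<^esub> B"
    proof
      fix x assume "x \<in> A"
      then have "x = x \<oplus>\<^bsub>R\<^esub> \<zero>\<^bsub>R\<^esub>" using A.a_Hcarr by simp
      then show "x \<in> A <+>\<^bsub>R\<^esub> B" using \<open>x \<in> A\<close> B.zero_closed unfolding set_add_def' by blast
    qed
    show "B \<subseteq> A <+>\<^bsub>R\<^esub> B"
    proof
      fix x assume "x \<in> B"
      then have "x = \<zero>\<^bsub>R\<^esub> \<oplus>\<^bsub>R\<^esub> x" using B.a_Hcarr by simp
      then show "x \<in> A <+>\<^bsub>R\<^esub> B" using \<open>x \<in> B\<close> A.zero_closed unfolding set_add_def' by blast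
    qed
  qed
  have "A <+>\<^bsub>R\<^esub> B = carrier R"
  proof (rule ccontr)
    assume "A <+>\<^bsub>R\<^esub> B \<noteq> carrier R"
    then obtain p where "primeideal p R" "A <+>\<^bsub>R\<^esub> B \<subseteq> p" using prime_above_proper[OF assms(1,2) AB] by blast
    then show False using assms(5) sub unfolding vanishing_def Spec_def by blast
  qed
  then have "\<one>\<^bsub>R\<^esub> \<in> A <+>\<^bsub>R\<^esub> B" by simp
  then obtain x y where "x \<in> A" "y \<in> B" "\<one>\<^bsub>R\<^esub> = x \<oplus>\<^bsub>R\<^esub> y" unfolding set_add_def' by blast
  then show ?thesis by metis
qed

section \<open>Closed sets and thick supports\<close>

lemma thick_support_vanishing:
  assumes "ideal J R"
  shows "thick_support R (vanishing R J)"
proof -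
  have "zariski_closed R (vanishing R J)"
    unfolding zariski_closed_def vanishing_def using assms by blast
  then show ?thesis
    unfolding thick_support_def by (intro exI[of _ "{vanishing R J}"]) simp
qed

lemma thick_support_Int:
  assumes "cring R" "thick_support R S" "thick_support R S'"
  shows "thick_support R (S \<inter> S')"
proof -
  interpret cring R by fact
  obtain \<C> where C: "\<forall>Z\<in>\<C>. zariski_closed R Z" "S = \<Union>\<C>" using assms(2) by (auto simp: thick_support_def)
  obtain \<D> where D: "\<forall>Z\<in>\<D>. zariski_closed R Z" "S' = \<Union>\<D>" using assms(3) by (auto simp: thick_support_def)
  have "zariski_closed R (Z \<inter> W)" if ZW: "zariski_closed R Z" "zariski_closed R W" for Z W
  proof -
    obtain A B where A: "ideal A R" "Z = {p \<in> Spec R. A \<subseteq> p}" and B: "ideal B R" "W = {p \<in> Spec R. B \<subseteq> p}"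
      using ZW unfolding zariski_closed_def by blast
    have U: "A \<union> B \<subseteq> carrier R" using ideal.Icarr[OF A(1)] ideal.Icarr[OF B(1)] by blast
    have "A \<union> B \<subseteq> p \<longleftrightarrow> Idl\<^bsub>R\<^esub> (A \<union> B) \<subseteq> p" if "p \<in> Spec R" for p
      using genideal_self[OF U] genideal_minimal[of p "A \<union> B"] that by (auto simp: Spec_def primeideal_def)
    then have "Z \<inter> W = {p \<in> Spec R. Idl\<^bsub>R\<^esub> (A \<union> B) \<subseteq> p}" using A B by auto
    then show ?thesis unfolding zariski_closed_def using genideal_ideal[OF U] by blast
  qed
  then have "\<forall>V\<in>{Z \<inter> W | Z W. Z \<in> \<C> \<and> W \<in> \<D>}. zariski_closed R V" using C D by blast
  moreover have "S \<inter> S' = \<Union>{Z \<inter> W | Z W. Z \<in> \<C> \<and> W \<in> \<D>}" unfolding C(2) D(2) by blast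
  ultimately show ?thesis unfolding thick_support_def by blast
qed

lemma thick_support_UN:
  assumes "\<And>i. i \<in> I \<Longrightarrow> thick_support R (S i)"
  shows "thick_support R (\<Union>i\<in>I. S i)"
proof -
  obtain \<C> where C: "\<And>i. i \<in> I \<Longrightarrow> (\<forall>Z\<in>\<C> i. zariski_closed R Z) \<and> S i = \<Union>(\<C> i)"
    using assms unfolding thick_support_def by metis
  show ?thesis unfolding thick_support_def
    by (rule exI[of _ "\<Union>i\<in>I. \<C> i"]) (use C in auto)
qed

lemma thick_support_upward:
  assumes "thick_support R S" "p \<in> S" "q \<in> Spec R" "p \<subseteq> q"
  shows "q \<in> S"
proof -
  obtain Z where Z: "zariski_closed R Z" "p \<in> Z" "Z \<subseteq> S"
    using assms(1,2) by (auto simp: thick_support_def)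
  then obtain I where "Z = {p \<in> Spec R. I \<subseteq> p}" by (auto simp: zariski_closed_def)
  then show ?thesis using Z assms(3,4) by blast
qed

lemma vanishing_ideal_prod:
  assumes "cring R" "ideal A R" "ideal B R"
  shows "vanishing R (A \<cdot>\<^bsub>R\<^esub> B) \<subseteq> vanishing R A \<union> vanishing R B"
proof
  fix p assume p: "p \<in> vanishing R (A \<cdot>\<^bsub>R\<^esub> B)"
  then interpret p: primeideal p R by (simp add: vanishing_def Spec_def)
  show "p \<in> vanishing R A \<union> vanishing R B"
  proof (rule ccontr)
    assume "\<not> ?thesis"
    then obtain x y where xy: "x \<in> A" "x \<notin> p" "y \<in> B" "y \<notin> p" using p by (auto simp: vanishing_def)
    have "x \<otimes>\<^bsub>R\<^esub> y \<in> p" using p ideal_prod.prod[OF xy(1,3)] by (auto simp: vanishing_def)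
    then show False using p.I_prime xy ideal.Icarr[OF assms(2) xy(1)] ideal.Icarr[OF assms(3) xy(3)] by blast
  qed
qed

text \<open>Elements of a product ideal are sums of products, so the claim is checked on products,
  in one argument after the other.\<close>

lemma ideal_prod_mult_closed:
  assumes "cring R" "ideal A R" "ideal A' R" "ideal B R" "ideal B' R" "ideal J R"
    and "\<And>x x' y y'. x \<in> A \<Longrightarrow> x' \<in> A' \<Longrightarrow> y \<in> B \<Longrightarrow> y' \<in> B' \<Longrightarrow> (x \<otimes>\<^bsub>R\<^esub> x') \<otimes>\<^bsub>R\<^esub> (y \<otimes>\<^bsub>R\<^esub> y') \<in> J"
    and x: "x \<in> A \<cdot>\<^bsub>R\<^esub> A'" and y: "y \<in> B \<cdot>\<^bsub>R\<^esub> B'"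
  shows "x \<otimes>\<^bsub>R\<^esub> y \<in> J"
proof -
  interpret cring R by fact
  interpret J: ideal J R by fact
  have Bc: "y \<in> carrier R" if "y \<in> B \<cdot>\<^bsub>R\<^esub> B'" for y using ideal_prod_in_carrier[OF assms(4,5)] that by blast
  have Ac: "y \<in> carrier R" if "y \<in> A \<cdot>\<^bsub>R\<^esub> A'" for y using ideal_prod_in_carrier[OF assms(2,3)] that by blast
  show ?thesis
    using x y
  proof (induction x rule: ideal_prod.induct)
    case (prod i j)
    have ij: "i \<otimes>\<^bsub>R\<^esub> j \<in> carrier R" using ideal.Icarr[OF assms(2)] ideal.Icarr[OF assms(3)] prod by blast
    show ?case
      using prod(3)
    proof (induction y rule: ideal_prod.induct)
      case (prod k l)
      then show ?case using assms(7) \<open>i \<in> A\<close> \<open>j \<in> A'\<close> by blast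
    next
      case (sum s t)
      then show ?case using ij Bc by (simp add: r_distr)
    qed
  next
    case (sum s t)
    then show ?case using Ac Bc by (simp add: l_distr)
  qed
qed

text \<open>A decomposition of a closed set into two thick supports is a decomposition into two closed
  sets: an ideal contains a product of primes containing it, and each of these primes lies in one
  of the two supports.\<close>

lemma vanishing_covered:
  assumes R: "cring R" and N: "noetherian_ring R" and S: "thick_support R S1" "thick_support R S2"
    and J: "ideal J R" and cov: "vanishing R J \<subseteq> S1 \<union> S2"
  shows "\<exists>A B. ideal A R \<and> ideal B R \<and> (\<forall>x\<in>A. \<forall>y\<in>B. x \<otimes>\<^bsub>R\<^esub> y \<in> J) \<and> vanishing R A \<subseteq> S1 \<and> vanishing R B \<subseteq> S2"
proof -
  interpret cring R by fact
  interpret noetherian_ring R by fact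
  have vR: "vanishing R (carrier R) = {}"
    using primeideal.I_notcarr ideal.Icarr primeideal.axioms(1) by (fastforce simp: vanishing_def Spec_def)
  have oneI: "ideal (carrier R) R" by (rule oneideal)
  \<comment> \<open>\<open>A\<close> and \<open>B\<close> collect the factors belonging to either
    side, with the unit ideal as the empty product. Carrying the pair through the induction avoids
    lists of primes.\<close>
  define P where "P J \<longleftrightarrow> (\<exists>A B. ideal A R \<and> ideal B R \<and> (\<forall>x\<in>A. \<forall>y\<in>B. x \<otimes>\<^bsub>R\<^esub> y \<in> J) \<and>
    vanishing R A \<subseteq> S1 \<and> vanishing R B \<subseteq> S2)" for J
  have "vanishing R J \<subseteq> S1 \<union> S2 \<longrightarrow> P J"
  proof (rule ideal_induct[where P = "\<lambda>J. vanishing R J \<subseteq> S1 \<union> S2 \<longrightarrow> P J", OF J], rule impI)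
    fix J assume 1: "ideal J R" "\<And>K. ideal K R \<Longrightarrow> J \<subset> K \<Longrightarrow> vanishing R K \<subseteq> S1 \<union> S2 \<longrightarrow> P K"
      "vanishing R J \<subseteq> S1 \<union> S2"
    interpret J: ideal J R by (rule 1(1))
    consider "J = carrier R" | "primeideal J R" | "J \<noteq> carrier R" "\<not> primeideal J R" by blast
    then show "P J"
    proof cases
      case 1
      then show ?thesis unfolding P_def using vR oneI by (intro exI[of _ "carrier R"]) auto
    next
      case 2
      have JJ: "J \<in> vanishing R J" using 2 by (simp add: vanishing_def Spec_def)
      \<comment> \<open>Thick supports are closed under specialisation, so the one that contains the
        prime \<open>J\<close> contains its whole closed set.\<close>
      have up: "vanishing R J \<subseteq> S" if "thick_support R S" "J \<in> S" for S
        using thick_support_upward[OF that] by (auto simp: vanishing_def)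
      show ?thesis
      proof (cases "J \<in> S1")
        case True
        show ?thesis unfolding P_def
          by (rule exI[of _ J], rule exI[of _ "carrier R"])
            (use up[OF S(1) True] vR oneI J.ideal_axioms J.I_r_closed in auto)
      next
        case False
        then have "J \<in> S2" using JJ 1(3) by blast
        then show ?thesis unfolding P_def
          by (intro exI[of _ "carrier R"] exI[of _ J])
            (use up[OF S(2)] vR oneI J.ideal_axioms J.I_l_closed in auto)
      qed
    next
      case 3
      then obtain a b where ab: "a \<in> carrier R" "b \<in> carrier R" "a \<otimes>\<^bsub>R\<^esub> b \<in> J" "a \<notin> J" "b \<notin> J"
        using primeidealI[OF J.ideal_axioms R] by blast
      \<comment> \<open>Two strictly larger ideals, for \<open>a\<close> and for \<open>b\<close>,
        whose product lies in \<open>J\<close> because the product of \<open>a\<close> and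
        \<open>b\<close> does; the pairs obtained for them are multiplied factor by factor.\<close>
      define K where "K c = Idl\<^bsub>R\<^esub> (insert c J)" for c
      have Kc: "insert c J \<subseteq> carrier R" if "c \<in> carrier R" for c using that J.Icarr by blast
      have K: "ideal (K c) R" "J \<subset> K c" if "c \<in> carrier R" "c \<notin> J" for c
        using genideal_ideal[OF Kc[OF that(1)]] genideal_self[OF Kc[OF that(1)]] that(2) unfolding K_def by auto
      have cov: "vanishing R (K c) \<subseteq> S1 \<union> S2" if "c \<in> carrier R" "c \<notin> J" for c
        using 1(3) K(2)[OF that] unfolding vanishing_def by blast
      have Kmult: "x \<otimes>\<^bsub>R\<^esub> y \<in> J" if x: "x \<in> K a" and y: "y \<in> K b" for x y
      proof -
        \<comment> \<open>The elements that multiply \<open>c\<close> into \<open>J\<close> form an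
          ideal. Used first with \<open>b\<close> and then with \<open>x\<close>, this extends the
          condition from generators to the two ideals.\<close>
        have L: "ideal {x \<in> carrier R. x \<otimes>\<^bsub>R\<^esub> c \<in> J} R" if c: "c \<in> carrier R" for c
        proof (rule idealI)
          show "ring R" by (rule ring_axioms)
          show "subgroup {x \<in> carrier R. x \<otimes>\<^bsub>R\<^esub> c \<in> J} (add_monoid R)"
            by (rule add.subgroupI) (use c J.zero_closed J.a_inv_closed J.a_closed in \<open>auto simp: l_minus l_distr\<close>)
        next
          fix u v assume "u \<in> {x \<in> carrier R. x \<otimes>\<^bsub>R\<^esub> c \<in> J}" "v \<in> carrier R"
          then have *: "v \<otimes>\<^bsub>R\<^esub> u \<in> {x \<in> carrier R. x \<otimes>\<^bsub>R\<^esub> c \<in> J}"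
            using c J.I_l_closed[of "u \<otimes>\<^bsub>R\<^esub> c" v] by (simp add: m_assoc)
          then show "v \<otimes>\<^bsub>R\<^esub> u \<in> {x \<in> carrier R. x \<otimes>\<^bsub>R\<^esub> c \<in> J}" .
          show "u \<otimes>\<^bsub>R\<^esub> v \<in> {x \<in> carrier R. x \<otimes>\<^bsub>R\<^esub> c \<in> J}"
            using * \<open>u \<in> _\<close> \<open>v \<in> carrier R\<close> by (simp add: m_comm)
        qed
        have xc: "x \<in> carrier R" "y \<in> carrier R" using x y ideal.Icarr[OF K(1)] ab by blast+
        have "K a \<subseteq> {x \<in> carrier R. x \<otimes>\<^bsub>R\<^esub> b \<in> J}"
          unfolding K_def by (rule genideal_minimal[OF L[OF ab(2)]]) (use ab J.Icarr J.I_r_closed in auto)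
        then have "x \<otimes>\<^bsub>R\<^esub> b \<in> J" using x by blast
        then have "b \<otimes>\<^bsub>R\<^esub> x \<in> J" using xc ab by (simp add: m_comm)
        then have "K b \<subseteq> {y \<in> carrier R. y \<otimes>\<^bsub>R\<^esub> x \<in> J}"
          unfolding K_def by (intro genideal_minimal[OF L[OF xc(1)]]) (use xc ab J.Icarr J.I_r_closed in auto)
        then have "y \<otimes>\<^bsub>R\<^esub> x \<in> J" using y by blast
        then show ?thesis using xc by (simp add: m_comm)
      qed
      obtain A B where A: "ideal A R" "ideal B R" "\<And>x y. x \<in> A \<Longrightarrow> y \<in> B \<Longrightarrow> x \<otimes>\<^bsub>R\<^esub> y \<in> K a" "vanishing R A \<subseteq> S1"
        "vanishing R B \<subseteq> S2"
        using 1(2)[OF K[OF ab(1,4)]] cov[OF ab(1,4)] unfolding P_def by blast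
      obtain A' B' where A': "ideal A' R" "ideal B' R" "\<And>x y. x \<in> A' \<Longrightarrow> y \<in> B' \<Longrightarrow> x \<otimes>\<^bsub>R\<^esub> y \<in> K b" "vanishing R A' \<subseteq>
        S1" "vanishing R B' \<subseteq> S2"
        using 1(2)[OF K[OF ab(2,5)]] cov[OF ab(2,5)] unfolding P_def by blast
      have "x \<otimes>\<^bsub>R\<^esub> y \<in> J" if "x \<in> A \<cdot>\<^bsub>R\<^esub> A'" "y \<in> B \<cdot>\<^bsub>R\<^esub> B'" for x y
      proof (rule ideal_prod_mult_closed[OF R A(1) A'(1) A(2) A'(2) J.ideal_axioms _ that])
        fix x x' y y' assume *: "x \<in> A" "x' \<in> A'" "y \<in> B" "y' \<in> B'"
        then have c: "x \<in> carrier R" "x' \<in> carrier R" "y \<in> carrier R" "y' \<in> carrier R"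
          using ideal.Icarr[OF A(1) *(1)] ideal.Icarr[OF A'(1) *(2)] ideal.Icarr[OF A(2) *(3)]
            ideal.Icarr[OF A'(2) *(4)] by auto
        have "(x \<otimes>\<^bsub>R\<^esub> x') \<otimes>\<^bsub>R\<^esub> (y \<otimes>\<^bsub>R\<^esub> y') = (x \<otimes>\<^bsub>R\<^esub> y) \<otimes>\<^bsub>R\<^esub> (x' \<otimes>\<^bsub>R\<^esub> y')" using c by (simp add: m_ac)
        also have "\<dots> \<in> J" using Kmult[OF A(3)[OF *(1,3)] A'(3)[OF *(2,4)]] .
        finally show "(x \<otimes>\<^bsub>R\<^esub> x') \<otimes>\<^bsub>R\<^esub> (y \<otimes>\<^bsub>R\<^esub> y') \<in> J" .
      qed
      then show ?thesis unfolding P_def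
      proof (intro exI conjI ballI)
        show "ideal (A \<cdot>\<^bsub>R\<^esub> A') R" "ideal (B \<cdot>\<^bsub>R\<^esub> B') R" by (intro ideal_prod_is_ideal A A')+
        show "vanishing R (A \<cdot>\<^bsub>R\<^esub> A') \<subseteq> S1" "vanishing R (B \<cdot>\<^bsub>R\<^esub> B') \<subseteq> S2"
          using vanishing_ideal_prod[OF R A(1) A'(1)] vanishing_ideal_prod[OF R A(2) A'(2)] A(4,5) A'(4,5) by blast+
      qed
    qed
  qed
  then show ?thesis using cov unfolding P_def by blast
qed

text \<open>The closed sets of \<open>A\<close> and \<open>B\<close> are disjoint, so 1 = x + y with
  x in \<open>A\<close> and y in \<open>B\<close>, and x y lies in \<open>J\<close>; the element
  sought is x. If x were in \<open>J\<close>, a prime in \<open>S2\<close>, which contains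
  \<open>B\<close>, would contain both x and y; the other case is symmetric.\<close>

lemma idempotent_of_decomposable:
  assumes R: "cring R" and N: "noetherian_ring R" and J: "ideal J R"
    and ne: "vanishing R J \<noteq> {}" and dec: "\<not> indecomposable_thick_support R (vanishing R J)"
  obtains e where "e \<in> carrier R" "e \<otimes>\<^bsub>R\<^esub> (\<one>\<^bsub>R\<^esub> \<ominus>\<^bsub>R\<^esub> e) \<in> J" "e \<notin> J" "\<one>\<^bsub>R\<^esub> \<ominus>\<^bsub>R\<^esub> e \<notin> J"
proof -
  interpret cring R by fact
  obtain S1 S2 where S: "thick_support R S1" "thick_support R S2" "S1 \<noteq> {}" "S2 \<noteq> {}" "S1 \<inter> S2 =
    {}" "vanishing R J = S1 \<union> S2"
    using dec ne thick_support_vanishing[OF J] unfolding indecomposable_thick_support_def by blast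
  obtain A B where AB: "ideal A R" "ideal B R" "\<And>x y. x \<in> A \<Longrightarrow> y \<in> B \<Longrightarrow> x \<otimes>\<^bsub>R\<^esub> y \<in> J" "vanishing R A \<subseteq> S1"
    "vanishing R B \<subseteq> S2"
    using vanishing_covered[OF R N S(1,2) J] S(6) by blast
  have "vanishing R A \<inter> vanishing R B = {}" using AB(4,5) S(5) by blast
  then obtain x y where xy: "x \<in> A" "y \<in> B" "x \<oplus>\<^bsub>R\<^esub> y = \<one>\<^bsub>R\<^esub>"
    using comaximal_if_vanishing_disjoint[OF R N AB(1,2)] by blast
  have c: "x \<in> carrier R" "y \<in> carrier R" using xy ideal.Icarr[OF AB(1)] ideal.Icarr[OF AB(2)] by auto
  have y: "\<one>\<^bsub>R\<^esub> \<ominus>\<^bsub>R\<^esub> x = y" unfolding xy(3)[symmetric] using c by algebra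
  \<comment> \<open>Products from \<open>A\<close> and \<open>B\<close> lie in \<open>J\<close>, so
    a prime above \<open>J\<close> is above one of the two. This identifies the primes of
    \<open>S1\<close> with those above \<open>A\<close>, and likewise for \<open>S2\<close> and
    \<open>B\<close>.\<close>
  have cover: "vanishing R J \<subseteq> vanishing R A \<union> vanishing R B"
  proof
    fix p assume p: "p \<in> vanishing R J"
    interpret p: primeideal p R using p by (simp add: vanishing_def Spec_def)
    show "p \<in> vanishing R A \<union> vanishing R B"
    proof (rule ccontr)
      assume "\<not> ?thesis"
      then obtain u v where uv: "u \<in> A" "u \<notin> p" "v \<in> B" "v \<notin> p" using p by (auto simp: vanishing_def)
      have "u \<otimes>\<^bsub>R\<^esub> v \<in> p" using p AB(3)[OF uv(1,3)] by (auto simp: vanishing_def)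
      then show False using p.I_prime uv ideal.Icarr[OF AB(1) uv(1)] ideal.Icarr[OF AB(2) uv(3)] by blast
    qed
  qed
  have no: False if "p \<in> vanishing R J" "x \<in> p" "y \<in> p" for p
  proof -
    interpret p: primeideal p R using that by (simp add: vanishing_def Spec_def)
    have "\<one>\<^bsub>R\<^esub> \<in> p" using p.a_closed[OF that(2,3)] xy(3) by simp
    then show False using p.one_imp_carrier p.I_notcarr by blast
  qed
  have "x \<notin> J"
  proof
    assume x: "x \<in> J"
    obtain p where p: "p \<in> S2" using S(4) by blast
    then have "p \<in> vanishing R J" "p \<in> vanishing R B" using S(5,6) cover AB(4) by auto
    then show False using no x xy(2) by (auto simp: vanishing_def)
  qed
  moreover have "y \<notin> J"
  proof
    assume y: "y \<in> J"
    obtain p where p: "p \<in> S1" using S(3) by blast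
    then have "p \<in> vanishing R J" "p \<in> vanishing R A" using S(5,6) cover AB(5) by auto
    then show False using no y xy(1) by (auto simp: vanishing_def)
  qed
  ultimately show ?thesis using that[of x] c(1) AB(3)[OF xy(1,2)] unfolding y by blast
qed

section \<open>Decompositions\<close>

text \<open>Bundling the side conditions turns homotopy into a relation that composes by plain
  rules, with no linearity premises left to discharge at each use.\<close>

definition htpy ::
  "('a, 'r) ring_scheme \<Rightarrow> ('a, 'u) cochain_complex \<Rightarrow> ('a, 'v) cochain_complex \<Rightarrow>
   (int \<Rightarrow> 'u \<Rightarrow> 'v) \<Rightarrow> (int \<Rightarrow> 'u \<Rightarrow> 'v) \<Rightarrow> bool" where
  "htpy R X Y f g \<longleftrightarrow> module_complex R X \<and> module_complex R Y \<and> chain_map R X Y f \<and> chain_map R X Y g \<and>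
    homotopic R X Y f g"

lemma htpyD:
  assumes "htpy R X Y f g"
  shows "module_complex R X" "module_complex R Y" "chain_map R X Y f" "chain_map R X Y g" "homotopic R X Y f g"
  using assms by (auto simp: htpy_def)

lemma htpy_refl: "module_complex R X \<Longrightarrow> module_complex R Y \<Longrightarrow> chain_map R X Y f \<Longrightarrow> htpy R X Y f f"
  unfolding htpy_def using homotopic_refl[of R X Y f] chain_mapD(1)[of R X Y f] by blast

lemma htpy_sym: "htpy R X Y f g \<Longrightarrow> htpy R X Y g f"
  unfolding htpy_def using homotopic_sym[of R X Y f g] chain_mapD(1) by blast

lemma htpy_trans:
  assumes "htpy R X Y f g" "htpy R X Y g k"
  shows "htpy R X Y f k"
  using htpyD[OF assms(1)] htpyD[OF assms(2)] homotopic_trans[of R X Y f g k] chain_mapD(1)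
  unfolding htpy_def by blast

lemma htpy_cong:
  assumes h: "htpy R X Y f g" and eq: "\<And>n x. x \<in> carrier (obj X n) \<Longrightarrow> f' n x = f n x"
    "\<And>n x. x \<in> carrier (obj X n) \<Longrightarrow> g' n x = g n x"
  shows "htpy R X Y f' g'"
proof -
  note X = htpyD(1)[OF h]
  have *: "chain_map R X Y k'" if k: "chain_map R X Y k"
    and "\<And>n x. x \<in> carrier (obj X n) \<Longrightarrow> k' n x = k n x" for k k'
    by (rule chain_mapI)
      (simp_all add: that(2) chain_mapD(2)[OF k] module_complex_closed(1)[OF X]
        module_hom_cong[OF chain_mapD(1)[OF k] module_complexD(1)[OF X]])
  show ?thesis
    unfolding htpy_def
    using *[OF htpyD(3)[OF h] eq(1)] *[OF htpyD(4)[OF h] eq(2)] homotopic_cong[OF htpyD(5)[OF h] X eq] htpyD(1,2)[OF h]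
    by blast
qed

lemma htpy_comp_left:
  assumes h: "htpy R X Y f g" and k: "chain_map R Y Z k" and Z: "module_complex R Z"
  shows "htpy R X Z (\<lambda>n x. k n (f n x)) (\<lambda>n x. k n (g n x))"
  unfolding htpy_def
  using htpyD[OF h] Z chain_map_comp[OF _ k]
    homotopic_comp_left[OF htpyD(1,2)[OF h] Z chain_mapD(1)[OF htpyD(3)[OF h]] chain_mapD(1)[OF htpyD(4)[OF h]] k]
  by blast

lemma htpy_comp_right:
  assumes h: "htpy R Y Z f g" and k: "chain_map R X Y k" and X: "module_complex R X"
  shows "htpy R X Z (\<lambda>n x. f n (k n x)) (\<lambda>n x. g n (k n x))"
  unfolding htpy_def
  using htpyD[OF h] X chain_map_comp[OF k]
    homotopic_comp_right[OF X htpyD(1,2)[OF h] chain_mapD(1)[OF htpyD(3)[OF h]] chain_mapD(1)[OF htpyD(4)[OF h]] k]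
  by blast

lemma htpy_plus:
  assumes h: "htpy R X Y f g" and h': "htpy R X Y f' g'"
  shows "htpy R X Y (\<lambda>n x. f n x \<oplus>\<^bsub>obj Y n\<^esub> f' n x) (\<lambda>n x. g n x \<oplus>\<^bsub>obj Y n\<^esub> g' n x)"
  unfolding htpy_def
  using htpyD(1,2)[OF h] chain_map_plus[OF htpyD(2)[OF h] htpyD(3)[OF h] htpyD(3)[OF h'] htpyD(1)[OF h]]
    chain_map_plus[OF htpyD(2)[OF h] htpyD(4)[OF h] htpyD(4)[OF h'] htpyD(1)[OF h]]
    homotopic_plus[OF htpyD(1,2)[OF h] chain_mapD(1)[OF htpyD(3)[OF h]] chain_mapD(1)[OF htpyD(4)[OF h]]
      chain_mapD(1)[OF htpyD(3)[OF h']] chain_mapD(1)[OF htpyD(4)[OF h']] htpyD(5)[OF h] htpyD(5)[OF h']]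
  by blast

lemma htpy_msum:
  assumes X: "module_complex R X" and Y: "module_complex R Y" and h: "\<And>i. i \<in> set L \<Longrightarrow> htpy R X Y (f i) (g i)"
  shows "htpy R X Y (\<lambda>n x. msum (obj Y n) (\<lambda>i. f i n x) L) (\<lambda>n x. msum (obj Y n) (\<lambda>i. g i n x) L)"
  using h
proof (induction L)
  case Nil
  show ?case using htpy_refl[OF X Y chain_map_zero[OF X Y]] by simp
next
  case (Cons a L)
  then show ?case using htpy_plus[of R X Y "f a" "g a"] by simp
qed

lemma htpy_msum_single:
  assumes k: "distinct L" "k \<in> set L" and f: "\<And>i. i \<in> set L \<Longrightarrow> chain_map R X Y (f i)"
    and X: "module_complex R X" and Y: "module_complex R Y"
    and h: "\<And>i. i \<in> set L \<Longrightarrow> i \<noteq> k \<Longrightarrow> htpy R X Y (f i) (\<lambda>n x. \<zero>\<^bsub>obj Y n\<^esub>)"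
  shows "htpy R X Y (\<lambda>n x. msum (obj Y n) (\<lambda>i. f i n x) L) (f k)"
proof (rule htpy_cong[OF htpy_msum[OF X Y, where g = "\<lambda>i. if i = k then f k else (\<lambda>n x. \<zero>\<^bsub>obj Y n\<^esub>)"]])
  show "htpy R X Y (f i) (if i = k then f k else (\<lambda>n x. \<zero>\<^bsub>obj Y n\<^esub>))" if "i \<in> set L" for i
    using h[OF that] htpy_refl[OF X Y f[OF that]] by (cases "i = k") simp_all
  fix n x assume x: "x \<in> carrier (obj X n)"
  interpret Y: abelian_group "obj Y n" by (rule module_complex_group[OF Y])
  show "f k n x = msum (obj Y n) (\<lambda>i. (if i = k then f k else (\<lambda>n x. \<zero>\<^bsub>obj Y n\<^esub>)) n x) L"
    by (subst Y.msum_single[OF k]) (simp_all add: chain_mapD(3)[OF f[OF k(2)] x])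
qed simp

lemma htpy_zero_if_vanishing_disjoint:
  assumes R: "cring R" "noetherian_ring R" and X: "module_complex R X" and Y: "module_complex R Y"
    and f: "chain_map R X Y f"
    and disj: "vanishing R (hann R X) \<inter> vanishing R (hann R Y) = {}"
  shows "htpy R X Y f (\<lambda>n x. \<zero>\<^bsub>obj Y n\<^esub>)"
proof -
  obtain r s where "r \<in> hann R X" "s \<in> hann R Y" "r \<oplus>\<^bsub>R\<^esub> s = \<one>\<^bsub>R\<^esub>"
    using comaximal_if_vanishing_disjoint[OF R ideal_hann[OF R(1) X] ideal_hann[OF R(1) Y] disj] by blast
  then have "homotopic R X Y f (\<lambda>n x. \<zero>\<^bsub>obj Y n\<^esub>)" by (rule homotopic_zero_if_comaximal[OF X Y f])
  then show ?thesis using X Y f chain_map_zero[OF X Y] by (simp add: htpy_def)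
qed

text \<open>\<open>p i \<circ> v j \<simeq> 0\<close> for \<open>i \<noteq> j\<close> follows from the disjointness of supports.\<close>

definition split_by ::
  "('a, 'r) ring_scheme \<Rightarrow> ('a, 'u) cochain_complex \<Rightarrow> 'i list \<Rightarrow> ('i \<Rightarrow> ('a, 'u) cochain_complex) \<Rightarrow>
   ('i \<Rightarrow> int \<Rightarrow> 'u \<Rightarrow> 'u) \<Rightarrow> ('i \<Rightarrow> int \<Rightarrow> 'u \<Rightarrow> 'u) \<Rightarrow> bool" where
  "split_by R X L Y p v \<longleftrightarrow> distinct L \<and>
    (\<forall>i\<in>set L. fgp_complex R (Y i) \<and> chain_map R X (Y i) (p i) \<and> chain_map R (Y i) X (v i) \<and>
      htpy R (Y i) (Y i) (\<lambda>n x. p i n (v i n x)) (\<lambda>n x. x) \<and>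
      indecomposable_thick_support R (vanishing R (hann R (Y i)))) \<and>
    htpy R X X (\<lambda>n x. msum (obj X n) (\<lambda>i. v i n (p i n x)) L) (\<lambda>n x. x) \<and>
    (\<forall>i\<in>set L. \<forall>j\<in>set L. i \<noteq> j \<longrightarrow> vanishing R (hann R (Y i)) \<inter> vanishing R (hann R (Y j)) = {})"

lemma split_byD:
  assumes "split_by R X L Y p v"
  shows "distinct L" "i \<in> set L \<Longrightarrow> fgp_complex R (Y i)" "i \<in> set L \<Longrightarrow> module_complex R (Y i)"
    "i \<in> set L \<Longrightarrow> chain_map R X (Y i) (p i)"
    "i \<in> set L \<Longrightarrow> chain_map R (Y i) X (v i)" "i \<in> set L \<Longrightarrow> htpy R (Y i) (Y i) (\<lambda>n x. p i n (v i n x)) (\<lambda>n x. x)"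
    "i \<in> set L \<Longrightarrow> indecomposable_thick_support R (vanishing R (hann R (Y i)))"
    "htpy R X X (\<lambda>n x. msum (obj X n) (\<lambda>i. v i n (p i n x)) L) (\<lambda>n x. x)" "module_complex R X"
    "i \<in> set L \<Longrightarrow> j \<in> set L \<Longrightarrow> i \<noteq> j \<Longrightarrow> vanishing R (hann R (Y i)) \<inter> vanishing R (hann R (Y j)) = {}"
  using assms by (auto simp: split_by_def htpy_def fgp_complex_def)

lemma split_by_vanishing_subset:
  assumes "split_by R X L Y p v" "i \<in> set L"
  shows "vanishing R (hann R (Y i)) \<subseteq> vanishing R (hann R X)"
  using hann_retract[OF split_byD(9)[OF assms(1)] split_byD(3)[OF assms] split_byD(4)[OF assms] split_byD(5)[OF assms]
      htpyD(5)[OF split_byD(6)[OF assms]]]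
  by (auto simp: vanishing_def)

lemma vanishing_disjoint_if_idempotent:
  assumes "cring R" "e \<in> A" "\<one>\<^bsub>R\<^esub> \<ominus>\<^bsub>R\<^esub> e \<in> B" "e \<in> carrier R"
  shows "vanishing R A \<inter> vanishing R B = {}"
proof -
  interpret cring R by fact
  have False if p: "p \<in> vanishing R A" "p \<in> vanishing R B" for p
  proof -
    interpret p: primeideal p R using p(1) by (simp add: vanishing_def Spec_def)
    have "e \<in> p" "\<one>\<^bsub>R\<^esub> \<ominus>\<^bsub>R\<^esub> e \<in> p" using p assms(2,3) by (auto simp: vanishing_def)
    then have "(\<one>\<^bsub>R\<^esub> \<ominus>\<^bsub>R\<^esub> e) \<oplus>\<^bsub>R\<^esub> e \<in> p" by (rule p.a_closed[rotated])
    also have "(\<one>\<^bsub>R\<^esub> \<ominus>\<^bsub>R\<^esub> e) \<oplus>\<^bsub>R\<^esub> e = \<one>\<^bsub>R\<^esub>" using assms(4) by algebra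
    finally show False using p.one_imp_carrier p.I_notcarr by blast
  qed
  then show ?thesis by blast
qed

text \<open>The indices of the second family are shifted by \<open>m\<close>. Components from
  different sides have disjoint supports because the support of a component lies in that of
  \<open>X1\<close> or \<open>X2\<close>, from which it was split off.\<close>

lemma split_by_combine:
  fixes X X1 X2 :: "('a, 'u) cochain_complex"
  assumes R: "cring R" and X: "module_complex R X"
    and s1: "split_by R X1 [0..<m] Y1 p1 v1" and s2: "split_by R X2 [0..<k] Y2 p2 v2"
    and i1: "chain_map R X X1 i1" and q1: "chain_map R X1 X q1" and e1: "htpy R X1 X1 (\<lambda>n x. i1 n (q1 n x)) (\<lambda>n x. x)"
    and i2: "chain_map R X X2 i2" and q2: "chain_map R X2 X q2" and e2: "htpy R X2 X2 (\<lambda>n x. i2 n (q2 n x)) (\<lambda>n x. x)"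
    and sum: "\<And>n x. x \<in> carrier (obj X n) \<Longrightarrow> q1 n (i1 n x) \<oplus>\<^bsub>obj X n\<^esub> q2 n (i2 n x) = x"
    and disj: "vanishing R (hann R X1) \<inter> vanishing R (hann R X2) = {}"
  shows "\<exists>Y p v. split_by R X [0..<m + k] Y p v"
proof -
  define Y where "Y i = (if i < m then Y1 i else Y2 (i - m))" for i
  define p where "p i = (if i < m then (\<lambda>n x. p1 i n (i1 n x)) else (\<lambda>n x. p2 (i - m) n (i2 n x)))" for i
  define v where "v i = (if i < m then (\<lambda>n x. q1 n (v1 i n x)) else (\<lambda>n x. q2 n (v2 (i - m) n x)))" for i
  note S1 = split_byD[OF s1] and S2 = split_byD[OF s2]
  have pv1: "htpy R (Y1 i) (Y1 i) (\<lambda>n x. p1 i n (i1 n (q1 n (v1 i n x)))) (\<lambda>n x. x)" if "i < m" for i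
    using htpy_trans[OF htpy_comp_left[OF htpy_comp_right[OF e1 S1(5) S1(3)] S1(4) S1(3)] S1(6)] that by simp
  have pv2: "htpy R (Y2 i) (Y2 i) (\<lambda>n x. p2 i n (i2 n (q2 n (v2 i n x)))) (\<lambda>n x. x)" if "i < k" for i
    using htpy_trans[OF htpy_comp_left[OF htpy_comp_right[OF e2 S2(5) S2(3)] S2(4) S2(3)] S2(6)] that by simp
  have t1: "htpy R X X (\<lambda>n x. q1 n (msum (obj X1 n) (\<lambda>i. v1 i n (p1 i n (i1 n x))) [0..<m])) (\<lambda>n x. q1 n (i1 n x))"
    by (rule htpy_comp_left[OF htpy_comp_right[OF S1(8) i1 X] q1 X])
  have t2: "htpy R X X (\<lambda>n x. q2 n (msum (obj X2 n) (\<lambda>i. v2 i n (p2 i n (i2 n x))) [0..<k])) (\<lambda>n x. q2 n (i2 n x))"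
    by (rule htpy_comp_left[OF htpy_comp_right[OF S2(8) i2 X] q2 X])
  have total: "htpy R X X (\<lambda>n x. msum (obj X n) (\<lambda>i. v i n (p i n x)) [0..<m + k]) (\<lambda>n x. x)"
  proof (rule htpy_cong[OF htpy_plus[OF t1 t2]])
    fix n x assume x: "x \<in> carrier (obj X n)"
    show "x = q1 n (i1 n x) \<oplus>\<^bsub>obj X n\<^esub> q2 n (i2 n x)" using sum[OF x] by simp
    interpret XX: abelian_group "obj X n" by (rule module_complex_group[OF X])
    have c1: "v1 i n (p1 i n (i1 n x)) \<in> carrier (obj X1 n)" if "i < m" for i
      using chain_mapD(3)[OF S1(5) chain_mapD(3)[OF S1(4) chain_mapD(3)[OF i1 x]]] that by simp
    have c2: "v2 i n (p2 i n (i2 n x)) \<in> carrier (obj X2 n)" if "i < k" for i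
      using chain_mapD(3)[OF S2(5) chain_mapD(3)[OF S2(4) chain_mapD(3)[OF i2 x]]] that by simp
    have "[0..<m + k] = [0..<m] @ map (\<lambda>i. i + m) [0..<k]"
      by (metis add.commute add_0 le_add1 map_add_upt upt_add_eq_append)
    moreover have "msum (obj X n) (\<lambda>i. v i n (p i n x)) ([0..<m] @ map (\<lambda>i. i + m) [0..<k]) =
      msum (obj X n) (\<lambda>i. v i n (p i n x)) [0..<m] \<oplus>\<^bsub>obj X n\<^esub> msum (obj X n) (\<lambda>i. v i n (p i n x))
        (map (\<lambda>i. i + m) [0..<k])"
      by (rule XX.msum_append) (auto simp: v_def p_def chain_mapD(3)[OF q1 c1] chain_mapD(3)[OF q2 c2])
    moreover have "msum (obj X n) (\<lambda>i. v i n (p i n x)) [0..<m] =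
      msum (obj X n) (\<lambda>i. q1 n (v1 i n (p1 i n (i1 n x)))) [0..<m]"
      by (rule msum_cong) (simp add: v_def p_def)
    moreover have "\<dots> = q1 n (msum (obj X1 n) (\<lambda>i. v1 i n (p1 i n (i1 n x))) [0..<m])"
      using c1 by (subst module_hom_msum[OF chain_mapD(1)[OF q1] module_complex_group[OF S1(9)]
        module_complex_group[OF X]]) simp_all
    moreover have "msum (obj X n) (\<lambda>i. v i n (p i n x)) (map (\<lambda>i. i + m) [0..<k]) =
        msum (obj X n) (\<lambda>i. q2 n (v2 i n (p2 i n (i2 n x)))) [0..<k]"
      unfolding msum_map by (rule msum_cong) (simp add: v_def p_def)
    moreover have "\<dots> = q2 n (msum (obj X2 n) (\<lambda>i. v2 i n (p2 i n (i2 n x))) [0..<k])"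
      using c2 by (subst module_hom_msum[OF chain_mapD(1)[OF q2] module_complex_group[OF S2(9)]
        module_complex_group[OF X]]) simp_all
    ultimately show "msum (obj X n) (\<lambda>i. v i n (p i n x)) [0..<m + k] =
      q1 n (msum (obj X1 n) (\<lambda>i. v1 i n (p1 i n (i1 n x))) [0..<m]) \<oplus>\<^bsub>obj X n\<^esub>
      q2 n (msum (obj X2 n) (\<lambda>i. v2 i n (p2 i n (i2 n x))) [0..<k])" by simp
  qed
  have sub1: "vanishing R (hann R (Y1 i)) \<subseteq> vanishing R (hann R X1)" if "i < m" for i
    using split_by_vanishing_subset[OF s1, of i] that by simp
  have sub2: "vanishing R (hann R (Y2 i)) \<subseteq> vanishing R (hann R X2)" if "i < k" for i
    using split_by_vanishing_subset[OF s2, of i] that by simp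
  have "split_by R X [0..<m + k] Y p v"
    unfolding split_by_def
  proof (intro conjI ballI impI)
    fix i assume i: "i \<in> set [0..<m + k]"
    show "fgp_complex R (Y i)" using i S1(2)[of i] S2(2)[of "i - m"] by (auto simp: Y_def)
    show "chain_map R X (Y i) (p i)"
      using i chain_map_comp[OF i1 S1(4)[of i]] chain_map_comp[OF i2 S2(4)[of "i - m"]] by (auto simp: Y_def p_def)
    show "chain_map R (Y i) X (v i)"
      using i chain_map_comp[OF S1(5)[of i] q1] chain_map_comp[OF S2(5)[of "i - m"] q2] by (auto simp: Y_def v_def)
    show "htpy R (Y i) (Y i) (\<lambda>n x. p i n (v i n x)) (\<lambda>n x. x)"
      using i pv1[of i] pv2[of "i - m"] by (auto simp: Y_def p_def v_def)
    show "indecomposable_thick_support R (vanishing R (hann R (Y i)))"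
      using i S1(7)[of i] S2(7)[of "i - m"] by (auto simp: Y_def)
    fix j assume j: "j \<in> set [0..<m + k]" "i \<noteq> j"
    consider "i < m" "j < m" | "i < m" "\<not> j < m" | "\<not> i < m" "j < m" | "\<not> i < m" "\<not> j < m" by blast
    then show "vanishing R (hann R (Y i)) \<inter> vanishing R (hann R (Y j)) = {}"
    proof cases
      case 1
      then show ?thesis using S1(10)[of i j] j by (simp add: Y_def)
    next
      case 2
      then show ?thesis using sub1[of i] sub2[of "j - m"] disj i j by (fastforce simp: Y_def)
    next
      case 3
      then show ?thesis using sub1[of j] sub2[of "i - m"] disj i j by (fastforce simp: Y_def)
    next
      case 4
      then show ?thesis using S2(10)[of "i - m" "j - m"] i j by (fastforce simp: Y_def)
    qed
  qed (use total in simp_all)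
  then show ?thesis by blast
qed

lemma split_by_exists:
  fixes X :: "('a, 'u) cochain_complex"
  assumes R: "cring R" "noetherian_ring R" and inf: "infinite (UNIV :: 'u set)" and X: "fgp_complex R X"
  shows "\<exists>m :: nat. \<exists>Y p v. split_by R X [0..<m] Y p v"
proof -
  have Xm: "module_complex R X" using X by (simp add: fgp_complex_def)
  \<comment> \<open>The induction runs over ideals, so the complex is quantified inside: the
    summands are new complexes with larger ideals.\<close>
  have main: "\<forall>X :: ('a, 'u) cochain_complex. fgp_complex R X \<and> hann R X = J \<longrightarrow>
    (\<exists>m :: nat. \<exists>Y p v. split_by R X [0..<m] Y p v)" if "ideal J R" for J
  proof (rule noetherian_ring.ideal_induct[OF R(2) that], intro allI impI)
    fix J and X :: "('a, 'u) cochain_complex"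
    assume J: "ideal J R"
      and IH: "\<And>K. ideal K R \<Longrightarrow> J \<subset> K \<Longrightarrow> \<forall>X :: ('a, 'u) cochain_complex. fgp_complex R X \<and> hann R X = K \<longrightarrow>
        (\<exists>m :: nat. \<exists>Y p v. split_by R X [0..<m] Y p v)"
      and "fgp_complex R X \<and> hann R X = J"
    then have X: "fgp_complex R X" and J_eq: "hann R X = J" by auto
    have Xm: "module_complex R X" using X by (simp add: fgp_complex_def)
    interpret cring R by (rule R)
    consider "vanishing R J = {}" | "indecomposable_thick_support R (vanishing R J)"
      | "vanishing R J \<noteq> {}" "\<not> indecomposable_thick_support R (vanishing R J)" by blast
    then show "\<exists>m :: nat. \<exists>Y p v. split_by R X [0..<m] Y p v"
    proof cases
      case 1
      \<comment> \<open>A proper ideal would lie in a prime. So multiplication by one is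
        null-homotopic, \<open>X\<close> is contractible, and the empty family decomposes
        it.\<close>
      then have "J = carrier R" using prime_above_proper[OF R J] by (auto simp: vanishing_def Spec_def)
      then have one: "\<one>\<^bsub>R\<^esub> \<in> hann R X" using J_eq by simp
      have "htpy R X X (\<lambda>n x. \<one>\<^bsub>R\<^esub> \<odot>\<^bsub>obj X n\<^esub> x) (\<lambda>n x. \<zero>\<^bsub>obj X n\<^esub>)"
        using one Xm chain_map_scalar[OF Xm] chain_map_zero[OF Xm Xm] by (simp add: htpy_def hann_def)
      then have "htpy R X X (\<lambda>n x. x) (\<lambda>n x. \<zero>\<^bsub>obj X n\<^esub>)"
        by (rule htpy_cong) (simp_all add: module.smult_one[OF module_complexD(1)[OF Xm]])
      from htpy_sym[OF this] have "split_by R X [0..<0] (\<lambda>i. X) (\<lambda>i n x. x) (\<lambda>i n x. x)"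
        by (simp add: split_by_def)
      then show ?thesis by blast
    next
      case 2
      have "htpy R X X (\<lambda>n x. x \<oplus>\<^bsub>obj X n\<^esub> \<zero>\<^bsub>obj X n\<^esub>) (\<lambda>n x. x)"
        by (rule htpy_cong[OF htpy_refl[OF Xm Xm chain_map_id]])
          (simp_all add: abelian_monoid.r_zero[OF abelian_group.axioms(1)[OF module_complex_group[OF Xm]]])
      then have "split_by R X [0..<1] (\<lambda>i. X) (\<lambda>i n x. x) (\<lambda>i n x. x)"
        using 2 J_eq X chain_map_id htpy_refl[OF Xm Xm chain_map_id] by (simp add: split_by_def)
      then show ?thesis by blast
    next
      case 3
      obtain e where e: "e \<in> carrier R" "e \<otimes>\<^bsub>R\<^esub> (\<one>\<^bsub>R\<^esub> \<ominus>\<^bsub>R\<^esub> e) \<in> J" "e \<notin> J" "\<one>\<^bsub>R\<^esub> \<ominus>\<^bsub>R\<^esub> e \<notin> J"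
        using idempotent_of_decomposable[OF R J 3] by blast
      obtain X1 X2 :: "('a, 'u) cochain_complex" and i1 q1 i2 q2 where
        X1: "fgp_complex R X1" "chain_map R X X1 i1" "chain_map R X1 X q1"
          "homotopic R X1 X1 (\<lambda>n x. i1 n (q1 n x)) (\<lambda>n x. x)"
        and X2: "fgp_complex R X2" "chain_map R X X2 i2" "chain_map R X2 X q2"
          "homotopic R X2 X2 (\<lambda>n x. i2 n (q2 n x)) (\<lambda>n x. x)"
        and sum: "\<And>n x. x \<in> carrier (obj X n) \<Longrightarrow> q1 n (i1 n x) \<oplus>\<^bsub>obj X n\<^esub> q2 n (i2 n x) = x"
        and eh: "\<one>\<^bsub>R\<^esub> \<ominus>\<^bsub>R\<^esub> e \<in> hann R X1" "e \<in> hann R X2"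
        by (rule idempotent_splitting[OF R(1) inf X e(1) e(2)[folded J_eq]]) (rule that)
      have m1: "module_complex R X1" and m2: "module_complex R X2" using X1(1) X2(1) by (simp_all add: fgp_complex_def)
      \<comment> \<open>1 - e annihilates the first summand up to homotopy but not \<open>X\<close>,
        so the ideal grows strictly; for the second summand \<open>e\<close> has this
        property.\<close>
      have J1: "J \<subset> hann R X1" using hann_retract[OF Xm m1 X1(2,3,4)] eh(1) e(4) J_eq by blast
      have J2: "J \<subset> hann R X2" using hann_retract[OF Xm m2 X2(2,3,4)] eh(2) e(3) J_eq by blast
      obtain m :: nat and Y1 p1 v1 where s1: "split_by R X1 [0..<m] Y1 p1 v1"
        using IH[OF ideal_hann[OF R(1) m1] J1] X1(1) by blast
      obtain k :: nat and Y2 p2 v2 where s2: "split_by R X2 [0..<k] Y2 p2 v2"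
        using IH[OF ideal_hann[OF R(1) m2] J2] X2(1) by blast
      have h1: "htpy R X1 X1 (\<lambda>n x. i1 n (q1 n x)) (\<lambda>n x. x)"
        using X1 m1 chain_map_comp[OF X1(3,2)] chain_map_id by (simp add: htpy_def)
      have h2: "htpy R X2 X2 (\<lambda>n x. i2 n (q2 n x)) (\<lambda>n x. x)"
        using X2 m2 chain_map_comp[OF X2(3,2)] chain_map_id by (simp add: htpy_def)
      have "vanishing R (hann R X1) \<inter> vanishing R (hann R X2) = {}"
        using vanishing_disjoint_if_idempotent[OF R(1) eh(2,1) e(1)] by blast
      from split_by_combine[OF R(1) Xm s1 s2 X1(2,3) h1 X2(2,3) h2 sum this] show ?thesis by blast
    qed
  qed
  show ?thesis using main[OF ideal_hann[OF R(1) Xm]] X by blast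
qed

section \<open>Direct sums of complexes and homotopy decompositions\<close>

lemma dsum_complex_simps [simp]:
  "obj (dsum_complex I Xs) n = dsum_module I (\<lambda>i. obj (Xs i) n)"
  "diff (dsum_complex I Xs) n x = (\<lambda>i\<in>I. diff (Xs i) n (x i))"
  by (simp_all add: dsum_complex_def)

lemma module_complex_dsum:
  assumes R: "cring R" and Xs: "\<And>i. i \<in> I \<Longrightarrow> module_complex R (Xs i)"
  shows "module_complex R (dsum_complex I Xs)"
  unfolding module_complex_def
proof (intro allI conjI ballI)
  fix n
  show "module R (obj (dsum_complex I Xs) n)"
    using module_dsum[OF R, of I "\<lambda>i. obj (Xs i) n"] module_complexD(1)[OF Xs] by simp
  have "(\<lambda>x. \<lambda>i\<in>I. diff (Xs i) n (x i)) \<in>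
    module_hom R (dsum_module I (\<lambda>i. obj (Xs i) n)) (dsum_module I (\<lambda>i. obj (Xs i) (n + 1)))"
  proof (rule dsum_tuple_hom)
    show "(\<lambda>x. diff (Xs i) n (x i)) \<in> module_hom R (dsum_module I (\<lambda>i. obj (Xs i) n)) (obj (Xs i) (n + 1))"
      if "i \<in> I" for i
      by (rule module_hom_comp[OF dsum_proj_hom[OF that, where M = "\<lambda>i. obj (Xs i) n"]
        module_complexD(2)[OF Xs[OF that]]])
    fix x assume "x \<in> carrier (dsum_module I (\<lambda>i. obj (Xs i) n))"
    then have fin: "finite {i \<in> I. x i \<noteq> \<zero>\<^bsub>obj (Xs i) n\<^esub>}" by simp
    have "diff (Xs i) n \<zero>\<^bsub>obj (Xs i) n\<^esub> = \<zero>\<^bsub>obj (Xs i) (n + 1)\<^esub>" if "i \<in> I" for i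
      by (rule module_hom_zero[OF module_complexD(2)[OF Xs[OF that]] module_complex_group[OF Xs[OF that]]
        module_complex_group[OF Xs[OF that]]])
    then show "finite {i \<in> I. diff (Xs i) n (x i) \<noteq> \<zero>\<^bsub>obj (Xs i) (n + 1)\<^esub>}"
      by (intro finite_subset[OF _ fin]) auto
  qed
  then show "diff (dsum_complex I Xs) n \<in> module_hom R (obj (dsum_complex I Xs) n) (obj (dsum_complex I Xs) (n + 1))"
    by (simp add: dsum_complex_def)
  fix x assume "x \<in> carrier (obj (dsum_complex I Xs) n)"
  then have "x i \<in> carrier (obj (Xs i) n)" if "i \<in> I" for i using that by (auto simp: PiE_def Pi_def)
  then show "diff (dsum_complex I Xs) (n + 1) (diff (dsum_complex I Xs) n x) = \<zero>\<^bsub>obj (dsum_complex I Xs) (n + 2)\<^esub>"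
    using module_complexD(3)[OF Xs] by (auto simp: restrict_def fun_eq_iff)
qed

lemma chain_map_dsum_proj: "i \<in> I \<Longrightarrow> chain_map R (dsum_complex I Xs) (Xs i) (\<lambda>n x. x i)"
  using dsum_proj_hom[of i I R "\<lambda>i. obj (Xs i) n" for n] by (auto intro!: chain_mapI)

lemma chain_map_dsum_tuple:
  assumes I: "finite I" and f: "\<And>i. i \<in> I \<Longrightarrow> chain_map R X (Xs i) (f i)"
  shows "chain_map R X (dsum_complex I Xs) (\<lambda>n x. \<lambda>i\<in>I. f i n x)"
proof (rule chain_mapI)
  fix n
  show "(\<lambda>x. \<lambda>i\<in>I. f i n x) \<in> module_hom R (obj X n) (obj (dsum_complex I Xs) n)"
    unfolding dsum_complex_simps by (rule dsum_tuple_hom) (simp_all add: chain_mapD(1)[OF f] I)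
  show "diff (dsum_complex I Xs) n (\<lambda>i\<in>I. f i n x) = (\<lambda>i\<in>I. f i (n + 1) (diff X n x))"
    if "x \<in> carrier (obj X n)" for x
    by (auto simp: fun_eq_iff chain_mapD(2)[OF f] that)
qed

lemma htpy_dsum:
  assumes I: "finite I" and X: "module_complex R X" and D: "module_complex R (dsum_complex I Xs)"
    and f: "chain_map R X (dsum_complex I Xs) f" and g: "chain_map R X (dsum_complex I Xs) g"
    and fg: "\<And>i. i \<in> I \<Longrightarrow> htpy R X (Xs i) (\<lambda>n x. f n x i) (\<lambda>n x. g n x i)"
  shows "htpy R X (dsum_complex I Xs) f g"
proof -
  have "\<exists>h. \<forall>n. h n \<in> module_hom R (obj X n) (obj (Xs i) (n - 1)) \<and> (\<forall>x\<in>carrier (obj X n). f n x i =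
      g n x i \<oplus>\<^bsub>obj (Xs i) n\<^esub> (diff (Xs i) (n - 1) (h n x) \<oplus>\<^bsub>obj (Xs i) n\<^esub> h (n + 1) (diff X n x)))" if i: "i \<in> I" for i
    by (rule homotopicE[OF htpyD(5,1,2)[OF fg[OF i]] chain_mapD(1)[OF htpyD(3)[OF fg[OF i]]]
      chain_mapD(1)[OF htpyD(4)[OF fg[OF i]]]]) blast
  then obtain h where h: "\<And>i n. i \<in> I \<Longrightarrow> h i n \<in> module_hom R (obj X n) (obj (Xs i) (n - 1))"
    "\<And>i n x. i \<in> I \<Longrightarrow> x \<in> carrier (obj X n) \<Longrightarrow> f n x i =
      g n x i \<oplus>\<^bsub>obj (Xs i) n\<^esub> (diff (Xs i) (n - 1) (h i n x) \<oplus>\<^bsub>obj (Xs i) n\<^esub> h i (n + 1) (diff X n x))"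
    by metis
  have "homotopic R X (dsum_complex I Xs) f g"
  proof (rule homotopicI[OF X D chain_mapD(1)[OF f] chain_mapD(1)[OF g], where h = "\<lambda>n x. \<lambda>i\<in>I. h i n x"])
    show "(\<lambda>x. \<lambda>i\<in>I. h i n x) \<in> module_hom R (obj X n) (obj (dsum_complex I Xs) (n - 1))" for n
      unfolding dsum_complex_simps by (rule dsum_tuple_hom) (simp_all add: h(1) I)
    fix n x assume x: "x \<in> carrier (obj X n)"
    have "f n x \<in> extensional I" using chain_mapD(3)[OF f x] by (simp add: PiE_def)
    then show "f n x = g n x \<oplus>\<^bsub>obj (dsum_complex I Xs) n\<^esub> (diff (dsum_complex I Xs) (n - 1) (\<lambda>i\<in>I. h i n x)
      \<oplus>\<^bsub>obj (dsum_complex I Xs) n\<^esub> (\<lambda>i\<in>I. h i (n + 1) (diff X n x)))"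
      by (intro extensionalityI[of _ I]) (simp_all add: h(2)[OF _ x])
  qed
  then show ?thesis using X D f g by (simp add: htpy_def)
qed

text \<open>The second composite is a matrix with entries \<open>p i\<close> after
  \<open>v j\<close>. Its diagonal is homotopic to the identity by assumption, and its other entries
  go between complexes with disjoint supports.\<close>

lemma split_by_homotopy_equiv:
  assumes R: "cring R" "noetherian_ring R" and s: "split_by R X L Y p v"
  shows "htpy R X X (\<lambda>n x. msum (obj X n) (\<lambda>i. v i n ((\<lambda>i\<in>set L. p i n x) i)) L) (\<lambda>n x. x)"
    "htpy R (dsum_complex (set L) Y) (dsum_complex (set L) Y)
      (\<lambda>n y. \<lambda>i\<in>set L. p i n (msum (obj X n) (\<lambda>i. v i n (y i)) L)) (\<lambda>n x. x)"
    "chain_map R X (dsum_complex (set L) Y) (\<lambda>n x. \<lambda>i\<in>set L. p i n x)"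
    "chain_map R (dsum_complex (set L) Y) X (\<lambda>n y. msum (obj X n) (\<lambda>i. v i n (y i)) L)"
proof -
  let ?D = "dsum_complex (set L) Y"
  note S = split_byD[OF s]
  have D: "module_complex R ?D" by (rule module_complex_dsum[OF R(1) S(3)])
  show "htpy R X X (\<lambda>n x. msum (obj X n) (\<lambda>i. v i n ((\<lambda>i\<in>set L. p i n x) i)) L) (\<lambda>n x. x)"
    by (rule htpy_cong[OF S(8)]) (auto intro: msum_cong)
  show u: "chain_map R X ?D (\<lambda>n x. \<lambda>i\<in>set L. p i n x)" by (rule chain_map_dsum_tuple) (simp_all add: S(4))
  have vi: "chain_map R ?D X (\<lambda>n y. v i n (y i))" if "i \<in> set L" for i
    by (rule chain_map_comp[OF chain_map_dsum_proj[OF that, where Xs = Y] S(5)[OF that]])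
  show w: "chain_map R ?D X (\<lambda>n y. msum (obj X n) (\<lambda>i. v i n (y i)) L)"
    by (rule chain_map_msum[OF D S(9) vi])
  show "htpy R ?D ?D (\<lambda>n y. \<lambda>i\<in>set L. p i n (msum (obj X n) (\<lambda>i. v i n (y i)) L)) (\<lambda>n x. x)"
  proof (rule htpy_dsum[OF finite_set D D chain_map_comp[OF w u] chain_map_id])
    fix i assume i: "i \<in> set L"
    have c: "chain_map R ?D (Y i) (\<lambda>n y. p i n (v j n (y j)))" if "j \<in> set L" for j
      by (rule chain_map_comp[OF vi[OF that] S(4)[OF i]])
    have z: "htpy R ?D (Y i) (\<lambda>n y. p i n (v j n (y j))) (\<lambda>n x. \<zero>\<^bsub>obj (Y i) n\<^esub>)" if j: "j \<in> set L" "j \<noteq> i" for j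
      by (rule htpy_comp_right[OF htpy_zero_if_vanishing_disjoint[OF R S(3)[OF j(1)] S(3)[OF i]
            chain_map_comp[OF S(5)[OF j(1)] S(4)[OF i]] S(10)[OF j(1) i j(2)]] chain_map_dsum_proj[OF j(1)] D])
    have "htpy R ?D (Y i) (\<lambda>n y. msum (obj (Y i) n) (\<lambda>j. p i n (v j n (y j))) L) (\<lambda>n y. p i n (v i n (y i)))"
      by (rule htpy_msum_single[OF S(1) i c D S(3)[OF i] z])
    from htpy_trans[OF this htpy_comp_right[OF S(6)[OF i] chain_map_dsum_proj[OF i] D]]
    show "htpy R ?D (Y i) (\<lambda>n y. (\<lambda>i\<in>set L. p i n (msum (obj X n) (\<lambda>i. v i n (y i)) L)) i) (\<lambda>n x. x i)"
    proof (rule htpy_cong)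
      fix n x assume x: "x \<in> carrier (obj ?D n)"
      show "(\<lambda>i\<in>set L. p i n (msum (obj X n) (\<lambda>i. v i n (x i)) L)) i = msum (obj (Y i) n) (\<lambda>j. p i n (v j n (x j))) L"
        using i module_hom_msum[OF chain_mapD(1)[OF S(4)[OF i]] module_complex_group[OF S(9)]
          module_complex_group[OF S(3)[OF i]], where L = L and g = "\<lambda>i. v i n (x i)"] chain_mapD(3)[OF vi x] by simp
    qed simp
  qed
qed

lemma support_decomposition_if_split_by:
  fixes X :: "('a, 'u) cochain_complex" and L :: "'i list"
  assumes R: "cring R" "noetherian_ring R" and inf: "infinite (UNIV :: 'u set)" and le: "carrier R \<lesssim> (UNIV :: 'u set)"
    and s: "split_by R X L Y p v"
  shows "support_decomposition R X (set L) Y"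
proof -
  let ?D = "dsum_complex (set L) Y"
  note S = split_byD[OF s]
  have D: "module_complex R ?D" by (rule module_complex_dsum[OF R(1) S(3)])
  obtain g :: "('i \<Rightarrow> 'u) \<Rightarrow> 'u" where g: "inj_on g (set L \<rightarrow>\<^sub>E UNIV)" using inj_on_PiE_finite[OF inf finite_set] by blast
  have g': "inj_on g (carrier (obj ?D n))" for n by (rule inj_on_subset[OF g]) (auto simp: PiE_def)
  \<comment> \<open>The sum has elements of function type; its copy in \<open>'u\<close> is the
    complex \<open>S\<close> demanded by \<open>support_decomposition\<close>.\<close>
  obtain T :: "('a, 'u) cochain_complex" and \<phi> \<psi> where T: "module_complex R T"
    and \<phi>: "chain_map R ?D T \<phi>" and \<psi>: "chain_map R T ?D \<psi>"
    and inv: "\<And>n x. x \<in> carrier (obj ?D n) \<Longrightarrow> \<psi> n (\<phi> n x) = x" "\<And>n y. y \<in> carrier (obj T n) \<Longrightarrow> \<phi> n (\<psi> n y) = y"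
    by (rule complex_transport[OF D, where g = "\<lambda>n. g"]) (use g' in blast)+
  have iso: "complex_iso R T ?D"
    unfolding complex_iso_def
    by (intro exI[of _ \<psi>] conjI \<psi> allI bij_betw_byWitness[where f' = "\<phi> n" for n])
      (use inv chain_mapD(3)[OF \<phi>] chain_mapD(3)[OF \<psi>] in blast)+
  note E = split_by_homotopy_equiv[OF R s]
  have "derived_iso R X T"
  proof (rule derived_iso_if_homotopy_equiv[OF S(9) T chain_map_comp[OF E(3) \<phi>] chain_map_comp[OF \<psi> E(4)]])
    show "homotopic R X X (\<lambda>n x. msum (obj X n) (\<lambda>i. v i n (\<psi> n (\<phi> n (\<lambda>i\<in>set L. p i n x)) i)) L) (\<lambda>n x. x)"
      by (rule htpyD(5)[OF htpy_cong[OF E(1)]]) (simp_all only: inv(1)[OF chain_mapD(3)[OF E(3)]])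
    show "homotopic R T T (\<lambda>n x. \<phi> n (\<lambda>i\<in>set L. p i n (msum (obj X n) (\<lambda>i. v i n (\<psi> n x i)) L))) (\<lambda>n x. x)"
      by (rule htpyD(5)[OF htpy_cong[OF htpy_comp_left[OF htpy_comp_right[OF E(2) \<psi> T] \<phi> T]]]) (simp_all add: inv(2))
  qed
  moreover have "Supp R (Y i) = vanishing R (hann R (Y i))" if "i \<in> set L" for i
    by (rule Supp_eq_vanishing[OF R(1) S(2)[OF that]])
  ultimately show ?thesis
    unfolding support_decomposition_def
    using S(2,7,10) perfect_iff_fgp_complex[OF R(1) inf le] T iso by auto
qed

text \<open>A null-homotopic identity would put 1 into the ideal, and no prime contains it.\<close>

lemma one_notin_hann:
  assumes R: "cring R" and ne: "vanishing R (hann R Y) \<noteq> {}" and Y: "module_complex R Y"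
  shows "\<not> htpy R Y Y (\<lambda>n x. x) (\<lambda>n x. \<zero>\<^bsub>obj Y n\<^esub>)"
proof
  interpret cring R by (rule R)
  assume h: "htpy R Y Y (\<lambda>n x. x) (\<lambda>n x. \<zero>\<^bsub>obj Y n\<^esub>)"
  have "htpy R Y Y (\<lambda>n x. \<one>\<^bsub>R\<^esub> \<odot>\<^bsub>obj Y n\<^esub> x) (\<lambda>n x. \<zero>\<^bsub>obj Y n\<^esub>)"
    by (rule htpy_cong[OF h]) (simp_all add: module.smult_one[OF module_complexD(1)[OF Y]])
  then have one: "\<one>\<^bsub>R\<^esub> \<in> hann R Y" by (simp add: hann_def htpy_def)
  obtain P where P: "primeideal P R" "hann R Y \<subseteq> P" using ne by (auto simp: vanishing_def Spec_def)
  interpret P: primeideal P R by (rule P(1))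
  show False using one P(2) P.one_imp_carrier P.I_notcarr by blast
qed

lemma chain_map_dsum_incl:
  assumes Xs: "\<And>i. i \<in> I \<Longrightarrow> module_complex R (Xs i)"
  shows "chain_map R (Xs i) (dsum_complex I Xs) (\<lambda>n x. \<lambda>j\<in>I. if j = i then x else \<zero>\<^bsub>obj (Xs j) n\<^esub>)"
proof (rule chain_mapI)
  fix n
  show "(\<lambda>x. \<lambda>j\<in>I. if j = i then x else \<zero>\<^bsub>obj (Xs j) n\<^esub>) \<in> module_hom R (obj (Xs i) n) (obj (dsum_complex I Xs) n)"
    using dsum_incl_hom[of I R "\<lambda>i. obj (Xs i) n" i] module_complexD(1)[OF Xs] by simp
  have "diff (Xs j) n \<zero>\<^bsub>obj (Xs j) n\<^esub> = \<zero>\<^bsub>obj (Xs j) (n + 1)\<^esub>" if "j \<in> I" for j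
    by (rule module_hom_zero[OF module_complexD(2)[OF Xs[OF that]] module_complex_group[OF Xs[OF that]]
      module_complex_group[OF Xs[OF that]]])
  then show "diff (dsum_complex I Xs) n (\<lambda>j\<in>I. if j = i then x else \<zero>\<^bsub>obj (Xs j) n\<^esub>) =
    (\<lambda>j\<in>I. if j = i then diff (Xs i) n x else \<zero>\<^bsub>obj (Xs j) (n + 1)\<^esub>)" for x
    by (auto simp: fun_eq_iff)
qed

lemma chain_map_inverse:
  assumes X: "module_complex R X" and f: "chain_map R X Y f"
    and bij: "\<And>n. bij_betw (f n) (carrier (obj X n)) (carrier (obj Y n))"
  obtains g where "chain_map R Y X g" "\<And>n x. x \<in> carrier (obj X n) \<Longrightarrow> g n (f n x) = x"
    "\<And>n y. y \<in> carrier (obj Y n) \<Longrightarrow> f n (g n y) = y"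
proof
  let ?g = "\<lambda>n. inv_into (carrier (obj X n)) (f n)"
  have gf: "?g n (f n x) = x" if "x \<in> carrier (obj X n)" for n x
    using bij_betw_inv_into_left[OF bij that] .
  have fg: "f n (?g n y) = y" if "y \<in> carrier (obj Y n)" for n y
    using bij_betw_inv_into_right[OF bij that] .
  have gc: "?g n y \<in> carrier (obj X n)" if "y \<in> carrier (obj Y n)" for n y
    using bij_betw_apply[OF bij_betw_inv_into[OF bij] that] .
  show "chain_map R Y X ?g"
  proof (rule chain_mapI)
    fix n
    interpret M: module R "obj X n" by (rule module_complexD(1)[OF X])
    show "?g n \<in> module_hom R (obj Y n) (obj X n)"
    proof (rule module_homI)
      fix y y' assume y: "y \<in> carrier (obj Y n)" "y' \<in> carrier (obj Y n)"
      have "y \<oplus>\<^bsub>obj Y n\<^esub> y' = f n (?g n y \<oplus>\<^bsub>obj X n\<^esub> ?g n y')"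
        by (simp add: module_hom_add[OF chain_mapD(1)[OF f]] gc fg y)
      then show "?g n (y \<oplus>\<^bsub>obj Y n\<^esub> y') = ?g n y \<oplus>\<^bsub>obj X n\<^esub> ?g n y'" using gf gc y by simp
    next
      fix r y assume y: "r \<in> carrier R" "y \<in> carrier (obj Y n)"
      have "r \<odot>\<^bsub>obj Y n\<^esub> y = f n (r \<odot>\<^bsub>obj X n\<^esub> ?g n y)"
        by (simp add: module_hom_smult[OF chain_mapD(1)[OF f]] gc fg y)
      then show "?g n (r \<odot>\<^bsub>obj Y n\<^esub> y) = r \<odot>\<^bsub>obj X n\<^esub> ?g n y" using gf gc y by simp
    qed (rule gc)
    fix y assume y: "y \<in> carrier (obj Y n)"
    have "diff Y n y = f (n + 1) (diff X n (?g n y))" using chain_mapD(2)[OF f gc[OF y]] fg[OF y] by simp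
    then show "diff X n (?g n y) = ?g (n + 1) (diff Y n y)" using gf[OF module_complex_closed(1)[OF X gc[OF y]]] by simp
  qed
qed (use bij_betw_inv_into_left[OF bij] bij_betw_inv_into_right[OF bij] in blast)+

text \<open>Compactness of \<open>X\<close> in concrete form: it has finitely many generators in
  finitely many degrees, each is sent to an element of finite support, and a component that vanishes
  on all generators vanishes.\<close>

lemma finite_support_of_chain_map:
  assumes X: "fgp_complex R X" and Xs: "\<And>i. i \<in> I \<Longrightarrow> module_complex R (Xs i)"
    and f: "chain_map R X (dsum_complex I Xs) f"
  shows "finite {i \<in> I. \<exists>n. \<exists>x\<in>carrier (obj X n). f n x i \<noteq> \<zero>\<^bsub>obj (Xs i) n\<^esub>}"
proof -
  have Xm: "module_complex R X" using X by (simp add: fgp_complex_def)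
  obtain a b where ab: "\<And>n. n < a \<or> b < n \<Longrightarrow> carrier (obj X n) = {\<zero>\<^bsub>obj X n\<^esub>}"
    using X unfolding fgp_complex_def by blast
  have "\<exists>L. dual_basis R (obj X n) L" for n using X by (auto simp: fgp_complex_def fgp_def)
  then obtain L where L: "\<And>n. dual_basis R (obj X n) (L n)" by metis
  have fi: "(\<lambda>x. f n x i) \<in> module_hom R (obj X n) (obj (Xs i) n)" if "i \<in> I" for i n
    using chain_mapD(1)[OF chain_map_comp[OF f chain_map_dsum_proj[OF that, where Xs = Xs]]] .
  have sub: "{i \<in> I. \<exists>n. \<exists>x\<in>carrier (obj X n). f n x i \<noteq> \<zero>\<^bsub>obj (Xs i) n\<^esub>} \<subseteq>
    (\<Union>n\<in>{a..b}. \<Union>l\<in>set (L n). {i \<in> I. f n (fst l) i \<noteq> \<zero>\<^bsub>obj (Xs i) n\<^esub>})"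
  proof clarify
    fix i n x assume i: "i \<in> I" and x: "x \<in> carrier (obj X n)" "f n x i \<noteq> \<zero>\<^bsub>obj (Xs i) n\<^esub>"
    have "f n \<zero>\<^bsub>obj X n\<^esub> i = \<zero>\<^bsub>obj (Xs i) n\<^esub>"
      by (rule module_hom_zero[OF fi[OF i] module_complex_group[OF Xm] module_complex_group[OF Xs[OF i]]])
    then have n: "n \<in> {a..b}" using ab[of n] x by force
    have "\<exists>l\<in>set (L n). f n (fst l) i \<noteq> \<zero>\<^bsub>obj (Xs i) n\<^esub>"
    proof (rule ccontr)
      assume "\<not> ?thesis"
      then have "f n x i = \<zero>\<^bsub>obj (Xs i) n\<^esub>"
        by (intro dual_basis_hom_ext[OF L module_complexD(1)[OF Xm] module_complexD(1)[OF Xs[OF i]] fi[OF i]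
              module_hom_const_zero[OF module_complexD(1)[OF Xs[OF i]]] _ x(1)]) blast
      then show False using x(2) by simp
    qed
    then show "i \<in> (\<Union>n\<in>{a..b}. \<Union>l\<in>set (L n). {i \<in> I. f n (fst l) i \<noteq> \<zero>\<^bsub>obj (Xs i) n\<^esub>})" using i n by blast
  qed
  have "finite {i \<in> I. f n (fst l) i \<noteq> \<zero>\<^bsub>obj (Xs i) n\<^esub>}" if "l \<in> set (L n)" for n l
    using chain_mapD(3)[OF f dual_basisD(1)[OF L that]] by simp
  then have "finite (\<Union>n\<in>{a..b}. \<Union>l\<in>set (L n). {i \<in> I. f n (fst l) i \<noteq> \<zero>\<^bsub>obj (Xs i) n\<^esub>})" by simp
  then show ?thesis by (rule finite_subset[OF sub])
qed

lemma dsum_expand: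
  assumes R: "cring R" and L: "distinct L" and M: "\<And>i. i \<in> set L \<Longrightarrow> module R (M i)"
    and y: "y \<in> carrier (dsum_module (set L) M)"
  shows "msum (dsum_module (set L) M) (\<lambda>i. \<lambda>j\<in>set L. if j = i then y i else \<zero>\<^bsub>M j\<^esub>) L = y" (is "msum ?D ?f L = y")
proof -
  have D: "abelian_group ?D" by (rule module_abelian_group[OF module_dsum[OF R M]])
  have yi: "y i \<in> carrier (M i)" if "i \<in> set L" for i using y that by (auto simp: PiE_def Pi_def)
  have fc: "?f i \<in> carrier ?D" if "i \<in> set L" for i
    by (rule module_hom_closed[OF dsum_incl_hom[where M = M and I = "set L" and i = i, OF M] yi[OF that]])
  have "msum ?D ?f L k = y k" if k: "k \<in> set L" for k
  proof -
    interpret Mk: abelian_group "M k" by (rule module_abelian_group[OF M[OF k]])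
    have "msum ?D ?f L k = msum (M k) (\<lambda>i. ?f i k) L"
      by (rule module_hom_msum[OF dsum_proj_hom[OF k] D Mk.abelian_group_axioms fc])
    also have "\<dots> = ?f k k" by (rule Mk.msum_single[OF L k]) (use k yi in auto)
    finally show ?thesis using k by simp
  qed
  moreover have "msum ?D ?f L \<in> carrier ?D" by (rule abelian_group.msum_closed[OF D fc])
  ultimately show ?thesis using y by (intro extensionalityI[of _ "set L"]) (simp_all add: PiE_def)
qed

lemma fgp_complex_if_iso_dsum:
  assumes S: "module_complex R S" and Xs: "\<And>i. i \<in> set L \<Longrightarrow> fgp_complex R (Xs i)"
    and p: "\<And>i. i \<in> set L \<Longrightarrow> chain_map R S (Xs i) (p i)" and v: "\<And>i. i \<in> set L \<Longrightarrow> chain_map R (Xs i) S (v i)"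
    and sum: "\<And>n x. x \<in> carrier (obj S n) \<Longrightarrow> msum (obj S n) (\<lambda>i. v i n (p i n x)) L = x"
  shows "fgp_complex R S"
  unfolding fgp_complex_def
proof (intro conjI allI)
  show "module_complex R S" by (rule S)
  show "fgp R (obj S n)" for n
  proof (rule fgp_sum_of_retracts[OF module_complexD(1)[OF S], where J = L and N = "\<lambda>i. obj (Xs i) n"
    and u = "\<lambda>i. p i n" and v = "\<lambda>i. v i n"])
    show "fgp R (obj (Xs i) n)" if "i \<in> set L" for i using Xs[OF that] by (simp add: fgp_complex_def)
  qed (simp_all add: chain_mapD(1)[OF p] chain_mapD(1)[OF v] sum)
  have "\<exists>a b. \<forall>n. n < a \<or> b < n \<longrightarrow> carrier (obj (Xs i) n) = {\<zero>\<^bsub>obj (Xs i) n\<^esub>}" if "i \<in> set L" for i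
    using Xs[OF that] by (simp add: fgp_complex_def)
  then obtain a b where ab: "\<And>i n. i \<in> set L \<Longrightarrow> n < a i \<or> b i < n \<Longrightarrow> carrier (obj (Xs i) n) = {\<zero>\<^bsub>obj (Xs i) n\<^esub>}"
    by metis
  define A B where "A = Min (insert 0 (a ` set L))" and "B = Max (insert 0 (b ` set L))"
  have AB: "A \<le> a i" "b i \<le> B" if "i \<in> set L" for i using that by (simp_all add: A_def B_def)
  have "carrier (obj S n) = {\<zero>\<^bsub>obj S n\<^esub>}" if n: "n < A \<or> B < n" for n
  proof -
    interpret S: abelian_group "obj S n" by (rule module_complex_group[OF S])
    have "x = \<zero>\<^bsub>obj S n\<^esub>" if x: "x \<in> carrier (obj S n)" for x
    proof -
      have "v i n (p i n x) = \<zero>\<^bsub>obj S n\<^esub>" if i: "i \<in> set L" for i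
      proof -
        have Xi: "module_complex R (Xs i)" using Xs[OF i] by (simp add: fgp_complex_def)
        have "p i n x = \<zero>\<^bsub>obj (Xs i) n\<^esub>" using ab[OF i, of n] AB[OF i] n chain_mapD(3)[OF p[OF i] x] by auto
        then show ?thesis
          using module_hom_zero[OF chain_mapD(1)[OF v[OF i]] module_complex_group[OF Xi]
            module_complex_group[OF S]] by simp
      qed
      then show ?thesis using sum[OF x] S.msum_zero[of L "\<lambda>i. v i n (p i n x)"] by simp
    qed
    then show ?thesis by auto
  qed
  then show "\<exists>a b. \<forall>n. n < a \<or> b < n \<longrightarrow> carrier (obj S n) = {\<zero>\<^bsub>obj S n\<^esub>}" by blast
qed

text \<open>Lifting the identity of \<open>S\<close> gives a right inverse \<open>w\<close> up to
  homotopy. It is a quasi-isomorphism as well and so has a right inverse itself; hence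
  \<open>w\<close>, with inverses on both sides, is invertible in the homotopy category.\<close>

lemma htpy_inverse_of_quasi_iso:
  assumes X: "fgp_complex R X" and S: "fgp_complex R S"
    and u: "chain_map R X S u" "coh_inj X S u" "coh_surj X S u"
  obtains w where "chain_map R S X w" "htpy R S S (\<lambda>n x. u n (w n x)) (\<lambda>n x. x)"
    "htpy R X X (\<lambda>n x. w n (u n x)) (\<lambda>n x. x)"
proof -
  have m: "module_complex R X" "module_complex R S" using X S by (simp_all add: fgp_complex_def)
  note ab = ab_complex_module[OF m(1)] ab_complex_module[OF m(2)]
  obtain w where w: "chain_map R S X w" "homotopic R S S (\<lambda>n x. u n (w n x)) (\<lambda>n x. x)"
    using lift_along_quasi_iso[OF S m u chain_map_id] by blast
  have uw: "htpy R S S (\<lambda>n x. u n (w n x)) (\<lambda>n x. x)"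
    using w m chain_map_comp[OF w(1) u(1)] chain_map_id by (simp add: htpy_def)
  have c: "coh_inj S S (\<lambda>n x. u n (w n x))" "coh_surj S S (\<lambda>n x. u n (w n x))"
    using coh_homotopic[OF ab(2,2) htpyD(5,3,4)[OF uw]] coh_id[OF ab(2)] by simp_all
  obtain u' where u': "chain_map R X S u'" "homotopic R X X (\<lambda>n x. w n (u' n x)) (\<lambda>n x. x)"
    using lift_along_quasi_iso[OF X m(2,1) w(1) coh_inj_cancel[OF ab u(1) c(1)]
        coh_surj_cancel_left[OF ab(2,1,2) w(1) u(1,2) c(2)] chain_map_id] by blast
  have wu': "htpy R X X (\<lambda>n x. w n (u' n x)) (\<lambda>n x. x)"
    using u' m chain_map_comp[OF u'(1) w(1)] chain_map_id by (simp add: htpy_def)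
  have 1: "htpy R X X (\<lambda>n x. w n (u n (w n (u' n x)))) (\<lambda>n x. w n (u n x))"
    by (rule htpy_comp_left[OF htpy_comp_left[OF wu' u(1) m(2)] w(1) m(1)])
  have 2: "htpy R X X (\<lambda>n x. w n (u n (w n (u' n x)))) (\<lambda>n x. w n (u' n x))"
    by (rule htpy_comp_left[OF htpy_comp_right[OF uw u'(1) m(1)] w(1) m(1)])
  show thesis by (rule that[OF w(1) uw htpy_trans[OF htpy_sym[OF 1] htpy_trans[OF 2 wu']]])
qed

text \<open>The index set is arbitrary and the isomorphism is one of the derived category. The main
  point is that \<open>I\<close> is finite; then the sum is a bounded projective complex again, and
  the quasi-isomorphism from \<open>X\<close> becomes a homotopy equivalence.\<close>

lemma split_by_if_support_decomposition:
  fixes X :: "('a, 'u) cochain_complex" and I :: "'i set"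
  assumes R: "cring R" and inf: "infinite (UNIV :: 'u set)" and le: "carrier R \<lesssim> (UNIV :: 'u set)"
    and X: "fgp_complex R X" and dec: "support_decomposition R X I Xs"
  obtains L p v where "set L = I" "split_by R X L Xs p v"
proof -
  have Xs: "fgp_complex R (Xs i)" if "i \<in> I" for i
    using dec that perfect_iff_fgp_complex[OF R inf le] by (auto simp: support_decomposition_def)
  then have Xsm: "module_complex R (Xs i)" if "i \<in> I" for i using that by (auto simp: fgp_complex_def)
  have Xm: "module_complex R X" using X by (simp add: fgp_complex_def)
  have ind: "indecomposable_thick_support R (vanishing R (hann R (Xs i)))" if "i \<in> I" for i
    using dec that Supp_eq_vanishing[OF R Xs[OF that]] by (auto simp: support_decomposition_def)
  have disj: "vanishing R (hann R (Xs i)) \<inter> vanishing R (hann R (Xs j)) = {}" if "i \<in> I" "j \<in> I" "i \<noteq> j" for i j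
    using dec that Supp_eq_vanishing[OF R Xs[OF that(1)]] Supp_eq_vanishing[OF R Xs[OF that(2)]]
    unfolding support_decomposition_def by metis
  let ?D = "dsum_complex I Xs"
  have D: "module_complex R ?D" by (rule module_complex_dsum[OF R Xsm])
  obtain S :: "('a, 'u) cochain_complex" where S: "module_complex R S" "complex_iso R S ?D" "derived_iso R X S"
    using dec by (auto simp: support_decomposition_def)
  obtain \<theta> where \<theta>: "chain_map R S ?D \<theta>" "\<And>n. bij_betw (\<theta> n) (carrier (obj S n)) (carrier (obj ?D n))"
    using S(2) by (auto simp: complex_iso_def)
  obtain \<kappa> where \<kappa>: "chain_map R ?D S \<kappa>" "\<And>n x. x \<in> carrier (obj S n) \<Longrightarrow> \<kappa> n (\<theta> n x) = x"
    "\<And>n y. y \<in> carrier (obj ?D n) \<Longrightarrow> \<theta> n (\<kappa> n y) = y" by (rule chain_map_inverse[OF S(1) \<theta>]) (rule that)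
  obtain u where u: "chain_map R X S u" "coh_inj X S u" "coh_surj X S u"
    using quasi_iso_if_derived_iso[OF X S(1,3)] by blast
  define \<pi> where "\<pi> i n x = \<theta> n x i" for i n x
  define \<iota> where "\<iota> i n x = \<kappa> n (\<lambda>j\<in>I. if j = i then x else \<zero>\<^bsub>obj (Xs j) n\<^esub>)" for i n x
  have \<pi>: "chain_map R S (Xs i) (\<pi> i)" if "i \<in> I" for i
    using chain_map_comp[OF \<theta>(1) chain_map_dsum_proj[OF that, where Xs = Xs]] unfolding \<pi>_def .
  have incl: "chain_map R (Xs i) ?D (\<lambda>n x. \<lambda>j\<in>I. if j = i then x else \<zero>\<^bsub>obj (Xs j) n\<^esub>)" for i
    by (rule chain_map_dsum_incl[OF Xsm])
  have \<iota>: "chain_map R (Xs i) S (\<iota> i)" for i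
    using chain_map_comp[OF incl \<kappa>(1)] unfolding \<iota>_def .
  have \<pi>\<iota>: "\<pi> i n (\<iota> i n x) = x" if "i \<in> I" "x \<in> carrier (obj (Xs i) n)" for i n x
    unfolding \<pi>_def \<iota>_def by (subst \<kappa>(3)[OF chain_mapD(3)[OF incl that(2)]]) (simp add: that(1))
  \<comment> \<open>Every index is reached by \<open>X\<close>. If the component at \<open>i\<close>
    of \<open>\<theta>\<close> after \<open>u\<close> were zero, then lifting the inclusion
    \<open>\<iota> i\<close> along \<open>u\<close> would make the identity of \<open>Xs i\<close>
    null-homotopic, although its support is nonempty.\<close>
  have "I \<subseteq> {i \<in> I. \<exists>n. \<exists>x\<in>carrier (obj X n). \<theta> n (u n x) i \<noteq> \<zero>\<^bsub>obj (Xs i) n\<^esub>}"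
  proof (rule ccontr)
    assume "\<not> ?thesis"
    then obtain i where i: "i \<in> I" "\<And>n x. x \<in> carrier (obj X n) \<Longrightarrow> \<theta> n (u n x) i = \<zero>\<^bsub>obj (Xs i) n\<^esub>" by blast
    obtain g where g: "chain_map R (Xs i) X g" "homotopic R (Xs i) S (\<lambda>n x. u n (g n x)) (\<iota> i)"
      using lift_along_quasi_iso[OF Xs[OF i(1)] Xm S(1) u \<iota>] by blast
    have "htpy R (Xs i) S (\<lambda>n x. u n (g n x)) (\<iota> i)"
      using g(2) Xsm[OF i(1)] S(1) chain_map_comp[OF g(1) u(1)] \<iota> by (simp add: htpy_def)
    from htpy_sym[OF htpy_comp_left[OF this \<pi>[OF i(1)] Xsm[OF i(1)]]]
    have "htpy R (Xs i) (Xs i) (\<lambda>n x. x) (\<lambda>n x. \<zero>\<^bsub>obj (Xs i) n\<^esub>)"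
      by (rule htpy_cong) (simp_all add: \<pi>\<iota>[OF i(1), unfolded \<pi>_def] \<pi>_def i(2)[OF chain_mapD(3)[OF g(1)]])
    moreover have "vanishing R (hann R (Xs i)) \<noteq> {}" using ind[OF i(1)] by (simp add: indecomposable_thick_support_def)
    ultimately show False using one_notin_hann[OF R _ Xsm[OF i(1)]] by blast
  qed
  then have "finite I" by (rule finite_subset[OF _ finite_support_of_chain_map[OF X Xsm chain_map_comp[OF u(1) \<theta>(1)]]])
  then obtain L where L: "set L = I" "distinct L" using finite_distinct_list by blast
  have sum: "msum (obj S n) (\<lambda>i. \<iota> i n (\<pi> i n x)) L = x" if x: "x \<in> carrier (obj S n)" for n x
  proof -
    have y: "\<theta> n x \<in> carrier (obj ?D n)" by (rule chain_mapD(3)[OF \<theta>(1) x])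
    have yi: "\<theta> n x i \<in> carrier (obj (Xs i) n)" if "i \<in> I" for i using chain_mapD(3)[OF \<pi>[OF that] x]
      by (simp add: \<pi>_def)
    have "msum (obj S n) (\<lambda>i. \<iota> i n (\<pi> i n x)) L =
      \<kappa> n (msum (obj ?D n) (\<lambda>i. \<lambda>j\<in>I. if j = i then \<theta> n x i else \<zero>\<^bsub>obj (Xs j) n\<^esub>) L)"
      unfolding \<iota>_def \<pi>_def
      by (rule module_hom_msum[OF chain_mapD(1)[OF \<kappa>(1)] module_complex_group[OF D] module_complex_group[OF S(1)],
        symmetric])
        (rule chain_mapD(3)[OF incl yi], simp add: L)
    also have "msum (obj ?D n) (\<lambda>i. \<lambda>j\<in>I. if j = i then \<theta> n x i else \<zero>\<^bsub>obj (Xs j) n\<^esub>) L = \<theta> n x"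
      using dsum_expand[OF R L(2), of "\<lambda>i. obj (Xs i) n" "\<theta> n x"] y module_complexD(1)[OF Xsm] L(1) by simp
    finally show ?thesis using \<kappa>(2)[OF x] by simp
  qed
  have Sf: "fgp_complex R S"
    by (rule fgp_complex_if_iso_dsum[OF S(1), where L = L and Xs = Xs and p = \<pi> and v = \<iota>]) (simp_all add: L Xs \<pi> \<iota> sum)
  obtain w where w: "chain_map R S X w" "htpy R S S (\<lambda>n x. u n (w n x)) (\<lambda>n x. x)"
    "htpy R X X (\<lambda>n x. w n (u n x)) (\<lambda>n x. x)"
    by (rule htpy_inverse_of_quasi_iso[OF X Sf u]) (rule that)
  have "split_by R X L Xs (\<lambda>i n x. \<pi> i n (u n x)) (\<lambda>i n x. w n (\<iota> i n x))"
    unfolding split_by_def L(1)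
  proof (intro conjI ballI impI L(2))
    fix i assume i: "i \<in> I"
    show "chain_map R X (Xs i) (\<lambda>n x. \<pi> i n (u n x))" by (rule chain_map_comp[OF u(1) \<pi>[OF i]])
    show "chain_map R (Xs i) X (\<lambda>n x. w n (\<iota> i n x))" by (rule chain_map_comp[OF \<iota> w(1)])
    show "htpy R (Xs i) (Xs i) (\<lambda>n x. \<pi> i n (u n (w n (\<iota> i n x)))) (\<lambda>n x. x)"
      by (rule htpy_cong[OF htpy_comp_left[OF htpy_comp_right[OF w(2) \<iota> Xsm[OF i]] \<pi>[OF i] Xsm[OF i]]])
        (simp_all add: \<pi>\<iota>[OF i])
  next
    show "htpy R X X (\<lambda>n x. msum (obj X n) (\<lambda>i. w n (\<iota> i n (\<pi> i n (u n x)))) L) (\<lambda>n x. x)"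
    proof (rule htpy_cong[OF w(3)])
      fix n x assume x: "x \<in> carrier (obj X n)"
      note ux = chain_mapD(3)[OF u(1) x]
      show "msum (obj X n) (\<lambda>i. w n (\<iota> i n (\<pi> i n (u n x)))) L = w n (u n x)"
        using module_hom_msum[OF chain_mapD(1)[OF w(1), where n = n] module_complex_group[OF S(1)]
          module_complex_group[OF Xm], where L = L and g = "\<lambda>i. \<iota> i n (\<pi> i n (u n x))"]
          chain_mapD(3)[OF \<iota> chain_mapD(3)[OF \<pi> ux]] sum[OF ux] L(1) by simp
    qed simp
  qed (use Xs ind disj in blast)+
  then show thesis by (rule that[OF L(1)])
qed

section \<open>Comparison of two decompositions by their supports\<close>

lemma prime_avoids_common_element:
  assumes P: "primeideal P R" and A: "\<And>i. i \<in> set L \<Longrightarrow> ideal (A i) R" and ex: "\<And>i. i \<in> set L \<Longrightarrow> \<not> A i \<subseteq> P"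
  shows "\<exists>r\<in>carrier R. r \<notin> P \<and> (\<forall>i\<in>set L. r \<in> A i)"
proof -
  interpret P: primeideal P R by (rule P)
  show ?thesis
    using A ex
  proof (induction L)
    case Nil
    then show ?case using P.one_imp_carrier P.I_notcarr by auto
  next
    case (Cons a L)
    then obtain r where r: "r \<in> carrier R" "r \<notin> P" "\<forall>i\<in>set L. r \<in> A i" by auto
    obtain s where s: "s \<in> A a" "s \<notin> P" using Cons.prems(2)[of a] by auto
    have sR: "s \<in> carrier R" using ideal.Icarr[OF Cons.prems(1)[of a] s(1)] by simp
    have "s \<otimes>\<^bsub>R\<^esub> r \<notin> P" using P.I_prime[OF sR r(1)] r(2) s(2) by blast
    moreover have "s \<otimes>\<^bsub>R\<^esub> r \<in> A i" if "i \<in> set (a # L)" for i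
      using that ideal.I_r_closed[OF Cons.prems(1)[of a] s(1) r(1)] ideal.I_l_closed[OF Cons.prems(1)[of i] _ sR]
        r(3) by auto
    ultimately show ?case using P.m_closed[OF sR r(1)] by blast
  qed
qed

text \<open>At a prime outside all supports of the components, some \<open>r\<close> not in the
  prime annihilates each component up to homotopy. Then \<open>r\<close> kills every composite
  \<open>v i\<close> after \<open>p i\<close>, hence their sum, which is homotopic to the identity
  of \<open>X\<close>.\<close>

lemma split_by_vanishing_cover:
  assumes R: "cring R" and s: "split_by R X L Y p v"
  shows "vanishing R (hann R X) \<subseteq> (\<Union>i\<in>set L. vanishing R (hann R (Y i)))"
proof
  fix P assume "P \<in> vanishing R (hann R X)"
  then have P: "primeideal P R" "P \<in> Spec R" "hann R X \<subseteq> P" by (auto simp: vanishing_def Spec_def)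
  note S = split_byD[OF s]
  show "P \<in> (\<Union>i\<in>set L. vanishing R (hann R (Y i)))"
  proof (rule ccontr)
    assume "\<not> ?thesis"
    then have "\<not> hann R (Y i) \<subseteq> P" if "i \<in> set L" for i using that P(2) by (auto simp: vanishing_def)
    then obtain r where r: "r \<in> carrier R" "r \<notin> P" "\<And>i. i \<in> set L \<Longrightarrow> r \<in> hann R (Y i)"
      using prime_avoids_common_element[OF P(1), of L "\<lambda>i. hann R (Y i)"] ideal_hann[OF R S(3)] by blast
    have z: "htpy R X X (\<lambda>n x. r \<odot>\<^bsub>obj X n\<^esub> v i n (p i n x)) (\<lambda>n x. \<zero>\<^bsub>obj X n\<^esub>)" if i: "i \<in> set L" for i
    proof -
      have "homotopic R (Y i) X (\<lambda>n x. r \<odot>\<^bsub>obj X n\<^esub> v i n x) (\<lambda>n x. \<zero>\<^bsub>obj X n\<^esub>)"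
        by (rule homotopic_zero_if_hann_left[OF S(3)[OF i] S(9) S(5)[OF i] r(3)[OF i]])
      then have "htpy R (Y i) X (\<lambda>n x. r \<odot>\<^bsub>obj X n\<^esub> v i n x) (\<lambda>n x. \<zero>\<^bsub>obj X n\<^esub>)"
        using S(3)[OF i] S(9) chain_map_comp[OF S(5)[OF i] chain_map_scalar[OF S(9) r(1)]]
          chain_map_zero[OF S(3)[OF i] S(9)]
        by (simp add: htpy_def)
      from htpy_comp_right[OF this S(4)[OF i] S(9)] show ?thesis .
    qed
    have c: "v i n (p i n x) \<in> carrier (obj X n)" if "i \<in> set L" "x \<in> carrier (obj X n)" for i n x
      by (rule chain_mapD(3)[OF S(5)[OF that(1)] chain_mapD(3)[OF S(4)[OF that(1)] that(2)]])
    have "htpy R X X (\<lambda>n x. msum (obj X n) (\<lambda>i. r \<odot>\<^bsub>obj X n\<^esub> v i n (p i n x)) L) (\<lambda>n x. msum (obj X n) (\<lambda>i. \<zero>\<^bsub>obj X n\<^esub>) L)"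
      by (rule htpy_msum[OF S(9,9) z])
    then have "htpy R X X (\<lambda>n x. r \<odot>\<^bsub>obj X n\<^esub> msum (obj X n) (\<lambda>i. v i n (p i n x)) L) (\<lambda>n x. \<zero>\<^bsub>obj X n\<^esub>)"
    proof (rule htpy_cong)
      fix n x assume x: "x \<in> carrier (obj X n)"
      interpret XX: abelian_group "obj X n" by (rule module_complex_group[OF S(9)])
      show "\<zero>\<^bsub>obj X n\<^esub> = msum (obj X n) (\<lambda>i. \<zero>\<^bsub>obj X n\<^esub>) L" by (simp add: XX.msum_zero)
      show "r \<odot>\<^bsub>obj X n\<^esub> msum (obj X n) (\<lambda>i. v i n (p i n x)) L = msum (obj X n) (\<lambda>i. r \<odot>\<^bsub>obj X n\<^esub> v i n (p i n x)) L"
        by (rule module_hom_msum[OF module_hom_scalar[OF module_complexD(1)[OF S(9)] r(1)] XX.abelian_group_axioms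
          XX.abelian_group_axioms c[OF _ x]])
    qed
    from htpy_trans[OF htpy_sym[OF htpy_comp_left[OF S(8) chain_map_scalar[OF S(9) r(1)] S(9)]] this]
    have "r \<in> hann R X" using r(1) by (simp add: hann_def htpy_def)
    then show False using r(2) P(3) by blast
  qed
qed

text \<open>The intersections of the support of \<open>Y i\<close> with those of the
  \<open>Z j\<close> are disjoint thick supports that cover it, so indecomposability leaves just one
  of them nonempty.\<close>

lemma split_by_meets_unique:
  assumes R: "cring R" and s: "split_by R X L Y p v" and t: "split_by R X K Z q w" and i: "i \<in> set L"
  shows "\<exists>!j. j \<in> set K \<and> vanishing R (hann R (Y i)) \<inter> vanishing R (hann R (Z j)) \<noteq> {}"
proof -
  let ?V = "\<lambda>X. vanishing R (hann R X)"
  note S = split_byD[OF s] and T = split_byD[OF t]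
  have cov: "?V (Y i) \<subseteq> (\<Union>j\<in>set K. ?V (Z j))"
    using split_by_vanishing_subset[OF s i] split_by_vanishing_cover[OF R t] by blast
  have ind: "indecomposable_thick_support R (?V (Y i))" by (rule S(7)[OF i])
  have th: "thick_support R (?V (Y i) \<inter> ?V (Z j))" if "j \<in> set K" for j
    by (rule thick_support_Int[OF R thick_support_vanishing[OF ideal_hann[OF R S(3)[OF i]]]
      thick_support_vanishing[OF ideal_hann[OF R T(3)[OF that]]]])
  have "?V (Y i) \<noteq> {}" using ind by (simp add: indecomposable_thick_support_def)
  then obtain j where j: "j \<in> set K" "?V (Y i) \<inter> ?V (Z j) \<noteq> {}" using cov by blast
  have "?V (Y i) \<inter> ?V (Z k) = {}" if k: "k \<in> set K" "k \<noteq> j" for k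
  proof (rule ccontr)
    \<comment> \<open>Indecomposability speaks of two pieces only, so all intersections other than
      the one at \<open>j\<close> are merged.\<close>
    let ?U = "\<Union>k\<in>set K - {j}. ?V (Y i) \<inter> ?V (Z k)"
    assume "?V (Y i) \<inter> ?V (Z k) \<noteq> {}"
    then have "?U \<noteq> {}" using k by blast
    moreover have "thick_support R ?U" by (rule thick_support_UN) (simp add: th)
    moreover have "(?V (Y i) \<inter> ?V (Z j)) \<inter> ?U = {}" using T(10)[OF j(1)] by blast
    moreover have "?V (Y i) = (?V (Y i) \<inter> ?V (Z j)) \<union> ?U" using cov by blast
    ultimately show False using ind th[OF j(1)] j(2) unfolding indecomposable_thick_support_def by blast
  qed
  then show ?thesis using j by blast
qed

text \<open>The identity of \<open>X\<close> is inserted between \<open>v i\<close> and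
  \<open>p i\<close> as the sum of the \<open>w k\<close> after \<open>q k\<close>. All terms but
  the one at \<open>j\<close> pass through a complex whose support is disjoint from that of
  \<open>Y i\<close>, and vanish up to homotopy.\<close>

lemma split_by_component_htpy:
  assumes R: "cring R" "noetherian_ring R" and s: "split_by R X L Y p v" and t: "split_by R X K Z q w"
    and i: "i \<in> set L" and j: "j \<in> set K"
    and disj: "\<And>k. k \<in> set K \<Longrightarrow> k \<noteq> j \<Longrightarrow> vanishing R (hann R (Y i)) \<inter> vanishing R (hann R (Z k)) = {}"
  shows "htpy R (Y i) (Y i) (\<lambda>n x. p i n (w j n (q j n (v i n x)))) (\<lambda>n x. x)"
proof -
  note S = split_byD[OF s] and T = split_byD[OF t]
  have c: "chain_map R (Y i) X (\<lambda>n x. w k n (q k n (v i n x)))" if "k \<in> set K" for k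
    by (rule chain_map_comp[OF chain_map_comp[OF S(5)[OF i] T(4)[OF that]] T(5)[OF that]])
  have z: "htpy R (Y i) X (\<lambda>n x. w k n (q k n (v i n x))) (\<lambda>n x. \<zero>\<^bsub>obj X n\<^esub>)" if k: "k \<in> set K" "k \<noteq> j" for k
  proof -
    have "htpy R (Y i) (Z k) (\<lambda>n x. q k n (v i n x)) (\<lambda>n x. \<zero>\<^bsub>obj (Z k) n\<^esub>)"
      by (rule htpy_zero_if_vanishing_disjoint[OF R S(3)[OF i] T(3)[OF k(1)]
        chain_map_comp[OF S(5)[OF i] T(4)[OF k(1)]] disj[OF k]])
    from htpy_comp_left[OF this T(5)[OF k(1)] S(9)] show ?thesis
      by (rule htpy_cong) (simp_all add: module_hom_zero[OF chain_mapD(1)[OF T(5)[OF k(1)]]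
        module_complex_group[OF T(3)[OF k(1)]] module_complex_group[OF S(9)]])
  qed
  have 1: "htpy R (Y i) X (\<lambda>n x. msum (obj X n) (\<lambda>k. w k n (q k n (v i n x))) K) (\<lambda>n x. w j n (q j n (v i n x)))"
    by (rule htpy_msum_single[OF T(1) j c S(3)[OF i] S(9) z])
  have 2: "htpy R (Y i) X (\<lambda>n x. msum (obj X n) (\<lambda>k. w k n (q k n (v i n x))) K) (\<lambda>n x. v i n x)"
    by (rule htpy_comp_right[OF T(8) S(5)[OF i] S(3)[OF i]])
  from htpy_trans[OF htpy_comp_left[OF htpy_trans[OF htpy_sym[OF 1] 2] S(4)[OF i] S(3)[OF i]] S(6)[OF i]] show ?thesis .
qed

text \<open>Components correspond when their supports meet. This relation is symmetric, and
  \<open>split_by_meets_unique\<close> makes it single-valued in both directions; the maps through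
  \<open>X\<close> between partners are mutually inverse up to homotopy by
  \<open>split_by_component_htpy\<close>, applied once from each side.\<close>

lemma split_by_unique:
  fixes X :: "('a, 'u) cochain_complex"
  assumes R: "cring R" "noetherian_ring R" and s: "split_by R X L Y p v" and t: "split_by R X K Z q w"
  shows "\<exists>\<sigma>. bij_betw \<sigma> (set L) (set K) \<and> (\<forall>i\<in>set L. derived_iso R (Y i) (Z (\<sigma> i)))"
proof -
  let ?m = "\<lambda>i j. vanishing R (hann R (Y i)) \<inter> vanishing R (hann R (Z j)) \<noteq> {}"
  note S = split_byD[OF s] and T = split_byD[OF t]
  have ex1: "\<exists>!j. j \<in> set K \<and> ?m i j" if "i \<in> set L" for i by (rule split_by_meets_unique[OF R(1) s t that])
  have ex2: "\<exists>!i. i \<in> set L \<and> ?m i j" if "j \<in> set K" for j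
    using split_by_meets_unique[OF R(1) t s that] by (simp add: Int_commute)
  define \<sigma> where "\<sigma> i = (THE j. j \<in> set K \<and> ?m i j)" for i
  have \<sigma>: "\<sigma> i \<in> set K" "?m i (\<sigma> i)" if "i \<in> set L" for i using theI'[OF ex1[OF that]] by (simp_all add: \<sigma>_def)
  have \<sigma>': "j = \<sigma> i" if "i \<in> set L" "j \<in> set K" "?m i j" for i j using ex1[OF that(1)] \<sigma>[OF that(1)] that(2,3) by blast
  have "bij_betw \<sigma> (set L) (set K)"
  proof (rule bij_betw_imageI)
    show "inj_on \<sigma> (set L)"
    proof (rule inj_onI)
      fix i i' assume i: "i \<in> set L" "i' \<in> set L" "\<sigma> i = \<sigma> i'"
      show "i = i'" using ex2[OF \<sigma>(1)[OF i(1)]] \<sigma>(2)[OF i(1)] \<sigma>(2)[OF i(2)] i by metis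
    qed
    show "\<sigma> ` set L = set K" using \<sigma>(1) ex2 \<sigma>' by blast
  qed
  moreover have "derived_iso R (Y i) (Z (\<sigma> i))" if i: "i \<in> set L" for i
  proof -
    note j = \<sigma>(1)[OF i]
    have 1: "htpy R (Y i) (Y i) (\<lambda>n x. p i n (w (\<sigma> i) n (q (\<sigma> i) n (v i n x)))) (\<lambda>n x. x)"
      by (rule split_by_component_htpy[OF R s t i j]) (use \<sigma>'[OF i] in blast)
    have 2: "htpy R (Z (\<sigma> i)) (Z (\<sigma> i)) (\<lambda>n x. q (\<sigma> i) n (v i n (p i n (w (\<sigma> i) n x)))) (\<lambda>n x. x)"
      by (rule split_by_component_htpy[OF R t s j i]) (use ex2[OF j] \<sigma>(2)[OF i] i in blast)
    show ?thesis
      by (rule derived_iso_if_homotopy_equiv[OF S(3)[OF i] T(3)[OF j] chain_map_comp[OF S(5)[OF i] T(4)[OF j]]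
            chain_map_comp[OF T(5)[OF j] S(4)[OF i]] htpyD(5)[OF 1] htpyD(5)[OF 2]])
  qed
  ultimately show ?thesis by blast
qed

theorem corollary1p2p3:
  fixes R :: "('a, 'r) ring_scheme" and X :: "('a, 'u) cochain_complex"
  assumes "cring R" and "noetherian_ring R"
    and "infinite (UNIV :: 'u set)" and "carrier R \<lesssim> (UNIV :: 'u set)"
    and "perfect_complex R X"
  shows "(\<exists>(I :: nat set) Xs. support_decomposition R X I Xs) \<and>
    (\<forall>(I :: 'i set) Xs (J :: 'j set) Ys.
      support_decomposition R X I Xs \<and> support_decomposition R X J Ys \<longrightarrow>
      (\<exists>\<sigma>. bij_betw \<sigma> I J \<and> (\<forall>i\<in>I. derived_iso R (Xs i) (Ys (\<sigma> i)))))"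
proof (intro conjI allI impI)
  have X: "fgp_complex R X" using assms(5) perfect_iff_fgp_complex[OF assms(1,3,4)] by blast
  show "\<exists>(I :: nat set) Xs. support_decomposition R X I Xs"
    using split_by_exists[OF assms(1-3) X] support_decomposition_if_split_by[OF assms(1-4)] by blast
  fix I :: "'i set" and Xs and J :: "'j set" and Ys
  assume "support_decomposition R X I Xs \<and> support_decomposition R X J Ys"
  then have d: "support_decomposition R X I Xs" "support_decomposition R X J Ys" by auto
  \<comment> \<open>The index sets were arbitrary; the lists obtained here also record that both are
    finite.\<close>
  obtain L p v where L: "set L = I" "split_by R X L Xs p v"
    by (rule split_by_if_support_decomposition[OF assms(1,3,4) X d(1)])
  obtain K q w where K: "set K = J" "split_by R X K Ys q w"
    by (rule split_by_if_support_decomposition[OF assms(1,3,4) X d(2)])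
  show "\<exists>\<sigma>. bij_betw \<sigma> I J \<and> (\<forall>i\<in>I. derived_iso R (Xs i) (Ys (\<sigma> i)))"
    using split_by_unique[OF assms(1,2) L(2) K(2)] L(1) K(1) by simp
qed

end
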